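(* Assume that conditions $\mathcal{C}_2(\boldsymbol{\gamma},\boldsymbol{\rho},\boldsymbol{A})$ and $\mathcal{J}(\boldsymbol{R})$ (stated in the context) hold with $\rho_j<0$ and $A_j(t)=\gamma_j\beta_jt^{\rho_j}$ for all $j$. Suppose that $n_1\leq\cdots\leq n_m$ and that, for any $j\in\{1,\ldots,m\}$, as $n\to\infty$: $k_j=k_j(n)\to\infty$, $k_j/n_j\to0$, $n_1/n_j\to b_j\in(0,1]$, $k_1/k_j\to c_j\in(0,\infty)$ and $\sqrt{k_j}A_j(n_j/k_j)\to0$. Assume that the matrix $\mathbf{V}$ defined in the context is positive definite. Assume further that, for all $j$, $\widehat{\beta}_j$ is a consistent estimator of $\beta_j$ and $(\widehat{\rho}_j-\rho_j)\log n_j=\operatorname{o}_{\mathbb{P}}(1)$. Consider $H_0$: there is $\gamma>0$ with $\boldsymbol{\gamma}=\gamma\boldsymbol{1}$, versus $H_1$: the $\gamma_j$ are not all equal. Let $\alpha\in(0,1)$ and let $\chi^2_{m-1,1-\alpha}$ be the $(1-\alpha)$th quantile of the chi-square distribution with $m-1$ degrees of freedom. Then, as $n\to\infty$, $\mathbb{P}(\Lambda_n>\chi^2_{m-1,1-\alpha})\to\alpha$ under $H_0$, and $\Lambda_n\stackrel{\mathbb{P}}{\longrightarrow}+\infty$ under $H_1$. Moreover, under $H_0$, if $\widehat{\boldsymbol{\omega}}_n$ are random vectors with $\widehat{\boldsymbol{\omega}}_n^\top\boldsymbol{1}=1$ and $\widehat{\boldsymbol{\omega}}_n\stackrel{\mathbb{P}}{\longrightarrow}\boldsymbol{\omega}$,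 then, for any $\alpha\in(0,1)$, $$\lim_{n\to\infty}\mathbb{P}\left(\gamma\in\left[\widehat{\gamma}_n(\widehat{\boldsymbol{\omega}}_n)\pm z_{1-\alpha/2}\sqrt{(\widehat{\boldsymbol{\omega}}_n^\top\widehat{\mathbf{V}}_{\boldsymbol{c}}\widehat{\boldsymbol{\omega}}_n)/k}\right]\right)=1-\alpha,$$ where $k=\sum_{j=1}^mk_j$ and $z_{1-\alpha/2}$ is the $(1-\alpha/2)$th quantile of the standard Gaussian distribution.
   Context: Setting: $m\geq2$ is a fixed integer, $\boldsymbol{X}=(X_1,\ldots,X_m)^\top$ is a random vector and $\boldsymbol{X}_i=(X_{i,1},\ldots,X_{i,m})^\top$, $i\geq1$, are independent copies of $\boldsymbol{X}$. The data are the $X_{i,j}$ for $1\leq j\leq m$, $1\leq i\leq n_j=n_j(n)$, with $n=\sum_{j=1}^m n_j$ and $n_j\to\infty$ as $n\to\infty$. Each $X_j$ has a continuous distribution function $F_j$, $\overline{F}_j=1-F_j$, and tail quantile function $U_j(t)=\inf\{x\in\mathbb{R}:1/\overline{F}_j(x)\geq t\}$. Condition $\mathcal{C}_2(\boldsymbol{\gamma},\boldsymbol{\rho},\boldsymbol{A})$: for every $j$, $\gamma_j>0$, $\rho_j\leq0$, $A_j$ has constant sign and converges to $0$ at infinity, and for all $x>0$, $\lim_{t\to\infty}\frac{1}{A_j(t)}\left[\frac{U_j(tx)}{U_j(t)}-x^{\gamma_j}\right]=x^{\gamma_j}\frac{x^{\rho_j}-1}{\rho_j}$ (read as $x^{\gamma_j}\log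 x$ if $\rho_j=0$). Condition $\mathcal{J}(\boldsymbol{R})$: with $\overline{C}_{j,\ell}(u,v)=\mathbb{P}(\overline{F}_j(X_j)\leq u,\overline{F}_\ell(X_\ell)\leq v)$, for any $j\neq\ell$ there is a function $R_{j,\ell}$ on $[0,\infty]^2\setminus\{(\infty,\infty)\}$ such that $\lim_{s\to\infty}s\,\overline{C}_{j,\ell}(x_j/s,x_\ell/s)=R_{j,\ell}(x_j,x_\ell)$ for all $(x_j,x_\ell)$ in this set. $\mathbf{V}$ is the symmetric matrix with $\mathbf{V}_{j,j}=\gamma_j^2$ and $\mathbf{V}_{j,\ell}=\gamma_j\gamma_\ell\sqrt{c_j/c_\ell}\,R_{j,\ell}(c_\ell/c_j,b_\ell/b_j)$ for $j<\ell$. Estimators: with $X_{1:n_j,j}\leq\cdots\leq X_{n_j:n_j,j}$ the order statistics of the $j$th sample, $\widehat{\gamma}_j(k_j)=k_j^{-1}\sum_{i=1}^{k_j}\log(X_{n_j-i+1:n_j,j}/X_{n_j-k_j:n_j,j})$, $\widehat{\boldsymbol{\gamma}}_n=(\widehat{\gamma}_1(k_1),\ldots,\widehat{\gamma}_m(k_m))^\top$ and $\widehat{\gamma}_n(\boldsymbol{\omega})=\boldsymbol{\omega}^\top\widehat{\boldsymbol{\gamma}}_n$. $\boldsymbol{1}$ is the vector of ones in $\mathbb{R}^m$. Let $n_{j,\ell}=\min(n_j,n_\ell)$, $k_{j,\ell}=k_j$ if $n_j<n_\ell$ and $k_{j,\ell}=k_\ell$ otherwise, and $$\widehat{R}_{j,\ell}(u,v)=\frac{1}{k_{j,\ell}}\sum_{i=1}^{n_{j,\ell}}\mathbb{1}\left\{\frac{n_{j,\ell}+1-r_{n_{j,\ell},i,j}}{k_{j,\ell}(n_{j,\ell}+1)/n_{j,\ell}}\leq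 u,\ \frac{n_{j,\ell}+1-r_{n_{j,\ell},i,\ell}}{k_{j,\ell}(n_{j,\ell}+1)/n_{j,\ell}}\leq v\right\},$$ where $r_{n_{j,\ell},i,j}$ (resp. $r_{n_{j,\ell},i,\ell}$) is the rank of $X_{i,j}$ among $X_{1,j},\ldots,X_{n_{j,\ell},j}$ (resp. of $X_{i,\ell}$ among $X_{1,\ell},\ldots,X_{n_{j,\ell},\ell}$). $\overline{\mathbf{V}}_{\boldsymbol{c}}$ is the symmetric matrix with $[\overline{\mathbf{V}}_{\boldsymbol{c}}]_{j,j}=k\,\widehat{\gamma}_j^2(k_j)/k_j$ and $[\overline{\mathbf{V}}_{\boldsymbol{c}}]_{j,\ell}=k\,\widehat{\gamma}_j(k_j)\widehat{\gamma}_\ell(k_\ell)k_j^{-1}\widehat{R}_{j,\ell}(k_j/k_\ell,n_j/n_\ell)$ for $j<\ell$. The test statistic is $$\Lambda_n=k(\widehat{\boldsymbol{\gamma}}_n-\overline{\mu}_n\boldsymbol{1})^\top\overline{\mathbf{V}}_{\boldsymbol{c}}^{-1}(\widehat{\boldsymbol{\gamma}}_n-\overline{\mu}_n\boldsymbol{1}),\quad \overline{\mu}_n=\frac{\boldsymbol{1}^\top\overline{\mathbf{V}}_{\boldsymbol{c}}^{-1}\widehat{\boldsymbol{\gamma}}_n}{\boldsymbol{1}^\top\overline{\mathbf{V}}_{\boldsymbol{c}}^{-1}\boldsymbol{1}}.$$ $\widehat{\mathbf{V}}_{\boldsymbol{c}}$ is the symmetric matrix with $[\widehat{\mathbf{V}}_{\boldsymbol{c}}]_{j,j}=k\,\widehat{\gamma}_n^2(\boldsymbol{\omega}_0)/k_j$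 and $[\widehat{\mathbf{V}}_{\boldsymbol{c}}]_{j,\ell}=k\,\widehat{\gamma}_n^2(\boldsymbol{\omega}_0)k_j^{-1}\widehat{R}_{j,\ell}(k_j/k_\ell,n_j/n_\ell)$ for $j<\ell$, where $\boldsymbol{\omega}_0$ is an arbitrary fixed (pilot) vector with $\boldsymbol{\omega}_0^\top\boldsymbol{1}=1$. *)

theory Defs
  imports "HOL-Probability.Probability"
begin

type_synonym 'm rvec = "(real, 'm) vec"
type_synonym 'm rmat = "((real, 'm) vec, 'm) vec"


section \<open>Tail quantities of the model\<close>

definition survival :: "real measure \<Rightarrow> real \<Rightarrow> real" where
  "survival \<mu> x = 1 - cdf \<mu> x"

text \<open>The quotient is taken in the extended reals, where \<open>1 / 0 = \<infinity>\<close>.\<close>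

definition tail_quantile :: "real measure \<Rightarrow> real \<Rightarrow> real" where
  "tail_quantile \<mu> t = Inf {x. 1 / ereal (survival \<mu> x) \<ge> ereal t}"

definition marginal :: "'a measure \<Rightarrow> ('a \<Rightarrow> ('m :: finite) rvec) \<Rightarrow> 'm \<Rightarrow> real measure" where
  "marginal M X j = distr M borel (\<lambda>w. X w $ j)"

definition survival_copula ::
  "'a measure \<Rightarrow> ('a \<Rightarrow> ('m :: finite) rvec) \<Rightarrow> 'm \<Rightarrow> 'm \<Rightarrow> ennreal \<Rightarrow> ennreal \<Rightarrow> real" where
  "survival_copula M X j l u v =
     measure M {w \<in> space M. ennreal (survival (marginal M X j) (X w $ j)) \<le> u
                           \<and> ennreal (survival (marginal M X l) (X w $ l)) \<le> v}"

definition second_order ::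
  "(real \<Rightarrow> real) \<Rightarrow> real \<Rightarrow> real \<Rightarrow> (real \<Rightarrow> real) \<Rightarrow> bool" where
  "second_order U g r A \<longleftrightarrow>
     g > 0 \<and> r \<le> 0 \<and>
     ((\<forall>t>0. A t > 0) \<or> (\<forall>t>0. A t < 0)) \<and> (A \<longlongrightarrow> 0) at_top \<and>
     (\<forall>x>0. ((\<lambda>t. 1 / A t * (U (t * x) / U t - x powr g)) \<longlongrightarrow>
              x powr g * (if r = 0 then ln x else (x powr r - 1) / r)) at_top)"

definition condition_C2 ::
  "'a measure \<Rightarrow> ('a \<Rightarrow> ('m :: finite) rvec) \<Rightarrow> 'm rvec \<Rightarrow> 'm rvec \<Rightarrow> ('m \<Rightarrow> real \<Rightarrow> real) \<Rightarrow> bool" where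
  "condition_C2 M X \<gamma> \<rho> A \<longleftrightarrow>
     (\<forall>j. second_order (tail_quantile (marginal M X j)) (\<gamma> $ j) (\<rho> $ j) (A j))"

text \<open>The arguments of the tail copula range over \<open>[0, \<infinity>]\<close>, excluding \<open>(\<infinity>, \<infinity>)\<close>; the value of
  \<open>R j l \<top> \<top>\<close> is irrelevant.\<close>

definition condition_J ::
  "'a measure \<Rightarrow> ('a \<Rightarrow> ('m :: finite) rvec) \<Rightarrow> ('m \<Rightarrow> 'm \<Rightarrow> ennreal \<Rightarrow> ennreal \<Rightarrow> real) \<Rightarrow> bool" where
  "condition_J M X R \<longleftrightarrow>
     (\<forall>j l. j \<noteq> l \<longrightarrow> (\<forall>x y. (x, y) \<noteq> (\<top>, \<top>) \<longrightarrow>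
        ((\<lambda>s. s * survival_copula M X j l (x / ennreal s) (y / ennreal s)) \<longlongrightarrow> R j l x y) at_top))"


section \<open>Matrices\<close>

definition pos_def :: "('m :: finite) rmat \<Rightarrow> bool" where
  "pos_def B \<longleftrightarrow> transpose B = B \<and> (\<forall>x. x \<noteq> 0 \<longrightarrow> x \<bullet> (B *v x) > 0)"

text \<open>The symmetric matrix with diagonal \<open>d\<close> and entries \<open>f j l\<close> above the diagonal.\<close>

definition sym_matrix ::
  "(('m :: {finite, linorder}) \<Rightarrow> real) \<Rightarrow> ('m \<Rightarrow> 'm \<Rightarrow> real) \<Rightarrow> 'm rmat" where
  "sym_matrix d f = (\<chi> j l. if j = l then d j else if j < l then f j l else f l j)"

definition V_mat ::
  "('m :: {finite, linorder}) rvec \<Rightarrow> 'm rvec \<Rightarrow> 'm rvec \<Rightarrow> ('m \<Rightarrow> 'm \<Rightarrow> ennreal \<Rightarrow> ennreal \<Rightarrow> real) \<Rightarrow>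
   'm rmat" where
  "V_mat \<gamma> b c R = sym_matrix
     (\<lambda>j. (\<gamma> $ j)\<^sup>2)
     (\<lambda>j l. \<gamma> $ j * \<gamma> $ l * sqrt (c $ j / c $ l) *
            R j l (ennreal (c $ l / c $ j)) (ennreal (b $ l / b $ j)))"


section \<open>Estimators\<close>

text \<open>All statistics are functions of a realised data set \<open>x\<close>, with \<open>x i $ j\<close> the observation
  numbered \<open>i \<ge> 1\<close> in the sample \<open>j\<close>, of the sample sizes \<open>N j\<close>, and of the numbers \<open>k j\<close> of
  upper order statistics.\<close>

definition order_stat :: "(nat \<Rightarrow> real) \<Rightarrow> nat \<Rightarrow> nat \<Rightarrow> real" where
  "order_stat x n i = sort (map x [1..<Suc n]) ! (i - 1)"

definition hill :: "(nat \<Rightarrow> real) \<Rightarrow> nat \<Rightarrow> nat \<Rightarrow> real" where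
  "hill x n k =
     1 / real k * (\<Sum>i = 1..k. ln (order_stat x n (n - i + 1) / order_stat x n (n - k)))"

definition hill_vec ::
  "(nat \<Rightarrow> ('m :: finite) rvec) \<Rightarrow> ('m \<Rightarrow> nat) \<Rightarrow> ('m \<Rightarrow> nat) \<Rightarrow> 'm rvec" where
  "hill_vec x N k = (\<chi> j. hill (\<lambda>i. x i $ j) (N j) (k j))"

definition pooled_hill ::
  "(nat \<Rightarrow> ('m :: finite) rvec) \<Rightarrow> ('m \<Rightarrow> nat) \<Rightarrow> ('m \<Rightarrow> nat) \<Rightarrow> 'm rvec \<Rightarrow> real" where
  "pooled_hill x N k v = v \<bullet> hill_vec x N k"

text \<open>Under continuous margins there are almost surely no ties, so this is the rank of \<open>x i\<close> in
  \<open>x 1, \<dots>, x n\<close>.\<close>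

definition rank_of :: "(nat \<Rightarrow> real) \<Rightarrow> nat \<Rightarrow> nat \<Rightarrow> nat" where
  "rank_of x n i = card {i' \<in> {1..n}. x i' \<le> x i}"

definition tail_copula_est ::
  "(nat \<Rightarrow> ('m :: finite) rvec) \<Rightarrow> ('m \<Rightarrow> nat) \<Rightarrow> ('m \<Rightarrow> nat) \<Rightarrow> 'm \<Rightarrow> 'm \<Rightarrow> real \<Rightarrow> real \<Rightarrow> real" where
  "tail_copula_est x N k j l u v =
     (let n' = min (N j) (N l);
          k' = (if N j < N l then k j else k l);
          e = (\<lambda>i j'. (real n' + 1 - real (rank_of (\<lambda>i'. x i' $ j') n' i)) /
                     (real k' * (real n' + 1) / real n'))
      in 1 / real k' * (\<Sum>i = 1..n'. of_bool (e i j \<le> u \<and> e i l \<le> v)))"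

definition k_total :: "(('m :: finite) \<Rightarrow> nat) \<Rightarrow> real" where
  "k_total k = real (\<Sum>j\<in>UNIV. k j)"

definition V_bar ::
  "(nat \<Rightarrow> ('m :: {finite, linorder}) rvec) \<Rightarrow> ('m \<Rightarrow> nat) \<Rightarrow> ('m \<Rightarrow> nat) \<Rightarrow> 'm rmat" where
  "V_bar x N k = sym_matrix
     (\<lambda>j. k_total k * (hill_vec x N k $ j)\<^sup>2 / real (k j))
     (\<lambda>j l. k_total k * hill_vec x N k $ j * hill_vec x N k $ l * (1 / real (k j)) *
            tail_copula_est x N k j l (real (k j) / real (k l)) (real (N j) / real (N l)))"

definition V_hat ::
  "('m :: {finite, linorder}) rvec \<Rightarrow> (nat \<Rightarrow> 'm rvec) \<Rightarrow> ('m \<Rightarrow> nat) \<Rightarrow> ('m \<Rightarrow> nat) \<Rightarrow>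
   'm rmat" where
  "V_hat \<omega>\<^sub>0 x N k = sym_matrix
     (\<lambda>j. k_total k * (pooled_hill x N k \<omega>\<^sub>0)\<^sup>2 / real (k j))
     (\<lambda>j l. k_total k * (pooled_hill x N k \<omega>\<^sub>0)\<^sup>2 * (1 / real (k j)) *
            tail_copula_est x N k j l (real (k j) / real (k l)) (real (N j) / real (N l)))"

definition mu_bar ::
  "(nat \<Rightarrow> ('m :: {finite, linorder}) rvec) \<Rightarrow> ('m \<Rightarrow> nat) \<Rightarrow> ('m \<Rightarrow> nat) \<Rightarrow> real" where
  "mu_bar x N k = (1 \<bullet> (matrix_inv (V_bar x N k) *v hill_vec x N k)) /
                  (1 \<bullet> (matrix_inv (V_bar x N k) *v 1))"

definition test_stat ::
  "(nat \<Rightarrow> ('m :: {finite, linorder}) rvec) \<Rightarrow> ('m \<Rightarrow> nat) \<Rightarrow> ('m \<Rightarrow> nat) \<Rightarrow> real" where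
  "test_stat x N k =
     (let d = hill_vec x N k - mu_bar x N k *\<^sub>R 1
      in k_total k * (d \<bullet> (matrix_inv (V_bar x N k) *v d)))"


section \<open>Convergence in probability and quantiles\<close>

definition tendsto_in_prob ::
  "'a measure \<Rightarrow> (nat \<Rightarrow> 'a \<Rightarrow> 'b :: metric_space) \<Rightarrow> 'b \<Rightarrow> bool" where
  "tendsto_in_prob M Y y \<longleftrightarrow>
     (\<forall>\<epsilon>>0. (\<lambda>n. measure M {w \<in> space M. dist (Y n w) y > \<epsilon>}) \<longlonglongrightarrow> 0)"

definition tendsto_in_prob_at_top :: "'a measure \<Rightarrow> (nat \<Rightarrow> 'a \<Rightarrow> real) \<Rightarrow> bool" where
  "tendsto_in_prob_at_top M Y \<longleftrightarrow>
     (\<forall>C. (\<lambda>n. measure M {w \<in> space M. Y n w > C}) \<longlonglongrightarrow> 1)"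

definition quantile :: "real measure \<Rightarrow> real \<Rightarrow> real" where
  "quantile \<mu> p = Inf {x. p \<le> cdf \<mu> x}"

definition chi_square :: "nat \<Rightarrow> real measure" where
  "chi_square d =
     distr (Pi\<^sub>M {..<d} (\<lambda>_. std_normal_distribution)) borel (\<lambda>z. \<Sum>i<d. (z i)\<^sup>2)"

end

theory Submission
  imports Defs "HOL-Real_Asymp.Real_Asymp"
begin

text \<open>
  Put \<open>E\<^sub>i\<^sub>j = - ln (survival (X\<^sub>i\<^sub>j))\<close>, a standard exponential variable. Since \<open>\<rho>\<^sub>j < 0\<close>, the second order condition
  gives \<open>ln X = \<gamma> E + C + O (exp (\<rho> E))\<close>, and the bias condition makes the error negligible, so that the Hill
  estimator may be replaced by \<open>\<gamma>\<close> times the mean excess of the exponential data over their order statistic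
  of rank \<open>n - k\<close>. Replacing this random threshold by \<open>u = ln (n / k)\<close> shows that \<open>\<surd>k (\<gamma>hat - \<gamma>)\<close> is
  asymptotically \<open>\<gamma> k\<^bsup>-1/2\<^esup> \<Sum>\<^sub>i ((E\<^sub>i - u)\<^sup>+ - 1{E\<^sub>i \<ge> u})\<close>. The summands are centred, and the homogeneity of the
  tail copula collapses their limiting covariances to its values at a single point. A Lindeberg-type
  argument gives the limits of the characteristic functions of linear combinations, and averaging these
  over a Gaussian direction gives the Laplace transform of quadratic forms, whence the chi-square limit.

  Convergence in probability is expressed by an ordinary limit along the filter \<open>whp M\<close> on \<open>nat \<times> 'a\<close>, so that
  the calculus of limits applies, and no measurability is needed before the very end.
\<close>

section \<open>Convergence with high probability as a filter\<close>

text \<open>On the exponential scale, lack of memory makes the mean excess over a level u and the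
  probability of reaching it both equal to exp (- u); the summands are therefore exactly centred for
  every n. Their indicator comes from the random threshold: moving the threshold by \<tau> costs k
  \<tau> in the sum of excesses, and \<tau> is asymptotically (T - k) / k, where T counts the
  exceedances of u, so that - k \<tau> becomes k - T. The samples have different sizes but are
  initial pieces of one sequence of independent vectors. Dependence is thus confined to the rows,
  and the smaller of two sizes normalises each covariance. The m - 1 degrees of freedom are the
  dimension of the hyperplane orthogonal to the constant vector: in a basis of it that is
  orthonormal for the limit covariance, the test statistic is asymptotically a sum of m - 1 squares
  of linear forms in the errors. Coverage of the confidence interval is squared and becomes the case
  of one degree of freedom, so that one limit theorem serves both claims.\<close>

definition whp :: "'a measure \<Rightarrow> (nat \<times> 'a) filter" where
  "whp M = Abs_filter (\<lambda>P. \<forall>\<epsilon>>0. \<forall>\<^sub>F n in sequentially.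
      \<exists>A\<in>sets M. measure M A > 1 - \<epsilon> \<and> (\<forall>w\<in>A. P (n, w)))"

text \<open>Tightness. It is not an eventuality along \<open>whp M\<close>, because the bound
  \<open>K\<close> may depend on \<epsilon>.\<close>

definition bdd_prob :: "'a measure \<Rightarrow> (nat \<times> 'a \<Rightarrow> real) \<Rightarrow> bool" where
  "bdd_prob M Y \<longleftrightarrow> (\<forall>\<epsilon>>0. \<exists>K. \<forall>\<^sub>F n in sequentially.
      \<exists>A\<in>sets M. measure M A > 1 - \<epsilon> \<and> (\<forall>w\<in>A. \<bar>Y (n, w)\<bar> \<le> K))"

lemma (in prob_space) prob_Int_gt:
  assumes "A \<in> events" "B \<in> events" "prob A > 1 - a" "prob B > 1 - b"
  shows "prob (A \<inter> B) > 1 - (a + b)"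
proof -
  have "prob (A \<union> B) = prob A + prob B - prob (A \<inter> B)"
    using assms by (simp add: finite_measure_Union' finite_measure_Diff' Int_commute)
  moreover have "prob (A \<union> B) \<le> 1" by simp
  ultimately show ?thesis using assms by linarith
qed

context prob_space
begin

lemma expectation_of_bool: "expectation (\<lambda>w. of_bool (P w)) = prob {w \<in> space M. P w}"
proof -
  have "expectation (\<lambda>w. of_bool (P w)) = expectation (indicator {w \<in> space M. P w} :: 'a \<Rightarrow> real)"
    by (rule Bochner_Integration.integral_cong) (auto simp: indicator_def)
  also have "\<dots> = prob {w \<in> space M. P w}"
    unfolding Bochner_Integration.integral_indicator by (rule arg_cong[of _ _ prob]) auto
  finally show ?thesis .
qed

text \<open>The witness \<open>A\<close> is an event inside the set where \<open>P\<close> holds, so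
  that set may be arbitrary. A conjunction spends \<epsilon> / 2 on each of its parts, which gives
  the filter property.\<close>

lemma eventually_whp:
  "eventually P (whp M) \<longleftrightarrow> (\<forall>\<epsilon>>0. \<forall>\<^sub>F n in sequentially.
      \<exists>A\<in>events. prob A > 1 - \<epsilon> \<and> (\<forall>w\<in>A. P (n, w)))"
  unfolding whp_def
proof (rule eventually_Abs_filter, rule is_filter.intro)
  show "\<forall>\<epsilon>>0. \<forall>\<^sub>F n in sequentially. \<exists>A\<in>events. 1 - \<epsilon> < prob A \<and> (\<forall>w\<in>A. True)"
    by (auto intro!: always_eventually bexI[of _ "space M"] simp: prob_space)
next
  fix P Q :: "nat \<times> 'a \<Rightarrow> bool"
  assume P: "\<forall>\<epsilon>>0. \<forall>\<^sub>F n in sequentially. \<exists>A\<in>events. 1 - \<epsilon> < prob A \<and> (\<forall>w\<in>A. P (n, w))"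
    and Q: "\<forall>\<epsilon>>0. \<forall>\<^sub>F n in sequentially. \<exists>A\<in>events. 1 - \<epsilon> < prob A \<and> (\<forall>w\<in>A. Q (n, w))"
  show "\<forall>\<epsilon>>0. \<forall>\<^sub>F n in sequentially.
      \<exists>A\<in>events. 1 - \<epsilon> < prob A \<and> (\<forall>w\<in>A. P (n, w) \<and> Q (n, w))"
  proof (intro allI impI)
    fix \<epsilon> :: real assume "\<epsilon> > 0"
    then have "\<epsilon> / 2 > 0" by simp
    from P[rule_format, OF this] Q[rule_format, OF this]
    show "\<forall>\<^sub>F n in sequentially. \<exists>A\<in>events. 1 - \<epsilon> < prob A \<and> (\<forall>w\<in>A. P (n, w) \<and> Q (n, w))"
    proof eventually_elim
      case (elim n)
      then obtain A B where "A \<in> events" "1 - \<epsilon> / 2 < prob A" "\<forall>w\<in>A. P (n, w)"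
        "B \<in> events" "1 - \<epsilon> / 2 < prob B" "\<forall>w\<in>B. Q (n, w)" by blast
      then show ?case
        using prob_Int_gt[of A B "\<epsilon> / 2" "\<epsilon> / 2"] by (intro bexI[of _ "A \<inter> B"]) auto
    qed
  qed
next
  fix P Q :: "nat \<times> 'a \<Rightarrow> bool"
  assume PQ: "\<forall>x. P x \<longrightarrow> Q x"
    and P: "\<forall>\<epsilon>>0. \<forall>\<^sub>F n in sequentially. \<exists>A\<in>events. 1 - \<epsilon> < prob A \<and> (\<forall>w\<in>A. P (n, w))"
  show "\<forall>\<epsilon>>0. \<forall>\<^sub>F n in sequentially. \<exists>A\<in>events. 1 - \<epsilon> < prob A \<and> (\<forall>w\<in>A. Q (n, w))"
    using P PQ by (fast elim!: eventually_mono)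
qed

lemma filterlim_fst_whp: "filterlim fst sequentially (whp M)"
  unfolding filterlim_iff
proof (intro allI impI)
  fix P :: "nat \<Rightarrow> bool" assume "eventually P sequentially"
  then show "\<forall>\<^sub>F x in whp M. P (fst x)"
    unfolding eventually_whp
    by (auto elim!: eventually_mono intro!: bexI[of _ "space M"] simp: prob_space)
qed

lemma eventually_whp_fst:
  assumes "eventually P sequentially"
  shows "\<forall>\<^sub>F x in whp M. P (fst x)"
  using filterlim_fst_whp assms by (auto simp: filterlim_iff)

lemma tendsto_whp_fst: "(f \<longlongrightarrow> l) sequentially \<Longrightarrow> ((\<lambda>x. f (fst x)) \<longlongrightarrow> l) (whp M)"
  by (rule filterlim_compose[OF _ filterlim_fst_whp])

lemma eventually_whp_space: "\<forall>\<^sub>F x in whp M. snd x \<in> space M"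
  unfolding eventually_whp
  by (auto intro!: always_eventually bexI[of _ "space M"] simp: prob_space)

lemma eventually_whpI:
  assumes "\<forall>\<^sub>F n in sequentially. E n \<in> events" "(\<lambda>n. prob (E n)) \<longlonglongrightarrow> 1"
    and "\<forall>\<^sub>F n in sequentially. \<forall>w\<in>E n. P (n, w)"
  shows "eventually P (whp M)"
  unfolding eventually_whp
proof (intro allI impI)
  fix \<epsilon> :: real assume "\<epsilon> > 0"
  with assms(2) have "\<forall>\<^sub>F n in sequentially. prob (E n) > 1 - \<epsilon>"
    by (intro order_tendstoD(1)) auto
  with assms(1,3) show "\<forall>\<^sub>F n in sequentially. \<exists>A\<in>events. 1 - \<epsilon> < prob A \<and> (\<forall>w\<in>A. P (n, w))"
    by eventually_elim auto
qed

lemma prob_tendsto_1_if_whp: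
  assumes "\<forall>\<^sub>F n in sequentially. E n \<in> events" "\<forall>\<^sub>F x in whp M. snd x \<in> E (fst x)"
  shows "(\<lambda>n. prob (E n)) \<longlonglongrightarrow> 1"
proof (rule order_tendstoI)
  fix a :: real assume "a < 1"
  then have "1 - a > 0" by simp
  from assms(2)[unfolded eventually_whp, rule_format, OF this] assms(1)
  show "\<forall>\<^sub>F n in sequentially. a < prob (E n)"
    by eventually_elim (force intro: less_le_trans[OF _ finite_measure_mono])
next
  fix a :: real assume "1 < a"
  then show "\<forall>\<^sub>F n in sequentially. prob (E n) < a"
    by (intro always_eventually allI) (metis le_less_trans prob_le_1)
qed

lemma tendsto_in_prob_imp_whp:
  assumes "tendsto_in_prob M Y y" "\<And>n. Y n \<in> borel_measurable M"
  shows "((\<lambda>x. Y (fst x) (snd x)) \<longlongrightarrow> y) (whp M)"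
proof (rule tendstoI)
  fix e :: real assume e: "e > 0"
  \<comment> \<open>The radius is halved because the complement of this event only yields a weak
    inequality, while a strict bound by \<open>e\<close> is required.\<close>
  have m: "{w \<in> space M. dist (Y n w) y > e / 2} \<in> events" for n
  proof -
    have "{w \<in> space M. dist (Y n w) y > e / 2} = Y n -` (- cball y (e/2)) \<inter> space M"
      by (auto simp: dist_commute)
    also have "\<dots> \<in> events"
      by (rule measurable_sets[OF assms(2)]) auto
    finally show ?thesis .
  qed
  have "(\<lambda>n. 1 - prob {w \<in> space M. dist (Y n w) y > e / 2}) \<longlonglongrightarrow> 1 - 0"
    using assms(1) by (intro tendsto_diff tendsto_const) (use half_gt_zero[OF e] in \<open>auto simp only: tendsto_in_prob_def\<close>)
  then have *: "(\<lambda>n. prob (space M - {w \<in> space M. dist (Y n w) y > e / 2})) \<longlonglongrightarrow> 1"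
    by (subst prob_compl[OF m]) simp
  show "\<forall>\<^sub>F x in whp M. dist (Y (fst x) (snd x)) y < e"
    by (rule eventually_whpI[OF _ *]) (use m e in \<open>auto intro!: always_eventually\<close>)
qed

lemma tendsto_in_prob_at_topI:
  assumes "\<forall>\<^sub>F n in sequentially. Y n \<in> borel_measurable M"
    and "filterlim (\<lambda>x. Y (fst x) (snd x)) at_top (whp M)"
  shows "tendsto_in_prob_at_top M Y"
  unfolding tendsto_in_prob_at_top_def
proof
  fix C
  show "(\<lambda>n. prob {w \<in> space M. C < Y n w}) \<longlonglongrightarrow> 1"
  proof (rule prob_tendsto_1_if_whp)
    show "\<forall>\<^sub>F n in sequentially. {w \<in> space M. C < Y n w} \<in> events"
      using assms(1) by (rule eventually_mono) measurable
    show "\<forall>\<^sub>F x in whp M. snd x \<in> {w \<in> space M. C < Y (fst x) w}"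
      using eventually_whp_space assms(2)[unfolded filterlim_at_top_dense, rule_format, of C]
      by eventually_elim auto
  qed
qed

section \<open>Moment criteria and the calculus of tight sequences\<close>

lemma whp_second_moment:
  fixes Y :: "nat \<Rightarrow> 'a \<Rightarrow> real"
  assumes "\<And>n. Y n \<in> borel_measurable M" "\<forall>\<^sub>F n in sequentially. integrable M (\<lambda>w. (Y n w)\<^sup>2)"
    and "(\<lambda>n. expectation (\<lambda>w. (Y n w)\<^sup>2)) \<longlonglongrightarrow> 0"
  shows "((\<lambda>x. Y (fst x) (snd x)) \<longlongrightarrow> 0) (whp M)"
proof (rule tendsto_in_prob_imp_whp[OF _ assms(1)], unfold tendsto_in_prob_def, intro allI impI)
  fix e :: real assume e: "e > 0"
  show "(\<lambda>n. prob {w \<in> space M. e < dist (Y n w) 0}) \<longlonglongrightarrow> 0"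
  proof (rule tendsto_sandwich[OF _ _ tendsto_const])
    show "\<forall>\<^sub>F n in sequentially. 0 \<le> prob {w \<in> space M. e < dist (Y n w) 0}" by simp
    show "\<forall>\<^sub>F n in sequentially. prob {w \<in> space M. e < dist (Y n w) 0} \<le> expectation (\<lambda>w. (Y n w)\<^sup>2) / e\<^sup>2"
      using assms(2)
    proof eventually_elim
      case (elim n)
      note [measurable] = assms(1)
      have "prob {w \<in> space M. e < dist (Y n w) 0} \<le> prob {w \<in> space M. e \<le> \<bar>Y n w\<bar>}"
        by (rule finite_measure_mono) auto
      also have "\<dots> \<le> expectation (\<lambda>w. (Y n w)\<^sup>2) / e\<^sup>2"
        by (rule second_moment_method) (use elim e in auto)
      finally show ?case .
    qed
    show "(\<lambda>n. expectation (\<lambda>w. (Y n w)\<^sup>2) / e\<^sup>2) \<longlonglongrightarrow> 0"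
      using tendsto_divide[OF assms(3) tendsto_const, of "e^2"] e by simp
  qed
qed

lemma bdd_prob_second_moment:
  fixes Y :: "nat \<Rightarrow> 'a \<Rightarrow> real"
  assumes "\<And>n. Y n \<in> borel_measurable M"
    and "\<forall>\<^sub>F n in sequentially. integrable M (\<lambda>w. (Y n w)\<^sup>2) \<and> expectation (\<lambda>w. (Y n w)\<^sup>2) \<le> C"
  shows "bdd_prob M (\<lambda>x. Y (fst x) (snd x))"
  unfolding bdd_prob_def
proof (intro allI impI)
  fix \<epsilon> :: real assume e: "\<epsilon> > 0"
  \<comment> \<open>Chebyshev's inequality requires C / K^2 < \<epsilon>. The added ones keep
    \<open>K\<close> positive and the inequality strict whatever the sign of
    \<open>C\<close>.\<close>
  define K where "K = sqrt ((\<bar>C\<bar> + 1) / \<epsilon>) + 1"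
  have K: "K > 0" and K2: "C / K\<^sup>2 < \<epsilon>"
  proof -
    have s: "sqrt ((\<bar>C\<bar> + 1) / \<epsilon>) > 0" using e by simp
    then show K: "K > 0" unfolding K_def by linarith
    have "K\<^sup>2 > (sqrt ((\<bar>C\<bar> + 1) / \<epsilon>))\<^sup>2" by (rule power_strict_mono) (use s in \<open>auto simp: K_def\<close>)
    then have "K\<^sup>2 * \<epsilon> > \<bar>C\<bar> + 1" using e by (simp add: field_simps)
    then show "C / K\<^sup>2 < \<epsilon>" using K by (simp add: field_simps)
  qed
  show "\<exists>K. \<forall>\<^sub>F n in sequentially. \<exists>A\<in>events. 1 - \<epsilon> < prob A \<and> (\<forall>w\<in>A. \<bar>Y (fst (n, w)) (snd (n, w))\<bar> \<le> K)"
    using assms(2)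
  proof (intro exI[of _ K], eventually_elim)
    case (elim n)
    note [measurable] = assms(1)
    have "prob {w \<in> space M. K \<le> \<bar>Y n w\<bar>} \<le> expectation (\<lambda>w. (Y n w)\<^sup>2) / K\<^sup>2"
      by (rule second_moment_method) (use elim K in auto)
    also have "\<dots> \<le> C / K\<^sup>2" using elim by (intro divide_right_mono) auto
    also note K2
    finally have "prob (space M - {w \<in> space M. K \<le> \<bar>Y n w\<bar>}) > 1 - \<epsilon>"
      by (subst prob_compl) auto
    then show ?case
      by (intro bexI[of _ "space M - {w \<in> space M. K \<le> \<bar>Y n w\<bar>}"]) auto
  qed
qed

text \<open>The bound on \<open>Y\<close> is fixed first, on an event of probability above 1 -
  \<epsilon> / 2; the smallness of \<open>X\<close> is then requested relative to that
  bound.\<close>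

lemma tendsto_mult_bdd_prob:
  assumes "(X \<longlongrightarrow> 0) (whp M)" "bdd_prob M Y"
  shows "((\<lambda>x. X x * Y x) \<longlongrightarrow> 0) (whp M)"
proof (rule tendstoI)
  fix e :: real assume e: "e > 0"
  show "\<forall>\<^sub>F x in whp M. dist (X x * Y x) 0 < e"
    unfolding eventually_whp
  proof (intro allI impI)
    fix \<epsilon> :: real assume "\<epsilon> > 0"
    then have e2: "\<epsilon> / 2 > 0" by simp
    from assms(2)[unfolded bdd_prob_def, rule_format, OF e2] obtain K where
      K: "\<forall>\<^sub>F n in sequentially. \<exists>A\<in>events. 1 - \<epsilon> / 2 < prob A \<and> (\<forall>w\<in>A. \<bar>Y (n, w)\<bar> \<le> K)" by blast
    define K' where "K' = \<bar>K\<bar> + 1"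
    have K': "K' > 0" by (simp add: K'_def)
    have "\<forall>\<^sub>F x in whp M. dist (X x) 0 < e / K'"
      using assms(1) by (rule tendstoD) (use e K' in auto)
    from this[unfolded eventually_whp, rule_format, OF e2] K
    show "\<forall>\<^sub>F n in sequentially. \<exists>A\<in>events. 1 - \<epsilon> < prob A \<and> (\<forall>w\<in>A. dist (X (n, w) * Y (n, w)) 0 < e)"
    proof eventually_elim
      case (elim n)
      then obtain A B where AB: "A \<in> events" "1 - \<epsilon> / 2 < prob A" "\<forall>w\<in>A. dist (X (n, w)) 0 < e / K'"
        "B \<in> events" "1 - \<epsilon> / 2 < prob B" "\<forall>w\<in>B. \<bar>Y (n, w)\<bar> \<le> K" by blast
      have "dist (X (n, w) * Y (n, w)) 0 < e" if "w \<in> A \<inter> B" for w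
      proof -
        have "\<bar>X (n, w)\<bar> * \<bar>Y (n, w)\<bar> \<le> \<bar>X (n, w)\<bar> * K'"
          using AB that by (intro mult_left_mono) (auto simp: K'_def intro: order_trans)
        also have "\<dots> < e"
          using AB that K' by (simp add: field_simps)
        finally show ?thesis by (simp add: abs_mult)
      qed
      then show ?case
        using AB prob_Int_gt[of A B "\<epsilon> / 2" "\<epsilon> / 2"] by (intro bexI[of _ "A \<inter> B"]) auto
    qed
  qed
qed

lemma bdd_prob_mult:
  assumes "bdd_prob M X" "bdd_prob M Y"
  shows "bdd_prob M (\<lambda>x. X x * Y x)"
  unfolding bdd_prob_def
proof (intro allI impI)
  fix \<epsilon> :: real assume "\<epsilon> > 0"
  then have e2: "\<epsilon> / 2 > 0" by simp
  from assms[unfolded bdd_prob_def, rule_format, OF e2] obtain K L where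
    KL: "\<forall>\<^sub>F n in sequentially. \<exists>A\<in>events. 1 - \<epsilon> / 2 < prob A \<and> (\<forall>w\<in>A. \<bar>X (n, w)\<bar> \<le> K)"
      "\<forall>\<^sub>F n in sequentially. \<exists>A\<in>events. 1 - \<epsilon> / 2 < prob A \<and> (\<forall>w\<in>A. \<bar>Y (n, w)\<bar> \<le> L)" by blast
  show "\<exists>K. \<forall>\<^sub>F n in sequentially. \<exists>A\<in>events. 1 - \<epsilon> < prob A \<and> (\<forall>w\<in>A. \<bar>X (n, w) * Y (n, w)\<bar> \<le> K)"
    using KL
  proof (intro exI[of _ "\<bar>K\<bar> * \<bar>L\<bar>"], eventually_elim)
    case (elim n)
    then obtain A B where AB: "A \<in> events" "1 - \<epsilon> / 2 < prob A" "\<forall>w\<in>A. \<bar>X (n, w)\<bar> \<le> K"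
      "B \<in> events" "1 - \<epsilon> / 2 < prob B" "\<forall>w\<in>B. \<bar>Y (n, w)\<bar> \<le> L" by blast
    have "\<bar>X (n, w) * Y (n, w)\<bar> \<le> \<bar>K\<bar> * \<bar>L\<bar>" if "w \<in> A \<inter> B" for w
      unfolding abs_mult by (rule mult_mono) (use AB that in \<open>auto intro: order_trans\<close>)
    then show ?case
      using AB prob_Int_gt[of A B "\<epsilon> / 2" "\<epsilon> / 2"] by (intro bexI[of _ "A \<inter> B"]) auto
  qed
qed

lemma bdd_prob_add:
  assumes "bdd_prob M X" "bdd_prob M Y"
  shows "bdd_prob M (\<lambda>x. X x + Y x)"
  unfolding bdd_prob_def
proof (intro allI impI)
  fix \<epsilon> :: real assume "\<epsilon> > 0"
  then have e2: "\<epsilon> / 2 > 0" by simp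
  from assms[unfolded bdd_prob_def, rule_format, OF e2] obtain K L where
    KL: "\<forall>\<^sub>F n in sequentially. \<exists>A\<in>events. 1 - \<epsilon> / 2 < prob A \<and> (\<forall>w\<in>A. \<bar>X (n, w)\<bar> \<le> K)"
      "\<forall>\<^sub>F n in sequentially. \<exists>A\<in>events. 1 - \<epsilon> / 2 < prob A \<and> (\<forall>w\<in>A. \<bar>Y (n, w)\<bar> \<le> L)" by blast
  show "\<exists>K. \<forall>\<^sub>F n in sequentially. \<exists>A\<in>events. 1 - \<epsilon> < prob A \<and> (\<forall>w\<in>A. \<bar>X (n, w) + Y (n, w)\<bar> \<le> K)"
    using KL
  proof (intro exI[of _ "K + L"], eventually_elim)
    case (elim n)
    then obtain A B where AB: "A \<in> events" "1 - \<epsilon> / 2 < prob A" "\<forall>w\<in>A. \<bar>X (n, w)\<bar> \<le> K"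
      "B \<in> events" "1 - \<epsilon> / 2 < prob B" "\<forall>w\<in>B. \<bar>Y (n, w)\<bar> \<le> L" by blast
    have "\<bar>X (n, w) + Y (n, w)\<bar> \<le> K + L" if "w \<in> A \<inter> B" for w
      by (rule order_trans[OF abs_triangle_ineq add_mono]) (use AB that in auto)
    then show ?case
      using AB prob_Int_gt[of A B "\<epsilon> / 2" "\<epsilon> / 2"] by (intro bexI[of _ "A \<inter> B"]) auto
  qed
qed

lemma bdd_prob_tendsto:
  assumes "(X \<longlongrightarrow> (c::real)) (whp M)"
  shows "bdd_prob M X"
  unfolding bdd_prob_def
proof (intro allI impI exI)
  fix \<epsilon> :: real assume "\<epsilon> > 0"
  have "\<forall>\<^sub>F x in whp M. \<bar>X x\<bar> \<le> \<bar>c\<bar> + 1"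
    using tendstoD[OF assms zero_less_one] by eventually_elim (auto simp: dist_real_def)
  then show "\<forall>\<^sub>F n in sequentially. \<exists>A\<in>events. 1 - \<epsilon> < prob A \<and> (\<forall>w\<in>A. \<bar>X (n, w)\<bar> \<le> \<bar>c\<bar> + 1)"
    using \<open>\<epsilon> > 0\<close> unfolding eventually_whp by blast
qed

lemma bdd_prob_sum:
  assumes "\<And>i. i \<in> I \<Longrightarrow> bdd_prob M (X i)"
  shows "bdd_prob M (\<lambda>x. \<Sum>i\<in>I. X i x)"
proof (cases "finite I")
  case True
  then show ?thesis using assms
    by induction (auto intro: bdd_prob_add bdd_prob_tendsto[OF tendsto_const])
qed (auto intro: bdd_prob_tendsto[OF tendsto_const])

lemma bdd_prob_close:
  assumes "bdd_prob M X" "((\<lambda>x. Y x - X x) \<longlongrightarrow> 0) (whp M)"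
  shows "bdd_prob M Y"
  using bdd_prob_add[OF assms(1) bdd_prob_tendsto[OF assms(2)]] by simp

text \<open>Outside an event of probability below r / 4, \<open>E n\<close> lies between the
  sublevel sets of \<open>Y n\<close> at q - d / 2 and q + d / 2, and continuity of \<open>F\<close>
  at \<open>q\<close> closes the gap. The approximated quantity \<open>Z\<close> may be any function
  on pairs; it enters only through the events \<open>E n\<close>.\<close>

lemma slutsky_cdf:
  fixes Y :: "nat \<Rightarrow> 'a \<Rightarrow> real" and F :: "real \<Rightarrow> real"
  assumes Y: "\<And>n. Y n \<in> borel_measurable M"
    and lim: "\<And>y. (\<lambda>n. prob {w \<in> space M. Y n w \<le> y}) \<longlonglongrightarrow> F y"
    and F: "isCont F q"
    and Z: "((\<lambda>x. Z x - Y (fst x) (snd x)) \<longlongrightarrow> 0) (whp M)"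
    and E: "\<forall>\<^sub>F n in sequentially. E n \<in> events"
      "\<forall>\<^sub>F x in whp M. snd x \<in> E (fst x) \<longleftrightarrow> Z x \<le> q"
  shows "(\<lambda>n. prob (E n)) \<longlonglongrightarrow> F q"
proof (rule LIMSEQ_I)
  fix r :: real assume "r > 0"
  then obtain d where d: "d > 0" and Fd: "\<And>y. \<bar>y - q\<bar> < d \<Longrightarrow> \<bar>F y - F q\<bar> < r / 4"
    using F[unfolded isCont_def LIM_def, rule_format, of "r/4"]
    by (metis abs_0 dist_real_def divide_pos_pos less_numeral_extra(3) right_minus_eq zero_less_numeral)
  define y1 where "y1 = q - d/2" define y2 where "y2 = q + d/2"
  have y: "\<bar>F y1 - F q\<bar> < r / 4" "\<bar>F y2 - F q\<bar> < r / 4"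
    using d Fd[of y1] Fd[of y2] by (simp_all add: y1_def y2_def)
  have "\<forall>\<^sub>F x in whp M. dist (Z x - Y (fst x) (snd x)) 0 < d/2"
    using Z by (rule tendstoD) (use d in auto)
  with E(2) have "\<forall>\<^sub>F x in whp M. (snd x \<in> E (fst x) \<longrightarrow> Y (fst x) (snd x) \<le> y2) \<and>
      (Y (fst x) (snd x) \<le> y1 \<longrightarrow> snd x \<in> E (fst x))"
  proof eventually_elim
    case (elim x)
    then have "Z x - Y (fst x) (snd x) < d / 2" "Y (fst x) (snd x) - Z x < d / 2"
      by (simp_all only: dist_real_def abs_less_iff diff_0_right) auto
    then show ?case using elim(1) by (auto simp: y1_def y2_def)
  qed
  from this[unfolded eventually_whp, rule_format, of "r/4"] \<open>r > 0\<close>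
  have ev: "\<forall>\<^sub>F n in sequentially. \<exists>A\<in>events. 1 - r / 4 < prob A \<and>
      (\<forall>w\<in>A. (w \<in> E n \<longrightarrow> Y n w \<le> y2) \<and> (Y n w \<le> y1 \<longrightarrow> w \<in> E n))" by simp
  have "\<forall>\<^sub>F n in sequentially. dist (prob {w \<in> space M. Y n w \<le> y1}) (F y1) < r/4"
       "\<forall>\<^sub>F n in sequentially. dist (prob {w \<in> space M. Y n w \<le> y2}) (F y2) < r/4"
    by (rule tendstoD[OF lim], use \<open>r > 0\<close> in simp)+
  with ev E(1) have "\<forall>\<^sub>F n in sequentially. norm (prob (E n) - F q) < r"
  proof eventually_elim
    case (elim n)
    then obtain A where A: "A \<in> events" "1 - r / 4 < prob A"
      "\<forall>w\<in>A. (w \<in> E n \<longrightarrow> Y n w \<le> y2) \<and> (Y n w \<le> y1 \<longrightarrow> w \<in> E n)" by blast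
    note [measurable] = Y elim(2) A(1)
    have comp: "prob (space M - A) < r / 4" using A by (simp add: prob_compl)
    have "prob (E n) \<le> prob ({w \<in> space M. Y n w \<le> y2} \<union> (space M - A))"
      by (rule finite_measure_mono) (use A sets.sets_into_space[OF elim(2)] in auto)
    also have "\<dots> \<le> prob {w \<in> space M. Y n w \<le> y2} + prob (space M - A)"
      by (rule measure_Un_le) auto
    finally have 1: "prob (E n) \<le> prob {w \<in> space M. Y n w \<le> y2} + r / 4" using comp by simp
    have "prob {w \<in> space M. Y n w \<le> y1} \<le> prob (E n \<union> (space M - A))"
      by (rule finite_measure_mono) (use A elim(2) in auto)
    also have "\<dots> \<le> prob (E n) + prob (space M - A)"
      by (rule measure_Un_le) (use elim(2) in auto)
    finally have 2: "prob {w \<in> space M. Y n w \<le> y1} \<le> prob (E n) + r / 4" using comp by simp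
    show ?case using 1 2 y elim(3,4) unfolding dist_real_def real_norm_def abs_less_iff by linarith
  qed
  then show "\<exists>no. \<forall>n\<ge>no. norm (prob (E n) - F q) < r" by (simp add: eventually_sequentially)
qed

end

section \<open>Order statistics\<close>

text \<open>An upward closed property of a sorted list is true on a final segment, which turns a
  statement about one entry into a count. The property is abstract so as to cover both > c and \<ge>
  c.\<close>

lemma sorted_nth_upward_iff:
  fixes xs :: "'a::linorder list"
  assumes "sorted xs" "i < length xs" and up: "\<And>x y. P x \<Longrightarrow> x \<le> y \<Longrightarrow> P y"
  shows "P (xs ! i) \<longleftrightarrow> length (filter P xs) \<ge> length xs - i"
proof
  assume c: "P (xs ! i)"
  have "{i..<length xs} \<subseteq> {j. j < length xs \<and> P (xs ! j)}"
    using up[OF c] sorted_nth_mono[OF assms(1), of i] by auto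
  from card_mono[OF _ this] show "length (filter P xs) \<ge> length xs - i"
    by (simp add: length_filter_conv_card)
next
  assume l: "length (filter P xs) \<ge> length xs - i"
  show "P (xs ! i)"
  proof (rule ccontr)
    assume n: "\<not> P (xs ! i)"
    have "{j. j < length xs \<and> P (xs ! j)} \<subseteq> {i<..<length xs}"
    proof
      fix j assume j: "j \<in> {j. j < length xs \<and> P (xs ! j)}"
      then have "\<not> j \<le> i" using n up[of "xs ! j" "xs ! i"] sorted_nth_mono[OF assms(1), of j i] assms(2) by auto
      then show "j \<in> {i<..<length xs}" using j by auto
    qed
    from card_mono[OF _ this] have "length (filter P xs) \<le> length xs - Suc i"
      by (simp add: length_filter_conv_card)
    with l assms(2) show False by linarith
  qed
qed

lemma length_filter_sort_map:
  "length (filter P (sort (map x [1..<Suc n]))) = card {i \<in> {1..n}. P (x i)}"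
proof -
  have "length (filter P (sort (map x [1..<Suc n]))) = length (filter P (map x [1..<Suc n]))"
    by (metis mset_filter mset_sort size_mset)
  also have "\<dots> = length (filter (P \<circ> x) [1..<Suc n])" by (simp only: filter_map length_map)
  also have "\<dots> = card (set (filter (P \<circ> x) [1..<Suc n]))"
    by (rule distinct_card[symmetric]) simp
  also have "set (filter (P \<circ> x) [1..<Suc n]) = {i \<in> {1..n}. P (x i)}" by auto
  finally show ?thesis .
qed

text \<open>Order statistics are numbered from 1 and list entries from 0, whence
  \<open>n + 1 - i\<close>. At i = n - k the condition reads: at least k + 1 observations have the
  property.\<close>

lemma order_stat_upward_iff:
  assumes "1 \<le> i" "i \<le> n" and "\<And>y z. P y \<Longrightarrow> y \<le> z \<Longrightarrow> P z"
  shows "P (order_stat x n i) \<longleftrightarrow> card {l \<in> {1..n}. P (x l)} \<ge> n + 1 - i"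
  unfolding order_stat_def using assms(1,2)
  by (subst sorted_nth_upward_iff[OF _ _ assms(3)])
    (auto simp only: length_filter_sort_map sorted_sort length_sort length_map length_upt)

lemma order_stat_gt_iff:
  "1 \<le> i \<Longrightarrow> i \<le> n \<Longrightarrow> order_stat x n i > c \<longleftrightarrow> card {l \<in> {1..n}. x l > c} \<ge> n + 1 - i"
  by (rule order_stat_upward_iff) auto

lemma order_stat_ge_iff:
  "1 \<le> i \<Longrightarrow> i \<le> n \<Longrightarrow> order_stat x n i \<ge> c \<longleftrightarrow> card {l \<in> {1..n}. x l \<ge> c} \<ge> n + 1 - i"
  by (rule order_stat_upward_iff) auto

lemma order_stat_mono:
  assumes "1 \<le> i" "i \<le> j" "j \<le> n"
  shows "order_stat x n i \<le> order_stat x n j"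
  unfolding order_stat_def using assms by (intro sorted_nth_mono) auto

text \<open>Sorting commutes even with a map that merges values; strict monotonicity would exclude
  distribution functions with flat parts.\<close>

lemma order_stat_comp_mono:
  assumes "mono f" "1 \<le> i" "i \<le> n"
  shows "order_stat (\<lambda>l. f (x l)) n i = f (order_stat x n i)"
proof -
  have "sort (map (\<lambda>l. f (x l)) [1..<Suc n]) = map f (sort (map x [1..<Suc n]))"
    by (rule properties_for_sort, auto simp: sorted_map comp_def  intro!: sorted_wrt_mono_rel[OF _ sorted_sort] monoD[OF assms(1)] simp del: upt_Suc,
        simp add: image_mset.compositionality comp_def)
  then show ?thesis unfolding order_stat_def using assms(2,3) by (simp add: nth_map del: upt_Suc)
qed

lemma sum_order_stat:
  fixes f :: "real \<Rightarrow> real"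
  shows "(\<Sum>i=1..n. f (order_stat x n i)) = (\<Sum>l=1..n. f (x l))"
proof -
  let ?s = "sort (map x [1..<Suc n])"
  have "(\<Sum>l=1..n. f (x l)) = sum_list (map f (map x [1..<Suc n]))"
    by (simp add: interv_sum_list_conv_sum_set_nat atLeastLessThanSuc_atLeastAtMost comp_def del: upt_Suc)
  also have "\<dots> = sum_list (map f ?s)"
    by (metis mset_map mset_sort sum_mset_sum_list)
  also have "\<dots> = (\<Sum>i<n. f (?s ! i))"
    by (simp add: sum_list_sum_nth atLeast0LessThan del: upt_Suc)
  also have "\<dots> = (\<Sum>i=1..n. f (?s ! (i - 1)))"
    by (rule sum.reindex_bij_witness[of _ "\<lambda>i. i - 1" Suc]) auto
  finally show ?thesis by (simp add: order_stat_def)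
qed

text \<open>The ranks up to n - k contribute 0 to the positive parts, so the sum over top ranks
  becomes a sum over the unordered observations. Once the threshold is replaced by a constant,
  independence can be applied to it.\<close>

lemma sum_top_order_stats:
  assumes "k < n"
  shows "(\<Sum>i=1..k. order_stat x n (n - i + 1) - order_stat x n (n - k)) =
    (\<Sum>l=1..n. max 0 (x l - order_stat x n (n - k)))"
proof -
  let ?t = "order_stat x n (n - k)"
  have "(\<Sum>l=1..n. max 0 (x l - ?t)) = (\<Sum>i=1..n. max 0 (order_stat x n i - ?t))"
    by (rule sum_order_stat[symmetric, where f = "\<lambda>y. max 0 (y - ?t)"])
  also have "\<dots> = (\<Sum>i\<in>{n-k+1..n}. max 0 (order_stat x n i - ?t))"
    by (rule sum.mono_neutral_right) (use assms in \<open>auto simp: not_le intro!: max_absorb1 order_stat_mono\<close>)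
  also have "\<dots> = (\<Sum>i\<in>{n-k+1..n}. order_stat x n i - ?t)"
    by (rule sum.cong) (use assms in \<open>auto intro!: max_absorb2 order_stat_mono\<close>)
  also have "\<dots> = (\<Sum>i=1..k. order_stat x n (n - i + 1) - ?t)"
    by (rule sum.reindex_bij_witness[of _ "\<lambda>i. n - i + 1" "\<lambda>i. n - i + 1"]) (use assms in auto)
  finally show ?thesis ..
qed

text \<open>Moving the threshold from \<open>u\<close> to the random \<open>x\<^bsub>n-k:n\<^esub>\<close> changes the sum of the excesses
  at a rate between \<open>k\<close> and the number of exceedances of \<open>u\<close>.\<close>

lemma top_sum_threshold:
  fixes x :: "nat \<Rightarrow> real" and u :: real
  assumes "k < n"
  defines "\<tau> \<equiv> order_stat x n (n - k) - u"
  defines "T \<equiv> real (card {l \<in> {1..n}. x l \<ge> u})"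
  shows "\<bar>(\<Sum>i=1..k. order_stat x n (n - i + 1) - order_stat x n (n - k)) -
     ((\<Sum>l=1..n. max 0 (x l - u)) - k * \<tau>)\<bar> \<le> \<bar>\<tau>\<bar> * \<bar>T - k\<bar>"
proof -
  have card_sum: "real (card {l \<in> {1..n}. P l}) = (\<Sum>l=1..n. of_bool (P l))" for P
    by (simp add: Int_def)
  have t: "order_stat x n (n - k) = u + \<tau>" by (simp add: \<tau>_def)
  have eq: "(\<Sum>i=1..k. order_stat x n (n - i + 1) - order_stat x n (n - k)) = (\<Sum>l=1..n. max 0 (x l - (u + \<tau>)))"
    using sum_top_order_stats[where x=x, OF assms(1), unfolded t] unfolding t .
  have nk: "1 \<le> n - k" "n - k \<le> n" using assms(1) by auto
  show ?thesis
  proof (cases "\<tau> \<ge> 0")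
    case True
    \<comment> \<open>Ties are harmless: at least k + 1 observations are \<ge> the order statistic
      and at most \<open>k\<close> are > it. The sign of \<tau> decides which of the two counts is
      used.\<close>
    have ge: "card {l \<in> {1..n}. x l \<ge> u + \<tau>} \<ge> k"
      using order_stat_ge_iff[OF nk, of "u + \<tau>" x] assms(1) by (simp add: t)
    have "(\<Sum>l=1..n. max 0 (x l - u)) - (\<Sum>l=1..n. max 0 (x l - (u + \<tau>))) \<le> (\<Sum>l=1..n. \<tau> * of_bool (x l \<ge> u))"
      unfolding sum_subtractf[symmetric] by (rule sum_mono) (use True in auto)
    also have "\<dots> = \<tau> * T" by (simp only: T_def card_sum sum_distrib_left)
    finally have 1: "(\<Sum>l=1..n. max 0 (x l - u)) - (\<Sum>l=1..n. max 0 (x l - (u + \<tau>))) \<le> \<tau> * T" .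
    have "\<tau> * k \<le> \<tau> * real (card {l \<in> {1..n}. x l \<ge> u + \<tau>})"
      using ge True by (intro mult_left_mono) auto
    also have "\<dots> = (\<Sum>l=1..n. \<tau> * of_bool (x l \<ge> u + \<tau>))" by (simp only: card_sum sum_distrib_left)
    also have "\<dots> \<le> (\<Sum>l=1..n. max 0 (x l - u)) - (\<Sum>l=1..n. max 0 (x l - (u + \<tau>)))"
      unfolding sum_subtractf[symmetric] by (rule sum_mono) (use True in auto)
    finally have 2: "\<tau> * k \<le> (\<Sum>l=1..n. max 0 (x l - u)) - (\<Sum>l=1..n. max 0 (x l - (u + \<tau>)))" .
    have "\<tau> * (T - k) \<le> \<bar>\<tau>\<bar> * \<bar>T - k\<bar>"
      unfolding abs_mult[symmetric] by (rule abs_ge_self)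
    with 1 2 show ?thesis unfolding eq abs_le_iff
      by (simp add: right_diff_distrib mult.commute)
  next
    case False
    have le: "card {l \<in> {1..n}. x l > u + \<tau>} \<le> k"
      using order_stat_gt_iff[OF nk, of "u + \<tau>" x] assms(1) by (simp add: t)
    have "(\<Sum>l=1..n. max 0 (x l - (u + \<tau>))) - (\<Sum>l=1..n. max 0 (x l - u)) \<le> (\<Sum>l=1..n. (-\<tau>) * of_bool (x l > u + \<tau>))"
      unfolding sum_subtractf[symmetric] by (rule sum_mono) (use False in auto)
    also have "\<dots> = - \<tau> * real (card {l \<in> {1..n}. x l > u + \<tau>})" by (simp only: card_sum sum_distrib_left)
    also have "\<dots> \<le> - \<tau> * k"
      using le False by (intro mult_left_mono) auto
    finally have 1: "(\<Sum>l=1..n. max 0 (x l - (u + \<tau>))) - (\<Sum>l=1..n. max 0 (x l - u)) \<le> - \<tau> * k" .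
    have "- \<tau> * T = (\<Sum>l=1..n. (-\<tau>) * of_bool (x l \<ge> u))"
      by (simp only: T_def card_sum sum_distrib_left)
    also have "\<dots> \<le> (\<Sum>l=1..n. max 0 (x l - (u + \<tau>))) - (\<Sum>l=1..n. max 0 (x l - u))"
      unfolding sum_subtractf[symmetric] by (rule sum_mono) (use False in auto)
    finally have 2: "- \<tau> * T \<le> (\<Sum>l=1..n. max 0 (x l - (u + \<tau>))) - (\<Sum>l=1..n. max 0 (x l - u))" .
    have "\<tau> * (T - k) \<le> \<bar>\<tau>\<bar> * \<bar>T - k\<bar>"
      unfolding abs_mult[symmetric] by (rule abs_ge_self)
    with 1 2 show ?thesis unfolding eq abs_le_iff
      by (simp add: right_diff_distrib mult.commute)
  qed
qed

section \<open>Expansion of the tail quantile function\<close>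

lemma abs_ln_ratio_le:
  fixes r c :: real
  assumes "c > 0" "\<bar>r - c\<bar> \<le> c / 2"
  shows "\<bar>ln r - ln c\<bar> \<le> 2 / c * \<bar>r - c\<bar>"
proof -
  have "c - r \<le> \<bar>r - c\<bar>" by simp
  then have r: "r \<ge> c / 2" "r > 0" using assms by linarith+
  have 1: "ln r - ln c \<le> (r - c) / c" using r assms ln_diff_le[of r c] by simp
  have 2: "ln c - ln r \<le> (c - r) / r" using r assms ln_diff_le[of c r] by simp
  have "(c - r) / r \<le> \<bar>r - c\<bar> / r" using r by (intro divide_right_mono) auto
  also have "\<dots> \<le> \<bar>r - c\<bar> / (c / 2)" using r assms by (intro divide_left_mono) auto
  finally have 3: "(c - r) / r \<le> 2 / c * \<bar>r - c\<bar>" by (simp add: field_simps)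
  have "(r - c) / c \<le> \<bar>r - c\<bar> / c" using assms by (intro divide_right_mono) auto
  also have "\<dots> \<le> 2 / c * \<bar>r - c\<bar>" using assms by (simp add: field_simps)
  finally show ?thesis using 1 2 3 by (simp add: abs_le_iff)
qed

text \<open>The increments of \<open>h t = ln (U t) - \<gamma> ln t\<close> along \<open>t, 2 t, 4 t, \<dots>\<close> are summable.\<close>

lemma second_order_ln_expansion:
  fixes U :: "real \<Rightarrow> real" and g r b :: real
  assumes so: "second_order U g r A" and r: "r < 0"
    and A: "\<And>t. t > 0 \<Longrightarrow> A t = g * b * t powr r"
    and mono: "\<And>s t. 1 < s \<Longrightarrow> s \<le> t \<Longrightarrow> U s \<le> U t"
  obtains C K t0 where "t0 > 1" "\<And>t. t \<ge> t0 \<Longrightarrow> U t > 0"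
    "\<And>t. t \<ge> t0 \<Longrightarrow> \<bar>ln (U t) - g * ln t - C\<bar> \<le> K * t powr r" "K > 0"
proof -
  define a where "a = \<bar>g * b\<bar>"
  have g: "g > 0" and A0: "\<And>t. t > 0 \<Longrightarrow> A t \<noteq> 0" and Alim: "(A \<longlongrightarrow> 0) at_top"
    and lim: "\<And>x. x > 0 \<Longrightarrow> ((\<lambda>t. 1 / A t * (U (t * x) / U t - x powr g)) \<longlongrightarrow> x powr g * ((x powr r - 1) / r)) at_top"
    using so r unfolding second_order_def by force+
  have a: "a > 0" using A0[of 1] A[of 1] by (simp add: a_def)
  have ratio: "((\<lambda>t. U (t * x) / U t) \<longlongrightarrow> x powr g) at_top" if "x > 0" for x
  proof -
    have "((\<lambda>t. A t * (1 / A t * (U (t * x) / U t - x powr g)) + x powr g) \<longlongrightarrow> 0 * (x powr g * ((x powr r - 1) / r)) + x powr g) at_top"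
      by (intro tendsto_intros Alim lim that)
    then have "((\<lambda>t. A t * (1 / A t * (U (t * x) / U t - x powr g)) + x powr g) \<longlongrightarrow> x powr g) at_top" by simp
    then show ?thesis
      by (rule Lim_transform_eventually) (use eventually_gt_at_top[of 0] in \<open>eventually_elim, auto simp: A0\<close>)
  qed
  \<comment> \<open>The modulus of the limit of the normalised ratio at x = 2, enlarged by 1 to
    become an eventual strict bound.\<close>
  define L where "L = \<bar>2 powr g * ((2 powr r - 1) / r)\<bar> + 1"
  have L: "L > 0" by (simp add: L_def add_nonneg_pos)
  have "\<forall>\<^sub>F t in at_top. \<bar>1 / A t * (U (t * 2) / U t - 2 powr g)\<bar> < L"
    by (rule order_tendstoD(2)[OF tendsto_rabs[OF lim]]) (auto simp: L_def)
  moreover have "\<forall>\<^sub>F t in at_top. U (t * 2) / U t > 1"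
    by (rule order_tendstoD(1)[OF ratio]) (use g in auto)
  moreover have "\<forall>\<^sub>F t in at_top. \<bar>U (t * 2) / U t - 2 powr g\<bar> < 2 powr g / 2"
  proof -
    have "\<forall>\<^sub>F t in at_top. dist (U (t * 2) / U t) (2 powr g) < 2 powr g / 2"
      by (rule tendstoD[OF ratio]) auto
    then show ?thesis by (simp add: dist_real_def)
  qed
  ultimately have "\<forall>\<^sub>F t in at_top. t > 1 \<and> \<bar>1 / A t * (U (t * 2) / U t - 2 powr g)\<bar> < L \<and>
      U (t * 2) / U t > 1 \<and> \<bar>U (t * 2) / U t - 2 powr g\<bar> < 2 powr g / 2"
    using eventually_gt_at_top[of "1::real"] by eventually_elim blast
  then obtain t0 where t0: "\<And>t. t \<ge> t0 \<Longrightarrow> t > 1 \<and> \<bar>1 / A t * (U (t * 2) / U t - 2 powr g)\<bar> < L \<and>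
      U (t * 2) / U t > 1 \<and> \<bar>U (t * 2) / U t - 2 powr g\<bar> < 2 powr g / 2"
    unfolding eventually_at_top_linorder by blast
  have t01: "t0 > 1" using t0[of t0] by simp
  \<comment> \<open>Ratios of \<open>U\<close> do not reveal its sign. If \<open>U t\<close> were
    negative, a ratio above 1 would give U (2 t) < U t, against monotonicity.\<close>
  have Upos: "U t > 0" if "t \<ge> t0" for t
  proof (rule ccontr)
    assume "\<not> U t > 0"
    moreover have "U t \<noteq> 0" using t0[OF that] by auto
    ultimately have "U t < 0" by simp
    moreover have "U (t * 2) / U t > 1" using t0[OF that] by simp
    ultimately have "U (t * 2) < U t" by (simp add: field_simps)
    moreover have "U t \<le> U (t * 2)" using t01 that by (intro mono) auto
    ultimately show False by simp
  qed
  define h where "h t = ln (U t) - g * ln t" for t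
  define K where "K = 2 / 2 powr g * L * a"
  have K: "K > 0" using L a by (simp add: K_def)
  have step: "\<bar>h (t * 2) - h t\<bar> \<le> K * t powr r" if "t \<ge> t0" for t
  proof -
    have t: "t > 1" using t0[OF that] by simp
    have "h (t * 2) - h t = ln (U (t * 2) / U t) - ln (2 powr g)"
      using Upos[OF that] Upos[of "t * 2"] that t by (simp add: h_def ln_div ln_mult ln_powr algebra_simps)
    also have "\<bar>\<dots>\<bar> \<le> 2 / 2 powr g * \<bar>U (t * 2) / U t - 2 powr g\<bar>"
      using t0[OF that] by (intro abs_ln_ratio_le) auto
    also have "\<dots> \<le> 2 / 2 powr g * (L * \<bar>A t\<bar>)"
    proof (rule mult_left_mono)
      have "\<bar>A t\<bar> > 0" using A0 t by simp
      moreover have "\<bar>U (t * 2) / U t - 2 powr g\<bar> / \<bar>A t\<bar> < L" using t0[OF that] by (simp add: abs_mult)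
      ultimately show "\<bar>U (t * 2) / U t - 2 powr g\<bar> \<le> L * \<bar>A t\<bar>" by (simp add: pos_divide_less_eq less_imp_le)
    qed simp
    also have "\<bar>A t\<bar> = a * t powr r" using A[of t] t by (simp add: a_def abs_mult)
    finally show ?thesis by (auto simp: K_def mult_ac mult_left_mono divide_right_mono)
  qed
  \<comment> \<open>The dyadic increments are bounded by a geometric series with this ratio, below 1
    because r < 0; its sum produces the final constant K / (1 - q).\<close>
  define q where "q = (2::real) powr r"
  have q: "0 < q" "q < 1" using r by (auto simp: q_def intro: powr_less_one)
  have pw: "(t * 2 ^ k) powr r = t powr r * q ^ k" if "t > 0" for t k
    using that by (induction k) (auto simp: powr_mult q_def mult_ac)
  define d where "d t k = h (t * 2 ^ Suc k) - h (t * 2 ^ k)" for t k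
  have d: "\<bar>d t k\<bar> \<le> K * t powr r * q ^ k" if "t \<ge> t0" for t k
  proof -
    have "t * 1 \<le> t * 2 ^ k" using that t01 by (intro mult_left_mono) auto
    then have "t * 2 ^ k \<ge> t0" using that by simp
    from step[OF this] show ?thesis using pw[of t k] that t01 by (simp add: d_def mult_ac)
  qed
  have summ: "summable (\<lambda>k. K * t powr r * q ^ k)" for t
    using q by (intro summable_mult summable_geometric) auto
  define l where "l t = h t + suminf (d t)" for t
  have hl: "(\<lambda>k. h (t * 2 ^ k)) \<longlonglongrightarrow> l t" and lb: "\<bar>l t - h t\<bar> \<le> K / (1 - q) * t powr r" if t: "t \<ge> t0" for t
  proof -
    have sd: "summable (d t)" by (rule summable_comparison_test'[OF summ]) (use d[OF t] in auto)
    have sa: "summable (\<lambda>k. \<bar>d t k\<bar>)" by (rule summable_comparison_test'[OF summ]) (use d[OF t] in auto)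
    have "(\<lambda>n. \<Sum>k<n. d t k) \<longlonglongrightarrow> suminf (d t)" using sd by (rule summable_LIMSEQ)
    moreover have "(\<Sum>k<n. d t k) = h (t * 2 ^ n) - h t" for n
      unfolding d_def using sum_lessThan_telescope[of "\<lambda>k. h (t * 2 ^ k)" n] by simp
    ultimately have "(\<lambda>n. h (t * 2 ^ n) - h t) \<longlonglongrightarrow> suminf (d t)" by simp
    from tendsto_add[OF this tendsto_const[of "h t"]] show "(\<lambda>k. h (t * 2 ^ k)) \<longlonglongrightarrow> l t"
      by (simp add: l_def add.commute)
    have "\<bar>suminf (d t)\<bar> \<le> (\<Sum>k. \<bar>d t k\<bar>)" by (rule summable_rabs[OF sa])
    also have "\<dots> \<le> (\<Sum>k. K * t powr r * q ^ k)" by (rule suminf_le[OF d[OF t] sa summ])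
    also have "\<dots> = K * t powr r * (1 / (1 - q))"
      using q by (subst suminf_mult) (auto intro: summable_geometric simp: suminf_geometric)
    finally show "\<bar>l t - h t\<bar> \<le> K / (1 - q) * t powr r" by (simp add: l_def)
  qed
  \<comment> \<open>The dyadic limit could still depend on its starting point. The ratio limit at an
    arbitrary \<open>x\<close> identifies the limits along the sequences started at t and at t
    x.\<close>
  have const: "l (t * x) = l t" if t: "t \<ge> t0" and x: "x \<ge> 1" for t x
  proof -
    have tx: "t * x \<ge> t0" using t x t01 mult_left_mono[of 1 x t] by linarith
    have "((\<lambda>s. h (s * x) - h s) \<longlongrightarrow> ln (x powr g) - g * ln x) at_top"
    proof (rule Lim_transform_eventually)
      show "((\<lambda>s. ln (U (s * x) / U s) - g * ln x) \<longlongrightarrow> ln (x powr g) - g * ln x) at_top"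
        using x by (intro tendsto_intros ratio) auto
      show "\<forall>\<^sub>F s in at_top. ln (U (s * x) / U s) - g * ln x = h (s * x) - h s"
        using eventually_ge_at_top[of t0]
      proof eventually_elim
        case (elim s)
        have "s * x \<ge> t0" using elim x t01 mult_left_mono[of 1 x s] by linarith
        then show ?case using Upos[OF elim] Upos[of "s * x"] elim x t01
          by (simp add: h_def ln_div ln_mult algebra_simps)
      qed
    qed
    then have "((\<lambda>s. h (s * x) - h s) \<longlongrightarrow> 0) at_top" using x by (simp add: ln_powr)
    moreover have "filterlim (\<lambda>k::nat. t * 2 ^ k) at_top sequentially"
    proof -
      have "t > 0" using t t01 by simp
      then show ?thesis by real_asymp
    qed
    ultimately have "((\<lambda>k. h (t * 2 ^ k * x) - h (t * 2 ^ k)) \<longlongrightarrow> 0) sequentially"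
      by (rule filterlim_compose)
    moreover have "((\<lambda>k. h (t * x * 2 ^ k) - h (t * 2 ^ k)) \<longlongrightarrow> l (t * x) - l t) sequentially"
      by (intro tendsto_diff hl t tx)
    ultimately show ?thesis
      using LIMSEQ_unique[of "\<lambda>k. h (t * x * 2 ^ k) - h (t * 2 ^ k)" 0 "l (t * x) - l t"] by (simp add: mult_ac)
  qed
  show thesis
  proof (rule that[of t0 "l t0" "K / (1 - q)"])
    fix t assume t: "t \<ge> t0"
    have "l (t0 * (t / t0)) = l t0" using t t01 by (intro const) auto
    then have "l t = l t0" using t01 by simp
    with lb[OF t] show "\<bar>ln (U t) - g * ln t - l t0\<bar> \<le> K / (1 - q) * t powr r"
      unfolding h_def by (simp add: abs_minus_commute)
  qed (use t01 Upos K q in auto)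
qed

context real_distribution
begin

lemma survival_bounds: "0 \<le> survival M x" "survival M x \<le> 1"
  by (auto simp: survival_def cdf_bounded_prob cdf_nonneg)

lemma survival_antimono: "x \<le> y \<Longrightarrow> survival M y \<le> survival M x"
  by (simp add: survival_def cdf_nondecreasing)

text \<open>Where the survival function vanishes, the extended quotient is \<infinity> and both
  sides are true; elsewhere the quotient is an ordinary real one.\<close>

lemma le_inverse_survival_iff:
  assumes "t > 0"
  shows "ereal t \<le> 1 / ereal (survival M x) \<longleftrightarrow> survival M x \<le> 1 / t"
proof (cases "survival M x = 0")
  case True
  then show ?thesis using assms by (simp add: zero_ereal_def[symmetric] divide_ereal_def)
next
  case False
  then have "survival M x > 0" using survival_bounds[of x] by simp
  then show ?thesis using assms by (simp add: divide_ereal_def one_ereal_def field_simps)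
qed

lemma survival_le_ex: assumes "v > 0" shows "\<exists>x. survival M x \<le> v"
proof -
  have "\<forall>\<^sub>F x in at_top. cdf M x > 1 - v"
    using cdf_lim_at_top_prob by (rule order_tendstoD) (use assms in auto)
  then obtain x where "cdf M x > 1 - v" by (auto simp: eventually_at_top_linorder)
  then show ?thesis by (intro exI[of _ x]) (simp add: survival_def)
qed

lemma survival_le_bdd_below: assumes "v < 1" shows "bdd_below {x. survival M x \<le> v}"
proof -
  have "\<forall>\<^sub>F x in at_bot. cdf M x < 1 - v"
    using cdf_lim_at_bot by (rule order_tendstoD) (use assms in auto)
  then obtain y where y: "\<And>x. x \<le> y \<Longrightarrow> cdf M x < 1 - v" by (auto simp: eventually_at_bot_linorder)
  show ?thesis
  proof (rule bdd_belowI[of _ y])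
    fix x assume "x \<in> {x. survival M x \<le> v}"
    then show "y \<le> x" using y[of x] by (cases "x \<le> y") (auto simp: survival_def)
  qed
qed

lemma tail_quantile_eq:
  assumes "t > 0"
  shows "tail_quantile M t = Inf {x. survival M x \<le> 1 / t}"
  unfolding tail_quantile_def using le_inverse_survival_iff[OF assms] by simp

text \<open>For t \<le> 1 the set below \<open>Inf\<close> is the whole line, where
  \<open>Inf\<close> is an unspecified default; hence the condition 1 < s.\<close>

lemma tail_quantile_mono:
  assumes "1 < s" "s \<le> t"
  shows "tail_quantile M s \<le> tail_quantile M t"
proof -
  have "1 / t \<le> 1 / s" using assms by (simp add: frac_le)
  then show ?thesis
    using assms survival_le_ex[of "1/t"] survival_le_bdd_below[of "1/s"]
    by (subst (1 2) tail_quantile_eq) (auto intro!: cInf_superset_mono)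
qed

lemma tail_quantile_inverse_survival_le:
  assumes "0 < survival M x" "survival M x < 1"
  shows "tail_quantile M (1 / survival M x) \<le> x"
  using assms survival_le_bdd_below[of "survival M x"]
  by (subst tail_quantile_eq) (auto intro!: cInf_lower)

lemma le_tail_quantile:
  assumes "0 < survival M x" "t > 1 / survival M x"
  shows "x \<le> tail_quantile M t"
proof -
  have t: "t > 0" using assms by (meson divide_pos_pos less_trans zero_less_one)
  have "1 / t < survival M x" using assms t by (simp add: field_simps)
  then show ?thesis using survival_le_ex[of "1/t"] t survival_antimono
    by (subst tail_quantile_eq[OF t]) (auto intro!: cInf_greatest, smt (verit) survival_antimono)
qed

text \<open>Every large \<open>x\<close> lies between \<open>U (1 / survival x)\<close> and \<open>U t\<close> for all \<open>t > 1 / survival x\<close>;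
  no almost sure statement is needed even if the distribution function has flat parts.\<close>

lemma ln_survival_expansion:
  assumes so: "second_order (tail_quantile M) g r A" and r: "r < 0"
    and A: "\<And>t. t > 0 \<Longrightarrow> A t = g * b * t powr r"
  obtains C K v0 where "0 < v0" "v0 < 1" "K > 0" "\<And>x. survival M x > 0"
    "\<And>x. survival M x \<le> v0 \<Longrightarrow> x > 0"
    "\<And>x. survival M x \<le> v0 \<Longrightarrow>
       \<bar>ln x - g * (- ln (survival M x)) - C\<bar> \<le> K * exp (r * (- ln (survival M x)))"
proof -
  obtain C K t0 where t0: "t0 > 1" and Up: "\<And>t. t \<ge> t0 \<Longrightarrow> tail_quantile M t > 0"
    and U: "\<And>t. t \<ge> t0 \<Longrightarrow> \<bar>ln (tail_quantile M t) - g * ln t - C\<bar> \<le> K * t powr r" and K: "K > 0"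
    using second_order_ln_expansion[OF so r A tail_quantile_mono] by metis
  have g: "g > 0" using so by (simp add: second_order_def)
  \<comment> \<open>A zero of the survival function would bound all tail quantiles from above,
    whereas by the expansion ln (U t) grows like g ln t.\<close>
  have pos: "survival M x > 0" for x
  proof (rule ccontr)
    assume "\<not> survival M x > 0"
    then have 0: "survival M x = 0" using survival_bounds(1)[of x] by simp
    have ub: "tail_quantile M t \<le> x" if "t > 1" for t
      using that survival_le_bdd_below[of "1/t"] 0 by (subst tail_quantile_eq) (auto intro!: cInf_lower)
    have "filterlim (\<lambda>t. g * ln t + (C - K)) at_top at_top"
      using g by real_asymp
    then have "\<forall>\<^sub>F t in at_top. g * ln t + (C - K) > ln x"
      by (auto simp: filterlim_at_top_dense)
    then have "\<forall>\<^sub>F t in at_top. t \<ge> t0 \<and> g * ln t + (C - K) > ln x"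
      using eventually_ge_at_top[of t0] by eventually_elim auto
    then obtain t where t: "t \<ge> t0" "g * ln t + (C - K) > ln x"
      by (auto simp: eventually_at_top_linorder)
    have "t powr r \<le> 1" using powr_mono[of r 0 t] r t t0 by simp
    then have "K * t powr r \<le> K" using K by (simp add: mult_left_le)
    then have "ln (tail_quantile M t) > ln x" using U[OF t(1)] t(2) by (auto simp: abs_le_iff)
    moreover have "tail_quantile M t \<le> x" using ub t t0 by auto
    ultimately show False using Up[OF t(1)] by (smt (verit) ln_le_cancel_iff)
  qed
  define v0 where "v0 = 1 / t0"
  have v0: "0 < v0" "v0 < 1" using t0 by (auto simp: v0_def)
  have main: "x > 0 \<and> \<bar>ln x - g * (- ln (survival M x)) - C\<bar> \<le> K * exp (r * (- ln (survival M x)))"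
    if "survival M x \<le> v0" for x
  proof -
    define v where "v = survival M x"
    have v: "0 < v" "v < 1" using pos that v0 by (auto simp: v_def)
    have tv: "1 / v \<ge> t0" using that v t0 by (simp add: v_def v0_def field_simps)
    have lo: "tail_quantile M (1 / v) \<le> x" using tail_quantile_inverse_survival_le[of x] v by (simp add: v_def)
    have x: "x > 0" using Up[OF tv] lo by simp
    have E: "exp (r * (- ln v)) = (1 / v) powr r" using v by (simp add: powr_def ln_div)
    have "ln (tail_quantile M (1 / v)) \<le> ln x" using Up[OF tv] lo by simp
    then have 1: "ln x - g * (- ln v) - C \<ge> - K * exp (r * (- ln v))"
      using U[OF tv] v unfolding E by (simp add: ln_div abs_le_iff)
    have up: "ln x \<le> g * ln t + C + K * t powr r" if "t > 1 / v" for t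
    proof -
      have "x \<le> tail_quantile M t" using le_tail_quantile[of x t] pos that by (simp add: v_def)
      then have "ln x \<le> ln (tail_quantile M t)" using x by simp
      then show ?thesis using U[of t] that tv by (simp add: abs_le_iff)
    qed
    \<comment> \<open>The upper bound is available only for t > 1 / v. Its right hand side is
      continuous in t, so t may decrease to 1 / v.\<close>
    have "((\<lambda>t. g * ln t + C + K * t powr r) \<longlongrightarrow> g * ln (1/v) + C + K * (1/v) powr r) (at_right (1/v))"
      using v by (intro tendsto_intros) auto
    then have "ln x \<le> g * ln (1/v) + C + K * (1/v) powr r"
      by (rule tendsto_lowerbound) (auto simp: eventually_at_filter up)
    then have 2: "ln x - g * (- ln v) - C \<le> K * exp (r * (- ln v))" using v unfolding E by (simp add: ln_div)
    from 1 2 x show ?thesis by (simp add: v_def abs_le_iff)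
  qed
  show thesis by (rule that[of v0 K C]) (use v0 K pos main in auto)
qed

end

section \<open>Triangular arrays of independent copies\<close>

lemma abs_exp_minus_le:
  fixes x :: real assumes "x \<ge> 0"
  shows "\<bar>exp (- x) - (1 - x)\<bar> \<le> x\<^sup>2"
proof -
  have 1: "exp (- x) \<ge> 1 - x" using exp_ge_add_one_self[of "-x"] by simp
  have "exp (- x) = 1 / exp x" by (simp add: exp_minus field_simps)
  also have "\<dots> \<le> 1 / (1 + x)" using exp_ge_add_one_self[of x] assms by (intro divide_left_mono) auto
  also have "\<dots> \<le> 1 - x + x\<^sup>2"
  proof -
    have "1 \<le> (1 - x + x\<^sup>2) * (1 + x)" using assms by (simp add: algebra_simps power2_eq_square)
    then show ?thesis using assms by (simp add: divide_le_eq)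
  qed
  finally show ?thesis using 1 by simp
qed

text \<open>\<open>X\<^sub>0\<close> is a generic copy on which all moments are computed; the sample
  is tied to it by the common law alone.\<close>

locale iid_copies = prob_space M for M :: "'a measure" +
  fixes X\<^sub>0 :: "'a \<Rightarrow> 'b::topological_space" and X :: "nat \<Rightarrow> 'a \<Rightarrow> 'b"
  assumes X0_measurable [measurable]: "X\<^sub>0 \<in> borel_measurable M"
    and indep: "indep_vars (\<lambda>_. borel) X {1..}"
    and distr_copy: "\<And>i. i \<ge> 1 \<Longrightarrow> distr M borel (X i) = distr M borel X\<^sub>0"
begin

lemma X_measurable: "i \<ge> 1 \<Longrightarrow> X i \<in> borel_measurable M"
  using indep unfolding indep_vars_def by auto

lemma expectation_copy:
  fixes f :: "'b \<Rightarrow> 'c::{banach, second_countable_topology}"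
  assumes "i \<ge> 1" "f \<in> borel_measurable borel"
  shows "expectation (\<lambda>w. f (X i w)) = expectation (\<lambda>w. f (X\<^sub>0 w))"
  using distr_copy[OF assms(1)] integral_distr[OF X_measurable[OF assms(1)] assms(2)]
    integral_distr[OF X0_measurable assms(2)] by simp

lemma integrable_copy:
  fixes f :: "'b \<Rightarrow> 'c::{banach, second_countable_topology}"
  assumes "i \<ge> 1" "f \<in> borel_measurable borel"
  shows "integrable M (\<lambda>w. f (X i w)) \<longleftrightarrow> integrable M (\<lambda>w. f (X\<^sub>0 w))"
  using distr_copy[OF assms(1)] integrable_distr_eq[OF X_measurable[OF assms(1)] assms(2)]
    integrable_distr_eq[OF X0_measurable assms(2)] by simp

lemma indep_comp:
  assumes "\<And>i. f i \<in> borel_measurable borel"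
  shows "indep_vars (\<lambda>_. borel) (\<lambda>i w. f i (X i w)) {1..n}"
  by (rule indep_vars_compose2[OF indep_vars_subset[OF indep]]) (use assms in auto)

lemma second_moment_sum:
  fixes f :: "nat \<Rightarrow> 'b \<Rightarrow> real"
  assumes f: "\<And>i. f i \<in> borel_measurable borel"
    and int: "\<And>i. integrable M (\<lambda>w. (f i (X\<^sub>0 w))\<^sup>2)"
    and mean: "\<And>i. expectation (\<lambda>w. f i (X\<^sub>0 w)) = 0"
  shows "expectation (\<lambda>w. (\<Sum>i=1..n. f i (X i w))\<^sup>2) = (\<Sum>i=1..n. expectation (\<lambda>w. (f i (X\<^sub>0 w))\<^sup>2)) \<and>
    integrable M (\<lambda>w. (\<Sum>i=1..n. f i (X i w))\<^sup>2)"
proof (induction n)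
  case (Suc n)
  let ?S = "\<lambda>n w. \<Sum>i=1..n. f i (X i w)"
  note [measurable] = f X_measurable
  have sq: "(\<lambda>x. (f i x)\<^sup>2) \<in> borel_measurable borel" for i by simp
  have intX2: "integrable M (\<lambda>w. (f (Suc n) (X (Suc n) w))\<^sup>2)"
    using integrable_copy[of "Suc n" "\<lambda>x. (f (Suc n) x)\<^sup>2"] int by simp
  have intX: "integrable M (\<lambda>w. f (Suc n) (X (Suc n) w))"
    by (rule square_integrable_imp_integrable[OF _ intX2]) simp
  have Smeas: "?S n \<in> borel_measurable M" by (intro borel_measurable_sum) auto
  have intS: "integrable M (?S n)"
    by (rule square_integrable_imp_integrable[OF Smeas]) (use Suc in auto)
  have ind: "indep_var borel (\<lambda>w. f (Suc n) (X (Suc n) w)) borel (?S n)"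
    using indep_comp[of f "Suc n", OF f] by (intro indep_vars_sum) (auto simp: atLeastAtMostSuc_conv)
  have m: "expectation (\<lambda>w. f (Suc n) (X (Suc n) w)) = 0"
    using expectation_copy[of "Suc n" "f (Suc n)"] mean by simp
  have eq: "(?S (Suc n) w)\<^sup>2 = (?S n w)\<^sup>2 + 2 * (f (Suc n) (X (Suc n) w) * ?S n w) + (f (Suc n) (X (Suc n) w))\<^sup>2" for w
    by (simp add: power2_sum algebra_simps)
  have prod: "expectation (\<lambda>w. f (Suc n) (X (Suc n) w) * ?S n w) = 0"
    "integrable M (\<lambda>w. f (Suc n) (X (Suc n) w) * ?S n w)"
    using indep_var_lebesgue_integral[OF ind intX intS] indep_var_integrable[OF ind intX intS] m by auto
  have m2: "expectation (\<lambda>w. (f (Suc n) (X (Suc n) w))\<^sup>2) = expectation (\<lambda>w. (f (Suc n) (X\<^sub>0 w))\<^sup>2)"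
    using expectation_copy[of "Suc n" "\<lambda>x. (f (Suc n) x)\<^sup>2"] by simp
  show ?case
    unfolding eq using Suc prod intX2 m2 by simp
qed simp

text \<open>The variance of a binomial count is at most its mean, so one deterministic sequence
  controls both. The scale \<open>a\<close> is free: 1 / k gives laws of large numbers, 1 / sqrt k
  gives local increments of the tail process.\<close>

lemma scaled_count_tendsto:
  fixes a :: "nat \<Rightarrow> real" and N :: "nat \<Rightarrow> nat"
  assumes B: "\<And>n. Measurable.pred borel (B n)"
    and mean: "(\<lambda>n. a n * (N n * prob {w \<in> space M. B n (X\<^sub>0 w)})) \<longlonglongrightarrow> l"
    and var: "(\<lambda>n. (a n)\<^sup>2 * (N n * prob {w \<in> space M. B n (X\<^sub>0 w)})) \<longlonglongrightarrow> 0"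
  shows "((\<lambda>x. a (fst x) * real (card {i \<in> {1..N (fst x)}. B (fst x) (X i (snd x))})) \<longlongrightarrow> l) (whp M)"
proof -
  define p where "p n = prob {w \<in> space M. B n (X\<^sub>0 w)}" for n
  define f where "f n x = of_bool (B n x) - p n" for n x
  note [measurable] = B X_measurable
  have f[measurable]: "f n \<in> borel_measurable borel" for n unfolding f_def by measurable
  have fb: "\<bar>f n x\<bar> \<le> 1" for n x
    proof -
    have "0 \<le> p n" "p n \<le> 1" by (simp_all add: p_def)
    then show ?thesis by (simp add: f_def)
  qed
  have int2: "integrable M (\<lambda>w. (f n (X\<^sub>0 w))\<^sup>2)" for n
    by (rule integrable_const_bound[of _ 1]) (use fb in \<open>auto simp: abs_square_le_1\<close>)
  have intB: "integrable M (\<lambda>w. of_bool (B n (X\<^sub>0 w)) :: real)" for n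
    by (rule integrable_const_bound[of _ 1]) auto
  have eB: "expectation (\<lambda>w. of_bool (B n (X\<^sub>0 w))) = p n" for n
    unfolding p_def by (rule expectation_of_bool)
  have mean0: "expectation (\<lambda>w. f n (X\<^sub>0 w)) = 0" for n
    unfolding f_def using intB by (simp add: eB prob_space)
  have var0: "expectation (\<lambda>w. (f n (X\<^sub>0 w))\<^sup>2) \<le> p n" for n
  proof -
    have "expectation (\<lambda>w. (f n (X\<^sub>0 w))\<^sup>2) = expectation (\<lambda>w. (1 - 2 * p n) * of_bool (B n (X\<^sub>0 w)) + (p n)\<^sup>2)"
      by (rule Bochner_Integration.integral_cong) (auto simp: f_def power2_eq_square algebra_simps)
    also have "\<dots> = (1 - 2 * p n) * p n + (p n)\<^sup>2" using intB by (simp add: eB prob_space)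
    also have "\<dots> \<le> p n" by (simp add: power2_eq_square algebra_simps)
    finally show ?thesis .
  qed
  define Y where "Y n w = a n * (\<Sum>i=1..N n. f n (X i w))" for n w
  have Ymeas: "Y n \<in> borel_measurable M" for n unfolding Y_def
    by (intro borel_measurable_times borel_measurable_sum borel_measurable_const) auto
  have sm: "integrable M (\<lambda>w. (Y n w)\<^sup>2)" "expectation (\<lambda>w. (Y n w)\<^sup>2) \<le> (a n)\<^sup>2 * (N n * p n)" for n
  proof -
    note * = second_moment_sum[of "\<lambda>_. f n" "N n", OF f int2 mean0]
    show "integrable M (\<lambda>w. (Y n w)\<^sup>2)" unfolding Y_def power_mult_distrib using * by simp
    show "expectation (\<lambda>w. (Y n w)\<^sup>2) \<le> (a n)\<^sup>2 * (N n * p n)"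
      unfolding Y_def power_mult_distrib using * var0[of n] by (auto intro!: mult_left_mono)
  qed
  have "((\<lambda>x. Y (fst x) (snd x)) \<longlongrightarrow> 0) (whp M)"
  proof (rule whp_second_moment[OF Ymeas])
    show "(\<lambda>n. expectation (\<lambda>w. (Y n w)\<^sup>2)) \<longlonglongrightarrow> 0"
      by (rule tendsto_sandwich[OF _ _ tendsto_const var]) (use sm in \<open>auto simp: p_def[symmetric]\<close>)
  qed (use sm in auto)
  from tendsto_add[OF this tendsto_whp_fst[OF mean]] show ?thesis
  proof (rule filterlim_cong[THEN iffD1, rotated -1])
    have "real (card {i \<in> {1..N n}. B n (X i w)}) = (\<Sum>i=1..N n. of_bool (B n (X i w)))" for n w
      by (simp add: Int_def)
    then show "\<forall>\<^sub>F x in whp M. Y (fst x) (snd x) + a (fst x) * (N (fst x) * prob {w \<in> space M. B (fst x) (X\<^sub>0 w)}) =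
        a (fst x) * real (card {i \<in> {1..N (fst x)}. B (fst x) (X i (snd x))})"
      unfolding Y_def f_def p_def[symmetric] by (simp add: sum_subtractf algebra_simps)
  qed auto
qed

text \<open>Each characteristic factor is compared with exp (- \<sigma> / 2), and the difference of
  two products in the unit disc is at most the sum of the differences of the factors. The summands
  depend on \<open>i\<close> through the function \<open>f n i\<close>, which allows samples of
  different lengths in one array; the condition on third moments is Lyapunov's.\<close>

lemma char_triangular_sum:
  fixes f :: "nat \<Rightarrow> nat \<Rightarrow> 'b \<Rightarrow> real" and r :: "nat \<Rightarrow> nat"
  assumes f: "\<And>n i. f n i \<in> borel_measurable borel"
    and int2: "\<And>n i. integrable M (\<lambda>w. (f n i (X\<^sub>0 w))\<^sup>2)"
    and int3: "\<And>n i. integrable M (\<lambda>w. \<bar>f n i (X\<^sub>0 w)\<bar> ^ 3)"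
    and mean: "\<And>n i. expectation (\<lambda>w. f n i (X\<^sub>0 w)) = 0"
    and var: "(\<lambda>n. \<Sum>i=1..r n. expectation (\<lambda>w. (f n i (X\<^sub>0 w))\<^sup>2)) \<longlonglongrightarrow> v"
    and small: "\<And>n i. expectation (\<lambda>w. (f n i (X\<^sub>0 w))\<^sup>2) \<le> s n" "s \<longlonglongrightarrow> 0"
    and third: "(\<lambda>n. \<Sum>i=1..r n. expectation (\<lambda>w. \<bar>f n i (X\<^sub>0 w)\<bar> ^ 3)) \<longlonglongrightarrow> 0"
  shows "(\<lambda>n. expectation (\<lambda>w. iexp (\<Sum>i=1..r n. f n i (X i w)))) \<longlonglongrightarrow> exp (- v / 2)"
proof -
  note [measurable] = f X_measurable
  define \<sigma> where "\<sigma> n i = expectation (\<lambda>w. (f n i (X\<^sub>0 w))\<^sup>2)" for n i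
  define \<kappa> where "\<kappa> n i = expectation (\<lambda>w. \<bar>f n i (X\<^sub>0 w)\<bar> ^ 3)" for n i
  have \<sigma>0: "\<sigma> n i \<ge> 0" for n i unfolding \<sigma>_def by simp
  define \<phi> where "\<phi> n i = char (distr M borel (\<lambda>w. f n i (X i w))) 1" for n i
  have ch: "expectation (\<lambda>w. iexp (\<Sum>i=1..r n. f n i (X i w))) = (\<Prod>i=1..r n. \<phi> n i)" for n
  proof -
    have "(\<Prod>i=1..r n. \<phi> n i) = char (distr M borel (\<lambda>w. \<Sum>i=1..r n. f n i (X i w))) 1"
      unfolding \<phi>_def by (rule char_distr_sum[symmetric]) (rule indep_comp[OF f])
    also have "\<dots> = expectation (\<lambda>w. iexp (\<Sum>i=1..r n. f n i (X i w)))"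
      unfolding char_def by (subst integral_distr) auto
    finally show ?thesis ..
  qed
  \<comment> \<open>The third order Taylor remainder of the characteristic function gives \<kappa>.
    The remainder of exp (- x) is of order \<sigma>^2, and one of these two factors is traded for
    the uniform bound \<open>s n\<close>.\<close>
  have appr: "cmod (\<phi> n i - exp (- \<sigma> n i / 2)) \<le> \<kappa> n i + s n * \<sigma> n i" if i: "i \<in> {1..r n}" for n i
  proof -
    have i1: "i \<ge> 1" using i by simp
    have int2': "integrable M (\<lambda>w. (f n i (X i w))\<^sup>2)"
      using integrable_copy[OF i1, of "\<lambda>x. (f n i x)\<^sup>2"] int2 by simp
    have int3': "integrable M (\<lambda>w. \<bar>f n i (X i w)\<bar> ^ 3)"
      using integrable_copy[OF i1, of "\<lambda>x. \<bar>f n i x\<bar> ^ 3"] int3 by simp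
    have m: "X i \<in> borel_measurable M" using i1 by (rule X_measurable)
    have int1': "integrable M (\<lambda>w. f n i (X i w))"
      by (rule square_integrable_imp_integrable[OF _ int2']) (use m in simp)
    have mean': "expectation (\<lambda>w. f n i (X i w)) = 0"
      using expectation_copy[OF i1 f] mean by simp
    have "cmod (\<phi> n i - (1 - 1\<^sup>2 * \<sigma> n i / 2)) \<le>
      (1\<^sup>2 / 6) * expectation (\<lambda>w. min (6 * (f n i (X i w))^2) (\<bar>1\<bar> * \<bar>f n i (X i w)\<bar>^3))"
      unfolding \<phi>_def
    proof (rule char_approx3'[OF _ int1' int2' mean' _ refl])
      show "variance (\<lambda>w. f n i (X i w)) = \<sigma> n i"
        using expectation_copy[OF i1, of "\<lambda>x. (f n i x)\<^sup>2"] by (simp add: mean' \<sigma>_def)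
    qed (use m in simp)
    also have "\<dots> \<le> 1 / 6 * expectation (\<lambda>w. \<bar>f n i (X i w)\<bar>^3)"
      using int2' int3' m
      by (auto intro!: integral_mono Bochner_Integration.integrable_bound[OF int3'])
    also have "expectation (\<lambda>w. \<bar>f n i (X i w)\<bar>^3) = \<kappa> n i"
      using expectation_copy[OF i1, of "\<lambda>x. \<bar>f n i x\<bar> ^ 3"] by (simp add: \<kappa>_def)
    finally have 1: "cmod (\<phi> n i - (1 - \<sigma> n i / 2)) \<le> \<kappa> n i / 6" by simp
    have \<kappa>0: "\<kappa> n i \<ge> 0" unfolding \<kappa>_def by simp
    have "cmod (complex_of_real (1 - \<sigma> n i / 2) - complex_of_real (exp (- \<sigma> n i / 2))) = \<bar>exp (- (\<sigma> n i / 2)) - (1 - \<sigma> n i / 2)\<bar>"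
      unfolding of_real_diff[symmetric] norm_of_real by (simp add: abs_minus_commute)
    also have "\<dots> \<le> (\<sigma> n i / 2)\<^sup>2" by (rule abs_exp_minus_le) (use \<sigma>0 in simp)
    also have "\<dots> \<le> \<sigma> n i * \<sigma> n i" using \<sigma>0[of n i] by (simp add: power2_eq_square)
    also have "\<dots> \<le> s n * \<sigma> n i" using small(1)[of n i] \<sigma>0[of n i] by (intro mult_right_mono) (auto simp: \<sigma>_def)
    finally have 2: "cmod (complex_of_real (1 - \<sigma> n i / 2) - complex_of_real (exp (- \<sigma> n i / 2))) \<le> s n * \<sigma> n i" .
    have "\<phi> n i - complex_of_real (exp (- \<sigma> n i / 2)) = (\<phi> n i - (1 - \<sigma> n i / 2)) + (complex_of_real (1 - \<sigma> n i / 2) - complex_of_real (exp (- \<sigma> n i / 2)))"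
      by simp
    also have "cmod \<dots> \<le> \<kappa> n i / 6 + s n * \<sigma> n i" by (rule order_trans[OF norm_triangle_ineq add_mono[OF 1 2]])
    also have "\<dots> \<le> \<kappa> n i + s n * \<sigma> n i" using \<kappa>0 by simp
    finally show ?thesis .
  qed
  define S where "S n = (\<Sum>i=1..r n. \<sigma> n i)" for n
  have S: "S \<longlonglongrightarrow> v" using var by (simp add: S_def[abs_def] \<sigma>_def)
  have bound: "cmod ((\<Prod>i=1..r n. \<phi> n i) - exp (- S n / 2)) \<le> (\<Sum>i=1..r n. \<kappa> n i) + s n * S n" for n
  proof -
    have e: "complex_of_real (exp (- S n / 2)) = (\<Prod>i=1..r n. complex_of_real (exp (- \<sigma> n i / 2)))"
      by (simp add: S_def sum_divide_distrib sum_negf[symmetric] exp_sum of_real_prod flip: of_real_exp)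
    have "cmod ((\<Prod>i=1..r n. \<phi> n i) - (\<Prod>i=1..r n. complex_of_real (exp (- \<sigma> n i / 2)))) \<le>
      (\<Sum>i=1..r n. cmod (\<phi> n i - complex_of_real (exp (- \<sigma> n i / 2))))"
    proof (rule norm_prod_diff)
      fix i assume "i \<in> {1..r n}"
      then have "X i \<in> borel_measurable M" by (intro X_measurable) simp
      then interpret D: real_distribution "distr M borel (\<lambda>w. f n i (X i w))"
        by (intro real_distribution_distr) simp
      show "cmod (\<phi> n i) \<le> 1" unfolding \<phi>_def by (rule D.cmod_char_le_1)
      show "cmod (complex_of_real (exp (- \<sigma> n i / 2))) \<le> 1"
        unfolding norm_of_real using \<sigma>0[of n i] by simp
    qed
    also have "\<dots> \<le> (\<Sum>i=1..r n. \<kappa> n i + s n * \<sigma> n i)" by (rule sum_mono) (rule appr)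
    also have "\<dots> = (\<Sum>i=1..r n. \<kappa> n i) + s n * S n" by (simp add: S_def sum.distrib sum_distrib_left)
    finally show ?thesis unfolding e .
  qed
  have "(\<lambda>n. (\<Sum>i=1..r n. \<kappa> n i) + s n * S n) \<longlonglongrightarrow> 0 + 0 * v"
    using third unfolding \<kappa>_def by (intro tendsto_intros small S)
  then have "(\<lambda>n. (\<Prod>i=1..r n. \<phi> n i) - exp (- S n / 2)) \<longlonglongrightarrow> 0"
    by (intro Lim_null_comparison[OF always_eventually[OF allI[OF bound]]]) simp
  moreover have "(\<lambda>n. complex_of_real (exp (- S n / 2))) \<longlonglongrightarrow> complex_of_real (exp (- v / 2))"
    by (intro tendsto_intros S) simp
  ultimately have "(\<lambda>n. (\<Prod>i=1..r n. \<phi> n i) - exp (- S n / 2) + complex_of_real (exp (- S n / 2))) \<longlonglongrightarrow> 0 + complex_of_real (exp (- v / 2))"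
    by (rule tendsto_add)
  then show ?thesis unfolding ch by simp
qed

end

section \<open>Positive definite matrices\<close>

lemma pos_def_form:
  assumes "pos_def B"
  shows "x \<bullet> (B *v y) = y \<bullet> (B *v x)" "x \<noteq> 0 \<Longrightarrow> x \<bullet> (B *v x) > 0"
proof -
  have "x v* B = B *v x"
    using assms transpose_matrix_vector[of B x] by (simp add: pos_def_def)
  then show "x \<bullet> (B *v y) = y \<bullet> (B *v x)" using dot_lmul_matrix[of x B y] by (simp add: inner_commute)
qed (use assms in \<open>auto simp: pos_def_def\<close>)

lemma pos_def_det: "pos_def B \<Longrightarrow> det B \<noteq> 0"
  using pos_def_form(2)[of B] by (metis det_nz_iff_inj inj_onI matrix_left_invertible_injective invertible_det_nz
    matrix_left_invertible_ker inner_zero_right less_irrefl invertible_left_inverse)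

text \<open>Cramer's rule makes the product a rational function of the entries, from which both
  continuity and measurability follow.\<close>

lemma matrix_inv_mult_vec:
  fixes A :: "real^'n^'n"
  assumes "det A \<noteq> 0"
  shows "matrix_inv A *v b = (\<chi> k. det (\<chi> i j. if j = k then b $ i else A $ i $ j) / det A)"
    "A *v (matrix_inv A *v b) = b" "matrix_inv A *v (A *v b) = b"
proof -
  have "invertible A" using assms by (simp add: invertible_det_nz)
  then have "A ** matrix_inv A = mat 1 \<and> matrix_inv A ** A = mat 1"
    unfolding matrix_inv_def invertible_def by (rule someI_ex)
  then show 1: "A *v (matrix_inv A *v b) = b" and "matrix_inv A *v (A *v b) = b"
    by (simp_all add: matrix_vector_mul_assoc)
  then show "matrix_inv A *v b = (\<chi> k. det (\<chi> i j. if j = k then b $ i else A $ i $ j) / det A)"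
    using cramer[OF assms, of "matrix_inv A *v b" b] by simp
qed

lemma tendsto_det:
  assumes "\<And>i j. ((\<lambda>x. A x $ i $ j) \<longlongrightarrow> L $ i $ j) F"
  shows "((\<lambda>x. det (A x :: real^'n^'n)) \<longlongrightarrow> det L) F"
  unfolding det_def by (intro tendsto_intros assms)

lemma tendsto_matrix_inv_mult:
  fixes L :: "real^'n^'n"
  assumes A: "(A \<longlongrightarrow> L) F" and b: "(b \<longlongrightarrow> c) F" and L: "det L \<noteq> 0"
  shows "((\<lambda>x. matrix_inv (A x) *v b x) \<longlongrightarrow> matrix_inv L *v c) F"
proof -
  have Ac: "((\<lambda>x. A x $ i $ j) \<longlongrightarrow> L $ i $ j) F" for i j by (intro tendsto_intros A)
  have bc: "((\<lambda>x. b x $ i) \<longlongrightarrow> c $ i) F" for i by (intro tendsto_intros b)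
  have d: "((\<lambda>x. det (A x)) \<longlongrightarrow> det L) F" by (rule tendsto_det[OF Ac])
  have "((\<lambda>x. \<chi> k. det (\<chi> i j. if j = k then b x $ i else A x $ i $ j) / det (A x)) \<longlongrightarrow>
      (\<chi> k. det (\<chi> i j. if j = k then c $ i else L $ i $ j) / det L)) F"
    by (intro tendsto_vec_lambda tendsto_divide tendsto_det d L) (auto intro: Ac bc)
  moreover have "\<forall>\<^sub>F x in F. det (A x) \<noteq> 0" using d L by (rule tendsto_imp_eventually_ne)
  then have "\<forall>\<^sub>F x in F. (\<chi> k. det (\<chi> i j. if j = k then b x $ i else A x $ i $ j) / det (A x)) = matrix_inv (A x) *v b x"
    by (rule eventually_mono) (simp add: matrix_inv_mult_vec(1))
  ultimately have "((\<lambda>x. matrix_inv (A x) *v b x) \<longlongrightarrow> (\<chi> k. det (\<chi> i j. if j = k then c $ i else L $ i $ j) / det L)) F"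
    by (rule Lim_transform_eventually)
  then show ?thesis unfolding matrix_inv_mult_vec(1)[OF L] .
qed

section \<open>Measurability of determinants and inverses\<close>

lemma measurable_vec_iff:
  fixes f :: "'a \<Rightarrow> real^'n"
  shows "f \<in> borel_measurable M \<longleftrightarrow> (\<forall>i. (\<lambda>x. f x $ i) \<in> borel_measurable M)"
proof
  assume "\<forall>i. (\<lambda>x. f x $ i) \<in> borel_measurable M"
  then show "f \<in> borel_measurable M"
    by (subst borel_measurable_euclidean_space) (auto simp: Basis_vec_def inner_axis)
next
  assume f: "f \<in> borel_measurable M"
  show "\<forall>i. (\<lambda>x. f x $ i) \<in> borel_measurable M"
    using borel_measurable_inner[OF f borel_measurable_const, of "axis _ 1"] by (auto simp: inner_axis)
qed

lemma measurable_det: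
  assumes "\<And>i j. (\<lambda>x. A x $ i $ j) \<in> borel_measurable M"
  shows "(\<lambda>x. det (A x :: real^'n^'n)) \<in> borel_measurable M"
  unfolding det_def using assms by (intro borel_measurable_sum borel_measurable_times borel_measurable_prod borel_measurable_const) auto

lemma measurable_matrix_inv_mult:
  fixes A :: "'a \<Rightarrow> real^'n^'n"
  assumes A: "\<And>i j. (\<lambda>x. A x $ i $ j) \<in> borel_measurable M" and b: "\<And>i. (\<lambda>x. b x $ i) \<in> borel_measurable M"
  shows "(\<lambda>x. (matrix_inv (A x) *v b x) $ k) \<in> borel_measurable M"
proof -
  \<comment> \<open>For a singular matrix the choice defining \<open>matrix_inv\<close> is made from
    the empty predicate, hence is the same matrix \<open>J\<close> for all of them; on that event
    the map is linear in \<open>b\<close>.\<close>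
  define J :: "real^'n^'n" where "J = (SOME A'. False)"
  have "matrix_inv B = J" if "det B = 0" for B :: "real^'n^'n"
  proof -
    have "\<not> (B ** A' = mat 1 \<and> A' ** B = mat 1)" for A'
      using that invertible_det_nz[of B] by (auto simp: invertible_def)
    then have "(\<lambda>A'. B ** A' = mat 1 \<and> A' ** B = mat 1) = (\<lambda>A'. False)" by blast
    then show ?thesis unfolding matrix_inv_def J_def by simp
  qed
  then have eq: "(matrix_inv (A x) *v b x) $ k = (if det (A x) = 0 then (\<Sum>i\<in>UNIV. J $ k $ i * b x $ i)
      else det (\<chi> i j. if j = k then b x $ i else A x $ i $ j) / det (A x))" for x
    by (cases "det (A x) = 0") (simp add: matrix_vector_mult_def, simp add: matrix_inv_mult_vec(1))
  have [measurable]: "(\<lambda>x. det (A x)) \<in> borel_measurable M" by (rule measurable_det[OF A])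
  have [measurable]: "(\<lambda>x. det (\<chi> i j. if j = k then b x $ i else A x $ i $ j)) \<in> borel_measurable M"
    by (rule measurable_det) (use A b in auto)
  note [measurable] = b
  show ?thesis unfolding eq by measurable
qed

text \<open>Gram-Schmidt inside \<open>S\<close> for the inner product defined by \<open>B\<close>.
  As long as fewer than dim S vectors have been built, some vector of \<open>S\<close> lies outside
  their span.\<close>

lemma pos_def_orthonormal_extend:
  fixes B :: "('m::finite) rmat"
  assumes B: "pos_def B" and S: "subspace S" and r: "r \<le> dim S"
  shows "\<exists>b. (\<forall>i<r. b i \<in> S) \<and> (\<forall>i<r. \<forall>j<r. b i \<bullet> (B *v b j) = of_bool (i = j))"
  using r
proof (induction r)
  case (Suc r)
  then obtain b where b: "\<And>i. i < r \<Longrightarrow> b i \<in> S"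
    and on: "\<And>i j. i < r \<Longrightarrow> j < r \<Longrightarrow> b i \<bullet> (B *v b j) = of_bool (i = j)" by auto
  have "dim (span (b ` {..<r})) \<le> card (b ` {..<r})" by (simp add: dim_le_card' )
  also have "\<dots> \<le> r" using card_image_le[of "{..<r}" b] by simp
  finally have "dim (span (b ` {..<r})) < dim S" using Suc.prems by simp
  then obtain x where x: "x \<in> S" "x \<notin> span (b ` {..<r})"
    by (metis dim_subset not_le subsetI)
  define y where "y = x - (\<Sum>i<r. (b i \<bullet> (B *v x)) *\<^sub>R b i)"
  have ysp: "(\<Sum>i<r. (b i \<bullet> (B *v x)) *\<^sub>R b i) \<in> span (b ` {..<r})"
    by (intro span_sum span_scale span_base) auto
  have "y \<noteq> 0" using x(2) ysp by (auto simp: y_def)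
  then have pos: "y \<bullet> (B *v y) > 0" by (rule pos_def_form(2)[OF B])
  have yS: "y \<in> S" unfolding y_def
    by (intro subspace_diff subspace_sum subspace_scale S x b) auto
  have orth: "b j \<bullet> (B *v y) = 0" if "j < r" for j
  proof -
    have "b j \<bullet> (B *v y) = b j \<bullet> (B *v x) - (\<Sum>i<r. (b i \<bullet> (B *v x)) * (b j \<bullet> (B *v b i)))"
      unfolding y_def by (simp add: matrix_vector_mult_diff_distrib inner_diff_right
        inner_sum_right linear_sum[OF matrix_vector_mul_linear] matrix_vector_mult_scaleR)
    also have "(\<Sum>i<r. (b i \<bullet> (B *v x)) * (b j \<bullet> (B *v b i))) = (\<Sum>i<r. if i = j then b j \<bullet> (B *v x) else 0)"
      by (rule sum.cong) (use on that in auto)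
    also have "\<dots> = b j \<bullet> (B *v x)" using that by simp
    finally show ?thesis by simp
  qed
  define z where "z = (1 / sqrt (y \<bullet> (B *v y))) *\<^sub>R y"
  have zS: "z \<in> S" unfolding z_def by (intro subspace_scale S yS)
  have zz: "z \<bullet> (B *v z) = 1" using pos by (simp add: z_def matrix_vector_mult_scaleR)
  have bz: "b j \<bullet> (B *v z) = 0" if "j < r" for j using orth[OF that] by (simp add: z_def matrix_vector_mult_scaleR)
  have zb: "z \<bullet> (B *v b j) = 0" if "j < r" for j using bz[OF that] pos_def_form(1)[OF B] by metis
  show ?case
  proof (intro exI[of _ "b(r := z)"] conjI allI impI)
    fix i assume "i < Suc r"
    then show "(b(r := z)) i \<in> S" using b zS by (auto simp: less_Suc_eq)
  next
    fix i j assume "i < Suc r" "j < Suc r"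
    then show "(b(r := z)) i \<bullet> (B *v (b(r := z)) j) = of_bool (i = j)"
      using on zz bz zb by (auto simp: less_Suc_eq)
  qed
qed auto

text \<open>By the choice of \<open>s\<close>, the vector w = inverse of B applied to z - s 1 is
  orthogonal to 1, so it lies in the hyperplane of which the \<open>b i\<close> are a
  \<open>B\<close>-orthonormal basis. The left side is w \<bullet> B w, and the coordinates of w are
  b i \<bullet> z because the \<open>b i\<close> annihilate 1.\<close>

lemma pos_def_generalised_distance:
  fixes B :: "('m::finite) rmat" and z :: "'m rvec"
  assumes B: "pos_def B"
    and b: "\<And>i. i < CARD('m) - 1 \<Longrightarrow> b i \<bullet> 1 = 0"
      "\<And>i j. i < CARD('m) - 1 \<Longrightarrow> j < CARD('m) - 1 \<Longrightarrow> b i \<bullet> (B *v b j) = of_bool (i = j)"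
  defines "s \<equiv> (1 \<bullet> (matrix_inv B *v z)) / (1 \<bullet> (matrix_inv B *v 1))"
  shows "(z - s *\<^sub>R 1) \<bullet> (matrix_inv B *v (z - s *\<^sub>R 1)) = (\<Sum>i<CARD('m) - 1. (b i \<bullet> z)\<^sup>2)"
    and "1 \<bullet> (matrix_inv B *v (1::'m rvec)) > 0"
proof -
  note det = pos_def_det[OF B]
  note inv = matrix_inv_mult_vec(2,3)[OF det]
  let ?q = "CARD('m) - 1"
  define u where "u = matrix_inv B *v (1::'m rvec)"
  have Bu: "B *v u = 1" by (simp add: u_def inv)
  have "u \<noteq> 0" using Bu by (metis matrix_vector_mult_0_right zero_neq_one)
  then show pos: "1 \<bullet> (matrix_inv B *v (1::'m rvec)) > 0"
    using pos_def_form(2)[OF B, of u] Bu by (simp add: u_def inner_commute)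
  define w where "w = matrix_inv B *v (z - s *\<^sub>R 1)"
  have Bw: "B *v w = z - s *\<^sub>R 1" by (simp add: w_def inv)
  have w: "w = matrix_inv B *v z - s *\<^sub>R u"
    by (simp add: w_def u_def matrix_vector_mult_diff_distrib matrix_vector_mult_scaleR)
  have "w \<bullet> 1 = 1 \<bullet> w" by (rule inner_commute)
  also have "\<dots> = 1 \<bullet> (matrix_inv B *v z) - s * (1 \<bullet> u)" by (simp add: w inner_diff_right)
  also have "\<dots> = 0" using pos by (simp add: s_def u_def)
  finally have w1: "w \<bullet> 1 = 0" .
  define S where "S = {x :: 'm rvec. x \<bullet> 1 = 0}"
  have S: "subspace S" by (auto simp: S_def subspace_def inner_add_left)
  have dimS: "dim S = ?q"
    using dim_hyperplane[of "1::'m rvec"] by (simp add: S_def inner_commute vec_eq_iff)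
  have bS: "b i \<in> S" if "i < ?q" for i using b(1)[OF that] by (simp add: S_def)
  define y where "y = w - (\<Sum>i<?q. (b i \<bullet> (B *v w)) *\<^sub>R b i)"
  have yS: "y \<in> S" unfolding y_def using w1 bS
    by (intro subspace_diff subspace_sum subspace_scale S) (auto simp: S_def)
  have lin: "x \<bullet> (B *v (\<Sum>i<?q. c i *\<^sub>R b i)) = (\<Sum>i<?q. c i * (x \<bullet> (B *v b i)))" for x c
    by (simp add: linear_sum[OF matrix_vector_mul_linear] matrix_vector_mult_scaleR inner_sum_right)
  have orth: "b j \<bullet> (B *v y) = 0" if "j < ?q" for j
  proof -
    have "b j \<bullet> (B *v y) = b j \<bullet> (B *v w) - (\<Sum>i<?q. (b i \<bullet> (B *v w)) * (b j \<bullet> (B *v b i)))"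
      unfolding y_def by (simp add: matrix_vector_mult_diff_distrib inner_diff_right lin[unfolded One_nat_def])
    also have "(\<Sum>i<?q. (b i \<bullet> (B *v w)) * (b j \<bullet> (B *v b i))) = (\<Sum>i<?q. if i = j then b j \<bullet> (B *v w) else 0)"
      by (rule sum.cong) (use b(2) that in auto)
    also have "\<dots> = b j \<bullet> (B *v w)" using that by simp
    finally show ?thesis by simp
  qed
  have indep0: "c j = 0" if "(\<Sum>i<?q. c i *\<^sub>R b i) = 0" "j < ?q" for c j
  proof -
    have "0 = b j \<bullet> (B *v (\<Sum>i<?q. c i *\<^sub>R b i))" using that by simp
    also have "\<dots> = (\<Sum>i<?q. c i * (b j \<bullet> (B *v b i)))" by (rule lin)
    also have "\<dots> = (\<Sum>i<?q. if i = j then c j else 0)"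
      by (rule sum.cong) (use b(2) that in auto)
    finally show ?thesis using that by simp
  qed
  have inj: "inj_on b {..<?q}"
  proof (rule inj_onI)
    fix i j assume "i \<in> {..<?q}" "j \<in> {..<?q}" "b i = b j"
    then show "i = j" using b(2)[of i j] b(2)[of i i] by (cases "i = j") auto
  qed
  \<comment> \<open>Orthonormal vectors are independent, and their number is the dimension of the
    hyperplane; hence they span it, and the part \<open>y\<close> of \<open>w\<close> orthogonal to
    all of them must vanish.\<close>
  have "independent (b ` {..<?q})"
  proof (rule independent_if_scalars_zero)
    fix f x assume s: "(\<Sum>x\<in>b ` {..<?q}. f x *\<^sub>R x) = 0" "x \<in> b ` {..<?q}"
    then obtain j where j: "j < ?q" "x = b j" by auto
    have "(\<Sum>i<?q. f (b i) *\<^sub>R b i) = 0" using s(1) unfolding sum.reindex[OF inj] by simp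
    from indep0[OF this j(1)] show "f x = 0" by (simp add: j)
  qed simp
  moreover have "b ` {..<?q} \<subseteq> S" using bS by auto
  moreover have "card (b ` {..<?q}) = dim S" by (simp only: card_image[OF inj] dimS card_lessThan)
  ultimately have span: "S \<subseteq> span (b ` {..<?q})" by (intro card_ge_dim_independent) auto
  have "y \<in> span (b ` {..<?q})" using yS span by auto
  moreover have "span (b ` {..<?q}) \<subseteq> {v. v \<bullet> (B *v y) = 0}"
    by (rule span_minimal) (auto simp: orth subspace_def inner_add_left)
  ultimately have "y \<bullet> (B *v y) = 0" by auto
  then have "y = 0" using pos_def_form(2)[OF B, of y] by fastforce
  then have weq: "w = (\<Sum>i<?q. (b i \<bullet> (B *v w)) *\<^sub>R b i)" by (simp add: y_def)
  have bz: "b i \<bullet> (B *v w) = b i \<bullet> z" if "i < ?q" for i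
    using b(1)[OF that] by (simp add: Bw inner_diff_right)
  have "(z - s *\<^sub>R 1) \<bullet> w = w \<bullet> (B *v w)" by (simp add: Bw inner_commute)
  also have "\<dots> = (\<Sum>i<?q. (b i \<bullet> (B *v w)) * (w \<bullet> (B *v b i)))"
    using arg_cong[OF weq, of "\<lambda>v. w \<bullet> (B *v v)"] lin[of w "\<lambda>i. b i \<bullet> (B *v w)"] by (rule trans)
  also have "\<dots> = (\<Sum>i<?q. (b i \<bullet> z)\<^sup>2)"
    by (rule sum.cong) (auto simp: bz pos_def_form(1)[OF B, of w] power2_eq_square)
  finally show "(z - s *\<^sub>R 1) \<bullet> (matrix_inv B *v (z - s *\<^sub>R 1)) = (\<Sum>i<?q. (b i \<bullet> z)\<^sup>2)"
    by (simp add: w_def)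
qed

section \<open>Convergence to a chi-square distribution\<close>

text \<open>For \<open>Y \<ge> 0\<close> the values of the Laplace transform at the integers are the moments of \<open>exp (- Y)\<close>,
  a random variable on the unit interval, where polynomials are dense.\<close>

lemma (in prob_space) weak_conv_from_laplace:
  fixes Y :: "nat \<Rightarrow> 'a \<Rightarrow> real" and \<mu> :: "real measure"
  assumes Y[measurable]: "\<And>n. Y n \<in> borel_measurable M" and Ypos: "\<And>n w. Y n w \<ge> 0"
    and \<mu>: "real_distribution \<mu>" and \<mu>pos: "AE x in \<mu>. x \<ge> 0"
    and lap: "\<And>p::nat. (\<lambda>n. expectation (\<lambda>w. exp (- (real p * Y n w)))) \<longlonglongrightarrow> (\<integral>x. exp (- (real p * x)) \<partial>\<mu>)"
  shows "weak_conv_m (\<lambda>n. distr M borel (Y n)) \<mu>"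
proof (rule integral_cts_step_conv_imp_weak_conv[OF real_distribution_distr \<mu>])
  interpret \<mu>: real_distribution \<mu> by (rule \<mu>)
  fix a b :: real assume ab: "a < b"
  \<comment> \<open>The step function carried to the unit interval by u = exp (- x). It vanishes for
    x \<ge> b, that is for u \<le> exp (- b), so the value 0 at u = 0 extends it
    continuously.\<close>
  define f where "f u = (if u \<le> 0 then 0 else cts_step a b (- ln u))" for u :: real
  have fc: "continuous_on {0..1} f"
  proof -
    have "continuous_on {exp (-b - 1)..1} f"
    proof (rule continuous_on_eq)
      have "continuous_on UNIV (cts_step a b)"
        by (rule uniformly_continuous_imp_continuous[OF cts_step_uniformly_continuous[OF ab]])
      then show "continuous_on {exp (-b - 1)..1} (\<lambda>u. cts_step a b (- ln u))"
      proof (rule continuous_on_compose2)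
        show "continuous_on {exp (-b - 1)..1} (\<lambda>u. - ln u)"
          by (intro continuous_intros) (use exp_gt_zero[of "-b - 1"] in \<open>auto simp del: exp_gt_zero\<close>)
      qed simp
      show "cts_step a b (- ln u) = f u" if "u \<in> {exp (-b - 1)..1}" for u
      proof -
        have "u > 0" using that by (auto intro: less_le_trans[OF exp_gt_zero])
        then show ?thesis by (simp add: f_def)
      qed
    qed
    moreover have "continuous_on {0..exp (-b)} f"
    proof (rule continuous_on_eq[OF continuous_on_const[of _ 0]])
      fix u assume u: "u \<in> {0..exp (-b)}"
      show "0 = f u"
      proof (cases "u \<le> 0")
        case False
        then have "ln u \<le> ln (exp (- b))" using u by (subst ln_le_cancel_iff) auto
        then show ?thesis using False ab by (simp add: f_def cts_step_def)
      qed (simp add: f_def)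
    qed
    ultimately have "continuous_on ({0..exp (-b)} \<union> {exp (-b - 1)..1}) f"
      by (intro continuous_on_closed_Un) auto
    moreover have "{0..1} \<subseteq> {0..exp (-b)} \<union> {exp (-b - 1)..1}"
      by auto (smt (verit) exp_le_cancel_iff)
    ultimately show ?thesis by (rule continuous_on_subset)
  qed
  have feq: "f (exp (- x)) = cts_step a b x" for x by (simp add: f_def)
  have conv: "(\<lambda>n. expectation (\<lambda>w. f (exp (- Y n w)))) \<longlonglongrightarrow> (\<integral>x. f (exp (- x)) \<partial>\<mu>)"
  proof (rule LIMSEQ_I)
    fix r :: real assume r: "r > 0"
    then obtain N where N: "\<And>x. x \<in> {0..1} \<Longrightarrow> \<bar>f x - (\<Sum>k\<le>N. f (k / N) * Bernstein N k x)\<bar> < r / 4"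
      using Bernstein_Weierstrass[OF fc, of "r/4"] by auto
    \<comment> \<open>The Bernstein approximant as a formal polynomial: its monomials in exp (- Y)
      are the exponentials whose expectations \<open>lap\<close> controls.\<close>
    define P where "P = (\<Sum>k\<le>N. Polynomial.smult (f (k / N) * real (N choose k)) ([:0, 1:] ^ k * [:1, -1:] ^ (N - k)))"
    have Pp: "poly P x = (\<Sum>k\<le>N. f (k / N) * Bernstein N k x)" for x
      by (simp add: P_def poly_sum Bernstein_def mult_ac)
    have pexp: "poly P (exp (- y)) = (\<Sum>i\<le>degree P. coeff P i * exp (- (real i * y)))" for y
      by (simp add: poly_altdef exp_of_nat_mult[symmetric])
    have ie: "integrable M (\<lambda>w. exp (- (real p * Y n w)))" for p n
      by (rule integrable_const_bound[of _ 1]) (use Ypos in auto)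
    have i\<mu>: "integrable \<mu> (\<lambda>x. exp (- (real p * x)))" for p
      by (rule \<mu>.integrable_const_bound[of _ 1]) (use \<mu>pos in auto)
    have "(\<lambda>n. expectation (\<lambda>w. poly P (exp (- Y n w)))) \<longlonglongrightarrow> (\<integral>x. poly P (exp (- x)) \<partial>\<mu>)"
      unfolding pexp by (simp add: ie i\<mu>, intro tendsto_intros lap)
    from LIMSEQ_D[OF this, of "r/4"] r obtain n0 where
      n0: "\<And>n. n \<ge> n0 \<Longrightarrow> \<bar>expectation (\<lambda>w. poly P (exp (- Y n w))) - (\<integral>x. poly P (exp (- x)) \<partial>\<mu>)\<bar> < r / 4" by auto
    have cb: "\<bar>cts_step a b x\<bar> \<le> 1" for x using ab by (auto simp: cts_step_def divide_simps)
    have cm[measurable]: "cts_step a b \<in> borel_measurable borel"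
      by (intro borel_measurable_continuous_onI uniformly_continuous_imp_continuous cts_step_uniformly_continuous ab)
    have close: "\<bar>f (exp (- y)) - poly P (exp (- y))\<bar> \<le> r / 4" if "y \<ge> 0" for y
      using N[of "exp (- y)"] that by (simp add: Pp)
    have pm[measurable]: "(\<lambda>y. poly P (exp (- y))) \<in> borel_measurable borel" unfolding pexp by measurable
    have ip: "integrable M (\<lambda>w. poly P (exp (- Y n w)))" for n unfolding pexp using ie by simp
    have ip\<mu>: "integrable \<mu> (\<lambda>x. poly P (exp (- x)))" unfolding pexp using i\<mu> by simp
    have ifM: "integrable M (\<lambda>w. f (exp (- Y n w)))" for n
      unfolding feq by (rule integrable_const_bound[of _ 1]) (use cb in auto)
    have if\<mu>: "integrable \<mu> (\<lambda>x. f (exp (- x)))"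
      unfolding feq by (rule \<mu>.integrable_const_bound[of _ 1]) (use cb in auto)
    have d1: "\<bar>expectation (\<lambda>w. f (exp (- Y n w))) - expectation (\<lambda>w. poly P (exp (- Y n w)))\<bar> \<le> r / 4" for n
    proof -
      have "\<bar>expectation (\<lambda>w. f (exp (- Y n w)) - poly P (exp (- Y n w)))\<bar> \<le> expectation (\<lambda>w. \<bar>f (exp (- Y n w)) - poly P (exp (- Y n w))\<bar>)"
        by (rule integral_abs_bound)
      also have "\<dots> \<le> expectation (\<lambda>w. r / 4)"
        by (rule integral_mono) (use ifM ip close Ypos in auto)
      finally show ?thesis using ifM ip by (simp add: prob_space)
    qed
    have d2: "\<bar>(\<integral>x. f (exp (- x)) \<partial>\<mu>) - (\<integral>x. poly P (exp (- x)) \<partial>\<mu>)\<bar> \<le> r / 4"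
    proof -
      have "\<bar>\<integral>x. f (exp (- x)) - poly P (exp (- x)) \<partial>\<mu>\<bar> \<le> (\<integral>x. \<bar>f (exp (- x)) - poly P (exp (- x))\<bar> \<partial>\<mu>)"
        by (rule integral_abs_bound)
      also have "\<dots> \<le> (\<integral>x. r / 4 \<partial>\<mu>)"
        by (rule integral_mono_AE) (use if\<mu> ip\<mu> \<mu>pos close in auto)
      finally show ?thesis using if\<mu> ip\<mu> using \<mu>.prob_space by simp
    qed
    have "norm (expectation (\<lambda>w. f (exp (- Y n w))) - (\<integral>x. f (exp (- x)) \<partial>\<mu>)) < r" if "n \<ge> n0" for n
      using d1[of n] d2 n0[OF that] r unfolding real_norm_def abs_less_iff abs_le_iff by linarith
    then show "\<exists>no. \<forall>n\<ge>no. norm (expectation (\<lambda>w. f (exp (- Y n w))) - (\<integral>x. f (exp (- x)) \<partial>\<mu>)) < r" by blast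
  qed
  have cm[measurable]: "cts_step a b \<in> borel_measurable borel"
    by (intro borel_measurable_continuous_onI uniformly_continuous_imp_continuous cts_step_uniformly_continuous ab)
  show "(\<lambda>n. integral\<^sup>L (distr M borel (Y n)) (cts_step a b)) \<longlonglongrightarrow> integral\<^sup>L \<mu> (cts_step a b)"
    using conv unfolding feq by (simp add: integral_distr)
qed (rule Y)

section \<open>Gaussian vectors and the chi-square law\<close>

interpretation normal: prob_space std_normal_distribution
  by (rule prob_space_normal_density) simp

abbreviation gauss :: "nat \<Rightarrow> (nat \<Rightarrow> real) measure" where
  "gauss d \<equiv> Pi\<^sub>M {..<d} (\<lambda>_. std_normal_distribution)"

lemma prob_space_gauss: "prob_space (gauss d)"
  by (rule prob_space_PiM) (rule normal.prob_space_axioms)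

lemma product_sigma_finite_std_normal: "product_sigma_finite (\<lambda>_. std_normal_distribution)"
  by (rule product_sigma_finite.intro) (rule normal.sigma_finite_measure_axioms)

lemma gauss_char:
  "(\<integral>\<xi>. iexp (\<Sum>i<d. \<xi> i * t i) \<partial>gauss d) = exp (- (\<Sum>i<d. (t i)\<^sup>2) / 2)"
proof -
  have "(\<integral>\<xi>. iexp (\<Sum>i<d. \<xi> i * t i) \<partial>gauss d) = (\<integral>\<xi>. (\<Prod>i<d. iexp (t i * \<xi> i)) \<partial>gauss d)"
    by (simp add: exp_sum sum_distrib_left mult_ac)
  also have "\<dots> = (\<Prod>i<d. \<integral>x. iexp (t i * x) \<partial>std_normal_distribution)"
    by (rule product_sigma_finite.product_integral_prod[OF product_sigma_finite_std_normal]) (auto intro!: normal.integrable_const_bound[of _ 1])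
  also have "\<dots> = (\<Prod>i<d. complex_of_real (exp (- (t i)\<^sup>2 / 2)))"
    using char_std_normal_distribution by (simp add: char_def fun_eq_iff)
  also have "\<dots> = exp (- (\<Sum>i<d. (t i)\<^sup>2) / 2)"
    by (simp add: exp_sum[symmetric] sum_negf sum_divide_distrib flip: of_real_exp of_real_prod)
  finally show ?thesis .
qed

lemma chi_square_real_distribution: "real_distribution (chi_square d)"
  unfolding chi_square_def by (rule prob_space.real_distribution_distr[OF prob_space_gauss]) measurable

text \<open>Writing \<open>exp (- p |W|\<^sup>2)\<close> as an average of \<open>exp (i \<surd>(2p) \<xi> \<bullet> W)\<close> over a Gaussian \<open>\<xi>\<close> turns
  one-dimensional characteristic functions into the Laplace transform of \<open>|W|\<^sup>2\<close>.\<close>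

lemma (in prob_space) sum_squares_weak_conv_chi_square:
  fixes W :: "nat \<Rightarrow> nat \<Rightarrow> 'a \<Rightarrow> real"
  assumes W[measurable]: "\<And>n i. W n i \<in> borel_measurable M"
    and char: "\<And>x. (\<lambda>n. expectation (\<lambda>w. iexp (\<Sum>i<d. x i * W n i w))) \<longlonglongrightarrow> exp (- (\<Sum>i<d. (x i)\<^sup>2) / 2)"
  shows "weak_conv_m (\<lambda>n. distr M borel (\<lambda>w. \<Sum>i<d. (W n i w)\<^sup>2)) (chi_square d)"
proof (rule weak_conv_from_laplace)
  show "(\<lambda>w. \<Sum>i<d. (W n i w)\<^sup>2) \<in> borel_measurable M" for n by measurable
  show "0 \<le> (\<Sum>i<d. (W n i w)\<^sup>2)" for n w by (intro sum_nonneg) auto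
  show "real_distribution (chi_square d)" by (rule chi_square_real_distribution)
  show "AE x in chi_square d. 0 \<le> x"
    unfolding chi_square_def by (subst AE_distr_iff) (auto intro!: AE_I2 sum_nonneg)
  fix p :: nat
  \<comment> \<open>Chosen so that half the squared length of c W equals p times the squared length
    of W.\<close>
  define c where "c = sqrt (2 * real p)"
  have c2: "c\<^sup>2 = 2 * real p" by (simp add: c_def)
  interpret G: prob_space "gauss d" by (rule prob_space_gauss)
  interpret P: pair_prob_space M "gauss d" ..
  have int: "integrable (M \<Otimes>\<^sub>M gauss d) (\<lambda>(w, \<xi>). iexp (\<Sum>i<d. \<xi> i * (c * W n i w)))" for n
    by (rule P.integrable_const_bound[of _ 1]) (auto simp: split_beta')
  have "complex_of_real (expectation (\<lambda>w. exp (- (real p * (\<Sum>i<d. (W n i w)\<^sup>2))))) =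
      (\<integral>\<xi>. expectation (\<lambda>w. iexp (\<Sum>i<d. (c * \<xi> i) * W n i w)) \<partial>gauss d)" for n
  proof -
    have "complex_of_real (expectation (\<lambda>w. exp (- (real p * (\<Sum>i<d. (W n i w)\<^sup>2))))) =
       expectation (\<lambda>w. complex_of_real (exp (- (\<Sum>i<d. (c * W n i w)\<^sup>2) / 2)))"
      by (simp add: power_mult_distrib c2 sum_distrib_left sum_divide_distrib flip: of_real_exp)
    also have "\<dots> = expectation (\<lambda>w. \<integral>\<xi>. iexp (\<Sum>i<d. \<xi> i * (c * W n i w)) \<partial>gauss d)"
      by (simp only: gauss_char)
    also have "\<dots> = (\<integral>\<xi>. expectation (\<lambda>w. iexp (\<Sum>i<d. \<xi> i * (c * W n i w))) \<partial>gauss d)"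
      by (rule P.Fubini_integral[symmetric, OF int])
    finally show ?thesis by (simp add: mult_ac)
  qed
  moreover have "(\<lambda>n. \<integral>\<xi>. expectation (\<lambda>w. iexp (\<Sum>i<d. (c * \<xi> i) * W n i w)) \<partial>gauss d) \<longlonglongrightarrow>
      (\<integral>\<xi>. complex_of_real (exp (- (\<Sum>i<d. (c * \<xi> i)\<^sup>2) / 2)) \<partial>gauss d)"
  proof (rule integral_dominated_convergence[of _ _ _ "\<lambda>_. 1"])
    show "(\<lambda>\<xi>. complex_of_real (exp (- (\<Sum>i<d. (c * \<xi> i)\<^sup>2) / 2))) \<in> borel_measurable (gauss d)" by measurable
    show "(\<lambda>\<xi>. expectation (\<lambda>w. iexp (\<Sum>i<d. (c * \<xi> i) * W n i w))) \<in> borel_measurable (gauss d)" for n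
      by measurable
    show "AE \<xi> in gauss d. norm (expectation (\<lambda>w. iexp (\<Sum>i<d. (c * \<xi> i) * W n i w))) \<le> 1" for n
    proof (rule AE_I2)
      fix \<xi>
      have "norm (expectation (\<lambda>w. iexp (\<Sum>i<d. (c * \<xi> i) * W n i w))) \<le> expectation (\<lambda>w. norm (iexp (\<Sum>i<d. (c * \<xi> i) * W n i w)))"
        by (rule integral_norm_bound)
      then show "norm (expectation (\<lambda>w. iexp (\<Sum>i<d. (c * \<xi> i) * W n i w))) \<le> 1" by (simp add: prob_space)
    qed
    show "AE \<xi> in gauss d. (\<lambda>n. expectation (\<lambda>w. iexp (\<Sum>i<d. (c * \<xi> i) * W n i w))) \<longlonglongrightarrow>
        complex_of_real (exp (- (\<Sum>i<d. (c * \<xi> i)\<^sup>2) / 2))"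
      by (rule AE_I2) (rule char)
  qed simp
  ultimately have "(\<lambda>n. complex_of_real (expectation (\<lambda>w. exp (- (real p * (\<Sum>i<d. (W n i w)\<^sup>2)))))) \<longlonglongrightarrow>
      complex_of_real (\<integral>\<xi>. exp (- (\<Sum>i<d. (c * \<xi> i)\<^sup>2) / 2) \<partial>gauss d)"
    by (simp del: of_real_exp)
  then have "(\<lambda>n. expectation (\<lambda>w. exp (- (real p * (\<Sum>i<d. (W n i w)\<^sup>2))))) \<longlonglongrightarrow>
      (\<integral>\<xi>. exp (- (\<Sum>i<d. (c * \<xi> i)\<^sup>2) / 2) \<partial>gauss d)"
    by (simp only: tendsto_of_real_iff)
  also have "(\<integral>\<xi>. exp (- (\<Sum>i<d. (c * \<xi> i)\<^sup>2) / 2) \<partial>gauss d) = (\<integral>x. exp (- (real p * x)) \<partial>chi_square d)"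
    unfolding chi_square_def
    by (subst integral_distr) (auto simp: power_mult_distrib c2 sum_distrib_left[symmetric])
  finally show "(\<lambda>n. expectation (\<lambda>w. exp (- (real p * (\<Sum>i<d. (W n i w)\<^sup>2))))) \<longlonglongrightarrow> (\<integral>x. exp (- (real p * x)) \<partial>chi_square d)" .
qed

lemma std_normal_countable_null: "countable A \<Longrightarrow> emeasure std_normal_distribution A = 0"
proof -
  assume "countable A"
  then have "A \<in> null_sets lborel" by (rule countable_imp_null_set_lborel)
  then have "A \<in> sets lborel" "AE x in lborel. x \<in> A \<longrightarrow> ennreal (std_normal_density x) = 0"
    using AE_not_in[of A lborel] by (auto elim: eventually_mono)
  then have "A \<in> null_sets std_normal_distribution"
    by (subst null_sets_density_iff) auto
  then show ?thesis by auto
qed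

text \<open>Given all coordinates but the last, at most two values of the last one put the vector on
  a given sphere. For d = 0 the law is concentrated at 0.\<close>

lemma chi_square_no_atom:
  assumes "d > 0"
  shows "measure (chi_square d) {q} = 0"
proof -
  obtain e where d: "d = Suc e" using assms by (cases d) auto
  have ins: "{..<d} = insert e {..<e}" by (auto simp: d)
  let ?N = "std_normal_distribution"
  let ?Q = "\<lambda>z::nat \<Rightarrow> real. \<Sum>i<d. (z i)\<^sup>2"
  have Q: "?Q \<in> borel_measurable (gauss d)" by measurable
  then have S: "?Q -` {q} \<inter> space (gauss d) \<in> sets (gauss d)" by (rule measurable_sets) simp
  have "emeasure (chi_square d) {q} = emeasure (gauss d) (?Q -` {q} \<inter> space (gauss d))"
    unfolding chi_square_def using Q by (rule emeasure_distr) simp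
  also have "\<dots> = (\<integral>\<^sup>+ z. indicator (?Q -` {q} \<inter> space (gauss d)) z \<partial>gauss d)"
    by (rule nn_integral_indicator[OF S, symmetric])
  also have "\<dots> = (\<integral>\<^sup>+ z. indicator {z. (\<Sum>i<d. (z i)\<^sup>2) = q} z \<partial>gauss d)"
    by (rule nn_integral_cong) (simp only: indicator_def vimage_def Int_iff mem_Collect_eq singleton_iff simp_thms)
  also have "\<dots> = (\<integral>\<^sup>+ z. (\<integral>\<^sup>+ y. indicator {z. (\<Sum>i<d. (z i)\<^sup>2) = q} (z(e := y)) \<partial>?N) \<partial>gauss e)"
    unfolding ins by (rule product_sigma_finite.product_nn_integral_insert[OF product_sigma_finite_std_normal]) auto
  also have "\<dots> = (\<integral>\<^sup>+ z. 0 \<partial>gauss e)"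
  proof (rule nn_integral_cong)
    fix z :: "nat \<Rightarrow> real"
    let ?s = "\<Sum>i<e. (z i)\<^sup>2"
    have s: "(\<Sum>i<d. ((z(e := y)) i)\<^sup>2) = y\<^sup>2 + ?s" for y by (simp add: d)
    have "(\<integral>\<^sup>+ y. indicator {z. (\<Sum>i<d. (z i)\<^sup>2) = q} (z(e := y)) \<partial>?N) = (\<integral>\<^sup>+ y. indicator {y. y\<^sup>2 = q - ?s} y \<partial>?N)"
      unfolding indicator_def mem_Collect_eq s by (intro nn_integral_cong) (auto simp: algebra_simps)
    also have "\<dots> \<le> (\<integral>\<^sup>+ y. indicator {sqrt (q - ?s), - sqrt (q - ?s)} y \<partial>?N)"
    proof (rule nn_integral_mono)
      fix y :: real
      have "y = sqrt (q - ?s) \<or> y = - sqrt (q - ?s)" if "y\<^sup>2 = q - ?s"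
        unfolding that[symmetric] by (auto simp: abs_if)
      then show "indicator {y. y\<^sup>2 = q - ?s} y \<le> (indicator {sqrt (q - ?s), - sqrt (q - ?s)} y :: ennreal)"
        by (simp add: indicator_def)
    qed
    also have "\<dots> = 0" by (subst nn_integral_indicator) (auto intro: std_normal_countable_null)
    finally show "(\<integral>\<^sup>+ y. indicator {z. (\<Sum>i<d. (z i)\<^sup>2) = q} (z(e := y)) \<partial>?N) = 0" by simp
  qed
  finally show ?thesis by (simp add: measure_def)
qed

section \<open>Continuity and quantiles of the limit laws\<close>

lemma isCont_cdf_chi_square: "d > 0 \<Longrightarrow> isCont (cdf (chi_square d)) q"
proof -
  assume "d > 0"
  interpret real_distribution "chi_square d" by (rule chi_square_real_distribution)
  show ?thesis using chi_square_no_atom[OF \<open>d > 0\<close>] by (simp add: isCont_cdf)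
qed

lemma isCont_cdf_std_normal: "isCont (cdf std_normal_distribution) q"
proof -
  interpret real_distribution std_normal_distribution by (rule real_dist_normal_dist)
  show ?thesis by (simp add: isCont_cdf measure_def std_normal_countable_null)
qed

text \<open>Continuity makes the set below \<open>Inf\<close> closed, so its infimum belongs to it;
  to the left of the infimum the distribution function is below \<open>p\<close>, and so is its left
  limit up to equality.\<close>

lemma cdf_quantile:
  assumes \<mu>: "real_distribution \<mu>" and cont: "\<And>x. isCont (cdf \<mu>) x" and p: "0 < p" "p < 1"
  shows "cdf \<mu> (quantile \<mu> p) = p"
proof -
  interpret real_distribution \<mu> by (rule \<mu>)
  let ?S = "{x. p \<le> cdf \<mu> x}"
  have "\<forall>\<^sub>F x in at_bot. cdf \<mu> x < p" using cdf_lim_at_bot p(1) by (rule order_tendstoD)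
  then obtain l where l: "\<And>x. x \<le> l \<Longrightarrow> cdf \<mu> x < p" by (auto simp: eventually_at_bot_linorder)
  have "\<forall>\<^sub>F x in at_top. cdf \<mu> x > p" using cdf_lim_at_top_prob p(2) by (rule order_tendstoD)
  then obtain u where u: "cdf \<mu> u > p" by (auto simp: eventually_at_top_linorder)
  have ne: "?S \<noteq> {}" using u less_imp_le by blast
  have bdd: "bdd_below ?S"
  proof (rule bdd_belowI[of _ l])
    fix x assume "x \<in> ?S" then show "l \<le> x" using l[of x] by (cases "x \<le> l") auto
  qed
  have "continuous_on UNIV (cdf \<mu>)" by (rule continuous_at_imp_continuous_on) (rule ballI, rule cont)
  then have "closed ?S" by (rule closed_Collect_le[OF continuous_on_const])
  then have "Inf ?S \<in> ?S" by (rule closed_contains_Inf[OF ne bdd])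
  then have 1: "p \<le> cdf \<mu> (Inf ?S)" by simp
  have 2: "cdf \<mu> (Inf ?S) \<le> p"
  proof (rule tendsto_upperbound)
    show "(cdf \<mu> \<longlongrightarrow> cdf \<mu> (Inf ?S)) (at_left (Inf ?S))"
      using cont[of "Inf ?S", unfolded isCont_def] by (rule tendsto_within_subset) simp
    show "\<forall>\<^sub>F x in at_left (Inf ?S). cdf \<mu> x \<le> p"
      unfolding eventually_at_filter
    proof (intro always_eventually allI impI)
      fix x assume "x \<in> {..<Inf ?S}"
      then have "x \<notin> ?S" using cInf_lower[OF _ bdd, of x] by (meson lessThan_iff not_le)
      then show "cdf \<mu> x \<le> p" by simp
    qed
  qed simp
  from 1 2 show ?thesis by (simp add: quantile_def)
qed

text \<open>Converts the chi-square limit with one degree of freedom into the Gaussian probability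
  of a symmetric interval, as the coverage statement requires.\<close>

lemma cdf_chi_square_1:
  assumes z: "z \<ge> 0"
  shows "cdf (chi_square 1) (z\<^sup>2) = measure std_normal_distribution {-z..z}"
proof -
  have "cdf (chi_square 1) (z\<^sup>2) = measure (gauss 1) {x \<in> space (gauss 1). (x 0)\<^sup>2 \<le> z\<^sup>2}"
    unfolding chi_square_def cdf_def by (subst measure_distr) (auto intro!: arg_cong2[of _ _ _ _ measure])
  also have "\<dots> = measure (gauss 1) ((\<lambda>x. x 0) -` {-z..z} \<inter> space (gauss 1))"
    using z by (intro arg_cong2[of _ _ _ _ measure]) (auto simp: abs_le_square_iff[symmetric] abs_le_iff)
  also have "\<dots> = measure (distr (gauss 1) std_normal_distribution (\<lambda>x. x 0)) {-z..z}"
    by (subst measure_distr) auto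
  also have "distr (gauss 1) std_normal_distribution (\<lambda>x. x 0) = std_normal_distribution"
    by (rule distr_PiM_component) (auto intro: normal.prob_space_axioms)
  finally show ?thesis .
qed

lemma std_normal_symmetric: "measure std_normal_distribution {x. x \<ge> z} = measure std_normal_distribution {x. x \<le> - z}"
proof -
  have "(\<integral>\<^sup>+x. std_normal_density x * indicator {x. x \<ge> z} x \<partial>lborel) = (\<integral>\<^sup>+x. std_normal_density x * indicator {x. x \<le> - z} x \<partial>lborel)"
    by (subst nn_integral_real_affine[where c = "-1" and t = 0])
      (auto simp: indicator_def std_normal_density_def intro!: nn_integral_cong)
  then show ?thesis
    unfolding measure_def by (subst (1 2) emeasure_density) (auto simp: ennreal_indicator[symmetric] ennreal_mult'[symmetric])
qed

text \<open>Positivity of the quantile is what permits squaring the inequality that defines the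
  interval. It follows from the values 1 - \<alpha> / 2 and \<alpha> / 2 of the distribution
  function at z and - z.\<close>

lemma std_normal_two_sided:
  assumes \<alpha>: "0 < \<alpha>" "\<alpha> < 1"
  defines "z \<equiv> quantile std_normal_distribution (1 - \<alpha> / 2)"
  shows "z > 0" "measure std_normal_distribution {-z..z} = 1 - \<alpha>"
proof -
  interpret N: real_distribution std_normal_distribution by (rule real_dist_normal_dist)
  let ?N = "std_normal_distribution"
  have cz: "cdf ?N z = 1 - \<alpha> / 2"
    unfolding z_def by (rule cdf_quantile[OF real_dist_normal_dist isCont_cdf_std_normal]) (use \<alpha> in auto)
  have atom: "measure ?N {x} = 0" for x by (simp add: measure_def std_normal_countable_null)
  have ge: "measure ?N {x. x \<ge> y} = 1 - cdf ?N y" for y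
  proof -
    have "measure ?N ({..<y} \<union> {y}) = measure ?N {..<y} + measure ?N {y}" by (rule normal.finite_measure_Union) auto
    moreover have "{..<y} \<union> {y} = {..y}" by auto
    moreover have "measure ?N (space ?N - {..<y}) = 1 - measure ?N {..<y}" by (rule normal.prob_compl) simp
    moreover have "space ?N - {..<y} = {x. x \<ge> y}" by auto
    ultimately show ?thesis using atom by (simp add: cdf_def)
  qed
  have cmz: "cdf ?N (- z) = \<alpha> / 2"
    using std_normal_symmetric[of z] ge[of z] cz by (simp add: cdf_def atMost_def)
  show z0: "z > 0"
  proof (rule ccontr)
    assume "\<not> z > 0"
    then have "cdf ?N z \<le> cdf ?N (- z)" by (intro N.cdf_nondecreasing) auto
    with cz cmz \<alpha> show False by simp
  qed
  have "measure ?N {-z..z} = measure ?N ({-z<..z} \<union> {-z})" using z0 by (intro arg_cong2[of _ _ _ _ measure]) auto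
  also have "\<dots> = measure ?N {-z<..z} + measure ?N {-z}" by (rule normal.finite_measure_Union) auto
  also have "measure ?N {-z<..z} = cdf ?N z - cdf ?N (-z)" using z0 by (intro N.cdf_diff_eq[symmetric]) auto
  finally show "measure ?N {-z..z} = 1 - \<alpha>" using cz cmz atom by simp
qed

section \<open>Truncated exponential variables\<close>

lemma abs_mult_le_squares: "\<bar>p * q\<bar> \<le> p\<^sup>2 + q\<^sup>2" for p q :: real
proof -
  have "2 * \<bar>p\<bar> * \<bar>q\<bar> \<le> p\<^sup>2 + q\<^sup>2" using sum_squares_bound[of "\<bar>p\<bar>" "\<bar>q\<bar>"] by simp
  moreover have "0 \<le> \<bar>p\<bar> * \<bar>q\<bar>" by simp
  ultimately show ?thesis unfolding abs_mult by linarith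
qed

text \<open>Centred at y = E - u for a standard exponential E and u \<ge> 0, where the positive part
  and the indicator have the same mean exp (- u).\<close>

definition centred_excess :: "real \<Rightarrow> real" where
  "centred_excess y = max 0 y - of_bool (y \<ge> 0)"

lemma centred_excess_measurable [measurable]: "centred_excess \<in> borel_measurable borel"
  unfolding centred_excess_def by measurable

context prob_space
begin

context
  fixes Y :: "'a \<Rightarrow> real"
  assumes D: "distributed M lborel Y (exponential_density 1)"
begin

text \<open>Lack of memory: beyond u the exponential density repeats itself with the factor exp (-
  u). Every truncated moment thereby reduces to the case u = 0, provided that \<open>g\<close>
  vanishes on the negative half line.\<close>

lemma exponential_shift:
  fixes g :: "real \<Rightarrow> real"
  assumes [measurable]: "g \<in> borel_measurable borel" and g0: "\<And>y. y < 0 \<Longrightarrow> g y = 0" and u: "u \<ge> 0"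
  shows "expectation (\<lambda>w. g (Y w - u)) = exp (- u) * expectation (\<lambda>w. g (Y w))"
    and "integrable M (\<lambda>w. g (Y w)) \<Longrightarrow> integrable M (\<lambda>w. g (Y w - u))"
proof -
  have nn: "0 \<le> exponential_density 1 x" for x :: real by (simp add: exponential_density_def)
  have eq: "exponential_density 1 (u + 1 * z) * g (u + 1 * z - u) = exp (- u) * (exponential_density 1 z * g z)" for z
    using g0[of z] u by (cases "z < 0") (auto simp: exponential_density_def exp_diff exp_minus exp_add field_simps)
  have "expectation (\<lambda>w. g (Y w - u)) = (\<integral>x. exponential_density 1 x * g (x - u) \<partial>lborel)"
    by (rule distributed_integral[OF D, symmetric]) (auto simp: nn)
  also have "\<dots> = (\<integral>z. exponential_density 1 (u + 1 * z) * g (u + 1 * z - u) \<partial>lborel)"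
    by (subst lborel_integral_real_affine[where c = 1 and t = u]) auto
  also have "\<dots> = exp (- u) * (\<integral>z. exponential_density 1 z * g z \<partial>lborel)" unfolding eq by simp
  also have "(\<integral>z. exponential_density 1 z * g z \<partial>lborel) = expectation (\<lambda>w. g (Y w))"
    by (rule distributed_integral[OF D]) (auto simp: nn)
  finally show "expectation (\<lambda>w. g (Y w - u)) = exp (- u) * expectation (\<lambda>w. g (Y w))" .
  assume "integrable M (\<lambda>w. g (Y w))"
  then have "integrable lborel (\<lambda>z. exponential_density 1 z * g z)"
    by (subst distributed_integrable[OF D]) (auto simp: nn)
  then have "integrable lborel (\<lambda>z. exponential_density 1 (u + 1 * z) * g (u + 1 * z - u))" unfolding eq by simp
  then have "integrable lborel (\<lambda>x. exponential_density 1 x * g (x - u))"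
    using lborel_integrable_real_affine_iff[of 1 "\<lambda>x. exponential_density 1 x * g (x - u)" u] by simp
  then show "integrable M (\<lambda>w. g (Y w - u))"
    by (subst (asm) distributed_integrable[OF D]) (auto simp: nn)
qed

lemma exponential_measurable: "Y \<in> borel_measurable M"
  using D by (simp add: distributed_def)

lemma exponential_AE_nonneg: "AE w in M. Y w \<ge> 0"
  by (subst distributed_AE2[OF D]) (auto simp: exponential_density_def)

lemma exponential_moment: "integrable M (\<lambda>w. Y w ^ i)" "expectation (\<lambda>w. Y w ^ i) = fact i"
  using erlang_ith_moment_integrable[OF _ D, of i] erlang_ith_moment[OF _ D, of i] by auto

lemma centred_excess_moments:
  assumes u: "u \<ge> 0"
  shows "expectation (\<lambda>w. centred_excess (Y w - u)) = 0"
    and "integrable M (\<lambda>w. (centred_excess (Y w - u))\<^sup>2)"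
    and "expectation (\<lambda>w. (centred_excess (Y w - u))\<^sup>2) = exp (- u)"
    and "integrable M (\<lambda>w. \<bar>centred_excess (Y w - u)\<bar> ^ 3)"
    and "expectation (\<lambda>w. \<bar>centred_excess (Y w - u)\<bar> ^ 3) \<le> 7 * exp (- u)"
proof -
  note [measurable] = exponential_measurable
  have ae: "AE w in M. centred_excess (Y w) = Y w - 1"
    using exponential_AE_nonneg by eventually_elim (simp add: centred_excess_def)
  have aesq: "AE w in M. (centred_excess (Y w))\<^sup>2 = (Y w)\<^sup>2 - 2 * Y w + 1"
    using ae by eventually_elim (simp add: power2_diff)
  have m1: "expectation Y = 1" "integrable M Y" using exponential_moment[of 1] by simp_all
  have "expectation (\<lambda>w. centred_excess (Y w)) = expectation (\<lambda>w. Y w - 1)"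
    by (rule integral_cong_AE) (use ae in auto)
  also have "\<dots> = 0" using m1 by (simp add: prob_space)
  finally show "expectation (\<lambda>w. centred_excess (Y w - u)) = 0"
    using exponential_shift(1)[of centred_excess u] u by (simp add: centred_excess_def)
  have sq: "integrable M (\<lambda>w. (centred_excess (Y w))\<^sup>2) \<longleftrightarrow> integrable M (\<lambda>w. (Y w)\<^sup>2 - 2 * Y w + 1)"
    by (rule integrable_cong_AE) (use aesq in auto)
  moreover have i2: "integrable M (\<lambda>w. (Y w)\<^sup>2 - 2 * Y w + 1)" using exponential_moment(1)[of 2] m1 by simp
  ultimately have int2: "integrable M (\<lambda>w. (centred_excess (Y w))\<^sup>2)" by simp
  then show "integrable M (\<lambda>w. (centred_excess (Y w - u))\<^sup>2)"
    using exponential_shift(2)[of "\<lambda>y. (centred_excess y)\<^sup>2" u] u by (simp add: centred_excess_def)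
  have "expectation (\<lambda>w. (centred_excess (Y w))\<^sup>2) = expectation (\<lambda>w. (Y w)\<^sup>2 - 2 * Y w + 1)"
    by (rule integral_cong_AE) (use aesq in auto)
  also have "\<dots> = 1" using exponential_moment[of 2] m1 by (simp add: prob_space)
  finally show "expectation (\<lambda>w. (centred_excess (Y w - u))\<^sup>2) = exp (- u)"
    using exponential_shift(1)[of "\<lambda>y. (centred_excess y)\<^sup>2" u] u by (simp add: centred_excess_def)
  \<comment> \<open>Origin of the constant 7: this bound together with the third moment 3! =
    6.\<close>
  have cube: "\<bar>y - 1\<bar> ^ 3 \<le> y ^ 3 + 1" if "y \<ge> 0" for y :: real
  proof (cases "y \<ge> 1")
    case True
    then have "\<bar>y - 1\<bar> ^ 3 \<le> y ^ 3" by (intro power_mono) auto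
    then show ?thesis by simp
  next
    case False
    then have "\<bar>y - 1\<bar> ^ 3 \<le> 1 ^ 3" using that by (intro power_mono) auto
    then show ?thesis using that by (simp add: add_increasing)
  qed
  have ae3: "AE w in M. \<bar>centred_excess (Y w)\<bar> ^ 3 \<le> Y w ^ 3 + 1"
    using ae exponential_AE_nonneg by eventually_elim (simp add: cube)
  have i3: "integrable M (\<lambda>w. Y w ^ 3 + 1)" using exponential_moment(1)[of 3] by simp
  have int3: "integrable M (\<lambda>w. \<bar>centred_excess (Y w)\<bar> ^ 3)"
    by (rule Bochner_Integration.integrable_bound[OF i3]) (use ae3 in \<open>auto elim!: eventually_mono\<close>)
  then show "integrable M (\<lambda>w. \<bar>centred_excess (Y w - u)\<bar> ^ 3)"
    using exponential_shift(2)[of "\<lambda>y. \<bar>centred_excess y\<bar> ^ 3" u] u by (simp add: centred_excess_def)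
  have "expectation (\<lambda>w. \<bar>centred_excess (Y w)\<bar> ^ 3) \<le> expectation (\<lambda>w. Y w ^ 3 + 1)"
    by (rule integral_mono_AE[OF int3 i3 ae3])
  also have "\<dots> = 7" using exponential_moment[of 3] by (simp add: prob_space fact_numeral)
  finally have "exp (- u) * expectation (\<lambda>w. \<bar>centred_excess (Y w)\<bar> ^ 3) \<le> exp (- u) * 7" by simp
  then show "expectation (\<lambda>w. \<bar>centred_excess (Y w - u)\<bar> ^ 3) \<le> 7 * exp (- u)"
    using exponential_shift(1)[of "\<lambda>y. \<bar>centred_excess y\<bar> ^ 3" u] u by (simp add: centred_excess_def)
qed

lemma exponential_tail:
  assumes x: "x \<ge> 0"
  shows "prob {w \<in> space M. Y w \<ge> x} = exp (- x)"
proof -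
  note [measurable] = exponential_measurable
  have "prob {w \<in> space M. Y w \<ge> x} = expectation (\<lambda>w. of_bool (Y w - x \<ge> 0))"
    by (subst expectation_of_bool) simp
  also have "\<dots> = exp (- x) * expectation (\<lambda>w. of_bool (Y w \<ge> 0))"
    by (rule exponential_shift(1)) (use x in auto)
  also have "expectation (\<lambda>w. of_bool (Y w \<ge> 0)) = expectation (\<lambda>w. 1 :: real)"
    by (rule integral_cong_AE) (use exponential_AE_nonneg in \<open>auto elim: eventually_mono\<close>)
  finally show ?thesis by (simp add: prob_space)
qed

lemma exponential_tail_le: "prob {w \<in> space M. Y w \<ge> x} \<le> exp (- x)"
proof (cases "x \<ge> 0")
  case False
  then show ?thesis using prob_le_1[of "{w \<in> space M. Y w \<ge> x}"] by (smt (verit) exp_le_one_iff one_le_exp_iff)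
qed (simp add: exponential_tail)

end

end

section \<open>Integrals of homogeneous kernels and limits of joint excesses\<close>

lemma nn_integral_exp_minus: "c > 0 \<Longrightarrow> (\<integral>\<^sup>+ s. ennreal (exp (- (c * s))) * indicator {0..} s \<partial>lborel) = ennreal (1 / c)"
proof -
  assume c: "c > 0"
  have "(\<integral>\<^sup>+ s. ennreal (exponential_density c s * s ^ 0) \<partial>lborel) = ennreal 1"
    using nn_integral_erlang_ith_moment[OF c, of 0 0] by simp
  moreover have "ennreal (exp (- (c * s))) * indicator {0..} s = ennreal (1 / c) * ennreal (exponential_density c s * s ^ 0)" for s
    using c by (auto simp: exponential_density_def indicator_def ennreal_mult'[symmetric] mult.commute)
  ultimately show ?thesis using c by (simp add: nn_integral_cmult)
qed

text \<open>The quadrant is cut along the diagonal. On t \<ge> s the kernel is exp (- s) K 0 (t -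
  s), so integrating out \<open>s\<close> contributes the factor 1 and leaves a one-dimensional
  integral; the other half is symmetric.\<close>

lemma nn_integral_pair_homogeneous:
  fixes K :: "real \<Rightarrow> real \<Rightarrow> real"
  assumes [measurable]: "(\<lambda>(s, t). ennreal (K s t) * (indicator {0..} s * indicator {0..} t)) \<in> borel_measurable (lborel \<Otimes>\<^sub>M lborel)"
    and hom: "\<And>s t r. s \<ge> 0 \<Longrightarrow> t \<ge> 0 \<Longrightarrow> r \<ge> 0 \<Longrightarrow> K (s + r) (t + r) = exp (- r) * K s t"
  shows "(\<integral>\<^sup>+ p. (case p of (s, t) \<Rightarrow> ennreal (K s t) * (indicator {0..} s * indicator {0..} t)) \<partial>(lborel \<Otimes>\<^sub>M lborel)) =
    (\<integral>\<^sup>+ t. ennreal (K 0 t) * indicator {0..} t \<partial>lborel) + (\<integral>\<^sup>+ s. ennreal (K s 0) * indicator {0..} s \<partial>lborel)"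
proof -
  let ?h = "\<lambda>(s::real) (t::real). ennreal (K s t) * (indicator {0..} s * indicator {0..} t)"
  let ?B = "lborel \<Otimes>\<^sub>M lborel :: (real \<times> real) measure"
  have hm[measurable]: "(\<lambda>p. ?h (fst p) (snd p)) \<in> borel_measurable ?B" using assms(1) by (simp add: split_beta')
  have m1: "(\<lambda>t. ?h s t) \<in> borel_measurable lborel" for s
    using measurable_compose[OF measurable_Pair1'[of s lborel lborel] hm] by simp
  have m2: "(\<lambda>s. ?h s t) \<in> borel_measurable lborel" for t
    using measurable_compose[OF measurable_Pair2'[of t lborel lborel] hm] by simp
  have e1: "(\<integral>\<^sup>+ s. ennreal (exp (- s)) * indicator {0..} s \<partial>lborel) = 1"
    using nn_integral_exp_minus[of 1] by simp
  have "(\<integral>\<^sup>+ p. ?h (fst p) (snd p) \<partial>?B) =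
      (\<integral>\<^sup>+ p. ?h (fst p) (snd p) * indicator {p. fst p \<le> snd p} p + ?h (fst p) (snd p) * indicator {p. snd p < fst p} p \<partial>?B)"
    by (rule nn_integral_cong) (auto simp: indicator_def)
  also have "\<dots> = (\<integral>\<^sup>+ p. ?h (fst p) (snd p) * indicator {p. fst p \<le> snd p} p \<partial>?B) +
      (\<integral>\<^sup>+ p. ?h (fst p) (snd p) * indicator {p. snd p < fst p} p \<partial>?B)"
    by (rule nn_integral_add) auto
  also have "(\<integral>\<^sup>+ p. ?h (fst p) (snd p) * indicator {p. fst p \<le> snd p} p \<partial>?B) =
      (\<integral>\<^sup>+ s. \<integral>\<^sup>+ t. ?h s t * indicator {s..} t \<partial>lborel \<partial>lborel)"
  proof -
    have "(\<lambda>p. ?h (fst p) (snd p) * indicator {p. fst p \<le> snd p} p) \<in> borel_measurable ?B" by measurable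
    from lborel.nn_integral_fst[OF this, symmetric] show ?thesis
      by (simp add: indicator_def)
  qed
  also have "\<dots> = (\<integral>\<^sup>+ s. ennreal (exp (- s)) * indicator {0..} s * (\<integral>\<^sup>+ v. ?h 0 v \<partial>lborel) \<partial>lborel)"
  proof (rule nn_integral_cong)
    fix s :: real
    show "(\<integral>\<^sup>+ t. ?h s t * indicator {s..} t \<partial>lborel) = ennreal (exp (- s)) * indicator {0..} s * (\<integral>\<^sup>+ v. ?h 0 v \<partial>lborel)"
    proof (cases "s \<ge> 0")
      case True
      have "(\<integral>\<^sup>+ t. ?h s t * indicator {s..} t \<partial>lborel) = (\<integral>\<^sup>+ v. ?h s (s + v) * indicator {s..} (s + v) \<partial>lborel)"
        using nn_integral_real_affine[of "\<lambda>t. ?h s t * indicator {s..} t" 1 s] m1[of s] by simp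
      also have "\<dots> = (\<integral>\<^sup>+ v. ennreal (exp (- s)) * ?h 0 v \<partial>lborel)"
        using True hom[of 0 _ s]
        by (intro nn_integral_cong) (auto simp: indicator_def ennreal_mult' add.commute)
      finally show ?thesis using True m1[of 0] by (simp add: nn_integral_cmult)
    qed simp
  qed
  also have "\<dots> = (\<integral>\<^sup>+ v. ?h 0 v \<partial>lborel)"
    by (subst nn_integral_multc) (auto simp: e1)
  also have "(\<integral>\<^sup>+ p. ?h (fst p) (snd p) * indicator {p. snd p < fst p} p \<partial>?B) =
      (\<integral>\<^sup>+ t. \<integral>\<^sup>+ s. ?h s t * indicator {t<..} s \<partial>lborel \<partial>lborel)"
  proof -
    have "(\<lambda>(s, t). ?h s t * indicator {p. snd p < fst p} (s, t)) \<in> borel_measurable ?B"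
      using hm by (simp add: split_beta')
    from lborel_pair.nn_integral_snd[OF this, symmetric] show ?thesis
      by (simp add: indicator_def split_beta')
  qed
  also have "\<dots> = (\<integral>\<^sup>+ t. ennreal (exp (- t)) * indicator {0..} t * (\<integral>\<^sup>+ v. ?h v 0 \<partial>lborel) \<partial>lborel)"
  proof (rule nn_integral_cong)
    fix t :: real
    show "(\<integral>\<^sup>+ s. ?h s t * indicator {t<..} s \<partial>lborel) = ennreal (exp (- t)) * indicator {0..} t * (\<integral>\<^sup>+ v. ?h v 0 \<partial>lborel)"
    proof (cases "t \<ge> 0")
      case True
      have "(\<integral>\<^sup>+ s. ?h s t * indicator {t<..} s \<partial>lborel) = (\<integral>\<^sup>+ v. ?h (t + v) t * indicator {t<..} (t + v) \<partial>lborel)"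
        using nn_integral_real_affine[of "\<lambda>s. ?h s t * indicator {t<..} s" 1 t] m2[of t] by simp
      also have "\<dots> = (\<integral>\<^sup>+ v. ennreal (exp (- t)) * ?h v 0 \<partial>lborel)"
      \<comment> \<open>The diagonal was given to the other half, so v = 0 must be discarded as a
        null set.\<close>
      proof (rule nn_integral_cong_AE)
        show "AE v in lborel. ?h (t + v) t * indicator {t<..} (t + v) = ennreal (exp (- t)) * ?h v 0"
          using AE_lborel_singleton[of "0::real"]
          by eventually_elim (use True hom[of _ 0 t] in \<open>auto simp: indicator_def ennreal_mult' add.commute\<close>)
      qed
      finally show ?thesis using True m2[of 0] by (simp add: nn_integral_cmult)
    qed simp
  qed
  also have "\<dots> = (\<integral>\<^sup>+ v. ?h v 0 \<partial>lborel)"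
    by (subst nn_integral_multc) (auto simp: e1)
  finally show ?thesis by (simp add: split_beta')
qed

lemma nn_integral_exp_half: "(\<integral>\<^sup>+ s. ennreal (exp (- s / 2)) * indicator {0..} s \<partial>lborel) = 2"
  using nn_integral_exp_minus[of "1/2"] by simp

lemma emeasure_Icc_0: "emeasure lborel {0..y::real} = ennreal (max 0 y)"
  by (cases "y \<ge> 0") (auto simp: max_def ennreal_neg)

context prob_space
begin

text \<open>A positive part is the integral of indicators of levels, so by Fubini these expectations
  are integrals of joint tail probabilities, to which dominated convergence applies. Measurability
  of the limit kernel comes from its being a pointwise limit, and finiteness of its integral from
  the dominating function.\<close>

lemma tendsto_excess_expectations:
  fixes Y Z :: "'a \<Rightarrow> real" and a u v :: "nat \<Rightarrow> real" and K :: "real \<Rightarrow> real \<Rightarrow> real"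
  assumes [measurable]: "Y \<in> borel_measurable M" "Z \<in> borel_measurable M"
    and Ytail: "\<And>x. prob {w \<in> space M. Y w \<ge> x} \<le> exp (- x)"
    and Ztail: "\<And>x. prob {w \<in> space M. Z w \<ge> x} \<le> exp (- x)"
    and a: "\<And>n. a n \<ge> 0"
    and bound: "\<And>n. a n * exp (- (u n + v n) / 2) \<le> 1"
    and lim: "\<And>s t. s \<ge> 0 \<Longrightarrow> t \<ge> 0 \<Longrightarrow>
      (\<lambda>n. a n * prob {w \<in> space M. Y w \<ge> u n + s \<and> Z w \<ge> v n + t}) \<longlonglongrightarrow> K s t"
  shows "(\<lambda>n. a n * expectation (\<lambda>w. max 0 (Y w - u n) * max 0 (Z w - v n))) \<longlonglongrightarrow>
      enn2real (\<integral>\<^sup>+ p. (case p of (s, t) \<Rightarrow> ennreal (K s t) * (indicator {0..} s * indicator {0..} t)) \<partial>(lborel \<Otimes>\<^sub>M lborel))"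
    and "(\<integral>\<^sup>+ p. (case p of (s, t) \<Rightarrow> ennreal (K s t) * (indicator {0..} s * indicator {0..} t)) \<partial>(lborel \<Otimes>\<^sub>M lborel)) < \<infinity>"
    and "(\<lambda>(s, t). ennreal (K s t) * (indicator {0..} s * indicator {0..} t)) \<in> borel_measurable (lborel \<Otimes>\<^sub>M lborel)"
    and "(\<lambda>n. a n * expectation (\<lambda>w. max 0 (Y w - u n) * of_bool (Z w \<ge> v n))) \<longlonglongrightarrow>
      enn2real (\<integral>\<^sup>+ s. ennreal (K s 0) * indicator {0..} s \<partial>lborel)"
proof -
  let ?B = "lborel \<Otimes>\<^sub>M lborel :: (real \<times> real) measure"
  interpret B: pair_sigma_finite M ?B ..
  interpret B1: pair_sigma_finite M "lborel :: real measure" ..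
  define P where "P n s t = prob {w \<in> space M. Y w \<ge> u n + s \<and> Z w \<ge> v n + t}" for n s t
  define k where "k n s t = ennreal (a n * P n s t) * (indicator {0..} s * indicator {0..} t)" for n and s t :: real
  define l where "l s t = ennreal (K s t) * (indicator {0..} s * indicator {0..} t)" for s t :: real
  have kl: "(\<lambda>n. k n s t) \<longlonglongrightarrow> l s t" for s t
    unfolding k_def l_def P_def indicator_def using lim[of s t] by auto
  \<comment> \<open>The joint tail is bounded by either margin, hence by their geometric mean, which
    decays in \<open>s\<close> and in \<open>t\<close> and is integrable over the quadrant. Its
    factor exp (- (u + v) / 2) is absorbed by \<open>bound\<close>.\<close>
  have Pb: "a n * P n s t \<le> exp (- s / 2) * exp (- t / 2)" for n s t
  proof -
    have "P n s t \<le> prob {w \<in> space M. Y w \<ge> u n + s}" "P n s t \<le> prob {w \<in> space M. Z w \<ge> v n + t}"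
      unfolding P_def by (rule finite_measure_mono; auto)+
    then have "P n s t \<le> exp (- (u n + s))" "P n s t \<le> exp (- (v n + t))"
      using Ytail[of "u n + s"] Ztail[of "v n + t"] by linarith+
    moreover have "P n s t \<ge> 0" by (simp add: P_def)
    ultimately have "P n s t * P n s t \<le> exp (- (u n + s)) * exp (- (v n + t))"
      by (intro mult_mono) auto
    also have "\<dots> = (exp (- (u n + v n) / 2) * (exp (- s / 2) * exp (- t / 2)))\<^sup>2"
      by (simp add: power2_eq_square mult_exp_exp field_simps)
    finally have "(P n s t)\<^sup>2 \<le> (exp (- (u n + v n) / 2) * (exp (- s / 2) * exp (- t / 2)))\<^sup>2"
      by (simp add: power2_eq_square)
    then have "P n s t \<le> exp (- (u n + v n) / 2) * (exp (- s / 2) * exp (- t / 2))"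
      by (rule power2_le_imp_le) simp
    then have "a n * P n s t \<le> a n * (exp (- (u n + v n) / 2) * (exp (- s / 2) * exp (- t / 2)))"
      using a[of n] by (rule mult_left_mono)
    also have "\<dots> = (a n * exp (- (u n + v n) / 2)) * (exp (- s / 2) * exp (- t / 2))" by simp
    also have "\<dots> \<le> 1 * (exp (- s / 2) * exp (- t / 2))"
      by (rule mult_right_mono[OF bound]) simp
    finally show ?thesis by simp
  qed
  have Pem: "ennreal (P n s t) = (\<integral>\<^sup>+ w. indicator {w. Y w \<ge> u n + s \<and> Z w \<ge> v n + t} w \<partial>M)" for n s t
  proof -
    have "(\<integral>\<^sup>+ w. indicator {w. Y w \<ge> u n + s \<and> Z w \<ge> v n + t} w \<partial>M) =
      (\<integral>\<^sup>+ w. indicator {w \<in> space M. Y w \<ge> u n + s \<and> Z w \<ge> v n + t} w \<partial>M)"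
      by (rule nn_integral_cong) (simp add: indicator_def)
    also have "\<dots> = emeasure M {w \<in> space M. Y w \<ge> u n + s \<and> Z w \<ge> v n + t}"
      by (rule nn_integral_indicator) measurable
    finally show ?thesis by (simp add: P_def emeasure_eq_measure)
  qed
  have key: "(\<lambda>(w, p). indicator {w. Y w \<ge> u n + fst p \<and> Z w \<ge> v n + snd p} w * (indicator {0..} (fst p) * indicator {0..} (snd p)) :: ennreal)
      \<in> borel_measurable (M \<Otimes>\<^sub>M ?B)" for n
  proof -
    have eq: "(\<lambda>(w, p). indicator {w. Y w \<ge> u n + fst p \<and> Z w \<ge> v n + snd p} w * (indicator {0..} (fst p) * indicator {0..} (snd p)) :: ennreal) =
      (\<lambda>x. of_bool (Y (fst x) \<ge> u n + fst (snd x) \<and> Z (fst x) \<ge> v n + snd (snd x)) * (indicator {0..} (fst (snd x)) * indicator {0..} (snd (snd x))))"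
      by (auto simp: fun_eq_iff indicator_def)
    show ?thesis unfolding eq by measurable
  qed
  have kint: "k n s t = ennreal (a n) * (\<integral>\<^sup>+ w. indicator {w. Y w \<ge> u n + s \<and> Z w \<ge> v n + t} w * (indicator {0..} s * indicator {0..} t) \<partial>M)" for n s t
  proof -
    have "(\<integral>\<^sup>+ w. indicator {w. Y w \<ge> u n + s \<and> Z w \<ge> v n + t} w * (indicator {0..} s * indicator {0..} t) \<partial>M) =
      ennreal (P n s t) * (indicator {0..} s * indicator {0..} t)"
      unfolding Pem by (cases "s \<ge> 0 \<and> t \<ge> 0") (auto simp: not_le)
    then show ?thesis using a[of n] by (simp add: k_def ennreal_mult' P_def mult.assoc)
  qed
  have km: "(\<lambda>p. k n (fst p) (snd p)) \<in> borel_measurable ?B" for n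
    unfolding kint using borel_measurable_nn_integral_fst[OF measurable_pair_swap[OF key[of n]]] by simp
  have lm: "(\<lambda>p. l (fst p) (snd p)) \<in> borel_measurable ?B"
    by (rule borel_measurable_LIMSEQ_order[OF kl km])
  then show "(\<lambda>(s, t). ennreal (K s t) * (indicator {0..} s * indicator {0..} t)) \<in> borel_measurable ?B"
    by (simp add: l_def split_beta')
  define d where "d s t = ennreal (exp (- s / 2)) * indicator {0..} s * (ennreal (exp (- t / 2)) * indicator {0..} t)" for s t :: real
  have dm: "(\<lambda>p. d (fst p) (snd p)) \<in> borel_measurable ?B" unfolding d_def by measurable
  have kd: "k n s t \<le> d s t" for n s t
    using Pb[of n s t] by (auto simp: k_def d_def indicator_def ennreal_mult[symmetric] intro!: ennreal_leI)
  have dint: "(\<integral>\<^sup>+ p. d (fst p) (snd p) \<partial>?B) = 4"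
  proof -
    have "(\<integral>\<^sup>+ p. d (fst p) (snd p) \<partial>?B) = (\<integral>\<^sup>+ s. \<integral>\<^sup>+ t. d s t \<partial>lborel \<partial>lborel)"
      using lborel.nn_integral_fst[OF dm] by simp
    also have "\<dots> = (\<integral>\<^sup>+ s. ennreal (exp (- s / 2)) * indicator {0..} s * 2 \<partial>lborel)"
      unfolding d_def by (subst nn_integral_cmult) (simp_all only: nn_integral_exp_half, simp)
    also have "\<dots> = 2 * 2" by (subst nn_integral_multc) (simp_all only: nn_integral_exp_half, simp)
    finally show ?thesis by simp
  qed
  have lim2: "(\<lambda>n. \<integral>\<^sup>+ p. k n (fst p) (snd p) \<partial>?B) \<longlonglongrightarrow> (\<integral>\<^sup>+ p. l (fst p) (snd p) \<partial>?B)"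
    by (rule nn_integral_dominated_convergence[OF km lm dm]) (use kd dint kl in auto)
  have lfin: "(\<integral>\<^sup>+ p. l (fst p) (snd p) \<partial>?B) \<le> 4"
    using LIMSEQ_le_const2[OF lim2, of 4] nn_integral_mono[of ?B "\<lambda>p. k _ (fst p) (snd p)" "\<lambda>p. d (fst p) (snd p)"] kd
    unfolding dint by blast
  then show "(\<integral>\<^sup>+ p. (case p of (s, t) \<Rightarrow> ennreal (K s t) * (indicator {0..} s * indicator {0..} t)) \<partial>?B) < \<infinity>"
    by (auto simp: l_def split_beta' elim!: le_less_trans)
  \<comment> \<open>\<open>enn2real\<close> is continuous only at finite values. The number 4 is the
    integral of the dominating function over the quadrant and also covers the one-dimensional case,
    where that integral is 2.\<close>
  have tend: "(\<lambda>n. enn2real (f n)) \<longlonglongrightarrow> enn2real x" if "f \<longlonglongrightarrow> x" "x \<le> 4" for f :: "nat \<Rightarrow> ennreal" and x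
  proof (rule tendsto_enn2real)
    have "x < \<top>" using that(2) by (rule le_less_trans) simp
    then show "f \<longlonglongrightarrow> ennreal (enn2real x)" using that(1) by (simp add: ennreal_enn2real)
  qed simp
  have "a n * expectation (\<lambda>w. max 0 (Y w - u n) * max 0 (Z w - v n)) = enn2real (\<integral>\<^sup>+ p. k n (fst p) (snd p) \<partial>?B)" for n
  proof -
    have "(\<integral>\<^sup>+ p. k n (fst p) (snd p) \<partial>?B) = ennreal (a n) * (\<integral>\<^sup>+ p. \<integral>\<^sup>+ w. indicator {w. Y w \<ge> u n + fst p \<and> Z w \<ge> v n + snd p} w * (indicator {0..} (fst p) * indicator {0..} (snd p)) \<partial>M \<partial>?B)"
      unfolding kint using borel_measurable_nn_integral_fst[OF measurable_pair_swap[OF key[of n]]] by (subst nn_integral_cmult) simp_all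
    also have "(\<integral>\<^sup>+ p. \<integral>\<^sup>+ w. indicator {w. Y w \<ge> u n + fst p \<and> Z w \<ge> v n + snd p} w * (indicator {0..} (fst p) * indicator {0..} (snd p)) \<partial>M \<partial>?B) =
       (\<integral>\<^sup>+ w. \<integral>\<^sup>+ p. indicator {w. Y w \<ge> u n + fst p \<and> Z w \<ge> v n + snd p} w * (indicator {0..} (fst p) * indicator {0..} (snd p)) \<partial>?B \<partial>M)"
      using B.Fubini[OF key[of n]] by simp
    also have "\<dots> = (\<integral>\<^sup>+ w. \<integral>\<^sup>+ p. indicator ({0..Y w - u n} \<times> {0..Z w - v n}) p \<partial>?B \<partial>M)"
      by (intro nn_integral_cong) (auto simp: indicator_def)
    also have "\<dots> = (\<integral>\<^sup>+ w. ennreal (max 0 (Y w - u n) * max 0 (Z w - v n)) \<partial>M)"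
      by (intro nn_integral_cong) (simp add: lborel.emeasure_pair_measure_Times emeasure_Icc_0 ennreal_mult)
    finally show ?thesis using a[of n]
      by (subst integral_eq_nn_integral) (simp_all add: enn2real_mult)
  qed
  moreover have "(\<lambda>(s, t). ennreal (K s t) * (indicator {0..} s * indicator {0..} t)) = (\<lambda>p. l (fst p) (snd p))"
    by (simp add: l_def split_beta')
  ultimately show "(\<lambda>n. a n * expectation (\<lambda>w. max 0 (Y w - u n) * max 0 (Z w - v n))) \<longlonglongrightarrow>
      enn2real (\<integral>\<^sup>+ p. (case p of (s, t) \<Rightarrow> ennreal (K s t) * (indicator {0..} s * indicator {0..} t)) \<partial>?B)"
    using tend[OF lim2 lfin] by simp
  have km0: "(\<lambda>s. k n s 0) \<in> borel_measurable lborel" for n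
    using measurable_compose[OF measurable_Pair2'[of "0::real" lborel lborel] km[of n]] by simp
  have lm0: "(\<lambda>s. l s 0) \<in> borel_measurable lborel"
    using measurable_compose[OF measurable_Pair2'[of "0::real" lborel lborel] lm] by simp
  have dint0: "(\<integral>\<^sup>+ s. d s 0 \<partial>lborel) = 2" unfolding d_def using nn_integral_exp_half by simp
  have lim0: "(\<lambda>n. \<integral>\<^sup>+ s. k n s 0 \<partial>lborel) \<longlonglongrightarrow> (\<integral>\<^sup>+ s. l s 0 \<partial>lborel)"
  proof (rule nn_integral_dominated_convergence[OF km0 lm0])
    show "(\<lambda>s. d s 0) \<in> borel_measurable lborel" unfolding d_def by measurable
    show "(\<integral>\<^sup>+ s. d s 0 \<partial>lborel) < \<infinity>" unfolding dint0 by simp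
    show "AE s in lborel. k n s 0 \<le> d s 0" for n by (rule AE_I2) (rule kd)
    show "AE s in lborel. (\<lambda>n. k n s 0) \<longlonglongrightarrow> l s 0" by (rule AE_I2) (rule kl)
  qed
  have lfin0: "(\<integral>\<^sup>+ s. l s 0 \<partial>lborel) \<le> 4"
  proof (rule LIMSEQ_le_const2[OF lim0], intro exI allI impI)
    fix n
    have "(\<integral>\<^sup>+ s. k n s 0 \<partial>lborel) \<le> (\<integral>\<^sup>+ s. d s 0 \<partial>lborel)" by (rule nn_integral_mono) (rule kd)
    then show "(\<integral>\<^sup>+ s. k n s 0 \<partial>lborel) \<le> 4" unfolding dint0 by (rule order_trans) simp
  qed
  have key0: "(\<lambda>(w, s). indicator {w. Y w \<ge> u n + s \<and> Z w \<ge> v n + 0} w * (indicator {0..} s * indicator {0..} (0::real)) :: ennreal)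
      \<in> borel_measurable (M \<Otimes>\<^sub>M lborel)" for n
  proof -
    have eq: "(\<lambda>(w, s). indicator {w. Y w \<ge> u n + s \<and> Z w \<ge> v n + 0} w * (indicator {0..} s * indicator {0..} (0::real)) :: ennreal) =
      (\<lambda>x. of_bool (Y (fst x) \<ge> u n + snd x \<and> Z (fst x) \<ge> v n + 0) * (indicator {0..} (snd x) * indicator {0..} (0::real)))"
      by (auto simp: fun_eq_iff indicator_def)
    show ?thesis unfolding eq by measurable
  qed
  have "a n * expectation (\<lambda>w. max 0 (Y w - u n) * of_bool (Z w \<ge> v n)) = enn2real (\<integral>\<^sup>+ s. k n s 0 \<partial>lborel)" for n
  proof -
    have "(\<integral>\<^sup>+ s. k n s 0 \<partial>lborel) = ennreal (a n) * (\<integral>\<^sup>+ s. \<integral>\<^sup>+ w. indicator {w. Y w \<ge> u n + s \<and> Z w \<ge> v n + 0} w * (indicator {0..} s * indicator {0..} (0::real)) \<partial>M \<partial>lborel)"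
      unfolding kint using borel_measurable_nn_integral_fst[OF measurable_pair_swap[OF key0[of n]]] by (subst nn_integral_cmult) simp_all
    also have "(\<integral>\<^sup>+ s. \<integral>\<^sup>+ w. indicator {w. Y w \<ge> u n + s \<and> Z w \<ge> v n + 0} w * (indicator {0..} s * indicator {0..} (0::real)) \<partial>M \<partial>lborel) =
       (\<integral>\<^sup>+ w. \<integral>\<^sup>+ s. indicator {w. Y w \<ge> u n + s \<and> Z w \<ge> v n + 0} w * (indicator {0..} s * indicator {0..} (0::real)) \<partial>lborel \<partial>M)"
      using B1.Fubini[OF key0[of n]] by simp
    also have "\<dots> = (\<integral>\<^sup>+ w. \<integral>\<^sup>+ s. of_bool (Z w \<ge> v n) * indicator {0..Y w - u n} s \<partial>lborel \<partial>M)"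
      by (intro nn_integral_cong) (auto simp: indicator_def)
    also have "\<dots> = (\<integral>\<^sup>+ w. ennreal (max 0 (Y w - u n) * of_bool (Z w \<ge> v n)) \<partial>M)"
      by (intro nn_integral_cong) (simp add: nn_integral_cmult emeasure_Icc_0 of_bool_def)
    finally show ?thesis using a[of n]
      by (subst integral_eq_nn_integral) (simp_all add: enn2real_mult)
  qed
  moreover have "(\<lambda>s. ennreal (K s 0) * indicator {0..} s) = (\<lambda>s. l s 0)"
    by (simp add: l_def)
  ultimately show "(\<lambda>n. a n * expectation (\<lambda>w. max 0 (Y w - u n) * of_bool (Z w \<ge> v n))) \<longlonglongrightarrow>
      enn2real (\<integral>\<^sup>+ s. ennreal (K s 0) * indicator {0..} s \<partial>lborel)"
    using tend[OF lim0 lfin0] by simp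
qed

text \<open>By homogeneity of \<open>K\<close> the double integral that is the limit of the products of the excesses splits
  into the limits of the two mixed terms, so only \<open>K 0 0\<close> survives.\<close>

lemma tendsto_centred_excess_covariance:
  fixes Y Z :: "'a \<Rightarrow> real" and a u v :: "nat \<Rightarrow> real" and K :: "real \<Rightarrow> real \<Rightarrow> real"
  assumes Y: "distributed M lborel Y (exponential_density 1)"
    and Z: "distributed M lborel Z (exponential_density 1)"
    and a: "\<And>n. a n \<ge> 0"
    and bound: "\<And>n. a n * exp (- (u n + v n) / 2) \<le> 1"
    and lim: "\<And>s t. s \<ge> 0 \<Longrightarrow> t \<ge> 0 \<Longrightarrow>
      (\<lambda>n. a n * prob {w \<in> space M. Y w \<ge> u n + s \<and> Z w \<ge> v n + t}) \<longlonglongrightarrow> K s t"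
    and hom: "\<And>s t r. s \<ge> 0 \<Longrightarrow> t \<ge> 0 \<Longrightarrow> r \<ge> 0 \<Longrightarrow> K (s + r) (t + r) = exp (- r) * K s t"
  shows "(\<lambda>n. a n * expectation (\<lambda>w. centred_excess (Y w - u n) * centred_excess (Z w - v n))) \<longlonglongrightarrow> K 0 0"
proof -
  note [measurable] = exponential_measurable[OF Y] exponential_measurable[OF Z]
  note Yt = exponential_tail_le[OF Y] and Zt = exponential_tail_le[OF Z]
  let ?D = "\<integral>\<^sup>+ p. (case p of (s, t) \<Rightarrow> ennreal (K s t) * (indicator {0..} s * indicator {0..} t)) \<partial>(lborel \<Otimes>\<^sub>M lborel)"
  let ?A = "\<integral>\<^sup>+ s. ennreal (K s 0) * indicator {0..} s \<partial>lborel"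
  let ?B = "\<integral>\<^sup>+ t. ennreal (K 0 t) * indicator {0..} t \<partial>lborel"
  note t1 = tendsto_excess_expectations[OF _ _ Yt Zt a bound lim, simplified]
  have bound': "a n * exp (- (v n + u n) / 2) \<le> 1" for n using bound[of n] by (simp add: add.commute)
  have lim': "(\<lambda>n. a n * prob {w \<in> space M. Z w \<ge> v n + s \<and> Y w \<ge> u n + t}) \<longlonglongrightarrow> K t s" if "s \<ge> 0" "t \<ge> 0" for s t
    using lim[OF that(2,1)] by (simp add: conj_commute)
  note t2 = tendsto_excess_expectations(4)[OF _ _ Zt Yt a bound' lim', simplified]
  have D: "?D = ?B + ?A" by (rule nn_integral_pair_homogeneous[OF t1(3) hom])
  have fin: "?A < \<infinity>" "?B < \<infinity>" using t1(2) unfolding D by auto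
  have lim0: "(\<lambda>n. a n * expectation (\<lambda>w. of_bool (Y w \<ge> u n) * of_bool (Z w \<ge> v n))) \<longlonglongrightarrow> K 0 0"
  proof -
    have "expectation (\<lambda>w. of_bool (Y w \<ge> u n) * of_bool (Z w \<ge> v n)) = prob {w \<in> space M. Y w \<ge> u n + 0 \<and> Z w \<ge> v n + 0}" for n
      using expectation_of_bool[of "\<lambda>w. Y w \<ge> u n \<and> Z w \<ge> v n"] by (simp add: of_bool_conj)
    then show ?thesis using lim[of 0 0] by simp
  qed
  have sqY: "integrable M (\<lambda>w. (Y w - x)\<^sup>2)" for x
    using exponential_moment(1)[OF Y, of 2] exponential_moment(1)[OF Y, of 1] by (simp add: power2_diff)
  have sqZ: "integrable M (\<lambda>w. (Z w - x)\<^sup>2)" for x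
    using exponential_moment(1)[OF Z, of 2] exponential_moment(1)[OF Z, of 1] by (simp add: power2_diff)
  have i1: "integrable M (\<lambda>w. max 0 (Y w - x) * max 0 (Z w - y))" for x y
  proof (rule Bochner_Integration.integrable_bound[OF Bochner_Integration.integrable_add[OF sqY[of x] sqZ[of y]]])
    have "\<bar>max 0 p * max 0 q\<bar> \<le> p\<^sup>2 + q\<^sup>2" for p q :: real
      using abs_mult_le_squares[of p q] by (auto simp: max_def)
    then show "AE w in M. norm (max 0 (Y w - x) * max 0 (Z w - y)) \<le> norm ((Y w - x)\<^sup>2 + (Z w - y)\<^sup>2)" by simp
  qed simp
  have iY: "integrable M (\<lambda>w. Y w - x)" for x using exponential_moment(1)[OF Y, of 1] by simp
  have iZ: "integrable M (\<lambda>w. Z w - x)" for x using exponential_moment(1)[OF Z, of 1] by simp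
  have i2: "integrable M (\<lambda>w. max 0 (Y w - x) * of_bool (Z w \<ge> y))" for x y
    by (rule Bochner_Integration.integrable_bound[OF iY[of x]]) auto
  have i3: "integrable M (\<lambda>w. max 0 (Z w - y) * of_bool (Y w \<ge> x))" for x y
    by (rule Bochner_Integration.integrable_bound[OF iZ[of y]]) auto
  have i4: "integrable M (\<lambda>w. of_bool (Y w \<ge> x) * of_bool (Z w \<ge> y) :: real)" for x y
    by (rule integrable_const_bound[of _ 1]) auto
  have eq: "expectation (\<lambda>w. centred_excess (Y w - u n) * centred_excess (Z w - v n)) =
      expectation (\<lambda>w. max 0 (Y w - u n) * max 0 (Z w - v n)) - expectation (\<lambda>w. max 0 (Y w - u n) * of_bool (Z w \<ge> v n))
      - expectation (\<lambda>w. max 0 (Z w - v n) * of_bool (Y w \<ge> u n)) + expectation (\<lambda>w. of_bool (Y w \<ge> u n) * of_bool (Z w \<ge> v n))" for n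
  proof -
    have "centred_excess (Y w - u n) * centred_excess (Z w - v n) =
       max 0 (Y w - u n) * max 0 (Z w - v n) - max 0 (Y w - u n) * of_bool (Z w \<ge> v n)
      - max 0 (Z w - v n) * of_bool (Y w \<ge> u n) + of_bool (Y w \<ge> u n) * of_bool (Z w \<ge> v n)" for w
      by (simp add: centred_excess_def algebra_simps)
    then show ?thesis
      by (simp only: Bochner_Integration.integral_add Bochner_Integration.integral_diff i1 i2 i3 i4
          Bochner_Integration.integrable_add Bochner_Integration.integrable_diff)
  qed
  have "(\<lambda>n. a n * expectation (\<lambda>w. max 0 (Y w - u n) * max 0 (Z w - v n)) - a n * expectation (\<lambda>w. max 0 (Y w - u n) * of_bool (Z w \<ge> v n))
      - a n * expectation (\<lambda>w. max 0 (Z w - v n) * of_bool (Y w \<ge> u n)) + a n * expectation (\<lambda>w. of_bool (Y w \<ge> u n) * of_bool (Z w \<ge> v n)))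
      \<longlonglongrightarrow> enn2real ?D - enn2real ?A - enn2real ?B + K 0 0"
    by (intro tendsto_add tendsto_diff t1(1) t1(4) t2 lim0)
  moreover have "enn2real ?D = enn2real ?B + enn2real ?A" unfolding D using fin by (simp add: enn2real_plus)
  ultimately show ?thesis unfolding eq by (simp add: algebra_simps)
qed

end

section \<open>The Hill estimator of exponential data\<close>

text \<open>One margin of a vector sample on the exponential scale. The functional \<open>e\<close>
  is kept apart from the data, and \<open>N\<close> and \<open>k\<close> are parameters, because the
  tail copula estimator looks at one margin with the sample size and the \<open>k\<close> of
  another.\<close>

locale exp_sample = iid_copies M X\<^sub>0 X
  for M :: "'a measure" and X\<^sub>0 :: "'a \<Rightarrow> 'b::topological_space" and X +
  fixes e :: "'b \<Rightarrow> real" and N k :: "nat \<Rightarrow> nat"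
  assumes e_measurable [measurable]: "e \<in> borel_measurable borel"
    and e_distr: "distributed M lborel (\<lambda>w. e (X\<^sub>0 w)) (exponential_density 1)"
    and N_lim: "filterlim N at_top sequentially"
    and k_lim: "filterlim k at_top sequentially"
    and k_frac: "(\<lambda>n. real (k n) / real (N n)) \<longlonglongrightarrow> 0"
begin

text \<open>The level exceeded with probability k / N. Truncation at 0 makes it nonnegative for
  every \<open>n\<close>, so the exact moment formulas are not restricted to large
  \<open>n\<close>.\<close>

definition threshold :: "nat \<Rightarrow> real" where
  "threshold n = max 0 (ln (real (N n) / real (k n)))"

definition excess_sum :: "nat \<Rightarrow> 'a \<Rightarrow> real" where
  "excess_sum n w = (\<Sum>i=1..N n. 1 / sqrt (k n) * centred_excess (e (X i w) - threshold n))"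

definition tail_count :: "nat \<Rightarrow> real \<Rightarrow> 'a \<Rightarrow> real" where
  "tail_count n s w = real (card {i \<in> {1..N n}. e (X i w) \<ge> threshold n + s}) / real (k n)"

definition top_excess :: "nat \<Rightarrow> 'a \<Rightarrow> real" where
  "top_excess n w = order_stat (\<lambda>i. e (X i w)) (N n) (N n - k n) - threshold n"

definition exp_hill :: "nat \<Rightarrow> 'a \<Rightarrow> real" where
  "exp_hill n w = (\<Sum>i=1..k n. order_stat (\<lambda>i. e (X i w)) (N n) (N n - i + 1) -
     order_stat (\<lambda>i. e (X i w)) (N n) (N n - k n)) / real (k n)"

lemma k_real_lim: "filterlim (\<lambda>n. real (k n)) at_top sequentially"
  by (rule filterlim_compose[OF filterlim_real_sequentially k_lim])

lemma k_less_N: "\<forall>\<^sub>F n in sequentially. 0 < k n \<and> k n < N n"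
proof -
  have "\<forall>\<^sub>F n in sequentially. real (k n) / real (N n) < 1"
    using k_frac by (rule order_tendstoD) simp
  moreover have "\<forall>\<^sub>F n in sequentially. k n \<ge> 1" using k_lim unfolding filterlim_at_top by blast
  moreover have "\<forall>\<^sub>F n in sequentially. N n \<ge> 1" using N_lim unfolding filterlim_at_top by blast
  ultimately show ?thesis by eventually_elim (auto simp: divide_less_eq)
qed

lemma threshold_eq: "\<forall>\<^sub>F n in sequentially. threshold n = ln (real (N n) / real (k n)) \<and>
    exp (- threshold n) = real (k n) / real (N n)"
  using k_less_N
proof eventually_elim
  case (elim n)
  then have "ln (real (N n) / real (k n)) \<ge> 0" by simp
  then have "threshold n = ln (real (N n) / real (k n))" by (simp add: threshold_def)
  moreover have "exp (- ln (real (N n) / real (k n))) = real (k n) / real (N n)"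
    using elim by (simp add: exp_minus)
  ultimately show ?case by simp
qed

lemma threshold_nonneg: "threshold n \<ge> 0" by (simp add: threshold_def)

lemma frac_at_top: "filterlim (\<lambda>n. real (N n) / real (k n)) at_top sequentially"
proof -
  have "filterlim (\<lambda>n. inverse (real (k n) / real (N n))) at_top sequentially"
  proof (rule filterlim_inverse_at_top[OF k_frac])
    show "\<forall>\<^sub>F n in sequentially. 0 < real (k n) / real (N n)" using k_less_N by eventually_elim simp
  qed
  then show ?thesis by simp
qed

lemma threshold_lim: "filterlim threshold at_top sequentially"
proof (rule filterlim_at_top_mono)
  show "filterlim (\<lambda>n. ln (real (N n) / real (k n))) at_top sequentially"
    by (rule filterlim_compose[OF ln_at_top frac_at_top])
  show "\<forall>\<^sub>F n in sequentially. ln (real (N n) / real (k n)) \<le> threshold n" by (simp add: threshold_def)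
qed

lemma excess_sum_measurable: "excess_sum n \<in> borel_measurable M"
  unfolding excess_sum_def[abs_def]
  by (intro borel_measurable_sum borel_measurable_times borel_measurable_const
      measurable_compose[OF X_measurable, of _ "\<lambda>x. centred_excess (e x - threshold n)"]) auto

lemma inverse_sqrt_k: "(\<lambda>n. 1 / sqrt (k n)) \<longlonglongrightarrow> 0"
  by (rule filterlim_compose[OF _ k_real_lim, of "\<lambda>z. 1 / sqrt z"]) real_asymp

text \<open>A band rather than two separate tails, since the variance of the difference of two tail
  counts is of the order of the mass between the thresholds only.\<close>

lemma count_band_tendsto:
  fixes a s t :: "nat \<Rightarrow> real"
  assumes le: "\<And>n. s n \<le> t n" and nonneg: "\<forall>\<^sub>F n in sequentially. threshold n + s n \<ge> 0"
    and mean: "(\<lambda>n. a n * (k n * (exp (- s n) - exp (- t n)))) \<longlonglongrightarrow> l"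
    and var: "(\<lambda>n. (a n)\<^sup>2 * (k n * (exp (- s n) - exp (- t n)))) \<longlonglongrightarrow> 0"
  shows "((\<lambda>x. a (fst x) * (k (fst x) * (tail_count (fst x) (s (fst x)) (snd x) - tail_count (fst x) (t (fst x)) (snd x)))) \<longlongrightarrow> l) (whp M)"
proof -
  define B where "B n x \<longleftrightarrow> threshold n + s n \<le> e x \<and> e x < threshold n + t n" for n x
  have Bm: "Measurable.pred borel (B n)" for n unfolding B_def by measurable
  define p where "p n = prob {w \<in> space M. B n (X\<^sub>0 w)}" for n
  have p: "\<forall>\<^sub>F n in sequentially. N n * p n = k n * (exp (- s n) - exp (- t n))"
    using nonneg threshold_eq k_less_N
  proof eventually_elim
    case (elim n)
    let ?A = "{w \<in> space M. e (X\<^sub>0 w) \<ge> threshold n + s n}" and ?C = "{w \<in> space M. e (X\<^sub>0 w) \<ge> threshold n + t n}"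
    have "{w \<in> space M. B n (X\<^sub>0 w)} = ?A - ?C" by (auto simp: B_def)
    moreover have "?C \<subseteq> ?A" using le[of n] by auto
    ultimately have "p n = prob ?A - prob ?C" by (simp add: p_def finite_measure_Diff)
    also have "\<dots> = exp (- (threshold n + s n)) - exp (- (threshold n + t n))"
      using elim(1) le[of n] by (simp add: exponential_tail[OF e_distr])
    also have "\<dots> = exp (- threshold n) * (exp (- s n) - exp (- t n))"
      by (simp add: exp_add exp_diff exp_minus field_simps)
    finally have "N n * p n = (N n * exp (- threshold n)) * (exp (- s n) - exp (- t n))" by simp
    also have "N n * exp (- threshold n) = k n"
    proof -
      have "exp (- threshold n) = k n / N n" using elim by blast
      then show ?thesis using elim by simp
    qed
    finally show ?case .
  qed
  have "((\<lambda>x. a (fst x) * real (card {i \<in> {1..N (fst x)}. B (fst x) (X i (snd x))})) \<longlongrightarrow> l) (whp M)"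
  proof (rule scaled_count_tendsto[OF Bm])
    show "(\<lambda>n. a n * (N n * prob {w \<in> space M. B n (X\<^sub>0 w)})) \<longlonglongrightarrow> l"
      by (rule Lim_transform_eventually[OF mean]) (use p in \<open>auto simp: p_def elim!: eventually_mono\<close>)
    show "(\<lambda>n. (a n)\<^sup>2 * (N n * prob {w \<in> space M. B n (X\<^sub>0 w)})) \<longlonglongrightarrow> 0"
      by (rule Lim_transform_eventually[OF var]) (use p in \<open>auto simp: p_def elim!: eventually_mono\<close>)
  qed
  then show ?thesis
  proof (rule Lim_transform_eventually)
    show "\<forall>\<^sub>F x in whp M. a (fst x) * real (card {i \<in> {1..N (fst x)}. B (fst x) (X i (snd x))}) =
        a (fst x) * (k (fst x) * (tail_count (fst x) (s (fst x)) (snd x) - tail_count (fst x) (t (fst x)) (snd x)))"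
      using eventually_whp_fst[OF k_less_N]
    proof eventually_elim
      case (elim x)
      obtain n w where x: "x = (n, w)" by (cases x)
      let ?A = "{i \<in> {1..N n}. e (X i w) \<ge> threshold n + s n}" and ?C = "{i \<in> {1..N n}. e (X i w) \<ge> threshold n + t n}"
      have "{i \<in> {1..N n}. B n (X i w)} = ?A - ?C" by (auto simp: B_def)
      moreover have CA: "?C \<subseteq> ?A" using le[of n] by auto
      ultimately have "real (card {i \<in> {1..N n}. B n (X i w)}) = real (card ?A) - real (card ?C)"
        using card_mono[OF _ CA] by (simp add: card_Diff_subset of_nat_diff)
      then show ?case using elim by (simp add: x tail_count_def diff_divide_distrib[symmetric])
    qed
  qed
qed

text \<open>A band of width |y| / sqrt k around the threshold holds about sqrt k |y| points, with
  standard deviation of order k^(1/4). After division by sqrt k only the mean survives: locally the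
  tail process has deterministic slope.\<close>

lemma tail_count_increment:
  "((\<lambda>x. sqrt (k (fst x)) * (tail_count (fst x) 0 (snd x) - tail_count (fst x) (y / sqrt (k (fst x))) (snd x))) \<longlongrightarrow> y) (whp M)"
proof -
  define a where "a n = 1 / sqrt (k n)" for n
  define r where "r n = y / sqrt (k n)" for n
  \<comment> \<open>The two thresholds in increasing order; the factor \<open>sgn y\<close> restores
    the orientation, so that one band treats both signs.\<close>
  define s where "s n = min 0 (r n)" for n
  define t where "t n = max 0 (r n)" for n
  have lims: "((\<lambda>z. sqrt z * (1 - exp (- (y / sqrt z)))) \<longlongrightarrow> y) at_top" "((\<lambda>z. (1 - exp (- (y / sqrt z)))) \<longlongrightarrow> 0) at_top"
      "((\<lambda>z. y / sqrt z) \<longlongrightarrow> 0) at_top"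
    by real_asymp+
  have l1: "(\<lambda>n. sqrt (k n) * (1 - exp (- r n))) \<longlonglongrightarrow> y"
    and l2: "(\<lambda>n. 1 - exp (- r n)) \<longlonglongrightarrow> 0" and l3: "r \<longlonglongrightarrow> 0"
    using filterlim_compose[OF lims(1) k_real_lim] filterlim_compose[OF lims(2) k_real_lim]
      filterlim_compose[OF lims(3) k_real_lim] by (simp_all add: r_def[abs_def])
  have ak: "\<forall>\<^sub>F n in sequentially. a n * real (k n) = sqrt (k n) \<and> (a n)\<^sup>2 * real (k n) = 1"
    using k_less_N by eventually_elim (simp add: a_def power_divide real_div_sqrt)
  have ex: "exp (- s n) - exp (- t n) = sgn y * (1 - exp (- r n))" for n
  proof -
    have "y > 0 \<Longrightarrow> r n \<ge> 0" "y < 0 \<Longrightarrow> r n \<le> 0" by (auto simp: r_def divide_nonpos_nonneg)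
    then show ?thesis by (cases y "0::real" rule: linorder_cases) (auto simp: s_def t_def r_def sgn_if)
  qed
  have "((\<lambda>x. a (fst x) * (k (fst x) * (tail_count (fst x) (s (fst x)) (snd x) - tail_count (fst x) (t (fst x)) (snd x)))) \<longlongrightarrow> sgn y * y) (whp M)"
  proof (rule count_band_tendsto)
    show "s n \<le> t n" for n by (simp add: s_def t_def)
    show "\<forall>\<^sub>F n in sequentially. 0 \<le> threshold n + s n"
    proof -
      have "\<forall>\<^sub>F n in sequentially. r n > -1" using l3 by (rule order_tendstoD) simp
      moreover have "\<forall>\<^sub>F n in sequentially. threshold n > 1" using threshold_lim by (simp add: filterlim_at_top_dense)
      ultimately show ?thesis by eventually_elim (simp add: s_def)
    qed
    have "(\<lambda>n. sgn y * (sqrt (k n) * (1 - exp (- r n)))) \<longlonglongrightarrow> sgn y * y"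
      by (intro tendsto_mult tendsto_const l1)
    then show "(\<lambda>n. a n * (k n * (exp (- s n) - exp (- t n)))) \<longlonglongrightarrow> sgn y * y"
      unfolding ex by (rule Lim_transform_eventually) (use ak in \<open>auto elim!: eventually_mono simp: mult.assoc[symmetric]\<close>)
    have "(\<lambda>n. sgn y * (1 - exp (- r n))) \<longlonglongrightarrow> sgn y * 0"
      by (intro tendsto_mult tendsto_const l2)
    then have "(\<lambda>n. sgn y * (1 - exp (- r n))) \<longlonglongrightarrow> 0" by simp
    then show "(\<lambda>n. (a n)\<^sup>2 * (k n * (exp (- s n) - exp (- t n)))) \<longlonglongrightarrow> 0"
      unfolding ex by (rule Lim_transform_eventually) (use ak in \<open>auto elim!: eventually_mono simp: mult.assoc[symmetric]\<close>)
  qed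
  then have "((\<lambda>x. sgn y * (a (fst x) * (k (fst x) * (tail_count (fst x) (s (fst x)) (snd x) - tail_count (fst x) (t (fst x)) (snd x))))) \<longlongrightarrow> sgn y * (sgn y * y)) (whp M)"
    by (rule tendsto_mult_left)
  then show ?thesis
  proof (rule Lim_transform_eventually[THEN tendsto_eq_rhs])
    show "sgn y * (sgn y * y) = y" by (simp add: sgn_if)
    show "\<forall>\<^sub>F x in whp M. sgn y * (a (fst x) * (k (fst x) * (tail_count (fst x) (s (fst x)) (snd x) - tail_count (fst x) (t (fst x)) (snd x)))) =
      sqrt (k (fst x)) * (tail_count (fst x) 0 (snd x) - tail_count (fst x) (y / sqrt (k (fst x))) (snd x))"
      using eventually_whp_fst[OF ak]
    proof eventually_elim
      case (elim x)
      have "y > 0 \<Longrightarrow> r n \<ge> 0" "y < 0 \<Longrightarrow> r n \<le> 0" for n by (auto simp: r_def divide_nonpos_nonneg)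
      then have "sgn y * (tail_count n (s n) w - tail_count n (t n) w) = tail_count n 0 w - tail_count n (r n) w" for n w
        by (cases y "0::real" rule: linorder_cases) (auto simp: s_def t_def r_def sgn_if)
      then show ?case using elim by (simp add: r_def[symmetric] mult.assoc[symmetric])
    qed
  qed
qed

lemma bdd_prob_tail_count:
  "bdd_prob M (\<lambda>x. sqrt (k (fst x)) * (tail_count (fst x) 0 (snd x) - 1))"
proof -
  define p where "p n = prob {w \<in> space M. e (X\<^sub>0 w) \<ge> threshold n}" for n
  define f where "f n x = (of_bool (e x \<ge> threshold n) - p n) / sqrt (k n)" for n x
  have f[measurable]: "f n \<in> borel_measurable borel" for n unfolding f_def by measurable
  have p: "p n = exp (- threshold n)" for n
    unfolding p_def by (rule exponential_tail[OF e_distr threshold_nonneg])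
  have p1: "p n \<le> 1" "0 \<le> p n" for n by (simp_all add: p threshold_nonneg)
  have eB: "expectation (\<lambda>w. of_bool (e (X\<^sub>0 w) \<ge> threshold n)) = p n" for n
    unfolding p_def by (rule expectation_of_bool)
  have iB: "integrable M (\<lambda>w. of_bool (e (X\<^sub>0 w) \<ge> threshold n) :: real)" for n
    by (rule integrable_const_bound[of _ 1]) auto
  have mean: "expectation (\<lambda>w. f n (X\<^sub>0 w)) = 0" for n
    unfolding f_def using iB eB by (simp add: prob_space)
  have sq: "(f n x)\<^sup>2 = ((1 - 2 * p n) * of_bool (e x \<ge> threshold n) + (p n)\<^sup>2) / k n" for n x
    by (simp add: f_def power_divide power2_eq_square field_simps)
  have int2: "integrable M (\<lambda>w. (f n (X\<^sub>0 w))\<^sup>2)" for n unfolding sq using iB by simp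
  have "expectation (\<lambda>w. (f n (X\<^sub>0 w))\<^sup>2) = ((1 - 2 * p n) * p n + (p n)\<^sup>2) / k n" for n
    unfolding sq using iB by (simp add: eB prob_space)
  also have "((1 - 2 * p n) * p n + (p n)\<^sup>2) / k n \<le> p n / k n" for n
    by (rule divide_right_mono) (auto simp: power2_eq_square algebra_simps)
  finally have var: "expectation (\<lambda>w. (f n (X\<^sub>0 w))\<^sup>2) \<le> p n / k n" for n .
  define Y where "Y n w = (\<Sum>i=1..N n. f n (X i w))" for n w
  have Ym: "Y n \<in> borel_measurable M" for n unfolding Y_def
    by (intro borel_measurable_sum measurable_compose[OF X_measurable f]) auto
  have sm: "integrable M (\<lambda>w. (Y n w)\<^sup>2)" "expectation (\<lambda>w. (Y n w)\<^sup>2) \<le> N n * (p n / k n)" for n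
    using second_moment_sum[of "\<lambda>_. f n" "N n", OF f int2 mean] mult_left_mono[OF var, of "real (N n)" n]
    unfolding Y_def by simp_all
  have "bdd_prob M (\<lambda>x. Y (fst x) (snd x))"
  proof (rule bdd_prob_second_moment[OF Ym])
    show "\<forall>\<^sub>F n in sequentially. integrable M (\<lambda>w. (Y n w)\<^sup>2) \<and> expectation (\<lambda>w. (Y n w)\<^sup>2) \<le> 1"
      using threshold_eq k_less_N
    proof eventually_elim
      case (elim n)
      then have "p n = k n / N n" using p[of n] by metis
      then have "N n * (p n / k n) = 1" using elim by simp
      with sm(2)[of n] have "expectation (\<lambda>w. (Y n w)\<^sup>2) \<le> 1" by (simp only:)
      then show ?case using sm(1)[of n] by simp
    qed
  qed
  moreover have "\<forall>\<^sub>F x in whp M. sqrt (k (fst x)) * (tail_count (fst x) 0 (snd x) - 1) - Y (fst x) (snd x) = 0"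
    using eventually_whp_fst[OF threshold_eq] eventually_whp_fst[OF k_less_N]
  proof eventually_elim
    case (elim x)
    obtain n w where x: "x = (n, w)" by (cases x)
    have c: "real (card {i \<in> {1..N n}. e (X i w) \<ge> threshold n}) = (\<Sum>i=1..N n. of_bool (e (X i w) \<ge> threshold n))"
      by (simp add: Int_def)
    have "p n = k n / N n" using elim p[of n] unfolding x fst_conv by metis
    then have Np: "N n * p n = k n" using elim by (simp add: x)
    have "Y n w = (real (card {i \<in> {1..N n}. e (X i w) \<ge> threshold n}) - N n * p n) / sqrt (k n)"
      unfolding Y_def f_def c by (simp add: sum_divide_distrib[symmetric] sum_subtractf)
    also have "\<dots> = sqrt (k n) * (tail_count n 0 w - 1)"
      using elim unfolding Np by (simp add: x tail_count_def field_simps)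
    finally show ?case by (simp add: x)
  qed
  then have "((\<lambda>x. sqrt (k (fst x)) * (tail_count (fst x) 0 (snd x) - 1) - Y (fst x) (snd x)) \<longlongrightarrow> 0) (whp M)"
    by (rule tendsto_eventually)
  ultimately show ?thesis by (rule bdd_prob_close)
qed

text \<open>Ghosh's argument: both quantities lie on the same side of each point of a fine grid.\<close>

lemma top_excess_bahadur:
  "((\<lambda>x. sqrt (k (fst x)) * top_excess (fst x) (snd x) - sqrt (k (fst x)) * (tail_count (fst x) 0 (snd x) - 1)) \<longlongrightarrow> 0) (whp M)"
proof (rule tendstoI)
  fix d :: real assume d: "d > 0"
  define Y where "Y n w = sqrt (k n) * (tail_count n 0 w - 1)" for n w
  show "\<forall>\<^sub>F x in whp M. dist (sqrt (k (fst x)) * top_excess (fst x) (snd x) - sqrt (k (fst x)) * (tail_count (fst x) 0 (snd x) - 1)) 0 < d"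
    unfolding eventually_whp
  proof (intro allI impI)
    fix \<epsilon> :: real assume "\<epsilon> > 0"
    then have e2: "\<epsilon> / 2 > 0" by simp
    from bdd_prob_tail_count[unfolded bdd_prob_def, rule_format, OF e2] obtain K where
      K: "\<forall>\<^sub>F n in sequentially. \<exists>A\<in>events. 1 - \<epsilon> / 2 < prob A \<and> (\<forall>w\<in>A. \<bar>Y n w\<bar> \<le> K)"
      unfolding Y_def by auto
    \<comment> \<open>If \<open>Y\<close> lies in the cell [i h, (i + 1) h), the order statistic
      will be trapped in [(i - 1) h, (i + 2) h), so the two differ by at most 2 h, well below
      \<open>d\<close>.\<close>
    define h where "h = d / 8"
    have h: "h > 0" using d by (simp add: h_def)
    \<comment> \<open>The grid must contain i - 1 and i + 2 for every cell i that meets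
      [- K, K].\<close>
    define m where "m = \<lceil>K / h\<rceil> + 3"
    define G where "G = (\<lambda>i. real_of_int i * h) ` {-m..m}"
    have finG: "finite G" by (simp add: G_def)
    have "\<forall>y\<in>G. \<forall>\<^sub>F x in whp M. dist (sqrt (k (fst x)) * (tail_count (fst x) 0 (snd x) - tail_count (fst x) (y / sqrt (k (fst x))) (snd x))) y < h"
      using tendstoD[OF tail_count_increment h] by blast
    then have "\<forall>\<^sub>F x in whp M. \<forall>y\<in>G. dist (sqrt (k (fst x)) * (tail_count (fst x) 0 (snd x) - tail_count (fst x) (y / sqrt (k (fst x))) (snd x))) y < h"
      using finG by (rule eventually_ball_finite[rotated])
    from this[unfolded eventually_whp, rule_format, OF e2] K k_less_N
    show "\<forall>\<^sub>F n in sequentially. \<exists>A\<in>events. 1 - \<epsilon> < prob A \<and> (\<forall>w\<in>A. dist (sqrt (k (fst (n, w))) * top_excess (fst (n, w)) (snd (n, w)) - sqrt (k (fst (n, w))) * (tail_count (fst (n, w)) 0 (snd (n, w)) - 1)) 0 < d)"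
    proof eventually_elim
      case (elim n)
      then obtain A B where AB: "A \<in> events" "1 - \<epsilon> / 2 < prob A"
        "\<And>w y. w \<in> A \<Longrightarrow> y \<in> G \<Longrightarrow> dist (sqrt (k n) * (tail_count n 0 w - tail_count n (y / sqrt (k n)) w)) y < h"
        "B \<in> events" "1 - \<epsilon> / 2 < prob B" "\<And>w. w \<in> B \<Longrightarrow> \<bar>Y n w\<bar> \<le> K" by auto
      have kN: "0 < k n" "k n < N n" using elim by auto
      have "\<bar>sqrt (k n) * top_excess n w - Y n w\<bar> < d" if w: "w \<in> A \<inter> B" for w
      proof -
        \<comment> \<open>The rank N - k means that k + 1 points must reach the level. A normalised
          count above 1 suffices for this and a count below 1 excludes it; the chosen grid points
          keep the count away from 1.\<close>
        have iff: "top_excess n w \<ge> s \<longleftrightarrow> card {i \<in> {1..N n}. e (X i w) \<ge> threshold n + s} > k n" for s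
        proof -
          have "top_excess n w \<ge> s \<longleftrightarrow> order_stat (\<lambda>i. e (X i w)) (N n) (N n - k n) \<ge> threshold n + s"
            by (auto simp: top_excess_def)
          also have "\<dots> \<longleftrightarrow> card {i \<in> {1..N n}. e (X i w) \<ge> threshold n + s} > k n"
            using kN by (subst order_stat_ge_iff) auto
          finally show ?thesis .
        qed
        have gt1: "top_excess n w \<ge> s" if "tail_count n s w > 1" for s
          using that kN unfolding iff by (simp add: tail_count_def)
        have lt1: "top_excess n w < s" if "tail_count n s w < 1" for s
          using that kN unfolding not_le[symmetric] iff by (simp add: tail_count_def)
        have sk: "sqrt (k n) > 0" using kN by simp
        have gridT: "\<bar>Y n w - sqrt (k n) * (tail_count n (y / sqrt (k n)) w - 1) - y\<bar> < h" if "y \<in> G" for y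
          using AB(3)[of w y] w that by (simp add: dist_real_def Y_def algebra_simps)
        have Yb: "\<bar>Y n w\<bar> \<le> K" using AB(6) w by auto
        define i where "i = \<lfloor>Y n w / h\<rfloor>"
        have i': "real_of_int i \<le> Y n w / h" "Y n w / h < real_of_int i + 1"
          unfolding i_def by linarith+
        have i: "real_of_int i * h \<le> Y n w" "Y n w < (real_of_int i + 1) * h"
          using i' h by (simp_all only: pos_le_divide_eq pos_divide_less_eq)
        have im: "i + 2 \<le> m" "- m \<le> i - 1"
        proof -
          have b: "Y n w / h \<le> K / h" "- (K / h) \<le> Y n w / h"
            unfolding minus_divide_left by (rule divide_right_mono; use Yb h in linarith)+
          have c: "K / h \<le> real_of_int \<lceil>K / h\<rceil>" by simp
          have "real_of_int i \<le> real_of_int \<lceil>K / h\<rceil>" using i'(1) b(1) c by linarith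
          then show "i + 2 \<le> m" unfolding m_def by simp
          have "real_of_int (- \<lceil>K / h\<rceil>) < real_of_int (i + 1)" unfolding of_int_minus of_int_add of_int_1 using i'(2) b(2) c by linarith
          then show "- m \<le> i - 1" unfolding m_def of_int_less_iff by linarith
        qed
        have g1: "real_of_int (i + 2) * h \<in> G" and g2: "real_of_int (i - 1) * h \<in> G"
          unfolding G_def by (rule imageI, use im in simp)+
        have "sqrt (k n) * (tail_count n (real_of_int (i + 2) * h / sqrt (k n)) w - 1) < 0"
          using gridT[OF g1] i by (simp add: abs_less_iff algebra_simps)
        then have "top_excess n w < real_of_int (i + 2) * h / sqrt (k n)"
          using sk by (intro lt1) (simp add: mult_less_0_iff)
        then have u: "sqrt (k n) * top_excess n w < real_of_int (i + 2) * h"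
          using sk by (simp add: field_simps)
        have "sqrt (k n) * (tail_count n (real_of_int (i - 1) * h / sqrt (k n)) w - 1) > 0"
          using gridT[OF g2] i by (simp add: abs_less_iff algebra_simps)
        then have "top_excess n w \<ge> real_of_int (i - 1) * h / sqrt (k n)"
          using sk by (intro gt1) (simp add: zero_less_mult_iff)
        then have l: "sqrt (k n) * top_excess n w \<ge> real_of_int (i - 1) * h"
          using sk by (simp add: field_simps)
        show ?thesis using u l i d unfolding h_def abs_less_iff by (simp add: algebra_simps)
      qed
      then show ?case
        using AB prob_Int_gt[of A B "\<epsilon> / 2" "\<epsilon> / 2"] by (intro bexI[of _ "A \<inter> B"]) (auto simp: Y_def)
    qed
  qed
qed

lemma top_excess_tendsto: "((\<lambda>x. top_excess (fst x) (snd x)) \<longlongrightarrow> 0) (whp M)"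
proof -
  have "bdd_prob M (\<lambda>x. sqrt (k (fst x)) * top_excess (fst x) (snd x))"
    by (rule bdd_prob_close[OF bdd_prob_tail_count top_excess_bahadur])
  then have "((\<lambda>x. 1 / sqrt (k (fst x)) * (sqrt (k (fst x)) * top_excess (fst x) (snd x))) \<longlongrightarrow> 0) (whp M)"
    using tendsto_mult_bdd_prob[OF tendsto_whp_fst[OF inverse_sqrt_k]] by blast
  then show ?thesis
    by (rule Lim_transform_eventually)
      (use eventually_whp_fst[OF k_less_N] in \<open>eventually_elim, simp\<close>)
qed

text \<open>Up to |\<tau>| |T - k| the top sum is the sum of the excesses over the deterministic
  threshold minus k \<tau>. The representation of the order statistic replaces k \<tau> by T - k,
  and the error divided by sqrt k is 1 / sqrt k times a product of two tight factors.\<close>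

lemma exp_hill_linearised:
  "((\<lambda>x. sqrt (k (fst x)) * (exp_hill (fst x) (snd x) - 1) - excess_sum (fst x) (snd x)) \<longlongrightarrow> 0) (whp M)"
proof -
  define Y where "Y n w = sqrt (k n) * (tail_count n 0 w - 1)" for n w
  define \<tau> where "\<tau> n w = sqrt (k n) * top_excess n w" for n w
  define r where "r n w = sqrt (k n) * (exp_hill n w - 1) - excess_sum n w - (Y n w - \<tau> n w)" for n w
  have Yb: "bdd_prob M (\<lambda>x. Y (fst x) (snd x))" unfolding Y_def by (rule bdd_prob_tail_count)
  have \<tau>Y: "((\<lambda>x. \<tau> (fst x) (snd x) - Y (fst x) (snd x)) \<longlongrightarrow> 0) (whp M)"
    unfolding Y_def \<tau>_def by (rule top_excess_bahadur)
  have \<tau>b: "bdd_prob M (\<lambda>x. \<tau> (fst x) (snd x))" by (rule bdd_prob_close[OF Yb \<tau>Y])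
  from tendsto_mult_bdd_prob[OF tendsto_whp_fst[OF inverse_sqrt_k] bdd_prob_mult[OF \<tau>b Yb]]
  have small: "((\<lambda>x. \<bar>1 / sqrt (k (fst x)) * (\<tau> (fst x) (snd x) * Y (fst x) (snd x))\<bar>) \<longlongrightarrow> 0) (whp M)"
    by (rule tendsto_rabs_zero)
  have bound: "\<bar>r n w\<bar> \<le> \<bar>1 / sqrt (k n) * (\<tau> n w * Y n w)\<bar>" if kN: "0 < k n" "k n < N n" for n w
  proof -
    let ?K = "real (k n)"
    let ?G = "\<Sum>l=1..N n. max 0 (e (X l w) - threshold n)"
    let ?T = "real (card {l \<in> {1..N n}. e (X l w) \<ge> threshold n})"
    have K: "?K > 0" using kN by simp
    have top: "\<bar>?K * exp_hill n w - (?G - ?K * top_excess n w)\<bar> \<le> \<bar>top_excess n w\<bar> * \<bar>?T - ?K\<bar>"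
      using top_sum_threshold[OF kN(2), of "\<lambda>i. e (X i w)" "threshold n"] K
      by (simp add: exp_hill_def top_excess_def)
    have T: "?T = ?K * tail_count n 0 w" using K by (simp add: tail_count_def)
    have es: "excess_sum n w = (?G - ?T) / sqrt ?K"
    proof -
      have "?T = (\<Sum>l=1..N n. of_bool (e (X l w) - threshold n \<ge> 0))"
        by (simp add: Int_def)
      then show ?thesis unfolding excess_sum_def centred_excess_def sum_distrib_left[symmetric] sum_subtractf
        by (simp only:) (simp add: field_simps)
    qed
    have "r n w = (?K * exp_hill n w - (?G - ?K * top_excess n w)) / sqrt ?K"
    proof -
      have alg: "q * (H - 1) - (G - q * q * T) / q - (q * (T - 1) - q * t) = (q * q * H - (G - q * q * t)) / q"
        if "q > 0" for q H G T t :: real using that by (simp add: field_simps)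
      have "sqrt ?K * sqrt ?K = ?K" using K by simp
      then show ?thesis
        unfolding r_def es \<tau>_def Y_def T using alg[of "sqrt ?K" "exp_hill n w" "?G" "tail_count n 0 w" "top_excess n w"] K by simp
    qed
    then have "\<bar>r n w\<bar> \<le> \<bar>top_excess n w\<bar> * \<bar>?T - ?K\<bar> / sqrt ?K"
      using top by (simp add: divide_right_mono)
    also have "\<dots> = \<bar>1 / sqrt ?K * (\<tau> n w * Y n w)\<bar>"
    proof -
      have "\<bar>?T - ?K\<bar> = ?K * \<bar>tail_count n 0 w - 1\<bar>"
        unfolding T using K abs_mult[of ?K "tail_count n 0 w - 1"] by (simp add: right_diff_distrib)
      moreover have "?K / sqrt ?K = sqrt ?K" using K by (simp add: real_div_sqrt)
      moreover have "\<bar>t\<bar> * (?K * \<bar>b\<bar>) / sqrt ?K = \<bar>t\<bar> * (?K / sqrt ?K) * \<bar>b\<bar>" for t b by simp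
      ultimately show ?thesis unfolding \<tau>_def Y_def using K by (simp only:) (simp add: abs_mult)
    qed
    finally show ?thesis .
  qed
  have "((\<lambda>x. r (fst x) (snd x)) \<longlongrightarrow> 0) (whp M)"
    by (rule Lim_null_comparison[OF _ small])
      (use eventually_whp_fst[OF k_less_N] bound in \<open>auto elim!: eventually_mono\<close>)
  from tendsto_diff[OF this \<tau>Y] show ?thesis by (simp add: r_def algebra_simps)
qed

text \<open>Law of large numbers at the level exceeded with probability k y / N. It locates the
  observations whose rank from the top is of order k.\<close>

lemma tail_count_scaled_tendsto:
  assumes y: "y > 0"
  shows "((\<lambda>x. real (card {i \<in> {1..N (fst x)}. e (X i (snd x)) \<ge> ln (real (N (fst x)) / (real (k (fst x)) * y))}) / k (fst x)) \<longlongrightarrow> y) (whp M)"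
proof -
  define B where "B n x \<longleftrightarrow> e x \<ge> ln (real (N n) / (real (k n) * y))" for n x
  have Bm: "Measurable.pred borel (B n)" for n unfolding B_def by measurable
  have p: "\<forall>\<^sub>F n in sequentially. N n * prob {w \<in> space M. B n (X\<^sub>0 w)} = k n * y"
    using k_less_N frac_at_top[unfolded filterlim_at_top_dense, rule_format, of y]
  proof eventually_elim
    case (elim n)
    then have "real (N n) / (real (k n) * y) > 1" using y by (simp add: field_simps)
    then have "prob {w \<in> space M. B n (X\<^sub>0 w)} = exp (- ln (real (N n) / (real (k n) * y)))"
      unfolding B_def by (intro exponential_tail[OF e_distr]) simp
    also have "\<dots> = real (k n) * y / real (N n)" using elim y by (simp add: exp_minus)
    finally show ?case using elim by simp
  qed
  have "((\<lambda>x. 1 / real (k (fst x)) * real (card {i \<in> {1..N (fst x)}. B (fst x) (X i (snd x))})) \<longlongrightarrow> y) (whp M)"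
  proof (rule scaled_count_tendsto[OF Bm])
    show "(\<lambda>n. 1 / real (k n) * (N n * prob {w \<in> space M. B n (X\<^sub>0 w)})) \<longlonglongrightarrow> y"
      by (rule tendsto_eventually) (use p k_less_N in \<open>eventually_elim, simp\<close>)
    have "(\<lambda>n. y / real (k n)) \<longlonglongrightarrow> 0"
      by (rule real_tendsto_divide_at_top[OF tendsto_const k_real_lim])
    then show "(\<lambda>n. (1 / real (k n))\<^sup>2 * (N n * prob {w \<in> space M. B n (X\<^sub>0 w)})) \<longlonglongrightarrow> 0"
      by (rule Lim_transform_eventually)
        (use p k_less_N in \<open>eventually_elim, simp add: power2_eq_square\<close>)
  qed
  then show ?thesis by (simp add: B_def)
qed

end

section \<open>The model\<close>

text \<open>For 0 < v < 1 the sublevel set is a half line [a, \<infinity>), and continuity forces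
  the value \<open>v\<close> at its endpoint, however flat the function is to the right of
  it.\<close>

lemma (in real_distribution) measure_survival_le:
  assumes cont: "continuous_on UNIV (cdf M)" and v: "0 \<le> v" "v \<le> 1"
  shows "measure M {x. survival M x \<le> v} = v"
proof -
  have meas: "{x. survival M x \<le> v} \<in> sets M" for v
  proof -
    have "closed {x. survival M x \<le> v}" unfolding survival_def
      by (intro closed_Collect_le continuous_intros cont)
    then show ?thesis by simp
  qed
  have main: "measure M {x. survival M x \<le> v} = v" if v: "0 < v" "v < 1" for v
  proof -
    let ?S = "{x. survival M x \<le> v}"
    have bdd: "bdd_below ?S" by (rule survival_le_bdd_below[OF v(2)])
    have ne: "?S \<noteq> {}" using survival_le_ex[OF v(1)] by auto
    have closed: "closed ?S" unfolding survival_def by (intro closed_Collect_le continuous_intros cont)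
    define a where "a = Inf ?S"
    have "a \<in> ?S" unfolding a_def by (rule closed_contains_Inf[OF ne bdd closed])
    then have le: "survival M a \<le> v" by simp
    have S: "?S = {a..}"
    proof (intro equalityI subsetI)
      fix x assume "x \<in> ?S" then show "x \<in> {a..}" unfolding a_def using cInf_lower[OF _ bdd] by auto
    next
      fix x assume "x \<in> {a..}" then show "x \<in> ?S" using survival_antimono[of a x] le by auto
    qed
    have ic: "isCont (cdf M) a" using cont by (simp add: continuous_on_eq_continuous_at)
    have ge: "survival M a \<ge> v"
    proof (rule tendsto_lowerbound)
      have "(cdf M \<longlongrightarrow> cdf M a) (at_left a)"
        using ic[unfolded isCont_def] by (rule tendsto_within_subset) simp
      then show "((\<lambda>x. survival M x) \<longlongrightarrow> survival M a) (at_left a)"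
        unfolding survival_def by (intro tendsto_intros)
      show "\<forall>\<^sub>F x in at_left a. v \<le> survival M x"
        unfolding eventually_at_filter
      proof (intro always_eventually allI impI)
        fix x assume "x \<in> {..<a}"
        then have "x \<notin> ?S" unfolding S by simp
        then show "v \<le> survival M x" by simp
      qed
    qed simp
    have "measure M ({..<a} \<union> {a}) = measure M {..<a} + measure M {a}"
      by (rule finite_measure_Union) auto
    moreover have "measure M {a} = 0" using ic by (simp add: isCont_cdf)
    moreover have "{..<a} \<union> {a} = {..a}" by auto
    moreover have "measure M (space M - {..<a}) = 1 - measure M {..<a}" by (rule prob_compl) simp
    moreover have "space M - {..<a} = {a..}" by auto
    ultimately have "measure M {a..} = survival M a" by (simp add: survival_def cdf_def)
    then show ?thesis using le ge S by simp
  qed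
  consider "v = 0" | "0 < v \<and> v < 1" | "v = 1" using v by linarith
  then show ?thesis
  proof cases
    case 1
    \<comment> \<open>The survival function may have no zero, so there is no endpoint to work with;
      the set is squeezed inside sublevel sets of small positive level.\<close>
    have "measure M {x. survival M x \<le> 0} \<le> 0"
    proof (rule field_le_epsilon)
      fix d :: real assume d: "d > 0"
      define d' where "d' = min d (1/2)"
      have d': "0 < d'" "d' < 1" "d' \<le> d" using d by (auto simp: d'_def)
      have "measure M {x. survival M x \<le> 0} \<le> measure M {x. survival M x \<le> d'}"
        using d' by (intro finite_measure_mono meas) auto
      also have "\<dots> = d'" using d' by (intro main)
      finally show "measure M {x. survival M x \<le> 0} \<le> 0 + d" using d' by simp
    qed
    then show ?thesis using 1 measure_nonneg[of M "{x. survival M x \<le> 0}"] by simp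
  next
    case 3
    have "{x. survival M x \<le> 1} = space M" using survival_bounds(2) by auto
    then show ?thesis using 3 prob_space by simp
  qed (use main in simp)
qed

lemma (in real_distribution) measure_survival_less:
  assumes cont: "continuous_on UNIV (cdf M)" and v: "0 < v" "v \<le> 1"
  shows "measure M {x. survival M x < v} = v"
proof -
  have cs: "continuous_on UNIV (survival M)" unfolding survival_def[abs_def] by (intro continuous_intros cont)
  have m1: "{x. survival M x < v} \<in> sets M"
    using open_Collect_less[OF cs continuous_on_const[of _ v]] by simp
  have m2: "{x. survival M x \<le> v} \<in> sets M"
    using closed_Collect_le[OF cs continuous_on_const[of _ v]] by simp
  have "measure M {x. survival M x < v} \<le> measure M {x. survival M x \<le> v}"
    by (rule finite_measure_mono[OF _ m2]) auto
  then have 1: "measure M {x. survival M x < v} \<le> v" using measure_survival_le[OF cont, of v] v by simp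
  have "v \<le> measure M {x. survival M x < v}"
  proof (rule field_le_epsilon)
    fix d :: real assume d: "d > 0"
    define d' where "d' = min d v"
    have d': "0 < d'" "d' \<le> v" "d' \<le> d" using d v by (auto simp: d'_def)
    have "v - d' = measure M {x. survival M x \<le> v - d'}"
      using measure_survival_le[OF cont, of "v - d'"] d' v by simp
    also have "\<dots> \<le> measure M {x. survival M x < v}"
      using d' by (intro finite_measure_mono m1) auto
    finally show "v \<le> measure M {x. survival M x < v} + d" using d' by simp
  qed
  with 1 show ?thesis by simp
qed

text \<open>Hill's estimator only depends on the top order statistics, all beyond the point from which the
  logarithm of the data is an affine function of \<open>E\<close> up to an exponentially small error.\<close>

lemma hill_close:
  fixes E :: "real \<Rightarrow> real"
  assumes mono: "mono E" and kn: "0 < k" "k < n" and r: "r < 0" and K: "K > 0"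
    and exp: "\<And>z. E z \<ge> e0 \<Longrightarrow> z > 0" "\<And>z. E z \<ge> e0 \<Longrightarrow> \<bar>ln z - g * E z - C\<bar> \<le> K * exp (r * E z)"
    and top: "order_stat (\<lambda>i. E (x i)) n (n - k) \<ge> e0"
  shows "\<bar>hill x n k - g * ((\<Sum>i=1..k. order_stat (\<lambda>i. E (x i)) n (n - i + 1) - order_stat (\<lambda>i. E (x i)) n (n - k)) / k)\<bar>
    \<le> 2 * K * exp (r * order_stat (\<lambda>i. E (x i)) n (n - k))"
proof -
  let ?t = "order_stat x n (n - k)"
  let ?s = "\<lambda>i. order_stat x n (n - i + 1)"
  let ?d = "2 * K * exp (r * E ?t)"
  have Et: "order_stat (\<lambda>i. E (x i)) n (n - k) = E ?t" using kn by (intro order_stat_comp_mono mono) auto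
  have Es: "order_stat (\<lambda>i. E (x i)) n (n - i + 1) = E (?s i)" if "i \<in> {1..k}" for i
    using kn that by (intro order_stat_comp_mono mono) auto
  have t: "E ?t \<ge> e0" using top Et by simp
  \<comment> \<open>In the logarithm of the ratio the constant \<open>C\<close> cancels. As r < 0,
    the expansion error at a higher order statistic is at most that at the lowest one, whence the
    factor 2.\<close>
  have term_le: "\<bar>ln (?s i / ?t) - g * (E (?s i) - E ?t)\<bar> \<le> ?d" if i: "i \<in> {1..k}" for i
  proof -
    have "?t \<le> ?s i" using i kn by (intro order_stat_mono) auto
    then have le: "E ?t \<le> E (?s i)" by (rule monoD[OF mono])
    then have s: "E (?s i) \<ge> e0" using t by simp
    have "exp (r * E (?s i)) \<le> exp (r * E ?t)" using le r by (simp add: mult_left_mono_neg)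
    then have "K * exp (r * E (?s i)) \<le> K * exp (r * E ?t)" using K by simp
    then have "\<bar>ln (?s i) - g * E (?s i) - C\<bar> \<le> K * exp (r * E ?t)" using exp(2)[OF s] by simp
    moreover have "\<bar>ln ?t - g * E ?t - C\<bar> \<le> K * exp (r * E ?t)" by (rule exp(2)[OF t])
    moreover have "ln (?s i / ?t) = ln (?s i) - ln ?t" using exp(1)[OF s] exp(1)[OF t] by (simp add: ln_div)
    ultimately show ?thesis unfolding abs_le_iff right_diff_distrib by linarith
  qed
  have eq: "hill x n k - g * ((\<Sum>i=1..k. E (?s i) - E ?t) / k) = (\<Sum>i=1..k. ln (?s i / ?t) - g * (E (?s i) - E ?t)) / k"
  proof -
    have "(\<Sum>i=1..k. ln (?s i / ?t) - g * (E (?s i) - E ?t)) = (\<Sum>i=1..k. ln (?s i / ?t)) - g * (\<Sum>i=1..k. E (?s i) - E ?t)"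
      unfolding sum_distrib_left by (rule sum_subtractf)
    then show ?thesis unfolding hill_def by (simp only: diff_divide_distrib times_divide_eq_left times_divide_eq_right mult_1_left)
  qed
  have "\<bar>hill x n k - g * ((\<Sum>i=1..k. E (?s i) - E ?t) / k)\<bar> \<le> (\<Sum>i=1..k. \<bar>ln (?s i / ?t) - g * (E (?s i) - E ?t)\<bar>) / k"
    unfolding eq abs_divide abs_of_nat by (rule divide_right_mono[OF sum_abs]) simp
  also have "\<dots> \<le> (\<Sum>i=1..k. ?d) / k"
  proof (rule divide_right_mono)
    show "(\<Sum>i=1..k. \<bar>ln (?s i / ?t) - g * (E (?s i) - E ?t)\<bar>) \<le> (\<Sum>i=1..k. ?d)"
      by (rule sum_mono) (rule term_le)
  qed (rule of_nat_0_le_iff)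
  also have "\<dots> = ?d" unfolding sum_constant card_atLeastAtMost using kn(1) by simp
  finally have "\<bar>hill x n k - g * ((\<Sum>i=1..k. E (?s i) - E ?t) / k)\<bar> \<le> ?d" .
  moreover have "(\<Sum>i=1..k. order_stat (\<lambda>i. E (x i)) n (n - i + 1) - order_stat (\<lambda>i. E (x i)) n (n - k)) = (\<Sum>i=1..k. E (?s i) - E ?t)"
    by (rule sum.cong[OF refl]) (simp only: Es Et)
  ultimately show ?thesis unfolding Et by simp
qed

locale tail_model = iid_copies M X\<^sub>0 X
  for M :: "'a measure" and X\<^sub>0 :: "'a \<Rightarrow> ('m :: {finite, linorder}) rvec" and X +
  fixes N k :: "nat \<Rightarrow> 'm \<Rightarrow> nat"
    and \<gamma> \<rho> \<beta> b c :: "'m rvec"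
    and A :: "'m \<Rightarrow> real \<Rightarrow> real"
    and R :: "'m \<Rightarrow> 'm \<Rightarrow> ennreal \<Rightarrow> ennreal \<Rightarrow> real"
  assumes F_cont: "\<And>j. continuous_on UNIV (cdf (marginal M X\<^sub>0 j))"
    and N_lim: "\<And>j. filterlim (\<lambda>n. N n j) at_top sequentially"
    and C2: "condition_C2 M X\<^sub>0 \<gamma> \<rho> A"
    and J: "condition_J M X\<^sub>0 R"
    and \<rho>_neg: "\<And>j. \<rho> $ j < 0"
    and A_eq: "\<And>j t. t > 0 \<Longrightarrow> A j t = \<gamma> $ j * \<beta> $ j * t powr (\<rho> $ j)"
    and N_mono: "\<And>n. mono (N n)"
    and k_lim: "\<And>j. filterlim (\<lambda>n. k n j) at_top sequentially"
    and k_frac: "\<And>j. (\<lambda>n. real (k n j) / real (N n j)) \<longlonglongrightarrow> 0"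
    and b_range: "\<And>j. 0 < b $ j \<and> b $ j \<le> 1"
    and b_lim: "\<And>j. (\<lambda>n. real (N n (Min UNIV)) / real (N n j)) \<longlonglongrightarrow> b $ j"
    and c_range: "\<And>j. 0 < c $ j"
    and c_lim: "\<And>j. (\<lambda>n. real (k n (Min UNIV)) / real (k n j)) \<longlonglongrightarrow> c $ j"
    and bias: "\<And>j. (\<lambda>n. sqrt (real (k n j)) * A j (real (N n j) / real (k n j))) \<longlonglongrightarrow> 0"
    and V: "pos_def (V_mat \<gamma> b c R)"
begin

abbreviation surv :: "'m \<Rightarrow> real \<Rightarrow> real" where
  "surv j \<equiv> survival (marginal M X\<^sub>0 j)"

definition expo :: "'m \<Rightarrow> 'm rvec \<Rightarrow> real" where
  "expo j v = - ln (surv j (v $ j))"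

lemma component_measurable [measurable]: "(\<lambda>v. v $ j) \<in> borel_measurable (borel :: 'm rvec measure)"
  by (intro borel_measurable_continuous_onI continuous_intros)

lemma X0_component_measurable [measurable]: "(\<lambda>w. X\<^sub>0 w $ j) \<in> borel_measurable M"
  by measurable

lemma real_distribution_marginal: "real_distribution (marginal M X\<^sub>0 j)"
  unfolding marginal_def by (rule real_distribution_distr) measurable

lemma surv_continuous: "continuous_on UNIV (surv j)"
  unfolding survival_def[abs_def] by (intro continuous_intros F_cont)

lemma surv_measurable [measurable]: "surv j \<in> borel_measurable borel"
  by (rule borel_measurable_continuous_onI[OF surv_continuous])

lemma expo_measurable [measurable]: "expo j \<in> borel_measurable borel"
  unfolding expo_def[abs_def] by measurable

lemma tail_expansion:
  obtains C K v0 where "0 < v0" "v0 < 1" "K > 0" "\<And>x. surv j x > 0"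
    "\<And>x. surv j x \<le> v0 \<Longrightarrow> x > 0"
    "\<And>x. surv j x \<le> v0 \<Longrightarrow> \<bar>ln x - \<gamma> $ j * (- ln (surv j x)) - C\<bar> \<le> K * exp (\<rho> $ j * (- ln (surv j x)))"
proof -
  have "second_order (tail_quantile (marginal M X\<^sub>0 j)) (\<gamma> $ j) (\<rho> $ j) (A j)"
    using C2 by (simp add: condition_C2_def)
  from real_distribution.ln_survival_expansion[OF real_distribution_marginal this \<rho>_neg A_eq] that show thesis by metis
qed

lemma surv_pos: "surv j x > 0"
  by (rule tail_expansion[of j]) blast

lemma expo_ge_iff: "expo j v \<ge> s \<longleftrightarrow> surv j (v $ j) \<le> exp (- s)"
  unfolding expo_def using surv_pos[of j "v $ j"] by (metis exp_le_cancel_iff exp_ln exp_minus le_minus_iff neg_le_iff_le minus_minus)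

lemma prob_surv_le:
  assumes "0 \<le> v" "v \<le> 1"
  shows "prob {w \<in> space M. surv j (X\<^sub>0 w $ j) \<le> v} = v"
proof -
  have "v = measure (marginal M X\<^sub>0 j) {x. surv j x \<le> v}"
    by (rule real_distribution.measure_survival_le[OF real_distribution_marginal F_cont assms, symmetric])
  also have "\<dots> = measure (distr M borel (\<lambda>w. X\<^sub>0 w $ j)) {x. surv j x \<le> v}" by (simp only: marginal_def)
  also have "\<dots> = prob ((\<lambda>w. X\<^sub>0 w $ j) -` {x. surv j x \<le> v} \<inter> space M)"
    by (rule measure_distr) auto
  also have "(\<lambda>w. X\<^sub>0 w $ j) -` {x. surv j x \<le> v} \<inter> space M = {w \<in> space M. surv j (X\<^sub>0 w $ j) \<le> v}" by auto
  finally show ?thesis ..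
qed

lemma expo_distributed: "distributed M lborel (\<lambda>w. expo j (X\<^sub>0 w)) (exponential_density 1)"
proof (subst exponential_distributed_iff[OF zero_less_one], intro conjI allI impI)
  show "(\<lambda>w. expo j (X\<^sub>0 w)) \<in> borel_measurable M" by measurable
  fix a :: real assume a: "0 \<le> a"
  have "exp (- a) = measure (marginal M X\<^sub>0 j) {x. surv j x < exp (- a)}"
    by (rule real_distribution.measure_survival_less[OF real_distribution_marginal F_cont, symmetric]) (use a in auto)
  also have "\<dots> = measure (distr M borel (\<lambda>w. X\<^sub>0 w $ j)) {x. surv j x < exp (- a)}" by (simp only: marginal_def)
  also have "\<dots> = prob ((\<lambda>w. X\<^sub>0 w $ j) -` {x. surv j x < exp (- a)} \<inter> space M)"
    by (rule measure_distr) auto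
  also have "(\<lambda>w. X\<^sub>0 w $ j) -` {x. surv j x < exp (- a)} \<inter> space M = space M - {w \<in> space M. expo j (X\<^sub>0 w) \<le> a}"
  proof -
    have "surv j x < exp (- a) \<longleftrightarrow> \<not> - ln (surv j x) \<le> a" for x
      using surv_pos[of j x] ln_less_cancel_iff[of "surv j x" "exp (- a)"] by auto
    then show ?thesis by (auto simp: expo_def)
  qed
  also have "prob \<dots> = 1 - prob {w \<in> space M. expo j (X\<^sub>0 w) \<le> a}" by (rule prob_compl) measurable
  finally show "prob {w \<in> space M. expo j (X\<^sub>0 w) \<le> a} = 1 - exp (- a * 1)" by simp
qed

end

sublocale tail_model \<subseteq> margin: exp_sample M X\<^sub>0 X "expo j" "\<lambda>n. N n j" "\<lambda>n. k n j" for j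
  by unfold_locales (use expo_distributed N_lim k_lim k_frac in auto)

context tail_model
begin

text \<open>The expansion error is of order exp (\<rho> E) at the random threshold, which differs
  from the deterministic one by a vanishing amount. At the latter it equals (N / k)^\<rho>, a
  constant multiple of A (N / k), and the bias condition makes it negligible against 1 / sqrt
  k.\<close>

lemma hill_linearised:
  "((\<lambda>x. sqrt (k (fst x) j) * (hill_vec (\<lambda>i. X i (snd x)) (N (fst x)) (k (fst x)) $ j - \<gamma> $ j) - \<gamma> $ j * margin.excess_sum j (fst x) (snd x)) \<longlongrightarrow> 0) (whp M)"
proof -
  obtain C K v0 where v0: "0 < v0" "v0 < 1" and K: "K > 0"
    and pos: "\<And>x. surv j x \<le> v0 \<Longrightarrow> x > 0"
    and ex: "\<And>x. surv j x \<le> v0 \<Longrightarrow> \<bar>ln x - \<gamma> $ j * (- ln (surv j x)) - C\<bar> \<le> K * exp (\<rho> $ j * (- ln (surv j x)))"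
    using tail_expansion[of j] by metis
  define E where "E x = - ln (surv j x)" for x
  define e0 where "e0 = - ln v0"
  have mono: "mono E"
  proof (rule monoI)
    fix x y :: real assume "x \<le> y"
      have "surv j y \<le> surv j x" by (rule real_distribution.survival_antimono[OF real_distribution_marginal]) fact
    then show "E x \<le> E y" using surv_pos[of j y] unfolding E_def by simp
  qed
  have Ee: "surv j z \<le> v0" if "E z \<ge> e0" for z
    using that surv_pos[of j z] v0 unfolding E_def e0_def by simp
  have eE: "expo j (X i w) = E (X i w $ j)" for i w by (simp add: expo_def E_def)
  define H where "H n w = hill (\<lambda>i. X i w $ j) (N n j) (k n j)" for n w
  define d where "d n w = 2 * K * exp (\<rho> $ j * (margin.threshold j n + margin.top_excess j n w))" for n w
  have close: "\<bar>H n w - \<gamma> $ j * margin.exp_hill j n w\<bar> \<le> d n w"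
    if "0 < k n j" "k n j < N n j" "margin.threshold j n + margin.top_excess j n w \<ge> e0" for n w
    using hill_close[of E "k n j" "N n j" "\<rho> $ j" K e0 "\<gamma> $ j" C "\<lambda>i. X i w $ j", OF mono that(1,2) \<rho>_neg K] pos ex Ee that
    unfolding H_def d_def margin.exp_hill_def margin.top_excess_def eE by (simp add: E_def)
  have te: "((\<lambda>x. margin.top_excess j (fst x) (snd x)) \<longlongrightarrow> 0) (whp M)" by (rule margin.top_excess_tendsto)
  have ev: "\<forall>\<^sub>F x in whp M. margin.threshold j (fst x) + margin.top_excess j (fst x) (snd x) \<ge> e0"
  proof -
    have "\<forall>\<^sub>F x in whp M. margin.top_excess j (fst x) (snd x) > -1" using te by (rule order_tendstoD) simp
    moreover have "\<forall>\<^sub>F x in whp M. margin.threshold j (fst x) > e0 + 1"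
      by (rule eventually_whp_fst) (use margin.threshold_lim in \<open>simp add: filterlim_at_top_dense\<close>)
    ultimately show ?thesis by eventually_elim simp
  qed
  \<comment> \<open>\<open>A\<close> has a constant nonzero sign, so its leading coefficient can be
    divided out of the bias condition.\<close>
  have gb: "\<gamma> $ j * \<beta> $ j \<noteq> 0"
  proof -
    have "second_order (tail_quantile (marginal M X\<^sub>0 j)) (\<gamma> $ j) (\<rho> $ j) (A j)"
      using C2 unfolding condition_C2_def by blast
    then have "(\<forall>t>0. A j t > 0) \<or> (\<forall>t>0. A j t < 0)"
      unfolding second_order_def by (elim conjE)
    then have "A j 1 > 0 \<or> A j 1 < 0" using zero_less_one by blast
    then show ?thesis using A_eq[of 1 j] by auto
  qed
  have det: "(\<lambda>n. sqrt (k n j) * exp (\<rho> $ j * margin.threshold j n)) \<longlonglongrightarrow> 0"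
  proof -
    have "(\<lambda>n. inverse (\<gamma> $ j * \<beta> $ j) * (sqrt (real (k n j)) * A j (real (N n j) / real (k n j)))) \<longlonglongrightarrow> inverse (\<gamma> $ j * \<beta> $ j) * 0"
      by (intro tendsto_mult_left bias)
    then have "(\<lambda>n. inverse (\<gamma> $ j * \<beta> $ j) * (sqrt (real (k n j)) * A j (real (N n j) / real (k n j)))) \<longlonglongrightarrow> 0" by simp
    then show ?thesis
    proof (rule Lim_transform_eventually)
      show "\<forall>\<^sub>F n in sequentially. inverse (\<gamma> $ j * \<beta> $ j) * (sqrt (real (k n j)) * A j (real (N n j) / real (k n j))) =
          sqrt (k n j) * exp (\<rho> $ j * margin.threshold j n)"
        using margin.k_less_N[of j] margin.threshold_eq[of j]
      proof eventually_elim
        case (elim n)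
        then have q: "real (N n j) / real (k n j) > 0" by simp
        have "margin.threshold j n = ln (real (N n j) / real (k n j))" using elim by simp
        then have "exp (\<rho> $ j * margin.threshold j n) = (real (N n j) / real (k n j)) powr (\<rho> $ j)"
          using elim by (simp add: powr_def)
        then show ?case using A_eq[OF q, of j] gb by (simp add: field_simps)
      qed
    qed
  qed
  have sd: "((\<lambda>x. sqrt (k (fst x) j) * d (fst x) (snd x)) \<longlongrightarrow> 0) (whp M)"
  proof -
    have "((\<lambda>x. (sqrt (k (fst x) j) * exp (\<rho> $ j * margin.threshold j (fst x))) * (2 * K * exp (\<rho> $ j * margin.top_excess j (fst x) (snd x)))) \<longlongrightarrow> 0 * (2 * K * exp (\<rho> $ j * 0))) (whp M)"
      by (intro tendsto_intros te tendsto_whp_fst[OF det])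
    then show ?thesis by (simp add: d_def distrib_left exp_add mult_ac)
  qed
  have "((\<lambda>x. sqrt (k (fst x) j) * (H (fst x) (snd x) - \<gamma> $ j * margin.exp_hill j (fst x) (snd x))) \<longlongrightarrow> 0) (whp M)"
  proof (rule Lim_null_comparison[OF _ sd])
    show "\<forall>\<^sub>F x in whp M. norm (sqrt (k (fst x) j) * (H (fst x) (snd x) - \<gamma> $ j * margin.exp_hill j (fst x) (snd x))) \<le> sqrt (k (fst x) j) * d (fst x) (snd x)"
      using ev eventually_whp_fst[OF margin.k_less_N[of j]]
    proof eventually_elim
      case (elim x)
      then have "\<bar>H (fst x) (snd x) - \<gamma> $ j * margin.exp_hill j (fst x) (snd x)\<bar> \<le> d (fst x) (snd x)"
        by (intro close) auto
      then show ?case by (simp add: abs_mult mult_left_mono)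
    qed
  qed
  moreover have "((\<lambda>x. \<gamma> $ j * (sqrt (k (fst x) j) * (margin.exp_hill j (fst x) (snd x) - 1) - margin.excess_sum j (fst x) (snd x))) \<longlongrightarrow> \<gamma> $ j * 0) (whp M)"
    by (intro tendsto_mult_left margin.exp_hill_linearised)
  ultimately have "((\<lambda>x. sqrt (k (fst x) j) * (H (fst x) (snd x) - \<gamma> $ j * margin.exp_hill j (fst x) (snd x)) +
      \<gamma> $ j * (sqrt (k (fst x) j) * (margin.exp_hill j (fst x) (snd x) - 1) - margin.excess_sum j (fst x) (snd x))) \<longlongrightarrow> 0 + \<gamma> $ j * 0) (whp M)"
    by (rule tendsto_add)
  then show ?thesis by (simp add: H_def hill_vec_def algebra_simps)
qed

end

section \<open>Tail copula\<close>

text \<open>If \<open>e\<close> reaches the level belonging to (1 - d) u, then so does every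
  observation with larger \<open>x\<close>, and fewer than about k u observations do. If it misses
  the level belonging to (1 + d) u, more than about k u observations have larger \<open>x\<close>.
  Only two counts are involved, hence uniformity in \<open>i\<close>; \<open>mono\<close> tolerates
  larger \<open>x\<close> with equal \<open>e\<close>.\<close>

lemma (in exp_sample) rank_sandwich:
  fixes x :: "'b \<Rightarrow> real" and u :: real
  assumes mono: "\<forall>v v'. e v > e v' \<longrightarrow> x v > x v'"
    and u: "u > 0" "un \<longlonglongrightarrow> u" and d: "0 < d" "d < 1"
  shows "\<forall>\<^sub>F z in whp M. \<forall>i\<in>{1..N (fst z)}.
    (e (X i (snd z)) \<ge> ln (real (N (fst z)) / (real (k (fst z)) * ((1 - d) * u))) \<longrightarrow>
      (real (N (fst z)) + 1 - real (rank_of (\<lambda>i. x (X i (snd z))) (N (fst z)) i)) /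
        (real (k (fst z)) * (real (N (fst z)) + 1) / real (N (fst z))) \<le> un (fst z)) \<and>
    ((real (N (fst z)) + 1 - real (rank_of (\<lambda>i. x (X i (snd z))) (N (fst z)) i)) /
        (real (k (fst z)) * (real (N (fst z)) + 1) / real (N (fst z))) \<le> un (fst z) \<longrightarrow>
      e (X i (snd z)) \<ge> ln (real (N (fst z)) / (real (k (fst z)) * ((1 + d) * u))))"
proof -
  define cnt where "cnt y n w = real (card {i \<in> {1..N n}. e (X i w) \<ge> ln (real (N n) / (real (k n) * y))}) / real (k n)" for y n w
  have lo: "(1 - d) * u > 0" and hi: "(1 + d) * u > 0" using u d by auto
  have p: "(\<lambda>n. un n * (real (N n) + 1) / real (N n)) \<longlonglongrightarrow> u"
  proof -
    have r: "filterlim (\<lambda>n. real (N n)) at_top sequentially"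
      by (rule filterlim_compose[OF filterlim_real_sequentially N_lim])
    have "((\<lambda>z. (z + 1) / z) \<longlongrightarrow> 1) (at_top :: real filter)" by real_asymp
    from filterlim_compose[OF this r] have "(\<lambda>n. (real (N n) + 1) / real (N n)) \<longlonglongrightarrow> 1" .
    from tendsto_mult[OF u(2) this] show ?thesis by simp
  qed
  have "\<forall>\<^sub>F z in whp M. cnt ((1 - d) * u) (fst z) (snd z) < (1 - d / 2) * u"
    unfolding cnt_def by (rule order_tendstoD(2)[OF tail_count_scaled_tendsto[OF lo]]) (use u d in simp)
  moreover have "\<forall>\<^sub>F z in whp M. cnt ((1 + d) * u) (fst z) (snd z) > (1 + d / 2) * u"
    unfolding cnt_def by (rule order_tendstoD(1)[OF tail_count_scaled_tendsto[OF hi]]) (use u d in simp)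
  moreover have "\<forall>\<^sub>F z in whp M. un (fst z) * (real (N (fst z)) + 1) / real (N (fst z)) > (1 - d / 2) * u"
    by (rule order_tendstoD(1)[OF tendsto_whp_fst[OF p]]) (use u d in simp)
  moreover have "\<forall>\<^sub>F z in whp M. un (fst z) * (real (N (fst z)) + 1) / real (N (fst z)) < (1 + d / 2) * u"
    by (rule order_tendstoD(2)[OF tendsto_whp_fst[OF p]]) (use u d in simp)
  ultimately show ?thesis using eventually_whp_fst[OF k_less_N]
  proof eventually_elim
    case (elim z)
    obtain n w where z: "z = (n, w)" by (cases z)
    have kN: "0 < k n" "0 < N n" using elim(5) by (auto simp: z)
    define P where "P = un n * (real (N n) + 1) / real (N n)"
    have c1: "cnt ((1 - d) * u) n w < P" and c2: "cnt ((1 + d) * u) n w > P"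
      using elim by (auto simp: z P_def)
    show ?case unfolding z fst_conv snd_conv
    proof (intro ballI conjI impI)
      fix i assume i: "i \<in> {1..N n}"
      \<comment> \<open>As the rank is defined with \<le>, N + 1 minus the rank is the number of
        strictly larger observations plus one.\<close>
      let ?G = "{i' \<in> {1..N n}. x (X i' w) > x (X i w)}"
      let ?top = "real (N n) + 1 - real (rank_of (\<lambda>i. x (X i w)) (N n) i)"
      have "{i' \<in> {1..N n}. x (X i' w) \<le> x (X i w)} = {1..N n} - ?G" by auto
      then have "rank_of (\<lambda>i. x (X i w)) (N n) i = N n - card ?G"
        unfolding rank_of_def using card_Diff_subset[of ?G "{1..N n}"] by fastforce
      moreover have "card ?G \<le> N n"
      proof -
        have "card ?G \<le> card {1..N n}" by (rule card_mono) auto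
        then show ?thesis by simp
      qed
      ultimately have top: "?top = real (card ?G) + 1" by (simp add: of_nat_diff)
      have cond: "?top / (real (k n) * (real (N n) + 1) / real (N n)) \<le> un n \<longleftrightarrow> (real (card ?G) + 1) / real (k n) \<le> P"
      proof -
        have D: "real (k n) * (real (N n) + 1) / real (N n) > 0" using kN by (intro divide_pos_pos mult_pos_pos) auto
        have "un n * (real (k n) * (real (N n) + 1) / real (N n)) = P * real (k n)" by (simp add: P_def)
        then show ?thesis unfolding top pos_divide_le_eq[OF D] using kN by (simp add: pos_divide_le_eq)
      qed
      {
        assume e: "e (X i w) \<ge> ln (real (N n) / (real (k n) * ((1 - d) * u)))"
        let ?B = "{i \<in> {1..N n}. e (X i w) \<ge> ln (real (N n) / (real (k n) * ((1 - d) * u)))}"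
        have "insert i ?G \<subseteq> ?B"
        proof
          fix i' assume "i' \<in> insert i ?G"
          moreover have "e (X i w) > e (X i' w) \<longrightarrow> x (X i w) > x (X i' w)" using mono by blast
          ultimately show "i' \<in> ?B" using i e by (cases "e (X i' w) < e (X i w)") auto
        qed
        from card_mono[OF _ this] have "card ?G + 1 \<le> card ?B" by simp
        then have "(real (card ?G) + 1) / real (k n) \<le> cnt ((1 - d) * u) n w"
          unfolding cnt_def by (intro divide_right_mono) auto
        with c1 show "?top / (real (k n) * (real (N n) + 1) / real (N n)) \<le> un n" unfolding cond by simp
      }
      assume c: "?top / (real (k n) * (real (N n) + 1) / real (N n)) \<le> un n"
      show "e (X i w) \<ge> ln (real (N n) / (real (k n) * ((1 + d) * u)))"
      proof (rule ccontr)
        assume lt: "\<not> ?thesis"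
        let ?B = "{i \<in> {1..N n}. e (X i w) \<ge> ln (real (N n) / (real (k n) * ((1 + d) * u)))}"
        have "?B \<subseteq> ?G" using lt by (auto intro!: mono[rule_format])
        from card_mono[OF _ this] have "card ?B \<le> card ?G" by simp
        then have "cnt ((1 + d) * u) n w \<le> (real (card ?G) + 1) / real (k n)"
          unfolding cnt_def by (intro divide_right_mono) auto
        with c c2 show False unfolding cond by simp
      qed
    qed
  qed
qed

lemma sum_power_le:
  fixes x :: "'i \<Rightarrow> real"
  assumes "finite I" "\<And>i. i \<in> I \<Longrightarrow> 0 \<le> x i" "p > 0"
  shows "(\<Sum>i\<in>I. x i) ^ p \<le> real (card I) ^ p * (\<Sum>i\<in>I. x i ^ p)"
proof (cases "I = {}")
  case True
  then show ?thesis using assms(3) by (simp add: zero_power)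
next
  case False
  define m where "m = Max (x ` I)"
  have "m \<in> x ` I" unfolding m_def using assms False by (intro Max_in) auto
  then obtain i where i: "i \<in> I" "m = x i" by auto
  have "(\<Sum>i\<in>I. x i) \<le> (\<Sum>i\<in>I. m)" unfolding m_def using assms by (intro sum_mono Max_ge) auto
  then have "(\<Sum>i\<in>I. x i) ^ p \<le> (real (card I) * m) ^ p"
    using assms by (intro power_mono) (auto intro: sum_nonneg)
  also have "\<dots> = real (card I) ^ p * x i ^ p" by (simp add: power_mult_distrib i)
  also have "\<dots> \<le> real (card I) ^ p * (\<Sum>i\<in>I. x i ^ p)"
    using assms i by (intro mult_left_mono member_le_sum) auto
  finally show ?thesis .
qed

context tail_model
begin

definition copula :: "'m \<Rightarrow> 'm \<Rightarrow> real \<Rightarrow> real \<Rightarrow> real" where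
  "copula j l u v = prob {w \<in> space M. surv j (X\<^sub>0 w $ j) \<le> u \<and> surv l (X\<^sub>0 w $ l) \<le> v}"

lemma copula_diff_le:
  assumes "0 \<le> u" "u \<le> u'" "u' \<le> 1" "0 \<le> v" "v \<le> v'" "v' \<le> 1"
  shows "0 \<le> copula j l u' v' - copula j l u v" "copula j l u' v' - copula j l u v \<le> (u' - u) + (v' - v)"
proof -
  let ?S = "\<lambda>u v. {w \<in> space M. surv j (X\<^sub>0 w $ j) \<le> u \<and> surv l (X\<^sub>0 w $ l) \<le> v}"
  let ?U = "\<lambda>j u. {w \<in> space M. surv j (X\<^sub>0 w $ j) \<le> u}"
  have "prob (?S u v) \<le> prob (?S u' v')" using assms by (intro finite_measure_mono) auto
  then show "0 \<le> copula j l u' v' - copula j l u v" by (simp add: copula_def)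
  have "prob (?S u' v') \<le> prob (?S u v \<union> ((?U j u' - ?U j u) \<union> (?U l v' - ?U l v)))"
    by (rule finite_measure_mono) auto
  also have "\<dots> \<le> prob (?S u v) + (prob (?U j u' - ?U j u) + prob (?U l v' - ?U l v))"
    by (intro order_trans[OF measure_Un_le] add_mono order_refl measure_Un_le) auto
  also have "prob (?U j u' - ?U j u) = u' - u"
    using assms by (subst finite_measure_Diff) (auto simp: prob_surv_le)
  also have "prob (?U l v' - ?U l v) = v' - v"
    using assms by (subst finite_measure_Diff) (auto simp: prob_surv_le)
  finally show "copula j l u' v' - copula j l u v \<le> (u' - u) + (v' - v)" by (simp add: copula_def)
qed

text \<open>The survival transforms are uniform, so moving one argument changes the probability by
  at most that amount. This extends the pointwise limit in \<open>condition_J\<close> to arguments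
  that vary with n.\<close>

lemma copula_lipschitz:
  assumes "0 \<le> u" "u \<le> 1" "0 \<le> u'" "u' \<le> 1" "0 \<le> v" "v \<le> 1" "0 \<le> v'" "v' \<le> 1"
  shows "\<bar>copula j l u v - copula j l u' v'\<bar> \<le> \<bar>u - u'\<bar> + \<bar>v - v'\<bar>"
proof -
  have a: "\<bar>copula j l u v - copula j l u' v\<bar> \<le> \<bar>u - u'\<bar>"
    using copula_diff_le[of u u' v v j l] copula_diff_le[of u' u v v j l] assms by (cases "u \<le> u'") auto
  have b: "\<bar>copula j l u' v - copula j l u' v'\<bar> \<le> \<bar>v - v'\<bar>"
    using copula_diff_le[of u' u' v v' j l] copula_diff_le[of u' u' v' v j l] assms by (cases "v \<le> v'") auto
  show ?thesis using a b by linarith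
qed

lemma survival_copula_eq:
  assumes "u \<ge> 0" "v \<ge> 0"
  shows "survival_copula M X\<^sub>0 j l (ennreal u) (ennreal v) = copula j l u v"
  unfolding survival_copula_def copula_def using assms by (simp add: ennreal_le_iff)

lemma copula_limit:
  assumes jl: "j \<noteq> l" and x: "x > 0" "xn \<longlonglongrightarrow> x" and y: "y > 0" "yn \<longlonglongrightarrow> y"
    and s: "filterlim s at_top sequentially"
  shows "(\<lambda>n. s n * copula j l (xn n / s n) (yn n / s n)) \<longlonglongrightarrow> R j l (ennreal x) (ennreal y)"
proof -
  have "((\<lambda>s. s * survival_copula M X\<^sub>0 j l (ennreal x / ennreal s) (ennreal y / ennreal s)) \<longlongrightarrow> R j l (ennreal x) (ennreal y)) at_top"
    using J jl unfolding condition_J_def by auto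
  from filterlim_compose[OF this s]
  have 1: "(\<lambda>n. s n * survival_copula M X\<^sub>0 j l (ennreal x / ennreal (s n)) (ennreal y / ennreal (s n))) \<longlonglongrightarrow> R j l (ennreal x) (ennreal y)" .
  have spos: "\<forall>\<^sub>F n in sequentially. s n > c" for c
    using s by (simp add: filterlim_at_top_dense)
  have 2: "(\<lambda>n. s n * copula j l (x / s n) (y / s n)) \<longlonglongrightarrow> R j l (ennreal x) (ennreal y)"
    by (rule Lim_transform_eventually[OF 1])
      (use spos[of 0] in \<open>eventually_elim, use x y in \<open>simp add: divide_ennreal survival_copula_eq\<close>\<close>)
  have 3: "(\<lambda>n. \<bar>xn n - x\<bar> + \<bar>yn n - y\<bar>) \<longlonglongrightarrow> 0"
  proof -
    have "(\<lambda>n. \<bar>xn n - x\<bar> + \<bar>yn n - y\<bar>) \<longlonglongrightarrow> \<bar>x - x\<bar> + \<bar>y - y\<bar>" by (intro tendsto_intros x y)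
    then show ?thesis by simp
  qed
  have "(\<lambda>n. s n * copula j l (xn n / s n) (yn n / s n) - s n * copula j l (x / s n) (y / s n)) \<longlonglongrightarrow> 0"
  proof (rule Lim_null_comparison[OF _ 3])
    have "\<forall>\<^sub>F n in sequentially. 0 < xn n \<and> xn n < x + 1" "\<forall>\<^sub>F n in sequentially. 0 < yn n \<and> yn n < y + 1"
      using x y by (auto intro!: eventually_conj order_tendstoD)
    then show "\<forall>\<^sub>F n in sequentially. norm (s n * copula j l (xn n / s n) (yn n / s n) - s n * copula j l (x / s n) (y / s n)) \<le> \<bar>xn n - x\<bar> + \<bar>yn n - y\<bar>"
      using spos[of "x + y + 1"]
    proof eventually_elim
      case (elim n)
      have sp: "s n > 0" using elim x y by linarith
      have "\<bar>copula j l (xn n / s n) (yn n / s n) - copula j l (x / s n) (y / s n)\<bar> \<le> \<bar>xn n / s n - x / s n\<bar> + \<bar>yn n / s n - y / s n\<bar>"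
        using elim x y sp by (intro copula_lipschitz) (auto simp: divide_le_eq)
      also have "\<dots> = (\<bar>xn n - x\<bar> + \<bar>yn n - y\<bar>) / s n"
        using sp by (simp add: diff_divide_distrib[symmetric] add_divide_distrib)
      finally have "s n * \<bar>copula j l (xn n / s n) (yn n / s n) - copula j l (x / s n) (y / s n)\<bar> \<le> \<bar>xn n - x\<bar> + \<bar>yn n - y\<bar>"
        using sp by (simp add: pos_le_divide_eq mult.commute)
      then show ?case using sp abs_mult[of "s n" "copula j l (xn n / s n) (yn n / s n) - copula j l (x / s n) (y / s n)"]
        by (simp add: right_diff_distrib)
    qed
  qed
  from tendsto_add[OF this 2] show ?thesis by simp
qed

text \<open>Substituting s = r n in the defining limit scales both arguments by r; limits are
  unique.\<close>

lemma R_homogeneous: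
  assumes "j \<noteq> l" "x > 0" "y > 0" "r > 0"
  shows "R j l (ennreal (r * x)) (ennreal (r * y)) = r * R j l (ennreal x) (ennreal y)"
proof (rule LIMSEQ_unique)
  have s: "filterlim (\<lambda>n. r * real n) at_top sequentially"
    using assms(4) by (intro filterlim_tendsto_pos_mult_at_top[OF tendsto_const] filterlim_real_sequentially) auto
  show "(\<lambda>n. (r * real n) * copula j l (r * x / (r * real n)) (r * y / (r * real n))) \<longlonglongrightarrow> R j l (ennreal (r * x)) (ennreal (r * y))"
    using assms by (intro copula_limit s tendsto_const) auto
  have "(\<lambda>n. r * (real n * copula j l (x / real n) (y / real n))) \<longlonglongrightarrow> r * R j l (ennreal x) (ennreal y)"
    using assms by (intro tendsto_mult_left copula_limit filterlim_real_sequentially tendsto_const) auto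
  then show "(\<lambda>n. (r * real n) * copula j l (r * x / (r * real n)) (r * y / (r * real n))) \<longlonglongrightarrow> r * R j l (ennreal x) (ennreal y)"
    using assms(4) by (simp add: mult.assoc)
qed

lemma N_le: "j \<le> l \<Longrightarrow> N n j \<le> N n l"
  using N_mono by (auto simp: mono_def)

lemma k_ratio: "(\<lambda>n. real (k n j) / real (k n l)) \<longlonglongrightarrow> c $ l / c $ j"
proof -
  have "(\<lambda>n. (real (k n (Min UNIV)) / real (k n l)) / (real (k n (Min UNIV)) / real (k n j))) \<longlonglongrightarrow> c $ l / c $ j"
    by (intro tendsto_divide c_lim) (use c_range[of j] in simp)
  then show ?thesis
    by (rule Lim_transform_eventually)
      (use margin.k_less_N[of "Min UNIV"] margin.k_less_N[of j] in \<open>eventually_elim, simp\<close>)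
qed

lemma N_ratio: "(\<lambda>n. real (N n j) / real (N n l)) \<longlonglongrightarrow> b $ l / b $ j"
proof -
  have "(\<lambda>n. (real (N n (Min UNIV)) / real (N n l)) / (real (N n (Min UNIV)) / real (N n j))) \<longlonglongrightarrow> b $ l / b $ j"
    by (intro tendsto_divide b_lim) (use b_range[of j] in simp)
  then show ?thesis
    by (rule Lim_transform_eventually)
      (use margin.k_less_N[of "Min UNIV"] margin.k_less_N[of j] in \<open>eventually_elim, simp\<close>)
qed

lemma expo_less_imp: "\<forall>v v'. expo j v > expo j v' \<longrightarrow> v $ j > v' $ j"
proof (intro allI impI, rule ccontr)
  fix v v' :: "'m rvec"
  assume less: "expo j v > expo j v'" and "\<not> v $ j > v' $ j"
  then have "surv j (v' $ j) \<le> surv j (v $ j)"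
    by (intro real_distribution.survival_antimono[OF real_distribution_marginal]) simp
  then have "expo j v \<le> expo j v'" unfolding expo_def using surv_pos[of j "v' $ j"] by simp
  with less show False by simp
qed

text \<open>By homogeneity of the tail copula it is enough to compare the random thresholds behind the ranks
  with the deterministic ones up to a factor \<open>1 \<plusminus> d\<close>.\<close>

lemma tail_copula_est_tendsto:
  assumes jl: "j < l"
  shows "((\<lambda>z. tail_copula_est (\<lambda>i. X i (snd z)) (N (fst z)) (k (fst z)) j l
      (real (k (fst z) j) / real (k (fst z) l)) (real (N (fst z) j) / real (N (fst z) l)))
    \<longlongrightarrow> R j l (ennreal (c $ l / c $ j)) (ennreal (b $ l / b $ j))) (whp M)"
proof -
  \<comment> \<open>Since j < l, the common sample size is always that of j, but at equal sizes the
    estimator takes the \<open>k\<close> of l. The sequence may switch between the two infinitely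
    often, so its growth and its ratio to N are checked anew.\<close>
  define k' where "k' n = (if N n j < N n l then k n j else k n l)" for n
  define u where "u = c $ l / c $ j" define v where "v = b $ l / b $ j"
  have u: "u > 0" and v: "v > 0" using c_range[of j] c_range[of l] b_range[of j] b_range[of l] by (auto simp: u_def v_def)
  have k'_lim: "filterlim k' at_top sequentially"
    unfolding filterlim_at_top
  proof
    fix Z
    have "\<forall>\<^sub>F n in sequentially. Z \<le> k n j" "\<forall>\<^sub>F n in sequentially. Z \<le> k n l"
      using k_lim[of j] k_lim[of l] by (simp_all add: filterlim_at_top)
    then show "\<forall>\<^sub>F n in sequentially. Z \<le> k' n" by eventually_elim (simp add: k'_def)
  qed
  have k'_frac: "(\<lambda>n. real (k' n) / real (N n j)) \<longlonglongrightarrow> 0"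
  proof (rule Lim_null_comparison)
    show "\<forall>\<^sub>F n in sequentially. norm (real (k' n) / real (N n j)) \<le> real (k n j) / real (N n j) + real (k n l) / real (N n l)"
    proof (rule always_eventually, rule allI)
      fix n
      have "N n j \<le> N n l" using jl by (intro N_le) simp
      then show "norm (real (k' n) / real (N n j)) \<le> real (k n j) / real (N n j) + real (k n l) / real (N n l)"
        by (cases "N n j < N n l") (auto simp: k'_def)
    qed
    show "(\<lambda>n. real (k n j) / real (N n j) + real (k n l) / real (N n l)) \<longlonglongrightarrow> 0"
      using tendsto_add[OF k_frac[of j] k_frac[of l]] by simp
  qed
  \<comment> \<open>Both margins are cut to the first \<open>N n j\<close> vectors and share
    \<open>k'\<close>, so that the two rank conditions become threshold conditions at a common
    scale.\<close>
  interpret J: exp_sample M X\<^sub>0 X "expo j" "\<lambda>n. N n j" k'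
    by unfold_locales (use expo_distributed N_lim k'_lim k'_frac in auto)
  interpret L: exp_sample M X\<^sub>0 X "expo l" "\<lambda>n. N n j" k'
    by unfold_locales (use expo_distributed N_lim k'_lim k'_frac in auto)
  define s where "s n = real (N n j) / real (k' n)" for n
  have s_lim: "filterlim s at_top sequentially" unfolding s_def[abs_def] by (rule J.frac_at_top)
  define B where "B x y n z \<longleftrightarrow> expo j z \<ge> ln (real (N n j) / (real (k' n) * x)) \<and> expo l z \<ge> ln (real (N n j) / (real (k' n) * y))" for x y n z
  have Bm: "Measurable.pred borel (B x y n)" for x y n unfolding B_def by measurable
  define D where "D x y n w = 1 / real (k' n) * real (card {i \<in> {1..N n j}. B x y n (X i w)})" for x y n w
  have D_lim: "((\<lambda>z. D x y (fst z) (snd z)) \<longlongrightarrow> R j l (ennreal x) (ennreal y)) (whp M)" if xy: "x > 0" "y > 0" for x y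
    unfolding D_def
  proof (rule scaled_count_tendsto[OF Bm])
    have pe: "\<forall>\<^sub>F n in sequentially. prob {w \<in> space M. B x y n (X\<^sub>0 w)} = copula j l (x / s n) (y / s n)"
      using J.k_less_N
    proof eventually_elim
      case (elim n)
      have "exp (- ln (real (N n j) / (real (k' n) * x))) = x / s n" if "x > 0" for x
        using that elim by (simp add: s_def exp_minus)
      then show ?case unfolding B_def copula_def expo_ge_iff using xy by simp
    qed
    have lim: "(\<lambda>n. s n * copula j l (x / s n) (y / s n)) \<longlonglongrightarrow> R j l (ennreal x) (ennreal y)"
      using xy jl by (intro copula_limit s_lim tendsto_const) auto
    show "(\<lambda>n. 1 / real (k' n) * (real (N n j) * prob {w \<in> space M. B x y n (X\<^sub>0 w)})) \<longlonglongrightarrow> R j l (ennreal x) (ennreal y)"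
      by (rule Lim_transform_eventually[OF lim]) (use pe in \<open>eventually_elim, simp add: s_def\<close>)
    have inv: "(\<lambda>n. 1 / real (k' n)) \<longlonglongrightarrow> 0"
      by (rule real_tendsto_divide_at_top[OF tendsto_const J.k_real_lim])
    have "(\<lambda>n. 1 / real (k' n) * (s n * copula j l (x / s n) (y / s n))) \<longlonglongrightarrow> 0 * R j l (ennreal x) (ennreal y)"
      by (rule tendsto_mult[OF inv lim])
    then have "(\<lambda>n. 1 / real (k' n) * (s n * copula j l (x / s n) (y / s n))) \<longlonglongrightarrow> 0" by simp
    then show "(\<lambda>n. (1 / real (k' n))\<^sup>2 * (real (N n j) * prob {w \<in> space M. B x y n (X\<^sub>0 w)})) \<longlonglongrightarrow> 0"
      by (rule Lim_transform_eventually) (use pe in \<open>eventually_elim, simp add: s_def power2_eq_square\<close>)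
  qed
  define T where "T n w = tail_copula_est (\<lambda>i. X i w) (N n) (k n) j l (real (k n j) / real (k n l)) (real (N n j) / real (N n l))" for n w
  have sandwich: "\<forall>\<^sub>F z in whp M. D ((1 - d) * u) ((1 - d) * v) (fst z) (snd z) \<le> T (fst z) (snd z) \<and>
      T (fst z) (snd z) \<le> D ((1 + d) * u) ((1 + d) * v) (fst z) (snd z)" if d: "0 < d" "d < 1" for d
    using J.rank_sandwich[where x = "\<lambda>v. v $ j", OF expo_less_imp u k_ratio[of j l, folded u_def] d]
      L.rank_sandwich[where x = "\<lambda>v. v $ l", OF expo_less_imp v N_ratio[of j l, folded v_def] d]
  proof eventually_elim
    case (elim z)
    obtain n w where z: "z = (n, w)" by (cases z)
    define cond where "cond j' t i \<longleftrightarrow> (real (N n j) + 1 - real (rank_of (\<lambda>i. X i w $ j') (N n j) i)) /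
        (real (k' n) * (real (N n j) + 1) / real (N n j)) \<le> t" for j' t i
    have "N n j \<le> N n l" using jl by (intro N_le) simp
    then have min: "min (N n j) (N n l) = N n j" by simp
    have "T n w = 1 / real (k' n) * (\<Sum>i=1..N n j. of_bool (cond j (real (k n j) / real (k n l)) i \<and> cond l (real (N n j) / real (N n l)) i))"
      unfolding T_def tail_copula_est_def Let_def min k'_def[symmetric] cond_def ..
    also have "(\<Sum>i=1..N n j. of_bool (cond j (real (k n j) / real (k n l)) i \<and> cond l (real (N n j) / real (N n l)) i)) =
        real (card {i \<in> {1..N n j}. cond j (real (k n j) / real (k n l)) i \<and> cond l (real (N n j) / real (N n l)) i})"
      by (simp add: Int_def)
    finally have T: "T n w = 1 / real (k' n) * real (card {i \<in> {1..N n j}. cond j (real (k n j) / real (k n l)) i \<and> cond l (real (N n j) / real (N n l)) i})" .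
    have e1: "\<And>i. i \<in> {1..N n j} \<Longrightarrow> expo j (X i w) \<ge> ln (real (N n j) / (real (k' n) * ((1 - d) * u))) \<Longrightarrow> cond j (real (k n j) / real (k n l)) i"
      "\<And>i. i \<in> {1..N n j} \<Longrightarrow> cond j (real (k n j) / real (k n l)) i \<Longrightarrow> expo j (X i w) \<ge> ln (real (N n j) / (real (k' n) * ((1 + d) * u)))"
      using elim(1) unfolding z fst_conv snd_conv cond_def by blast+
    have e2: "\<And>i. i \<in> {1..N n j} \<Longrightarrow> expo l (X i w) \<ge> ln (real (N n j) / (real (k' n) * ((1 - d) * v))) \<Longrightarrow> cond l (real (N n j) / real (N n l)) i"
      "\<And>i. i \<in> {1..N n j} \<Longrightarrow> cond l (real (N n j) / real (N n l)) i \<Longrightarrow> expo l (X i w) \<ge> ln (real (N n j) / (real (k' n) * ((1 + d) * v)))"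
      using elim(2) unfolding z fst_conv snd_conv cond_def by blast+
    show ?case unfolding z fst_conv snd_conv T D_def B_def
      using e1 e2 by (intro conjI mult_left_mono of_nat_mono card_mono) auto
  qed
  let ?R = "R j l (ennreal u) (ennreal v)"
  have hom: "R j l (ennreal (r * u)) (ennreal (r * v)) = r * ?R" if "r > 0" for r
    using R_homogeneous[OF _ u v that] jl by auto
  have "((\<lambda>z. T (fst z) (snd z)) \<longlongrightarrow> ?R) (whp M)"
  proof (rule tendstoI)
    fix \<epsilon> :: real assume eps: "\<epsilon> > 0"
    \<comment> \<open>Makes d |R| \<le> \<epsilon> / 2, including R = 0, and keeps 1 - d positive
      for the use of homogeneity.\<close>
    define d where "d = min (1/2) (\<epsilon> / (2 * (\<bar>?R\<bar> + 1)))"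
    have d: "0 < d" "d < 1" using eps by (auto simp: d_def)
    have "d * \<bar>?R\<bar> \<le> \<epsilon> / (2 * (\<bar>?R\<bar> + 1)) * \<bar>?R\<bar>" by (intro mult_right_mono) (auto simp: d_def)
    also have "\<dots> \<le> \<epsilon> / 2" using eps by (simp add: field_simps)
    finally have dR: "\<bar>d * ?R\<bar> \<le> \<epsilon> / 2" using d by (simp add: abs_mult)
    have "\<forall>\<^sub>F z in whp M. dist (D ((1 - d) * u) ((1 - d) * v) (fst z) (snd z)) ((1 - d) * ?R) < \<epsilon> / 2"
      using D_lim[of "(1 - d) * u" "(1 - d) * v"] hom[of "1 - d"] d u v eps by (intro tendstoD) auto
    moreover have "\<forall>\<^sub>F z in whp M. dist (D ((1 + d) * u) ((1 + d) * v) (fst z) (snd z)) ((1 + d) * ?R) < \<epsilon> / 2"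
      using D_lim[of "(1 + d) * u" "(1 + d) * v"] hom[of "1 + d"] d u v eps by (intro tendstoD) auto
    ultimately show "\<forall>\<^sub>F z in whp M. dist (T (fst z) (snd z)) ?R < \<epsilon>"
      using sandwich[OF d]
    proof eventually_elim
      case (elim z)
      have tri: "\<bar>t - r\<bar> < \<epsilon>"
        if "\<bar>x - (r - q)\<bar> < \<epsilon> / 2" "\<bar>y - (r + q)\<bar> < \<epsilon> / 2" "x \<le> t" "t \<le> y" "\<bar>q\<bar> \<le> \<epsilon> / 2" for x y t r q :: real
        using that by linarith
      from elim show ?case unfolding dist_real_def
        by (intro tri[OF _ _ _ _ dR]) (auto simp: left_diff_distrib distrib_right)
    qed
  qed
  then show ?thesis unfolding T_def u_def v_def .
qed

end

section \<open>Joint asymptotic normality\<close>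

context tail_model
begin

abbreviation (input) centred :: "nat \<Rightarrow> 'm \<Rightarrow> 'm rvec \<Rightarrow> real" where
  "centred n j v \<equiv> centred_excess (expo j v - margin.threshold j n)"

text \<open>The limit covariance of the standardised excess sums; scaling its entries by \<gamma>_j
  \<gamma>_l gives V.\<close>

definition corr_mat :: "'m rmat" where
  "corr_mat = sym_matrix (\<lambda>_. 1)
     (\<lambda>j l. sqrt (c $ j / c $ l) * R j l (ennreal (c $ l / c $ j)) (ennreal (b $ l / b $ j)))"

lemma exp_threshold_le: "k n j > 0 \<Longrightarrow> N n j > 0 \<Longrightarrow> exp (- margin.threshold j n) \<le> real (k n j) / real (N n j)"
proof -
  assume p: "k n j > 0" "N n j > 0"
  have "exp (- margin.threshold j n) \<le> exp (- ln (real (N n j) / real (k n j)))"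
    unfolding margin.threshold_def by simp
  also have "\<dots> = real (k n j) / real (N n j)" using p by (simp add: exp_minus)
  finally show ?thesis .
qed

text \<open>At scale s = N_j / k_j the joint tail beyond the two thresholds is the survival copula
  at exp (- x) / s and at a second argument that carries the ratio of the two exceedance levels. Its
  limit is a kernel that decays like exp (- r) along the diagonal direction, so only the value at
  the origin remains.\<close>

lemma centred_excess_covariance_tendsto:
  assumes jl: "j < l"
  shows "(\<lambda>n. real (N n j) / (sqrt (k n j) * sqrt (k n l)) * expectation (\<lambda>w. centred n j (X\<^sub>0 w) * centred n l (X\<^sub>0 w)))
    \<longlonglongrightarrow> corr_mat $ j $ l"
proof -
  \<comment> \<open>The limit of (k_l / N_l) / (k_j / N_j), the relative level of the two
    thresholds.\<close>
  define r where "r = c $ j / c $ l * (b $ l / b $ j)"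
  have pos: "c $ j > 0" "c $ l > 0" "b $ j > 0" "b $ l > 0" using c_range b_range by auto
  have r: "r > 0" using pos by (simp add: r_def)
  define K where "K s t = sqrt (c $ l / c $ j) * R j l (ennreal (exp (- s))) (ennreal (exp (- t) * r))" for s t
  have ne: "j \<noteq> l" using jl by simp
  define a where "a n = real (N n j) / (sqrt (k n j) * sqrt (k n l))" for n
  define s where "s n = real (N n j) / real (k n j)" for n
  have "(\<lambda>n. a n * expectation (\<lambda>w. centred n j (X\<^sub>0 w) * centred n l (X\<^sub>0 w))) \<longlonglongrightarrow> K 0 0"
  proof (rule tendsto_centred_excess_covariance[where K = K, OF expo_distributed expo_distributed])
    show "a n \<ge> 0" for n by (simp add: a_def)
    \<comment> \<open>The exponential is at most sqrt (k_j k_l / (N_j N_l)), and N_j \<le> N_l turns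
      this into sqrt (k_j k_l) / N_j. In the degenerate case \<open>a n\<close> is 0, by the
      convention for division by 0.\<close>
    show "a n * exp (- (margin.threshold j n + margin.threshold l n) / 2) \<le> 1" for n
    proof (cases "N n j = 0 \<or> k n j = 0 \<or> k n l = 0")
      case False
      then have p: "N n j > 0" "k n j > 0" "k n l > 0" by auto
      have Nl: "N n j \<le> N n l" using jl by (intro N_le) simp
      have "exp (- (margin.threshold j n + margin.threshold l n) / 2) = sqrt (exp (- margin.threshold j n) * exp (- margin.threshold l n))"
      proof (rule real_sqrt_unique[symmetric])
        show "(exp (- (margin.threshold j n + margin.threshold l n) / 2))\<^sup>2 = exp (- margin.threshold j n) * exp (- margin.threshold l n)"
          unfolding power2_eq_square mult_exp_exp by (rule arg_cong[of _ _ exp]) simp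
      qed simp
      also have "\<dots> \<le> sqrt ((real (k n j) / real (N n j)) * (real (k n l) / real (N n l)))"
        using exp_threshold_le[of n j] exp_threshold_le[of n l] p Nl by (intro real_sqrt_le_mono mult_mono) auto
      also have "\<dots> \<le> sqrt ((real (k n j) / real (N n j)) * (real (k n l) / real (N n j)))"
        using p Nl by (intro real_sqrt_le_mono mult_left_mono divide_left_mono) auto
      also have "\<dots> = sqrt (k n j) * sqrt (k n l) / real (N n j)"
        using p by (simp add: real_sqrt_mult real_sqrt_divide)
      finally have "a n * exp (- (margin.threshold j n + margin.threshold l n) / 2) \<le> a n * (sqrt (k n j) * sqrt (k n l) / real (N n j))"
        by (rule mult_left_mono) (simp add: a_def)
      also have "\<dots> = 1" using p by (simp add: a_def)
      finally show ?thesis .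
    qed (auto simp: a_def)
    show "K (x + q) (y + q) = exp (- q) * K x y" if "x \<ge> 0" "y \<ge> 0" "q \<ge> 0" for x y q
      using R_homogeneous[OF ne, of "exp (- x)" "exp (- y) * r" "exp (- q)"] r
      by (simp add: K_def exp_add exp_diff exp_minus field_simps)
    show "(\<lambda>n. a n * prob {w \<in> space M. margin.threshold j n + x \<le> expo j (X\<^sub>0 w) \<and> margin.threshold l n + y \<le> expo l (X\<^sub>0 w)}) \<longlonglongrightarrow> K x y"
      if "x \<ge> 0" "y \<ge> 0" for x y
    proof -
      define yn where "yn n = exp (- y) * (real (k n l) / real (k n j) * (real (N n j) / real (N n l)))" for n
      have yn: "yn \<longlonglongrightarrow> exp (- y) * r"
        unfolding yn_def r_def by (intro tendsto_mult_left tendsto_mult k_ratio N_ratio)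
      have "(\<lambda>n. s n * copula j l (exp (- x) / s n) (yn n / s n)) \<longlonglongrightarrow> R j l (ennreal (exp (- x))) (ennreal (exp (- y) * r))"
        unfolding s_def using r by (intro copula_limit ne yn tendsto_const margin.frac_at_top) auto
      then have "(\<lambda>n. sqrt (real (k n j) / real (k n l)) * (s n * copula j l (exp (- x) / s n) (yn n / s n))) \<longlonglongrightarrow> K x y"
        unfolding K_def by (intro tendsto_mult tendsto_real_sqrt k_ratio)
      then show ?thesis
      proof (rule Lim_transform_eventually)
        show "\<forall>\<^sub>F n in sequentially. sqrt (real (k n j) / real (k n l)) * (s n * copula j l (exp (- x) / s n) (yn n / s n)) =
            a n * prob {w \<in> space M. margin.threshold j n + x \<le> expo j (X\<^sub>0 w) \<and> margin.threshold l n + y \<le> expo l (X\<^sub>0 w)}"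
          using margin.k_less_N[of j] margin.k_less_N[of l] margin.threshold_eq[of j] margin.threshold_eq[of l]
        proof eventually_elim
          case (elim n)
          have p: "real (k n j) > 0" "real (k n l) > 0" "real (N n j) > 0" "real (N n l) > 0" using elim by auto
          have "exp (- (margin.threshold j n + x)) = exp (- margin.threshold j n) * exp (- x)" by (simp add: exp_add[symmetric])
          also have "\<dots> = exp (- x) / s n" using conjunct2[OF elim(3)] by (simp add: s_def)
          finally have 1: "exp (- (margin.threshold j n + x)) = exp (- x) / s n" .
          have "exp (- (margin.threshold l n + y)) = exp (- margin.threshold l n) * exp (- y)" by (simp add: exp_add[symmetric])
          also have "\<dots> = yn n / s n" using conjunct2[OF elim(4)] p by (simp add: s_def yn_def)
          finally have 2: "exp (- (margin.threshold l n + y)) = yn n / s n" .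
          have 3: "sqrt (real (k n j) / real (k n l)) * s n = a n"
            using p real_div_sqrt[of "real (k n j)"] by (simp add: a_def s_def real_sqrt_divide field_simps)
          show ?case unfolding expo_ge_iff 1 2 copula_def[symmetric] mult.assoc[symmetric] 3 ..
        qed
      qed
    qed
  qed
  \<comment> \<open>The factor c_j / c_l carries the point (c_l / c_j, b_l / b_j) of the definition
    of V to (1, r), so homogeneity of \<open>R\<close> reconciles the two forms.\<close>
  moreover have "K 0 0 = corr_mat $ j $ l"
  proof -
    have eq: "c $ j / c $ l * (c $ l / c $ j) = 1" "c $ j / c $ l * (b $ l / b $ j) = r" using pos by (simp_all add: r_def)
    let ?Q = "R j l (ennreal (c $ l / c $ j)) (ennreal (b $ l / b $ j))"
    have "R j l (ennreal 1) (ennreal r) = c $ j / c $ l * ?Q"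
      using R_homogeneous[OF ne, of "c $ l / c $ j" "b $ l / b $ j" "c $ j / c $ l"] pos unfolding eq by simp
    then have "K 0 0 = sqrt (c $ l / c $ j) * (c $ j / c $ l * ?Q)" by (simp only: K_def minus_zero exp_zero mult_1_left)
    also have "\<dots> = (sqrt (c $ l / c $ j) * (c $ j / c $ l)) * ?Q" by (rule mult.assoc[symmetric])
    also have "sqrt (c $ l / c $ j) * (c $ j / c $ l) = sqrt (c $ j / c $ l)"
      using pos real_sqrt_mult_self[of "c $ j"] real_sqrt_mult_self[of "c $ l"]
      by (simp add: real_sqrt_divide field_simps)
    finally have "K 0 0 = sqrt (c $ j / c $ l) * ?Q" .
    then show ?thesis using jl by (simp add: corr_mat_def sym_matrix_def)
  qed
  ultimately show ?thesis unfolding a_def by simp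
qed

lemma corr_mat_sym: "corr_mat $ l $ j = corr_mat $ j $ l"
  unfolding corr_mat_def sym_matrix_def by (cases j l rule: linorder_cases) auto

lemma centred_second_moment: "expectation (\<lambda>w. (centred n j (X\<^sub>0 w))\<^sup>2) = exp (- margin.threshold j n)"
  by (rule centred_excess_moments(3)[OF expo_distributed margin.threshold_nonneg])

lemma integrable_centred_mult: "integrable M (\<lambda>w. centred n j (X\<^sub>0 w) * centred n l (X\<^sub>0 w))"
proof (rule Bochner_Integration.integrable_bound)
  show "integrable M (\<lambda>w. (centred n j (X\<^sub>0 w))\<^sup>2 + (centred n l (X\<^sub>0 w))\<^sup>2)"
    by (intro Bochner_Integration.integrable_add centred_excess_moments(2)[OF expo_distributed margin.threshold_nonneg])
  show "AE w in M. norm (centred n j (X\<^sub>0 w) * centred n l (X\<^sub>0 w)) \<le> norm ((centred n j (X\<^sub>0 w))\<^sup>2 + (centred n l (X\<^sub>0 w))\<^sup>2)"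
    using abs_mult_le_squares by simp
qed measurable

text \<open>Only the vectors common to both samples contribute to the covariance of the sums, whence
  the minimum of the two sizes.\<close>

lemma covariance_tendsto:
  "(\<lambda>n. real (min (N n j) (N n l)) / (sqrt (k n j) * sqrt (k n l)) * expectation (\<lambda>w. centred n j (X\<^sub>0 w) * centred n l (X\<^sub>0 w)))
    \<longlonglongrightarrow> corr_mat $ j $ l"
proof (cases j l rule: linorder_cases)
  case less
  then have "min (N n j) (N n l) = N n j" for n using N_le[of j l n] by simp
  then show ?thesis using centred_excess_covariance_tendsto[OF less] by simp
next
  case greater
  then have "min (N n j) (N n l) = N n l" for n using N_le[of l j n] by simp
  then show ?thesis using centred_excess_covariance_tendsto[OF greater] by (simp add: corr_mat_sym[of j l] mult.commute)
next
  case equal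
  have "\<forall>\<^sub>F n in sequentially. real (min (N n j) (N n l)) / (sqrt (k n j) * sqrt (k n l)) * expectation (\<lambda>w. centred n j (X\<^sub>0 w) * centred n l (X\<^sub>0 w)) = 1"
    using margin.k_less_N[of j] margin.threshold_eq[of j]
  proof eventually_elim
    case (elim n)
    have "expectation (\<lambda>w. centred n j (X\<^sub>0 w) * centred n l (X\<^sub>0 w)) = real (k n j) / real (N n j)"
      using centred_second_moment[where n = n and j = j] conjunct2[OF elim(2)] by (simp add: equal power2_eq_square)
    then show ?case using elim(1) by (simp add: equal)
  qed
  then show ?thesis using equal by (intro tendsto_eventually) (simp add: corr_mat_def sym_matrix_def)
qed

text \<open>Samples of different sizes are merged into one triangular array by cutting each sample off at its size.\<close>

definition array :: "('m \<Rightarrow> real) \<Rightarrow> nat \<Rightarrow> nat \<Rightarrow> 'm rvec \<Rightarrow> real" where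
  "array a n i v = (\<Sum>j\<in>UNIV. a j * of_bool (i \<le> N n j) * (1 / sqrt (k n j) * centred n j v))"

lemma array_measurable [measurable]: "array a n i \<in> borel_measurable borel"
  unfolding array_def[abs_def] by measurable

lemma sum_array:
  "(\<Sum>i=1..(\<Sum>j\<in>UNIV. N n j). array a n i (X i w)) = (\<Sum>j\<in>UNIV. a j * margin.excess_sum j n w)"
proof -
  \<comment> \<open>The number of rows only has to dominate all sample sizes; rows beyond
    \<open>N n j\<close> contribute 0 to margin j.\<close>
  have le: "N n j \<le> (\<Sum>j\<in>UNIV. N n j)" for j by (rule member_le_sum) auto
  have "(\<Sum>i=1..(\<Sum>j\<in>UNIV. N n j). array a n i (X i w)) =
    (\<Sum>j\<in>UNIV. \<Sum>i=1..(\<Sum>j\<in>UNIV. N n j). a j * of_bool (i \<le> N n j) * (1 / sqrt (k n j) * centred n j (X i w)))"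
    unfolding array_def by (rule sum.swap)
  also have "\<dots> = (\<Sum>j\<in>UNIV. a j * margin.excess_sum j n w)"
  proof (rule sum.cong[OF refl])
    fix j
    have "(\<Sum>i=1..(\<Sum>j\<in>UNIV. N n j). a j * of_bool (i \<le> N n j) * (1 / sqrt (k n j) * centred n j (X i w))) =
        (\<Sum>i=1..N n j. a j * of_bool (i \<le> N n j) * (1 / sqrt (k n j) * centred n j (X i w)))"
      using le[of j] by (intro sum.mono_neutral_right) auto
    also have "\<dots> = (\<Sum>i=1..N n j. a j * (1 / sqrt (k n j) * centred n j (X i w)))"
      by (rule sum.cong) auto
    finally show "(\<Sum>i=1..(\<Sum>j\<in>UNIV. N n j). a j * of_bool (i \<le> N n j) * (1 / sqrt (k n j) * centred n j (X i w))) = a j * margin.excess_sum j n w"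
      by (simp add: margin.excess_sum_def sum_distrib_left)
  qed
  finally show ?thesis .
qed

lemma array_power_le:
  assumes "p > 0"
  shows "\<bar>array a n i v\<bar> ^ p \<le> real CARD('m) ^ p * (\<Sum>j\<in>UNIV. (\<bar>a j\<bar> * of_bool (i \<le> N n j) / sqrt (k n j)) ^ p * \<bar>centred n j v\<bar> ^ p)"
proof -
  have "\<bar>array a n i v\<bar> \<le> (\<Sum>j\<in>UNIV. \<bar>a j * of_bool (i \<le> N n j) * (1 / sqrt (k n j) * centred n j v)\<bar>)"
    unfolding array_def by (rule sum_abs)
  also have "\<dots> = (\<Sum>j\<in>UNIV. \<bar>a j\<bar> * of_bool (i \<le> N n j) / sqrt (k n j) * \<bar>centred n j v\<bar>)"
    by (rule sum.cong) (auto simp: abs_mult)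
  finally have "\<bar>array a n i v\<bar> ^ p \<le> (\<Sum>j\<in>UNIV. \<bar>a j\<bar> * of_bool (i \<le> N n j) / sqrt (k n j) * \<bar>centred n j v\<bar>) ^ p"
    by (rule power_mono) simp
  also have "\<dots> \<le> real CARD('m) ^ p * (\<Sum>j\<in>UNIV. (\<bar>a j\<bar> * of_bool (i \<le> N n j) / sqrt (k n j) * \<bar>centred n j v\<bar>) ^ p)"
    by (rule sum_power_le) (use assms in auto)
  finally show ?thesis by (simp only: power_mult_distrib)
qed

text \<open>Every linear combination of the excess sums is a row sum of one triangular array with
  independent rows. Its summed variances converge by \<open>covariance_tendsto\<close>, single
  variances are of order 1 / k, and the third moments add up to order 1 / sqrt k.\<close>

lemma joint_char:
  "(\<lambda>n. expectation (\<lambda>w. iexp (\<Sum>j\<in>UNIV. a j * margin.excess_sum j n w))) \<longlonglongrightarrow>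
    exp (- (\<Sum>j\<in>UNIV. \<Sum>l\<in>UNIV. a j * a l * corr_mat $ j $ l) / 2)"
proof -
  let ?m = "real CARD('m)"
  let ?r = "\<lambda>n. \<Sum>j\<in>UNIV. N n j"
  note mom = centred_excess_moments[OF expo_distributed margin.threshold_nonneg]
  have le: "N n j \<le> ?r n" for n j by (rule member_le_sum) auto
  have sq_eq: "(array a n i v)\<^sup>2 = (\<Sum>j\<in>UNIV. \<Sum>l\<in>UNIV. a j * a l * (of_bool (i \<le> N n j) * of_bool (i \<le> N n l)) /
      (sqrt (k n j) * sqrt (k n l)) * (centred n j v * centred n l v))" for n i v
    unfolding array_def power2_eq_square sum_product by (intro sum.cong refl) (simp add: mult_ac)
  have int2: "integrable M (\<lambda>w. (array a n i (X\<^sub>0 w))\<^sup>2)" for n i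
    unfolding sq_eq by (intro Bochner_Integration.integrable_sum integrable_mult_right integrable_centred_mult)
  have e2: "expectation (\<lambda>w. (array a n i (X\<^sub>0 w))\<^sup>2) = (\<Sum>j\<in>UNIV. \<Sum>l\<in>UNIV. a j * a l * (of_bool (i \<le> N n j) * of_bool (i \<le> N n l)) /
      (sqrt (k n j) * sqrt (k n l)) * expectation (\<lambda>w. centred n j (X\<^sub>0 w) * centred n l (X\<^sub>0 w)))" for n i
    unfolding sq_eq
    by (subst Bochner_Integration.integral_sum, intro Bochner_Integration.integrable_sum integrable_mult_right integrable_centred_mult, rule sum.cong[OF refl],
        subst Bochner_Integration.integral_sum, intro integrable_mult_right integrable_centred_mult, rule sum.cong[OF refl], rule integral_mult_right_zero)
  have int3: "integrable M (\<lambda>w. \<bar>array a n i (X\<^sub>0 w)\<bar> ^ 3)" for n i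
  proof (rule Bochner_Integration.integrable_bound)
    show "integrable M (\<lambda>w. ?m ^ 3 * (\<Sum>j\<in>UNIV. (\<bar>a j\<bar> * of_bool (i \<le> N n j) / sqrt (k n j)) ^ 3 * \<bar>centred n j (X\<^sub>0 w)\<bar> ^ 3))"
      by (intro integrable_mult_right Bochner_Integration.integrable_sum mom)
    show "AE w in M. norm (\<bar>array a n i (X\<^sub>0 w)\<bar> ^ 3) \<le> norm (?m ^ 3 * (\<Sum>j\<in>UNIV. (\<bar>a j\<bar> * of_bool (i \<le> N n j) / sqrt (k n j)) ^ 3 * \<bar>centred n j (X\<^sub>0 w)\<bar> ^ 3))"
      using array_power_le[of 3 a n i] by (intro AE_I2) (auto simp del: of_nat_power simp: sum_nonneg)
  qed measurable
  have int1: "integrable M (\<lambda>w. centred n j (X\<^sub>0 w))" for n j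
    by (rule square_integrable_imp_integrable[OF _ mom(2)]) measurable
  have mean: "expectation (\<lambda>w. array a n i (X\<^sub>0 w)) = 0" for n i
    unfolding array_def using int1 mom(1) by (simp add: Bochner_Integration.integral_sum)
  have inv: "(\<lambda>n. 1 / real (k n j)) \<longlonglongrightarrow> 0" for j
    by (rule real_tendsto_divide_at_top[OF tendsto_const margin.k_real_lim])
  note inv2 = margin.inverse_sqrt_k
  have "(\<lambda>n. expectation (\<lambda>w. iexp (\<Sum>i=1..?r n. array a n i (X i w)))) \<longlonglongrightarrow>
      exp (- (\<Sum>j\<in>UNIV. \<Sum>l\<in>UNIV. a j * a l * corr_mat $ j $ l) / 2)"
  proof (rule char_triangular_sum[OF array_measurable int2 int3 mean])
    have "(\<Sum>i=1..?r n. expectation (\<lambda>w. (array a n i (X\<^sub>0 w))\<^sup>2)) = (\<Sum>j\<in>UNIV. \<Sum>l\<in>UNIV. a j * a l *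
       (real (min (N n j) (N n l)) / (sqrt (k n j) * sqrt (k n l)) * expectation (\<lambda>w. centred n j (X\<^sub>0 w) * centred n l (X\<^sub>0 w))))" for n
    proof -
      have cnt: "(\<Sum>i=1..?r n. of_bool (i \<le> N n j) * of_bool (i \<le> N n l)) = real (min (N n j) (N n l))" for j l
      proof -
        have "(\<Sum>i=1..?r n. of_bool (i \<le> N n j) * of_bool (i \<le> N n l) :: real) = (\<Sum>i=1..min (N n j) (N n l). 1)"
          using le[of n j] le[of n l] by (intro sum.mono_neutral_cong_right) auto
        then show ?thesis by simp
      qed
      have "(\<Sum>i=1..?r n. expectation (\<lambda>w. (array a n i (X\<^sub>0 w))\<^sup>2)) =
        (\<Sum>j\<in>UNIV. \<Sum>l\<in>UNIV. \<Sum>i=1..?r n. a j * a l * (of_bool (i \<le> N n j) * of_bool (i \<le> N n l)) /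
          (sqrt (k n j) * sqrt (k n l)) * expectation (\<lambda>w. centred n j (X\<^sub>0 w) * centred n l (X\<^sub>0 w)))"
        unfolding e2 by (subst sum.swap, rule sum.cong[OF refl], rule sum.swap)
      also have "\<dots> = (\<Sum>j\<in>UNIV. \<Sum>l\<in>UNIV. a j * a l * ((\<Sum>i=1..?r n. of_bool (i \<le> N n j) * of_bool (i \<le> N n l)) /
          (sqrt (k n j) * sqrt (k n l)) * expectation (\<lambda>w. centred n j (X\<^sub>0 w) * centred n l (X\<^sub>0 w))))"
      proof (intro sum.cong refl)
        have "(\<Sum>i\<in>S. A * o' i / B * E) = A * ((\<Sum>i\<in>S. o' i) / B * E)" for S :: "nat set" and A B E :: real and o'
          by (simp add: sum_distrib_left sum_distrib_right sum_divide_distrib mult_ac)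
        then show "(\<Sum>i=1..?r n. a j * a l * (of_bool (i \<le> N n j) * of_bool (i \<le> N n l)) /
            (sqrt (k n j) * sqrt (k n l)) * expectation (\<lambda>w. centred n j (X\<^sub>0 w) * centred n l (X\<^sub>0 w))) =
          a j * a l * ((\<Sum>i=1..?r n. of_bool (i \<le> N n j) * of_bool (i \<le> N n l)) /
            (sqrt (k n j) * sqrt (k n l)) * expectation (\<lambda>w. centred n j (X\<^sub>0 w) * centred n l (X\<^sub>0 w)))" for j l .
      qed
      finally show ?thesis unfolding cnt .
    qed
    then show "(\<lambda>n. \<Sum>i=1..?r n. expectation (\<lambda>w. (array a n i (X\<^sub>0 w))\<^sup>2)) \<longlonglongrightarrow> (\<Sum>j\<in>UNIV. \<Sum>l\<in>UNIV. a j * a l * corr_mat $ j $ l)"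
      by (simp only:) (intro tendsto_sum tendsto_mult_left covariance_tendsto)
    define s where "s n = ?m\<^sup>2 * (\<Sum>j\<in>UNIV. \<bar>a j\<bar>\<^sup>2 * (1 / real (k n j)))" for n
    show "expectation (\<lambda>w. (array a n i (X\<^sub>0 w))\<^sup>2) \<le> s n" for n i
    proof -
      have "expectation (\<lambda>w. (array a n i (X\<^sub>0 w))\<^sup>2) \<le> expectation (\<lambda>w. ?m\<^sup>2 * (\<Sum>j\<in>UNIV. (\<bar>a j\<bar> * of_bool (i \<le> N n j) / sqrt (k n j))\<^sup>2 * (centred n j (X\<^sub>0 w))\<^sup>2))"
        using array_power_le[of 2 a n i] by (intro integral_mono int2 integrable_mult_right Bochner_Integration.integrable_sum mom) simp
      also have "\<dots> = ?m\<^sup>2 * (\<Sum>j\<in>UNIV. (\<bar>a j\<bar> * of_bool (i \<le> N n j) / sqrt (k n j))\<^sup>2 * exp (- margin.threshold j n))"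
        using mom(2,3) by (simp add: Bochner_Integration.integral_sum)
      also have "\<dots> \<le> s n" unfolding s_def
      proof (intro mult_left_mono sum_mono)
        fix j
        have "(\<bar>a j\<bar> * of_bool (i \<le> N n j) / sqrt (k n j))\<^sup>2 * exp (- margin.threshold j n) \<le> (\<bar>a j\<bar> / sqrt (k n j))\<^sup>2 * 1"
          using margin.threshold_nonneg[of j n] by (intro mult_mono power_mono) (auto simp: divide_right_mono)
        also have "\<dots> = \<bar>a j\<bar>\<^sup>2 * (1 / real (k n j))" by (simp add: power_divide)
        finally show "(\<bar>a j\<bar> * of_bool (i \<le> N n j) / sqrt (k n j))\<^sup>2 * exp (- margin.threshold j n) \<le> \<bar>a j\<bar>\<^sup>2 * (1 / real (k n j))" .
      qed simp
      finally show ?thesis .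
    qed
    have "s \<longlonglongrightarrow> ?m\<^sup>2 * (\<Sum>j\<in>UNIV. \<bar>a j\<bar>\<^sup>2 * 0)"
      unfolding s_def by (intro tendsto_mult_left tendsto_sum inv)
    then show "s \<longlonglongrightarrow> 0" by simp
    \<comment> \<open>Per margin there are N terms of size k^(-3/2) times a third moment of at most
      7 k / N; the constant is the one from \<open>centred_excess_moments\<close>.\<close>
    define t where "t n = ?m ^ 3 * (\<Sum>j\<in>UNIV. \<bar>a j\<bar> ^ 3 * (7 * (1 / sqrt (k n j))))" for n
    show "(\<lambda>n. \<Sum>i=1..?r n. expectation (\<lambda>w. \<bar>array a n i (X\<^sub>0 w)\<bar> ^ 3)) \<longlonglongrightarrow> 0"
    proof (rule tendsto_sandwich[OF _ _ tendsto_const])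
      show "\<forall>\<^sub>F n in sequentially. 0 \<le> (\<Sum>i=1..?r n. expectation (\<lambda>w. \<bar>array a n i (X\<^sub>0 w)\<bar> ^ 3))"
        by (intro always_eventually allI sum_nonneg) simp
      have "\<forall>\<^sub>F n in sequentially. \<forall>j\<in>UNIV. (0 < k n j \<and> k n j < N n j)"
        by (intro eventually_ball_finite ballI margin.k_less_N) simp
      then show "\<forall>\<^sub>F n in sequentially. (\<Sum>i=1..?r n. expectation (\<lambda>w. \<bar>array a n i (X\<^sub>0 w)\<bar> ^ 3)) \<le> t n"
      proof eventually_elim
        case (elim n)
        have "(\<Sum>i=1..?r n. expectation (\<lambda>w. \<bar>array a n i (X\<^sub>0 w)\<bar> ^ 3)) \<le>
          (\<Sum>i=1..?r n. ?m ^ 3 * (\<Sum>j\<in>UNIV. (\<bar>a j\<bar> * of_bool (i \<le> N n j) / sqrt (k n j)) ^ 3 * (7 * exp (- margin.threshold j n))))"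
        proof (rule sum_mono)
          fix i
          have "expectation (\<lambda>w. \<bar>array a n i (X\<^sub>0 w)\<bar> ^ 3) \<le> expectation (\<lambda>w. ?m ^ 3 * (\<Sum>j\<in>UNIV. (\<bar>a j\<bar> * of_bool (i \<le> N n j) / sqrt (k n j)) ^ 3 * \<bar>centred n j (X\<^sub>0 w)\<bar> ^ 3))"
            using array_power_le[of 3 a n i] by (intro integral_mono int3 integrable_mult_right Bochner_Integration.integrable_sum mom) simp
          also have "\<dots> = ?m ^ 3 * (\<Sum>j\<in>UNIV. (\<bar>a j\<bar> * of_bool (i \<le> N n j) / sqrt (k n j)) ^ 3 * expectation (\<lambda>w. \<bar>centred n j (X\<^sub>0 w)\<bar> ^ 3))"
            using mom(4) by (simp add: Bochner_Integration.integral_sum)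
          also have "\<dots> \<le> ?m ^ 3 * (\<Sum>j\<in>UNIV. (\<bar>a j\<bar> * of_bool (i \<le> N n j) / sqrt (k n j)) ^ 3 * (7 * exp (- margin.threshold j n)))"
            by (intro mult_left_mono sum_mono mom(5)) auto
          finally show "expectation (\<lambda>w. \<bar>array a n i (X\<^sub>0 w)\<bar> ^ 3) \<le> ?m ^ 3 * (\<Sum>j\<in>UNIV. (\<bar>a j\<bar> * of_bool (i \<le> N n j) / sqrt (k n j)) ^ 3 * (7 * exp (- margin.threshold j n)))" .
        qed
        also have "\<dots> = ?m ^ 3 * (\<Sum>j\<in>UNIV. \<Sum>i=1..?r n. (\<bar>a j\<bar> * of_bool (i \<le> N n j) / sqrt (k n j)) ^ 3 * (7 * exp (- margin.threshold j n)))"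
          unfolding sum_distrib_left[symmetric] by (subst sum.swap) (rule refl)
        also have "\<dots> \<le> t n" unfolding t_def
        proof (intro mult_left_mono sum_mono)
          fix j
          have p: "0 < k n j" "0 < N n j" using bspec[OF elim UNIV_I[of j]] by auto
          have "(\<Sum>i=1..?r n. (\<bar>a j\<bar> * of_bool (i \<le> N n j) / sqrt (k n j)) ^ 3 * (7 * exp (- margin.threshold j n))) =
            (\<Sum>i=1..N n j. (\<bar>a j\<bar> / sqrt (k n j)) ^ 3 * (7 * exp (- margin.threshold j n)))"
            using le[of n j] by (intro sum.mono_neutral_cong_right) auto
          also have "\<dots> = real (N n j) * ((\<bar>a j\<bar> / sqrt (k n j)) ^ 3 * (7 * exp (- margin.threshold j n)))" by simp
          also have "\<dots> \<le> real (N n j) * ((\<bar>a j\<bar> / sqrt (k n j)) ^ 3 * (7 * (real (k n j) / real (N n j))))"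
            using exp_threshold_le[OF p] by (intro mult_left_mono) auto
          also have "\<dots> = \<bar>a j\<bar> ^ 3 * (7 * (1 / sqrt (k n j)))"
          proof -
            have alg: "y * ((x / q) ^ 3 * (7 * (q * q / y))) = x ^ 3 * (7 * (1 / q))" if "q > 0" "y > 0" for x q y :: real
              using that by (simp add: power_divide power3_eq_cube field_simps)
            show ?thesis using alg[of "sqrt (k n j)" "real (N n j)" "\<bar>a j\<bar>"] p by simp
          qed
          finally show "(\<Sum>i=1..?r n. (\<bar>a j\<bar> * of_bool (i \<le> N n j) / sqrt (k n j)) ^ 3 * (7 * exp (- margin.threshold j n))) \<le> \<bar>a j\<bar> ^ 3 * (7 * (1 / sqrt (k n j)))" .
        qed simp
        finally show ?case .
      qed
      have "t \<longlonglongrightarrow> ?m ^ 3 * (\<Sum>j\<in>UNIV. \<bar>a j\<bar> ^ 3 * (7 * 0))"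
        unfolding t_def by (intro tendsto_mult_left tendsto_sum inv2)
      then show "t \<longlonglongrightarrow> 0" by simp
    qed
  qed
  then show ?thesis unfolding sum_array .
qed

lemma bdd_prob_excess_sum: "bdd_prob M (\<lambda>x. margin.excess_sum j (fst x) (snd x))"
proof (rule bdd_prob_second_moment)
  show "margin.excess_sum j n \<in> borel_measurable M" for n by (rule margin.excess_sum_measurable)
  note mom = centred_excess_moments[OF expo_distributed margin.threshold_nonneg]
  show "\<forall>\<^sub>F n in sequentially. integrable M (\<lambda>w. (margin.excess_sum j n w)\<^sup>2) \<and> expectation (\<lambda>w. (margin.excess_sum j n w)\<^sup>2) \<le> 1"
    using margin.k_less_N[of j]
  proof eventually_elim
    case (elim n)
    have f: "(\<lambda>v. 1 / sqrt (k n j) * centred n j v) \<in> borel_measurable borel" by measurable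
    have "expectation (\<lambda>w. (margin.excess_sum j n w)\<^sup>2) = (\<Sum>i=1..N n j. expectation (\<lambda>w. (1 / sqrt (k n j) * centred n j (X\<^sub>0 w))\<^sup>2)) \<and>
      integrable M (\<lambda>w. (margin.excess_sum j n w)\<^sup>2)"
      unfolding margin.excess_sum_def
      by (rule second_moment_sum[OF f]) (simp_all only: power_mult_distrib integrable_mult_right mom(1,2) integral_mult_right_zero mult_zero_right)
    moreover have "(\<Sum>i=1..N n j. expectation (\<lambda>w. (1 / sqrt (k n j) * centred n j (X\<^sub>0 w))\<^sup>2)) \<le> 1"
    proof -
      have "(\<Sum>i=1..N n j. expectation (\<lambda>w. (1 / sqrt (k n j) * centred n j (X\<^sub>0 w))\<^sup>2)) = real (N n j) * ((1 / sqrt (k n j))\<^sup>2 * exp (- margin.threshold j n))"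
        unfolding power_mult_distrib integral_mult_right_zero mom(3) by simp
      also have "\<dots> \<le> real (N n j) * ((1 / sqrt (k n j))\<^sup>2 * (real (k n j) / real (N n j)))"
        using exp_threshold_le[of n j] elim by (intro mult_left_mono) auto
      also have "\<dots> = 1" using elim by (simp add: power_divide)
      finally show ?thesis .
    qed
    ultimately show ?case by simp
  qed
qed

end

section \<open>The test statistic\<close>

text \<open>An event of positive probability is nonempty. This makes limits along the filter unique,
  which lets a constraint on random weights pass to their limit.\<close>

lemma (in prob_space) whp_neq_bot: "whp M \<noteq> bot"
proof
  assume "whp M = bot"
  then have "\<forall>\<^sub>F x in whp M. False" by simp
  from this[unfolded eventually_whp, rule_format, of 1]
  have "\<forall>\<^sub>F n in sequentially. \<exists>A\<in>events. 0 < prob A \<and> A = {}" by auto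
  then have "\<forall>\<^sub>F n :: nat in sequentially. False" by (rule eventually_mono) auto
  then show False by simp
qed

lemma pos_def_diag_scaling:
  fixes V :: "('m::finite) rmat"
  assumes V: "pos_def V" and d: "\<And>j. d j > 0"
  shows "pos_def (\<chi> j l. d j * d l * V $ j $ l)"
  unfolding pos_def_def
proof (intro conjI allI impI)
  have "transpose V = V" using V by (simp add: pos_def_def)
  then have "V $ l $ j = V $ j $ l" for j l by (metis transpose_def vec_lambda_beta)
  then show "transpose (\<chi> j l. d j * d l * V $ j $ l) = (\<chi> j l. d j * d l * V $ j $ l)"
    by (simp add: transpose_def vec_eq_iff)
  fix x :: "'m rvec" assume x: "x \<noteq> 0"
  define y :: "'m rvec" where "y = (\<chi> j. d j * x $ j)"
  have "y \<noteq> 0" using x d by (auto simp: y_def vec_eq_iff) (metis less_irrefl)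
  then have "0 < y \<bullet> (V *v y)" using V by (simp add: pos_def_def)
  also have "y \<bullet> (V *v y) = x \<bullet> ((\<chi> j l. d j * d l * V $ j $ l) *v x)"
    by (simp add: y_def inner_vec_def matrix_vector_mult_def sum_distrib_left mult_ac)
  finally show "0 < x \<bullet> ((\<chi> j l. d j * d l * V $ j $ l) *v x)" .
qed

section \<open>Measurability of the statistics\<close>

lemma measurable_order_stat:
  assumes f: "\<And>l. l \<in> {1..n} \<Longrightarrow> f l \<in> borel_measurable M" and i: "1 \<le> i" "i \<le> n"
  shows "(\<lambda>w. order_stat (\<lambda>l. f l w) n i) \<in> borel_measurable M"
  unfolding borel_measurable_iff_greater
proof
  fix a
  have c: "real (card {l \<in> {1..n}. f l w > a}) = (\<Sum>l=1..n. of_bool (f l w > a))" for w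
    by (simp add: Int_def)
  have "(\<lambda>w. \<Sum>l=1..n. of_bool (f l w > a) :: real) \<in> borel_measurable M"
  proof (rule borel_measurable_sum)
    fix l assume "l \<in> {1..n}"
    then have [measurable]: "f l \<in> borel_measurable M" by (rule f)
    show "(\<lambda>w. of_bool (f l w > a) :: real) \<in> borel_measurable M" by measurable
  qed
  then have [measurable]: "(\<lambda>w. real (card {l \<in> {1..n}. f l w > a})) \<in> borel_measurable M" unfolding c .
  have "{w \<in> space M. a < order_stat (\<lambda>l. f l w) n i} = {w \<in> space M. real (card {l \<in> {1..n}. f l w > a}) \<ge> real (n + 1 - i)}"
    unfolding order_stat_gt_iff[OF i] by simp
  also have "\<dots> \<in> sets M" by measurable
  finally show "{w \<in> space M. a < order_stat (\<lambda>l. f l w) n i} \<in> sets M" .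
qed

lemma measurable_hill:
  assumes f: "\<And>l. l \<in> {1..n} \<Longrightarrow> f l \<in> borel_measurable M" and k: "k < n"
  shows "(\<lambda>w. hill (\<lambda>l. f l w) n k) \<in> borel_measurable M"
  unfolding hill_def
proof (intro borel_measurable_times borel_measurable_const borel_measurable_sum)
  fix i assume i: "i \<in> {1..k}"
  have [measurable]: "(\<lambda>w. order_stat (\<lambda>l. f l w) n (n - i + 1)) \<in> borel_measurable M"
    "(\<lambda>w. order_stat (\<lambda>l. f l w) n (n - k)) \<in> borel_measurable M"
    using i k by (auto intro!: measurable_order_stat f)
  show "(\<lambda>w. ln (order_stat (\<lambda>l. f l w) n (n - i + 1) / order_stat (\<lambda>l. f l w) n (n - k))) \<in> borel_measurable M"
    by measurable
qed

lemma measurable_rank_of: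
  assumes f: "\<And>l. l \<in> {1..n} \<Longrightarrow> f l \<in> borel_measurable M" and i: "i \<in> {1..n}"
  shows "(\<lambda>w. real (rank_of (\<lambda>l. f l w) n i)) \<in> borel_measurable M"
proof -
  have c: "real (rank_of (\<lambda>l. f l w) n i) = (\<Sum>l=1..n. of_bool (f l w \<le> f i w))" for w
    by (simp add: rank_of_def Int_def)
  have [measurable]: "f i \<in> borel_measurable M" by (rule f[OF i])
  show ?thesis unfolding c
  proof (rule borel_measurable_sum)
    fix l assume "l \<in> {1..n}"
    then have [measurable]: "f l \<in> borel_measurable M" by (rule f)
    show "(\<lambda>w. of_bool (f l w \<le> f i w) :: real) \<in> borel_measurable M" by measurable
  qed
qed

lemma measurable_tail_copula_est:
  fixes X :: "nat \<Rightarrow> 'a \<Rightarrow> ('m::finite) rvec"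
  assumes X: "\<And>i j. i \<ge> 1 \<Longrightarrow> (\<lambda>w. X i w $ j) \<in> borel_measurable M"
  shows "(\<lambda>w. tail_copula_est (\<lambda>i. X i w) N k j l u v) \<in> borel_measurable M"
  unfolding tail_copula_est_def Let_def
proof (intro borel_measurable_times borel_measurable_const borel_measurable_sum)
  let ?n = "min (N j) (N l)"
  fix i assume i: "i \<in> {1..?n}"
  have [measurable]: "(\<lambda>w. real (rank_of (\<lambda>i'. X i' w $ j') ?n i)) \<in> borel_measurable M" for j'
    by (rule measurable_rank_of[OF X i]) simp
  show "(\<lambda>w. of_bool ((real ?n + 1 - real (rank_of (\<lambda>i'. X i' w $ j) ?n i)) / (real (if N j < N l then k j else k l) * (real ?n + 1) / real ?n) \<le> u \<and>
      (real ?n + 1 - real (rank_of (\<lambda>i'. X i' w $ l) ?n i)) / (real (if N j < N l then k j else k l) * (real ?n + 1) / real ?n) \<le> v) :: real) \<in> borel_measurable M"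
    by measurable
qed

text \<open>The generalised least squares residual of \<open>z\<close> after fitting a multiple of the constant vector.\<close>

definition residual :: "('m::finite) rmat \<Rightarrow> 'm rvec \<Rightarrow> 'm rvec" where
  "residual B z = z - ((1 \<bullet> (matrix_inv B *v z)) / (1 \<bullet> (matrix_inv B *v 1))) *\<^sub>R 1"

definition residual_form :: "('m::finite) rmat \<Rightarrow> 'm rvec \<Rightarrow> 'm rvec \<Rightarrow> real" where
  "residual_form B x y = residual B x \<bullet> (matrix_inv B *v residual B y)"

lemma residual_linear: "linear (residual B)"
  unfolding residual_def
  by (rule linearI) (simp_all add: matrix_vector_right_distrib inner_add_right add_divide_distrib algebra_simps matrix_vector_mult_scaleR)

lemma residual_const: "1 \<bullet> (matrix_inv B *v (1::('m::finite) rvec)) \<noteq> 0 \<Longrightarrow> residual B (g *\<^sub>R (1::'m rvec)) = 0"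
  by (simp add: residual_def matrix_vector_mult_scaleR)

text \<open>Separates the estimated matrix from the error vector: the coefficients converge while
  the coordinates are merely tight, and a vanishing coefficient times a tight product
  vanishes.\<close>

lemma residual_form_expand:
  "residual_form B z z = (\<Sum>j\<in>UNIV. \<Sum>l\<in>UNIV. z $ j * z $ l * residual_form B (axis j 1) (axis l 1))"
proof -
  have z: "z = (\<Sum>j\<in>UNIV. z $ j *\<^sub>R axis j 1)"
    using basis_expansion[of z] by (simp add: scalar_mult_eq_scaleR)
  have r: "residual B z = (\<Sum>j\<in>UNIV. z $ j *\<^sub>R residual B (axis j 1))"
    by (subst z) (simp add: linear_sum[OF residual_linear] linear_cmul[OF residual_linear])
  show ?thesis
    unfolding residual_form_def r
    by (simp add: linear_sum[OF matrix_vector_mul_linear] matrix_vector_mult_scaleR inner_sum_left inner_sum_right sum_distrib_left mult_ac)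
      (subst sum.swap, simp add: mult.left_commute)
qed

lemma tendsto_residual_form:
  fixes L :: "('m::finite) rmat"
  assumes A: "(A \<longlongrightarrow> L) F" and x: "(x \<longlongrightarrow> p) F" and y: "(y \<longlongrightarrow> q) F" and L: "pos_def L"
    and one: "1 \<bullet> (matrix_inv L *v (1::'m rvec)) \<noteq> 0"
  shows "((\<lambda>t. residual_form (A t) (x t) (y t)) \<longlongrightarrow> residual_form L p q) F"
proof -
  note m = tendsto_matrix_inv_mult[OF A _ pos_def_det[OF L]]
  have r: "((\<lambda>t. residual (A t) (x t)) \<longlongrightarrow> residual L p) F" if "(x \<longlongrightarrow> p) F" for x p
    unfolding residual_def by (intro tendsto_intros m that one)
  show ?thesis unfolding residual_form_def by (intro tendsto_inner r x m y)
qed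

lemma test_stat_eq: "test_stat x N k = k_total k * residual_form (V_bar x N k) (hill_vec x N k) (hill_vec x N k)"
  by (simp add: test_stat_def mu_bar_def residual_form_def residual_def Let_def)

text \<open>Fitting a constant annihilates constants, so equal tail indices drop out and only the
  scaled estimation error is left.\<close>

lemma residual_form_shift:
  assumes "1 \<bullet> (matrix_inv B *v (1::('m::finite) rvec)) \<noteq> 0"
  shows "residual_form B (g *\<^sub>R 1 + t *\<^sub>R z) (g *\<^sub>R 1 + t *\<^sub>R z) = t\<^sup>2 * residual_form B z z"
proof -
  have "residual B (g *\<^sub>R 1 + t *\<^sub>R z) = t *\<^sub>R residual B z"
    using residual_const[OF assms, of g] by (simp add: linear_add[OF residual_linear] linear_cmul[OF residual_linear])
  then show ?thesis by (simp add: residual_form_def matrix_vector_mult_scaleR power2_eq_square)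
qed

text \<open>Subtracting a multiple of 1 keeps unequal coordinates unequal, so the residual is
  nonzero and the positive definite form detects it.\<close>

lemma residual_form_pos:
  fixes B :: "('m::finite) rmat"
  assumes B: "pos_def B" and z: "z $ j \<noteq> z $ l"
  shows "residual_form B z z > 0"
proof -
  define y where "y = matrix_inv B *v residual B z"
  have By: "B *v y = residual B z" unfolding y_def by (rule matrix_inv_mult_vec(2)[OF pos_def_det[OF B]])
  have "residual B z $ j \<noteq> residual B z $ l" using z by (simp add: residual_def)
  then have "residual B z \<noteq> 0" by auto
  then have "y \<noteq> 0" using By by auto
  then have "y \<bullet> (B *v y) > 0" by (rule pos_def_form(2)[OF B])
  then show ?thesis unfolding By by (simp add: residual_form_def y_def inner_commute)
qed

section \<open>Limits of the tail index and covariance estimators\<close>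

context tail_model
begin

definition k_sum :: "nat \<Rightarrow> real" where "k_sum n = k_total (k n)"

text \<open>The limit of the total k divided by k_j.\<close>

definition \<kappa> :: "'m \<Rightarrow> real" where "\<kappa> j = (\<Sum>l\<in>UNIV. c $ j / c $ l)"

text \<open>The limit covariance when all coordinates are normalised by the square root of the total
  k instead of their own k_j; this is the matrix that the plug-in estimators approach.\<close>

definition Sigma_mat :: "'m rmat" where
  "Sigma_mat = (\<chi> j l. (sqrt (\<kappa> j) * \<gamma> $ j) * (sqrt (\<kappa> l) * \<gamma> $ l) * corr_mat $ j $ l)"

definition scaled_error :: "nat \<Rightarrow> 'a \<Rightarrow> 'm rvec" where
  "scaled_error n w = sqrt (k_sum n) *\<^sub>R (hill_vec (\<lambda>i. X i w) (N n) (k n) - \<gamma>)"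

text \<open>The linear surrogate of y \<bullet> \<open>scaled_error\<close>: measurable for every
  \<open>n\<close>, and covered by \<open>joint_char\<close>.\<close>

definition lin_comb :: "'m rvec \<Rightarrow> nat \<Rightarrow> 'a \<Rightarrow> real" where
  "lin_comb y n w = (\<Sum>j\<in>UNIV. y $ j * (sqrt (\<kappa> j) * \<gamma> $ j) * margin.excess_sum j n w)"

lemma \<kappa>_eq: "\<kappa> j = c $ j * (\<Sum>l\<in>UNIV. 1 / c $ l)"
  by (simp add: \<kappa>_def sum_distrib_left)

lemma sum_inverse_c_pos: "(\<Sum>l\<in>UNIV. 1 / c $ l) > 0"
  by (rule sum_pos) (use c_range in auto)

lemma \<kappa>_pos: "\<kappa> j > 0"
  unfolding \<kappa>_eq using c_range[of j] sum_inverse_c_pos by simp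

lemma k_sum_ratio: "(\<lambda>n. k_sum n / real (k n j)) \<longlonglongrightarrow> \<kappa> j"
proof -
  have "(\<lambda>n. \<Sum>l\<in>UNIV. real (k n l) / real (k n j)) \<longlonglongrightarrow> \<kappa> j"
    unfolding \<kappa>_def by (intro tendsto_sum k_ratio)
  then show ?thesis by (simp add: k_sum_def k_total_def sum_divide_distrib)
qed

lemma k_sum_lim: "filterlim k_sum at_top sequentially"
proof (rule filterlim_at_top_mono)
  show "filterlim (\<lambda>n. real (k n (Min UNIV))) at_top sequentially" by (rule margin.k_real_lim)
  show "\<forall>\<^sub>F n in sequentially. real (k n (Min UNIV)) \<le> k_sum n"
    unfolding k_sum_def k_total_def by (intro always_eventually allI of_nat_mono member_le_sum) auto
qed

lemma k_sum_pos: "\<forall>\<^sub>F n in sequentially. k_sum n > 0"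
  using k_sum_lim by (simp add: filterlim_at_top_dense)

lemma Sigma_mat_eq_V: "Sigma_mat = (\<chi> j l. sqrt (\<kappa> j) * sqrt (\<kappa> l) * V_mat \<gamma> b c R $ j $ l)"
proof -
  have "V_mat \<gamma> b c R $ j $ l = \<gamma> $ j * \<gamma> $ l * corr_mat $ j $ l" for j l
    by (simp add: V_mat_def corr_mat_def sym_matrix_def power2_eq_square)
  then show ?thesis by (simp add: Sigma_mat_def vec_eq_iff)
qed

lemma pos_def_Sigma: "pos_def Sigma_mat"
  unfolding Sigma_mat_eq_V by (rule pos_def_diag_scaling[OF V]) (simp add: \<kappa>_pos)

lemma Sigma_orthonormal:
  obtains y :: "nat \<Rightarrow> 'm rvec" where "\<And>i. i < CARD('m) - 1 \<Longrightarrow> y i \<bullet> 1 = 0"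
    "\<And>i i'. i < CARD('m) - 1 \<Longrightarrow> i' < CARD('m) - 1 \<Longrightarrow> y i \<bullet> (Sigma_mat *v y i') = of_bool (i = i')"
proof -
  define S where "S = {x :: 'm rvec. x \<bullet> 1 = 0}"
  have "subspace S" by (auto simp: S_def subspace_def inner_add_left)
  moreover have "dim S = CARD('m) - 1" using dim_hyperplane[of "1::'m rvec"] by (simp add: S_def inner_commute vec_eq_iff)
  ultimately obtain y where "\<forall>i<CARD('m) - 1. y i \<in> S"
    "\<forall>i<CARD('m) - 1. \<forall>j<CARD('m) - 1. y i \<bullet> (Sigma_mat *v y j) = of_bool (i = j)"
    using pos_def_orthonormal_extend[OF pos_def_Sigma, of S "CARD('m) - 1"] by auto
  then show thesis by (intro that[of y]) (simp_all add: S_def)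
qed

lemma one_Sigma: "1 \<bullet> (matrix_inv Sigma_mat *v (1::'m rvec)) > 0"
  by (rule Sigma_orthonormal) (rule pos_def_generalised_distance(2)[OF pos_def_Sigma])

lemma hill_tendsto: "((\<lambda>x. hill_vec (\<lambda>i. X i (snd x)) (N (fst x)) (k (fst x)) $ j) \<longlongrightarrow> \<gamma> $ j) (whp M)"
proof -
  let ?h = "\<lambda>x. hill_vec (\<lambda>i. X i (snd x)) (N (fst x)) (k (fst x)) $ j"
  have "bdd_prob M (\<lambda>x. \<gamma> $ j * margin.excess_sum j (fst x) (snd x))"
    by (intro bdd_prob_mult bdd_prob_tendsto[OF tendsto_const] bdd_prob_excess_sum)
  then have "bdd_prob M (\<lambda>x. sqrt (k (fst x) j) * (?h x - \<gamma> $ j))"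
    by (rule bdd_prob_close[OF _ hill_linearised])
  from tendsto_mult_bdd_prob[OF tendsto_whp_fst[OF margin.inverse_sqrt_k] this]
  have "((\<lambda>x. 1 / sqrt (k (fst x) j) * (sqrt (k (fst x) j) * (?h x - \<gamma> $ j)) + \<gamma> $ j) \<longlongrightarrow> 0 + \<gamma> $ j) (whp M)"
    by (intro tendsto_add tendsto_const)
  then have "((\<lambda>x. 1 / sqrt (k (fst x) j) * (sqrt (k (fst x) j) * (?h x - \<gamma> $ j)) + \<gamma> $ j) \<longlongrightarrow> \<gamma> $ j) (whp M)" by simp
  then show ?thesis
    by (rule Lim_transform_eventually)
      (use eventually_whp_fst[OF margin.k_less_N[of j]] in \<open>eventually_elim, simp\<close>)
qed

lemma hill_vec_tendsto: "((\<lambda>x. hill_vec (\<lambda>i. X i (snd x)) (N (fst x)) (k (fst x))) \<longlongrightarrow> \<gamma>) (whp M)"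
  by (rule vec_tendstoI) (rule hill_tendsto)

lemma scaled_error_linearised:
  "((\<lambda>x. scaled_error (fst x) (snd x) $ j - sqrt (\<kappa> j) * \<gamma> $ j * margin.excess_sum j (fst x) (snd x)) \<longlongrightarrow> 0) (whp M)"
proof -
  let ?h = "\<lambda>x. hill_vec (\<lambda>i. X i (snd x)) (N (fst x)) (k (fst x)) $ j"
  let ?L = "\<lambda>x. margin.excess_sum j (fst x) (snd x)"
  let ?q = "\<lambda>n. sqrt (k_sum n / real (k n j))"
  have q: "?q \<longlonglongrightarrow> sqrt (\<kappa> j)" by (intro tendsto_intros k_sum_ratio)
  have q0: "(\<lambda>n. ?q n - sqrt (\<kappa> j)) \<longlonglongrightarrow> 0" using tendsto_diff[OF q tendsto_const[of "sqrt (\<kappa> j)"]] by simp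
  have Lb: "bdd_prob M (\<lambda>x. \<gamma> $ j * ?L x)"
    by (intro bdd_prob_mult bdd_prob_tendsto[OF tendsto_const] bdd_prob_excess_sum)
  have "((\<lambda>x. ?q (fst x) * (sqrt (k (fst x) j) * (?h x - \<gamma> $ j) - \<gamma> $ j * ?L x) + (?q (fst x) - sqrt (\<kappa> j)) * (\<gamma> $ j * ?L x)) \<longlongrightarrow> sqrt (\<kappa> j) * 0 + 0) (whp M)"
    by (intro tendsto_add tendsto_mult tendsto_whp_fst[OF q] hill_linearised tendsto_mult_bdd_prob[OF tendsto_whp_fst[OF q0] Lb])
  then have "((\<lambda>x. ?q (fst x) * (sqrt (k (fst x) j) * (?h x - \<gamma> $ j) - \<gamma> $ j * ?L x) + (?q (fst x) - sqrt (\<kappa> j)) * (\<gamma> $ j * ?L x)) \<longlongrightarrow> 0) (whp M)"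
    by simp
  then show ?thesis
  proof (rule Lim_transform_eventually)
    show "\<forall>\<^sub>F x in whp M. ?q (fst x) * (sqrt (k (fst x) j) * (?h x - \<gamma> $ j) - \<gamma> $ j * ?L x) + (?q (fst x) - sqrt (\<kappa> j)) * (\<gamma> $ j * ?L x) =
       scaled_error (fst x) (snd x) $ j - sqrt (\<kappa> j) * \<gamma> $ j * ?L x"
      using eventually_whp_fst[OF margin.k_less_N[of j]]
    proof eventually_elim
      case (elim x)
      have q: "?q (fst x) * sqrt (k (fst x) j) = sqrt (k_sum (fst x))" using elim by (simp add: real_sqrt_mult[symmetric])
      have "?q (fst x) * (sqrt (k (fst x) j) * (?h x - \<gamma> $ j)) = sqrt (k_sum (fst x)) * (?h x - \<gamma> $ j)"
        unfolding q[symmetric] by (rule mult.assoc[symmetric])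
      then show ?case by (simp only: scaled_error_def vector_scaleR_component vector_minus_component right_diff_distrib left_diff_distrib) (simp add: algebra_simps)
    qed
  qed
qed

lemma scaled_error_bdd: "bdd_prob M (\<lambda>x. scaled_error (fst x) (snd x) $ j)"
proof (rule bdd_prob_close[OF _ scaled_error_linearised])
  show "bdd_prob M (\<lambda>x. sqrt (\<kappa> j) * \<gamma> $ j * margin.excess_sum j (fst x) (snd x))"
    by (intro bdd_prob_mult bdd_prob_tendsto[OF tendsto_const] bdd_prob_excess_sum)
qed

lemma inner_scaled_error_bdd: "bdd_prob M (\<lambda>x. y \<bullet> scaled_error (fst x) (snd x))"
  unfolding inner_vec_def inner_real_def
  by (intro bdd_prob_sum bdd_prob_mult bdd_prob_tendsto[OF tendsto_const] scaled_error_bdd)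

lemma inner_scaled_error_linearised:
  "((\<lambda>x. y \<bullet> scaled_error (fst x) (snd x) - lin_comb y (fst x) (snd x)) \<longlongrightarrow> 0) (whp M)"
proof -
  have "((\<lambda>x. \<Sum>j\<in>UNIV. y $ j * (scaled_error (fst x) (snd x) $ j - sqrt (\<kappa> j) * \<gamma> $ j * margin.excess_sum j (fst x) (snd x))) \<longlongrightarrow> (\<Sum>j\<in>UNIV. y $ j * 0)) (whp M)"
    by (intro tendsto_sum tendsto_mult_left scaled_error_linearised)
  then show ?thesis
    by (simp add: inner_vec_def lin_comb_def right_diff_distrib sum_subtractf mult.assoc)
qed

text \<open>A difference of squares is a vanishing difference times a tight sum.\<close>

lemma inner_scaled_error_square:
  "((\<lambda>x. (y \<bullet> scaled_error (fst x) (snd x))\<^sup>2 - (lin_comb y (fst x) (snd x))\<^sup>2) \<longlongrightarrow> 0) (whp M)"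
proof -
  let ?Z = "\<lambda>x. y \<bullet> scaled_error (fst x) (snd x)" and ?W = "\<lambda>x. lin_comb y (fst x) (snd x)"
  have "((\<lambda>x. - (?Z x - ?W x)) \<longlongrightarrow> - 0) (whp M)" by (intro tendsto_minus inner_scaled_error_linearised)
  then have "((\<lambda>x. ?W x - ?Z x) \<longlongrightarrow> 0) (whp M)" by simp
  then have "bdd_prob M ?W" by (rule bdd_prob_close[OF inner_scaled_error_bdd])
  then have "bdd_prob M (\<lambda>x. ?Z x + ?W x)" by (rule bdd_prob_add[OF inner_scaled_error_bdd])
  from tendsto_mult_bdd_prob[OF inner_scaled_error_linearised this] show ?thesis
    by (simp add: power2_eq_square square_diff_square_factored mult.commute)
qed

lemma lin_comb_measurable: "lin_comb y n \<in> borel_measurable M"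
proof -
  note [measurable] = margin.excess_sum_measurable
  show ?thesis unfolding lin_comb_def[abs_def] by measurable
qed

text \<open>A combination of the forms y i with weights x i is again a form in the excess sums, of
  limiting variance v \<bullet> Sigma v; orthonormality reduces this to the sum of the squares of
  the x i.\<close>

lemma lin_comb_chi_square:
  assumes on: "\<And>i i'. i < d \<Longrightarrow> i' < d \<Longrightarrow> y i \<bullet> (Sigma_mat *v y i') = of_bool (i = i')" and d: "d > 0"
  shows "(\<lambda>n. prob {w \<in> space M. (\<Sum>i<d. (lin_comb (y i) n w)\<^sup>2) \<le> q}) \<longlonglongrightarrow> cdf (chi_square d) q"
proof -
  have "weak_conv_m (\<lambda>n. distr M borel (\<lambda>w. \<Sum>i<d. (lin_comb (y i) n w)\<^sup>2)) (chi_square d)"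
  proof (rule sum_squares_weak_conv_chi_square[OF lin_comb_measurable])
    fix x :: "nat \<Rightarrow> real"
    define v where "v = (\<Sum>i<d. x i *\<^sub>R y i)"
    define a where "a j = v $ j * (sqrt (\<kappa> j) * \<gamma> $ j)" for j
    have "(\<Sum>i<d. x i * lin_comb (y i) n w) = (\<Sum>j\<in>UNIV. a j * margin.excess_sum j n w)" for n w
      unfolding lin_comb_def a_def v_def
      by (simp add: sum_distrib_left sum_distrib_right mult.assoc) (subst sum.swap, simp)
    moreover have "(\<Sum>j\<in>UNIV. \<Sum>l\<in>UNIV. a j * a l * corr_mat $ j $ l) = v \<bullet> (Sigma_mat *v v)"
      by (simp add: a_def Sigma_mat_def inner_vec_def matrix_vector_mult_def sum_distrib_left mult_ac)
    moreover have "v \<bullet> (Sigma_mat *v v) = (\<Sum>i<d. (x i)\<^sup>2)"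
    proof -
      have "v \<bullet> (Sigma_mat *v v) = (\<Sum>i<d. \<Sum>i'<d. x i * x i' * (y i \<bullet> (Sigma_mat *v y i')))"
        unfolding v_def
        by (simp add: linear_sum[OF matrix_vector_mul_linear] matrix_vector_mult_scaleR inner_sum_left inner_sum_right sum_distrib_left mult_ac)
          (subst sum.swap, simp add: mult.left_commute)
      also have "\<dots> = (\<Sum>i<d. \<Sum>i'<d. if i = i' then (x i)\<^sup>2 else 0)"
        by (intro sum.cong refl) (simp add: on power2_eq_square)
      also have "\<dots> = (\<Sum>i<d. (x i)\<^sup>2)" by simp
      finally show ?thesis .
    qed
    ultimately show "(\<lambda>n. expectation (\<lambda>w. iexp (\<Sum>i<d. x i * lin_comb (y i) n w))) \<longlonglongrightarrow> exp (- (\<Sum>i<d. (x i)\<^sup>2) / 2)"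
      using joint_char[of a] by simp
  qed
  then have "(\<lambda>n. cdf (distr M borel (\<lambda>w. \<Sum>i<d. (lin_comb (y i) n w)\<^sup>2)) q) \<longlonglongrightarrow> cdf (chi_square d) q"
    using isCont_cdf_chi_square[OF d] by (auto simp: weak_conv_m_def weak_conv_def)
  moreover have "cdf (distr M borel (\<lambda>w. \<Sum>i<d. (lin_comb (y i) n w)\<^sup>2)) q = prob {w \<in> space M. (\<Sum>i<d. (lin_comb (y i) n w)\<^sup>2) \<le> q}" for n
  proof -
    have m: "(\<lambda>w. \<Sum>i<d. (lin_comb (y i) n w)\<^sup>2) \<in> borel_measurable M"
      using lin_comb_measurable by measurable
    show ?thesis unfolding cdf_def by (subst measure_distr[OF m]) (auto intro: arg_cong[of _ _ prob])
  qed
  ultimately show ?thesis by simp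
qed

text \<open>Serves both covariance estimators, which differ only in the plugged-in tail index
  \<open>h\<close>: the estimator of each margin, or one pooled value for all.\<close>

lemma sym_estimate_tendsto:
  fixes g h :: "nat \<times> 'a \<Rightarrow> 'm \<Rightarrow> real"
  assumes g: "\<And>j. ((\<lambda>x. h x j) \<longlongrightarrow> \<gamma> $ j) (whp M)"
    and W: "\<And>x. W x = sym_matrix (\<lambda>j. k_sum (fst x) * (h x j)\<^sup>2 / real (k (fst x) j))
      (\<lambda>j l. k_sum (fst x) * h x j * h x l * (1 / real (k (fst x) j)) *
        tail_copula_est (\<lambda>i. X i (snd x)) (N (fst x)) (k (fst x)) j l (real (k (fst x) j) / real (k (fst x) l)) (real (N (fst x) j) / real (N (fst x) l)))"
  shows "(W \<longlongrightarrow> Sigma_mat) (whp M)"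
proof -
  let ?T = "\<lambda>x j l. tail_copula_est (\<lambda>i. X i (snd x)) (N (fst x)) (k (fst x)) j l (real (k (fst x) j) / real (k (fst x) l)) (real (N (fst x) j) / real (N (fst x) l))"
  have k_sum: "((\<lambda>x. k_sum (fst x) / real (k (fst x) j)) \<longlongrightarrow> \<kappa> j) (whp M)" for j
    by (rule tendsto_whp_fst[OF k_sum_ratio])
  have diag: "((\<lambda>x. k_sum (fst x) * (h x j)\<^sup>2 / real (k (fst x) j)) \<longlongrightarrow> Sigma_mat $ j $ j) (whp M)" for j
  proof -
    have "((\<lambda>x. k_sum (fst x) / real (k (fst x) j) * (h x j)\<^sup>2) \<longlongrightarrow> \<kappa> j * (\<gamma> $ j)\<^sup>2) (whp M)"
      by (intro tendsto_mult k_sum tendsto_power g)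
    moreover have "Sigma_mat $ j $ j = \<kappa> j * (\<gamma> $ j)\<^sup>2"
      using \<kappa>_pos[of j] by (simp add: Sigma_mat_def corr_mat_def sym_matrix_def power2_eq_square)
    ultimately show ?thesis by simp
  qed
  have off: "((\<lambda>x. k_sum (fst x) * h x j * h x l * (1 / real (k (fst x) j)) * ?T x j l) \<longlongrightarrow> Sigma_mat $ j $ l) (whp M)" if jl: "j < l" for j l
  proof -
    let ?R = "R j l (ennreal (c $ l / c $ j)) (ennreal (b $ l / b $ j))"
    have "((\<lambda>x. k_sum (fst x) / real (k (fst x) j) * h x j * h x l * ?T x j l) \<longlongrightarrow> \<kappa> j * \<gamma> $ j * \<gamma> $ l * ?R) (whp M)"
      by (intro tendsto_mult k_sum g tail_copula_est_tendsto jl)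
    \<comment> \<open>As \<kappa>_j / \<kappa>_l = c_j / c_l, the product of the three square roots
      collapses to \<kappa>_j, which matches the asymmetric factor k / k_j in the estimator.\<close>
    moreover have "Sigma_mat $ j $ l = \<kappa> j * \<gamma> $ j * \<gamma> $ l * ?R"
    proof -
      have p: "c $ j > 0" "c $ l > 0" using c_range by auto
      have "sqrt (\<kappa> j) * sqrt (\<kappa> l) * sqrt (c $ j / c $ l) = sqrt (\<kappa> j * \<kappa> l * (c $ j / c $ l))"
        by (simp only: real_sqrt_mult)
      also have "\<kappa> j * \<kappa> l * (c $ j / c $ l) = (\<kappa> j)\<^sup>2"
        using p by (simp add: \<kappa>_eq power2_eq_square)
      finally have "sqrt (\<kappa> j) * sqrt (\<kappa> l) * sqrt (c $ j / c $ l) = \<kappa> j" using \<kappa>_pos[of j] by simp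
      moreover have "Sigma_mat $ j $ l = (sqrt (\<kappa> j) * sqrt (\<kappa> l) * sqrt (c $ j / c $ l)) * \<gamma> $ j * \<gamma> $ l * ?R"
        using jl by (simp add: Sigma_mat_def corr_mat_def sym_matrix_def)
      ultimately show ?thesis by (simp only:)
    qed
    ultimately show ?thesis by (simp add: mult_ac)
  qed
  have Ss: "Sigma_mat $ l $ j = Sigma_mat $ j $ l" for j l
    unfolding Sigma_mat_def by (simp add: corr_mat_sym[of l j] mult_ac)
  show ?thesis
  proof (intro vec_tendstoI)
    fix j l
    show "((\<lambda>x. W x $ j $ l) \<longlongrightarrow> Sigma_mat $ j $ l) (whp M)"
    proof (cases j l rule: linorder_cases)
      case less
      then have "W x $ j $ l = k_sum (fst x) * h x j * h x l * (1 / real (k (fst x) j)) * ?T x j l" for x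
        unfolding W sym_matrix_def vec_lambda_beta by (auto dest: less_asym)
      then show ?thesis by (simp only: off[OF less])
    next
      case equal
      then have "W x $ j $ l = k_sum (fst x) * (h x j)\<^sup>2 / real (k (fst x) j)" for x
        unfolding W sym_matrix_def vec_lambda_beta by (auto dest: less_asym)
      then show ?thesis by (simp only: diag equal)
    next
      case greater
      then have "W x $ j $ l = k_sum (fst x) * h x l * h x j * (1 / real (k (fst x) l)) * ?T x l j" for x
        unfolding W sym_matrix_def vec_lambda_beta by (auto dest: less_asym)
      then show ?thesis by (simp only: off[OF greater] Ss[of j l])
    qed
  qed
qed

lemma V_bar_tendsto: "((\<lambda>x. V_bar (\<lambda>i. X i (snd x)) (N (fst x)) (k (fst x))) \<longlongrightarrow> Sigma_mat) (whp M)"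
  by (rule sym_estimate_tendsto[OF hill_tendsto]) (simp add: V_bar_def k_sum_def)

lemma V_hat_tendsto:
  assumes \<omega>\<^sub>0: "\<omega>\<^sub>0 \<bullet> 1 = 1" and \<gamma>: "\<gamma> = g *\<^sub>R 1"
  shows "((\<lambda>x. V_hat \<omega>\<^sub>0 (\<lambda>i. X i (snd x)) (N (fst x)) (k (fst x))) \<longlongrightarrow> Sigma_mat) (whp M)"
proof (rule sym_estimate_tendsto[where h = "\<lambda>x j. pooled_hill (\<lambda>i. X i (snd x)) (N (fst x)) (k (fst x)) \<omega>\<^sub>0"])
  fix j
  have "((\<lambda>x. pooled_hill (\<lambda>i. X i (snd x)) (N (fst x)) (k (fst x)) \<omega>\<^sub>0) \<longlongrightarrow> \<omega>\<^sub>0 \<bullet> \<gamma>) (whp M)"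
    unfolding pooled_hill_def by (intro tendsto_intros hill_vec_tendsto)
  moreover have "\<omega>\<^sub>0 \<bullet> \<gamma> = \<gamma> $ j" using \<omega>\<^sub>0 by (simp add: \<gamma>)
  ultimately show "((\<lambda>x. pooled_hill (\<lambda>i. X i (snd x)) (N (fst x)) (k (fst x)) \<omega>\<^sub>0) \<longlongrightarrow> \<gamma> $ j) (whp M)" by simp
qed (simp add: V_hat_def k_sum_def power2_eq_square mult.assoc)

section \<open>Measurability of the estimators for large n\<close>

lemma X_component_measurable: "i \<ge> 1 \<Longrightarrow> (\<lambda>w. X i w $ j) \<in> borel_measurable M"
  using measurable_compose[OF X_measurable component_measurable] by simp

lemma all_k_less_N: "\<forall>\<^sub>F n in sequentially. \<forall>j. k n j < N n j"
proof -
  have "\<forall>\<^sub>F n in sequentially. \<forall>j\<in>UNIV. k n j < N n j"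
    by (intro eventually_ball_finite ballI eventually_mono[OF margin.k_less_N]) auto
  then show ?thesis by simp
qed

lemma hill_measurable:
  assumes "\<forall>j. k n j < N n j"
  shows "(\<lambda>w. hill_vec (\<lambda>i. X i w) (N n) (k n) $ j) \<in> borel_measurable M"
  unfolding hill_vec_def vec_lambda_beta
  by (rule measurable_hill[where f = "\<lambda>i w. X i w $ j"]) (use assms X_component_measurable in auto)

lemma estimate_measurable:
  assumes "\<forall>j. k n j < N n j"
  shows "(\<lambda>w. V_bar (\<lambda>i. X i w) (N n) (k n) $ j $ l) \<in> borel_measurable M"
    and "(\<lambda>w. V_hat \<omega>\<^sub>0 (\<lambda>i. X i w) (N n) (k n) $ j $ l) \<in> borel_measurable M"
    and "(\<lambda>w. pooled_hill (\<lambda>i. X i w) (N n) (k n) \<omega>\<^sub>0) \<in> borel_measurable M"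
proof -
  note [measurable] = hill_measurable[OF assms] measurable_tail_copula_est[OF X_component_measurable]
  show p[measurable]: "(\<lambda>w. pooled_hill (\<lambda>i. X i w) (N n) (k n) \<omega>\<^sub>0) \<in> borel_measurable M"
    unfolding pooled_hill_def inner_vec_def inner_real_def by measurable
  show "(\<lambda>w. V_bar (\<lambda>i. X i w) (N n) (k n) $ j $ l) \<in> borel_measurable M"
    unfolding V_bar_def sym_matrix_def vec_lambda_beta
    by (cases j l rule: linorder_cases) (simp_all, measurable)
  show "(\<lambda>w. V_hat \<omega>\<^sub>0 (\<lambda>i. X i w) (N n) (k n) $ j $ l) \<in> borel_measurable M"
    unfolding V_hat_def sym_matrix_def vec_lambda_beta
    by (cases j l rule: linorder_cases) (simp_all, measurable)
qed

lemma test_stat_measurable: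
  assumes kN: "\<forall>j. k n j < N n j"
  shows "(\<lambda>w. test_stat (\<lambda>i. X i w) (N n) (k n)) \<in> borel_measurable M"
proof -
  let ?h = "\<lambda>w. hill_vec (\<lambda>i. X i w) (N n) (k n)" and ?V = "\<lambda>w. V_bar (\<lambda>i. X i w) (N n) (k n)"
  have inv: "(\<lambda>w. (matrix_inv (?V w) *v b w) $ j) \<in> borel_measurable M"
    if "\<And>i. (\<lambda>w. b w $ i) \<in> borel_measurable M" for b j
    by (rule measurable_matrix_inv_mult[OF estimate_measurable(1)[OF kN] that])
  note [measurable] = hill_measurable[OF kN]
  have [measurable]: "(\<lambda>w. (matrix_inv (?V w) *v ?h w) $ j) \<in> borel_measurable M" for j by (rule inv) measurable
  have [measurable]: "(\<lambda>w. (matrix_inv (?V w) *v 1) $ j) \<in> borel_measurable M" for j by (rule inv) measurable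
  have r[measurable]: "(\<lambda>w. residual (?V w) (?h w) $ j) \<in> borel_measurable M" for j
    unfolding residual_def inner_vec_def inner_real_def vector_minus_component vector_scaleR_component by measurable
  have [measurable]: "(\<lambda>w. (matrix_inv (?V w) *v residual (?V w) (?h w)) $ j) \<in> borel_measurable M" for j by (rule inv) (rule r)
  show ?thesis unfolding test_stat_eq residual_form_def inner_vec_def inner_real_def by measurable
qed

section \<open>Level, consistency and coverage\<close>

lemma one_V_bar: "\<forall>\<^sub>F x in whp M. 1 \<bullet> (matrix_inv (V_bar (\<lambda>i. X i (snd x)) (N (fst x)) (k (fst x))) *v (1::'m rvec)) \<noteq> 0"
proof (rule tendsto_imp_eventually_ne)
  show "((\<lambda>x. 1 \<bullet> (matrix_inv (V_bar (\<lambda>i. X i (snd x)) (N (fst x)) (k (fst x))) *v (1::'m rvec))) \<longlongrightarrow> 1 \<bullet> (matrix_inv Sigma_mat *v 1)) (whp M)"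
    by (intro tendsto_inner tendsto_const tendsto_matrix_inv_mult V_bar_tendsto pos_def_det[OF pos_def_Sigma])
  show "1 \<bullet> (matrix_inv Sigma_mat *v (1::'m rvec)) \<noteq> 0" using one_Sigma by simp
qed

text \<open>Under equal tail indices the statistic is the residual form of the scaled error.
  Replacing the estimated matrix by its limit splits the form into m - 1 squares, and each of these
  may be replaced by its linear surrogate.\<close>

lemma test_stat_null:
  assumes m: "CARD('m) \<ge> 2" and \<gamma>: "\<gamma> = g *\<^sub>R 1" and \<alpha>: "0 < \<alpha>" "\<alpha> < 1"
  shows "(\<lambda>n. prob {w \<in> space M. test_stat (\<lambda>i. X i w) (N n) (k n) > quantile (chi_square (CARD('m) - 1)) (1 - \<alpha>)}) \<longlonglongrightarrow> \<alpha>"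
proof -
  let ?d = "CARD('m) - 1"
  define q where "q = quantile (chi_square ?d) (1 - \<alpha>)"
  have d: "?d > 0" using m by simp
  obtain y where yS: "\<And>i. i < ?d \<Longrightarrow> y i \<bullet> 1 = 0"
    and on: "\<And>i i'. i < ?d \<Longrightarrow> i' < ?d \<Longrightarrow> y i \<bullet> (Sigma_mat *v y i') = of_bool (i = i')"
    by (rule Sigma_orthonormal) blast
  let ?V = "\<lambda>x. V_bar (\<lambda>i. X i (snd x)) (N (fst x)) (k (fst x))"
  let ?Z = "\<lambda>x. scaled_error (fst x) (snd x)"
  let ?W = "\<lambda>x. \<Sum>i<?d. (lin_comb (y i) (fst x) (snd x))\<^sup>2"
  let ?T = "\<lambda>x. test_stat (\<lambda>i. X i (snd x)) (N (fst x)) (k (fst x))"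
  have eq: "\<forall>\<^sub>F x in whp M. ?T x = residual_form (?V x) (?Z x) (?Z x)"
    using one_V_bar eventually_whp_fst[OF k_sum_pos]
  proof eventually_elim
    case (elim x)
    let ?t = "1 / sqrt (k_sum (fst x))"
    let ?h = "hill_vec (\<lambda>i. X i (snd x)) (N (fst x)) (k (fst x))"
    have h: "?h = \<gamma> + ?t *\<^sub>R ?Z x"
      using elim by (simp add: scaled_error_def)
    have "residual_form (?V x) ?h ?h = ?t\<^sup>2 * residual_form (?V x) (?Z x) (?Z x)"
      unfolding h by (rule residual_form_shift[OF elim(1), of g, folded \<gamma>])
    then show ?case unfolding test_stat_eq using elim(2) by (simp add: k_sum_def power_divide)
  qed
  have lim1: "((\<lambda>x. residual_form (?V x) (?Z x) (?Z x) - residual_form Sigma_mat (?Z x) (?Z x)) \<longlongrightarrow> 0) (whp M)"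
  proof -
    have "((\<lambda>x. \<Sum>j\<in>UNIV. \<Sum>l\<in>UNIV. (residual_form (?V x) (axis j 1) (axis l 1) - residual_form Sigma_mat (axis j 1) (axis l 1)) * (?Z x $ j * ?Z x $ l)) \<longlongrightarrow> (\<Sum>j\<in>(UNIV::'m set). \<Sum>l\<in>(UNIV::'m set). 0)) (whp M)"
    proof (intro tendsto_sum tendsto_mult_bdd_prob bdd_prob_mult scaled_error_bdd)
      fix j l :: 'm
      have "((\<lambda>x. residual_form (?V x) (axis j 1) (axis l 1)) \<longlongrightarrow> residual_form Sigma_mat (axis j 1) (axis l 1)) (whp M)"
        using one_Sigma by (intro tendsto_residual_form V_bar_tendsto tendsto_const pos_def_Sigma) simp
      then show "((\<lambda>x. residual_form (?V x) (axis j 1) (axis l 1) - residual_form Sigma_mat (axis j 1) (axis l 1)) \<longlongrightarrow> 0) (whp M)"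
        by (simp add: LIM_zero)
    qed
    moreover have "residual_form (?V x) (?Z x) (?Z x) - residual_form Sigma_mat (?Z x) (?Z x) =
      (\<Sum>j\<in>UNIV. \<Sum>l\<in>UNIV. (residual_form (?V x) (axis j 1) (axis l 1) - residual_form Sigma_mat (axis j 1) (axis l 1)) * (?Z x $ j * ?Z x $ l))" for x
      unfolding residual_form_expand[of "?V x" "?Z x"] residual_form_expand[of Sigma_mat "?Z x"] sum_subtractf[symmetric]
      by (intro sum.cong refl) (simp add: algebra_simps)
    ultimately show ?thesis by simp
  qed
  have dist: "residual_form Sigma_mat z z = (\<Sum>i<?d. (y i \<bullet> z)\<^sup>2)" for z
    unfolding residual_form_def residual_def
    by (rule pos_def_generalised_distance(1)[OF pos_def_Sigma yS on])
  have "((\<lambda>x. \<Sum>i<?d. (y i \<bullet> ?Z x)\<^sup>2 - (lin_comb (y i) (fst x) (snd x))\<^sup>2) \<longlongrightarrow> (\<Sum>i<?d. 0)) (whp M)"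
    by (intro tendsto_sum inner_scaled_error_square)
  then have lim2: "((\<lambda>x. residual_form Sigma_mat (?Z x) (?Z x) - ?W x) \<longlongrightarrow> 0) (whp M)"
    unfolding dist by (simp add: sum_subtractf)
  have lim: "((\<lambda>x. ?T x - ?W x) \<longlongrightarrow> 0) (whp M)"
  proof -
    have "((\<lambda>x. (residual_form (?V x) (?Z x) (?Z x) - residual_form Sigma_mat (?Z x) (?Z x)) + (residual_form Sigma_mat (?Z x) (?Z x) - ?W x)) \<longlongrightarrow> 0 + 0) (whp M)"
      by (intro tendsto_add lim1 lim2)
    then have "((\<lambda>x. residual_form (?V x) (?Z x) (?Z x) - ?W x) \<longlongrightarrow> 0) (whp M)" by simp
    then show ?thesis by (rule Lim_transform_eventually) (use eq in \<open>eventually_elim, simp\<close>)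
  qed
  have "(\<lambda>n. prob {w \<in> space M. test_stat (\<lambda>i. X i w) (N n) (k n) \<le> q}) \<longlonglongrightarrow> cdf (chi_square ?d) q"
  proof (rule slutsky_cdf[where Y = "\<lambda>n w. \<Sum>i<?d. (lin_comb (y i) n w)\<^sup>2", OF _ lin_comb_chi_square[OF on d] isCont_cdf_chi_square[OF d] lim])
    show "(\<lambda>w. \<Sum>i<?d. (lin_comb (y i) n w)\<^sup>2) \<in> borel_measurable M" for n
      using lin_comb_measurable by measurable
    show "\<forall>\<^sub>F n in sequentially. {w \<in> space M. test_stat (\<lambda>i. X i w) (N n) (k n) \<le> q} \<in> events"
      using all_k_less_N
    proof eventually_elim
      case (elim n)
      note [measurable] = test_stat_measurable[OF elim]
      show ?case by measurable
    qed
    show "\<forall>\<^sub>F x in whp M. snd x \<in> {w \<in> space M. test_stat (\<lambda>i. X i w) (N (fst x)) (k (fst x)) \<le> q} \<longleftrightarrow> ?T x \<le> q"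
      using eventually_whp_space by eventually_elim simp
  qed
  then have "(\<lambda>n. 1 - prob {w \<in> space M. test_stat (\<lambda>i. X i w) (N n) (k n) \<le> q}) \<longlonglongrightarrow> 1 - cdf (chi_square ?d) q"
    by (intro tendsto_diff tendsto_const)
  moreover have "cdf (chi_square ?d) q = 1 - \<alpha>"
    unfolding q_def by (rule cdf_quantile[OF chi_square_real_distribution isCont_cdf_chi_square[OF d]]) (use \<alpha> in auto)
  ultimately have "(\<lambda>n. 1 - prob {w \<in> space M. test_stat (\<lambda>i. X i w) (N n) (k n) \<le> q}) \<longlonglongrightarrow> \<alpha>" by simp
  \<comment> \<open>The limit was obtained for the event \<le> q, as distribution functions require;
    passing to the complement uses measurability of the statistic, which holds for all large
    n.\<close>
  then have "(\<lambda>n. prob {w \<in> space M. test_stat (\<lambda>i. X i w) (N n) (k n) > q}) \<longlonglongrightarrow> \<alpha>"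
  proof (rule Lim_transform_eventually)
    show "\<forall>\<^sub>F n in sequentially. 1 - prob {w \<in> space M. test_stat (\<lambda>i. X i w) (N n) (k n) \<le> q} = prob {w \<in> space M. test_stat (\<lambda>i. X i w) (N n) (k n) > q}"
      using all_k_less_N
    proof eventually_elim
      case (elim n)
      note [measurable] = test_stat_measurable[OF elim]
      have "prob (space M - {w \<in> space M. test_stat (\<lambda>i. X i w) (N n) (k n) \<le> q}) = 1 - prob {w \<in> space M. test_stat (\<lambda>i. X i w) (N n) (k n) \<le> q}"
        by (rule prob_compl) measurable
      moreover have "space M - {w \<in> space M. test_stat (\<lambda>i. X i w) (N n) (k n) \<le> q} = {w \<in> space M. test_stat (\<lambda>i. X i w) (N n) (k n) > q}" by auto
      ultimately show ?case by simp
    qed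
  qed
  then show ?thesis unfolding q_def .
qed

text \<open>The residual form tends to a positive number while its factor, the total k,
  diverges.\<close>

lemma test_stat_alternative:
  assumes "\<gamma> $ j \<noteq> \<gamma> $ l"
  shows "tendsto_in_prob_at_top M (\<lambda>n w. test_stat (\<lambda>i. X i w) (N n) (k n))"
proof (rule tendsto_in_prob_at_topI)
  show "\<forall>\<^sub>F n in sequentially. (\<lambda>w. test_stat (\<lambda>i. X i w) (N n) (k n)) \<in> borel_measurable M"
    using all_k_less_N by eventually_elim (rule test_stat_measurable)
  let ?V = "\<lambda>x. V_bar (\<lambda>i. X i (snd x)) (N (fst x)) (k (fst x))"
  let ?h = "\<lambda>x. hill_vec (\<lambda>i. X i (snd x)) (N (fst x)) (k (fst x))"
  have "((\<lambda>x. residual_form (?V x) (?h x) (?h x)) \<longlongrightarrow> residual_form Sigma_mat \<gamma> \<gamma>) (whp M)"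
    using one_Sigma by (intro tendsto_residual_form V_bar_tendsto hill_vec_tendsto pos_def_Sigma) simp
  from filterlim_tendsto_pos_mult_at_top[OF this residual_form_pos[OF pos_def_Sigma assms] filterlim_compose[OF k_sum_lim filterlim_fst_whp]]
  show "filterlim (\<lambda>x. test_stat (\<lambda>i. X i (snd x)) (N (fst x)) (k (fst x))) at_top (whp M)"
    unfolding test_stat_eq by (simp add: k_sum_def mult.commute)
qed

text \<open>Coverage means that the square of the studentised error is at most z^2, so the
  chi-square limit with one degree of freedom applies.\<close>

lemma confidence_interval:
  assumes \<omega>\<^sub>0: "\<omega>\<^sub>0 \<bullet> 1 = 1" and g: "\<gamma> = g *\<^sub>R 1"
    and \<omega>m: "\<And>n. \<omega>hat n \<in> borel_measurable M" and \<omega>1: "\<And>n w. w \<in> space M \<Longrightarrow> \<omega>hat n w \<bullet> 1 = 1"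
    and \<omega>lim: "tendsto_in_prob M \<omega>hat \<omega>" and \<alpha>: "0 < \<alpha>" "\<alpha> < 1"
  shows "(\<lambda>n. prob {w \<in> space M.
     let est = pooled_hill (\<lambda>i. X i w) (N n) (k n) (\<omega>hat n w);
         h = quantile std_normal_distribution (1 - \<alpha> / 2) *
             sqrt (\<omega>hat n w \<bullet> (V_hat \<omega>\<^sub>0 (\<lambda>i. X i w) (N n) (k n) *v \<omega>hat n w) / k_total (k n))
     in g \<in> {est - h .. est + h}}) \<longlonglongrightarrow> 1 - \<alpha>"
proof -
  define z where "z = quantile std_normal_distribution (1 - \<alpha> / 2)"
  have z: "z > 0" "measure std_normal_distribution {-z..z} = 1 - \<alpha>"
    using std_normal_two_sided[OF \<alpha>] by (auto simp: z_def)
  let ?\<omega> = "\<lambda>x. \<omega>hat (fst x) (snd x)"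
  let ?Z = "\<lambda>x. scaled_error (fst x) (snd x)"
  define v where "v = (\<lambda>n w. \<omega>hat n w \<bullet> (V_hat \<omega>\<^sub>0 (\<lambda>i. X i w) (N n) (k n) *v \<omega>hat n w))"
  have \<omega>: "(?\<omega> \<longlongrightarrow> \<omega>) (whp M)" by (rule tendsto_in_prob_imp_whp[OF \<omega>lim \<omega>m])
  \<comment> \<open>The limit weights inherit the constraint; in particular they are not 0, and the
    limiting variance is positive.\<close>
  have "((\<lambda>x. ?\<omega> x \<bullet> 1) \<longlongrightarrow> \<omega> \<bullet> 1) (whp M)" by (intro tendsto_inner \<omega> tendsto_const)
  moreover have "((\<lambda>x. ?\<omega> x \<bullet> 1) \<longlongrightarrow> 1) (whp M)"
    by (rule tendsto_eventually) (use eventually_whp_space in \<open>eventually_elim, simp add: \<omega>1\<close>)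
  ultimately have "\<omega> \<bullet> 1 = 1" using tendsto_unique[OF whp_neq_bot] by blast
  then have "\<omega> \<noteq> 0" by auto
  define v0 where "v0 = \<omega> \<bullet> (Sigma_mat *v \<omega>)"
  have v0: "v0 > 0" unfolding v0_def by (rule pos_def_form(2)[OF pos_def_Sigma \<open>\<omega> \<noteq> 0\<close>])
  have vlim: "((\<lambda>x. v (fst x) (snd x)) \<longlongrightarrow> v0) (whp M)"
  proof -
    note Vh = V_hat_tendsto[OF \<omega>\<^sub>0 g]
    have "((\<lambda>x. \<Sum>j\<in>UNIV. ?\<omega> x $ j * (\<Sum>l\<in>UNIV. V_hat \<omega>\<^sub>0 (\<lambda>i. X i (snd x)) (N (fst x)) (k (fst x)) $ j $ l * ?\<omega> x $ l)) \<longlongrightarrow>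
        (\<Sum>j\<in>UNIV. \<omega> $ j * (\<Sum>l\<in>UNIV. Sigma_mat $ j $ l * \<omega> $ l))) (whp M)"
      by (intro tendsto_sum tendsto_mult tendsto_vec_nth \<omega> Vh)
    then show ?thesis by (simp add: v_def v0_def inner_vec_def matrix_vector_mult_def)
  qed
  \<comment> \<open>The limit weights scaled to unit length for the limit covariance.\<close>
  define y where "y = (1 / sqrt v0) *\<^sub>R \<omega>"
  have yy: "y \<bullet> (Sigma_mat *v y) = 1"
    using v0 by (simp add: y_def matrix_vector_mult_scaleR v0_def[symmetric])
  let ?S = "\<lambda>x. (?\<omega> x \<bullet> ?Z x)\<^sup>2 / v (fst x) (snd x)"
  have d1: "((\<lambda>x. ?\<omega> x \<bullet> ?Z x - \<omega> \<bullet> ?Z x) \<longlongrightarrow> 0) (whp M)"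
  proof -
    have "((\<lambda>x. \<Sum>j\<in>UNIV. (?\<omega> x $ j - \<omega> $ j) * ?Z x $ j) \<longlongrightarrow> (\<Sum>j\<in>(UNIV::'m set). 0)) (whp M)"
    proof (intro tendsto_sum tendsto_mult_bdd_prob scaled_error_bdd)
      fix j
      have "((\<lambda>x. ?\<omega> x $ j) \<longlongrightarrow> \<omega> $ j) (whp M)" by (intro tendsto_vec_nth \<omega>)
      then show "((\<lambda>x. ?\<omega> x $ j - \<omega> $ j) \<longlongrightarrow> 0) (whp M)" by (simp add: LIM_zero)
    qed
    then show ?thesis by (simp add: inner_vec_def left_diff_distrib sum_subtractf)
  qed
  have b: "bdd_prob M (\<lambda>x. \<omega> \<bullet> ?Z x)" by (rule inner_scaled_error_bdd)
  have d2: "((\<lambda>x. (?\<omega> x \<bullet> ?Z x)\<^sup>2 - (\<omega> \<bullet> ?Z x)\<^sup>2) \<longlongrightarrow> 0) (whp M)"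
    using tendsto_mult_bdd_prob[OF d1 bdd_prob_add[OF bdd_prob_close[OF b d1] b]]
    by (simp add: power2_eq_square square_diff_square_factored mult.commute)
  have inv: "((\<lambda>x. 1 / v (fst x) (snd x)) \<longlongrightarrow> 1 / v0) (whp M)"
    by (intro tendsto_divide tendsto_const vlim) (use v0 in simp)
  \<comment> \<open>Three replacements in turn: the random weights by their limit, the estimated
    variance by its limit, and the scaled error by its linear surrogate.\<close>
  have "((\<lambda>x. ((?\<omega> x \<bullet> ?Z x)\<^sup>2 - (\<omega> \<bullet> ?Z x)\<^sup>2) * (1 / v (fst x) (snd x)) + (1 / v (fst x) (snd x) - 1 / v0) * ((\<omega> \<bullet> ?Z x) * (\<omega> \<bullet> ?Z x)) +
     ((y \<bullet> ?Z x)\<^sup>2 - (lin_comb y (fst x) (snd x))\<^sup>2)) \<longlongrightarrow> 0 * (1 / v0) + 0 + 0) (whp M)"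
    by (intro tendsto_add tendsto_mult d2 inv tendsto_mult_bdd_prob bdd_prob_mult b inner_scaled_error_square LIM_zero)
  moreover have "(y \<bullet> t)\<^sup>2 = (\<omega> \<bullet> t) * (\<omega> \<bullet> t) * (1 / v0)" for t
    using v0 by (simp add: y_def power_divide power2_eq_square)
  ultimately have lim: "((\<lambda>x. ?S x - (lin_comb y (fst x) (snd x))\<^sup>2) \<longlongrightarrow> 0) (whp M)"
    by (simp add: algebra_simps power2_eq_square diff_divide_distrib)
  let ?E = "\<lambda>n. {w \<in> space M.
     let est = pooled_hill (\<lambda>i. X i w) (N n) (k n) (\<omega>hat n w); h = z * sqrt (v n w / k_total (k n))
     in g \<in> {est - h .. est + h}}"
  have "(\<lambda>n. prob (?E n)) \<longlonglongrightarrow> cdf (chi_square 1) (z\<^sup>2)"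
  proof (rule slutsky_cdf[OF _ _ isCont_cdf_chi_square[OF zero_less_one] lim])
    show "(\<lambda>w. (lin_comb y n w)\<^sup>2) \<in> borel_measurable M" for n using lin_comb_measurable by measurable
    show "(\<lambda>n. prob {w \<in> space M. (lin_comb y n w)\<^sup>2 \<le> t}) \<longlonglongrightarrow> cdf (chi_square 1) t" for t
      using lin_comb_chi_square[of 1 "\<lambda>_. y" t] yy by simp
    show "\<forall>\<^sub>F n in sequentially. ?E n \<in> events"
      using all_k_less_N
    proof eventually_elim
      case (elim n)
      have [measurable]: "(\<lambda>w. \<omega>hat n w $ j) \<in> borel_measurable M" for j
        using \<omega>m[of n] by (simp add: measurable_vec_iff)
      note [measurable] = hill_measurable[OF elim] estimate_measurable[OF elim]
      have [measurable]: "(\<lambda>w. pooled_hill (\<lambda>i. X i w) (N n) (k n) (\<omega>hat n w)) \<in> borel_measurable M"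
        unfolding pooled_hill_def inner_vec_def inner_real_def by measurable
      have [measurable]: "(\<lambda>w. v n w) \<in> borel_measurable M"
        unfolding v_def inner_vec_def inner_real_def matrix_vector_mult_def vec_lambda_beta by measurable
      show ?case unfolding Let_def atLeastAtMost_iff by measurable
    qed
    show "\<forall>\<^sub>F x in whp M. snd x \<in> ?E (fst x) \<longleftrightarrow> ?S x \<le> z\<^sup>2"
      using eventually_whp_space order_tendstoD(1)[OF vlim v0] eventually_whp_fst[OF k_sum_pos]
    proof eventually_elim
      case (elim x)
      obtain n w where x: "x = (n, w)" by (cases x)
      have w: "w \<in> space M" and v: "v n w > 0" and kp: "k_sum n > 0" using elim by (auto simp: x)
      define D where "D = pooled_hill (\<lambda>i. X i w) (N n) (k n) (\<omega>hat n w) - g"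
      define h where "h = z * sqrt (v n w / k_sum n)"
      have h0: "h \<ge> 0" using z v kp by (simp add: h_def)
      have "\<omega>hat n w \<bullet> \<gamma> = g * (\<omega>hat n w \<bullet> 1)" by (simp add: g)
      then have \<omega>\<gamma>: "\<omega>hat n w \<bullet> \<gamma> = g" using \<omega>1[OF w, of n] by simp
      have Zw: "\<omega>hat n w \<bullet> scaled_error n w = sqrt (k_sum n) * D"
        by (simp add: scaled_error_def inner_diff_right \<omega>\<gamma> D_def pooled_hill_def)
      have "w \<in> ?E n \<longleftrightarrow> \<bar>D\<bar> \<le> h"
        using w by (auto simp: D_def h_def k_sum_def Let_def abs_le_iff)
      also have "\<dots> \<longleftrightarrow> D\<^sup>2 \<le> h\<^sup>2" using abs_le_square_iff[of D h] h0 by simp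
      also have "h\<^sup>2 = z\<^sup>2 * (v n w / k_sum n)" using v kp by (simp add: h_def power_mult_distrib)
      also have "D\<^sup>2 \<le> z\<^sup>2 * (v n w / k_sum n) \<longleftrightarrow> k_sum n * D\<^sup>2 / v n w \<le> z\<^sup>2"
        using v kp by (simp add: field_simps)
      also have "k_sum n * D\<^sup>2 = (\<omega>hat n w \<bullet> scaled_error n w)\<^sup>2" using kp by (simp add: Zw power_mult_distrib)
      finally show ?case by (simp add: x)
    qed
  qed
  then show ?thesis using z(2) cdf_chi_square_1[of z] z(1) unfolding v_def z_def by simp
qed

end

theorem corollary3:
  fixes M :: "'a measure"
    and X\<^sub>0 :: "'a \<Rightarrow> ('m :: {finite, linorder}) rvec"
    and X :: "nat \<Rightarrow> 'a \<Rightarrow> 'm rvec"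
    and N k :: "nat \<Rightarrow> 'm \<Rightarrow> nat"
    and \<gamma> \<rho> \<beta> b c \<omega>\<^sub>0 :: "'m rvec"
    and A :: "'m \<Rightarrow> real \<Rightarrow> real"
    and R :: "'m \<Rightarrow> 'm \<Rightarrow> ennreal \<Rightarrow> ennreal \<Rightarrow> real"
    and \<beta>hat \<rho>hat :: "nat \<Rightarrow> 'a \<Rightarrow> 'm rvec"
    and \<alpha> :: real
  assumes m: "CARD('m) \<ge> 2"
    and M: "prob_space M"
    and X0_meas: "X\<^sub>0 \<in> borel_measurable M"
    and X_indep: "prob_space.indep_vars M (\<lambda>_. borel) X {1..}"
    and X_copies: "\<And>i. i \<ge> 1 \<Longrightarrow> distr M borel (X i) = distr M borel X\<^sub>0"
    and F_cont: "\<And>j. continuous_on UNIV (cdf (marginal M X\<^sub>0 j))"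
    and N_sum: "\<And>n. (\<Sum>j\<in>UNIV. N n j) = n"
    and N_lim: "\<And>j. filterlim (\<lambda>n. N n j) at_top sequentially"
    and C2: "condition_C2 M X\<^sub>0 \<gamma> \<rho> A"
    and J: "condition_J M X\<^sub>0 R"
    and \<rho>_neg: "\<And>j. \<rho> $ j < 0"
    and A_eq: "\<And>j t. t > 0 \<Longrightarrow> A j t = \<gamma> $ j * \<beta> $ j * t powr (\<rho> $ j)"
    and N_mono: "\<And>n. mono (N n)"
    and k_lim: "\<And>j. filterlim (\<lambda>n. k n j) at_top sequentially"
    and k_frac: "\<And>j. (\<lambda>n. real (k n j) / real (N n j)) \<longlonglongrightarrow> 0"
    and b_range: "\<And>j. 0 < b $ j \<and> b $ j \<le> 1"
    and b_lim: "\<And>j. (\<lambda>n. real (N n (Min UNIV)) / real (N n j)) \<longlonglongrightarrow> b $ j"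
    and c_range: "\<And>j. 0 < c $ j"
    and c_lim: "\<And>j. (\<lambda>n. real (k n (Min UNIV)) / real (k n j)) \<longlonglongrightarrow> c $ j"
    and bias: "\<And>j. (\<lambda>n. sqrt (real (k n j)) * A j (real (N n j) / real (k n j))) \<longlonglongrightarrow> 0"
    and V: "pos_def (V_mat \<gamma> b c R)"
    and \<beta>hat_meas: "\<And>n. \<beta>hat n \<in> borel_measurable M"
    and \<beta>hat_lim: "\<And>j. tendsto_in_prob M (\<lambda>n w. \<beta>hat n w $ j) (\<beta> $ j)"
    and \<rho>hat_meas: "\<And>n. \<rho>hat n \<in> borel_measurable M"
    and \<rho>hat_lim: "\<And>j. tendsto_in_prob M (\<lambda>n w. (\<rho>hat n w $ j - \<rho> $ j) * ln (real (N n j))) 0"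
    and \<omega>\<^sub>0: "\<omega>\<^sub>0 \<bullet> 1 = 1"
    and \<alpha>: "0 < \<alpha>" "\<alpha> < 1"
  shows
    "((\<exists>g>0. \<gamma> = g *\<^sub>R 1) \<longrightarrow>
        (\<lambda>n. measure M {w \<in> space M. test_stat (\<lambda>i. X i w) (N n) (k n)
                                       > quantile (chi_square (CARD('m) - 1)) (1 - \<alpha>)})
          \<longlonglongrightarrow> \<alpha>) \<and>
     ((\<exists>j l. \<gamma> $ j \<noteq> \<gamma> $ l) \<longrightarrow>
        tendsto_in_prob_at_top M (\<lambda>n w. test_stat (\<lambda>i. X i w) (N n) (k n))) \<and>
     (\<forall>g>0. \<gamma> = g *\<^sub>R 1 \<longrightarrow>
        (\<forall>(\<omega>hat :: nat \<Rightarrow> 'a \<Rightarrow> 'm rvec) \<omega>.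
           (\<forall>n. \<omega>hat n \<in> borel_measurable M) \<and>
           (\<forall>n. \<forall>w\<in>space M. \<omega>hat n w \<bullet> 1 = 1) \<and>
           tendsto_in_prob M \<omega>hat \<omega> \<longrightarrow>
           (\<forall>\<alpha>'. 0 < \<alpha>' \<and> \<alpha>' < 1 \<longrightarrow>
              (\<lambda>n. measure M {w \<in> space M.
                 let est = pooled_hill (\<lambda>i. X i w) (N n) (k n) (\<omega>hat n w);
                     h = quantile std_normal_distribution (1 - \<alpha>' / 2) *
                         sqrt (\<omega>hat n w \<bullet> (V_hat \<omega>\<^sub>0 (\<lambda>i. X i w) (N n) (k n) *v \<omega>hat n w)
                               / k_total (k n))
                 in g \<in> {est - h .. est + h}})
                \<longlonglongrightarrow> 1 - \<alpha>')))"
proof -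
  interpret prob_space M by (rule M)
  interpret tail_model M X\<^sub>0 X N k \<gamma> \<rho> \<beta> b c A R
    by unfold_locales
      (use X0_meas X_indep X_copies F_cont N_lim C2 J \<rho>_neg A_eq N_mono k_lim k_frac b_range b_lim
        c_range c_lim bias V in auto)
  show ?thesis
  proof (intro conjI impI allI)
    assume "\<exists>g>0. \<gamma> = g *\<^sub>R 1"
    then obtain g where g: "\<gamma> = g *\<^sub>R 1" by blast
    show "(\<lambda>n. measure M {w \<in> space M. test_stat (\<lambda>i. X i w) (N n) (k n)
        > quantile (chi_square (CARD('m) - 1)) (1 - \<alpha>)}) \<longlonglongrightarrow> \<alpha>"
      by (rule test_stat_null[OF m g \<alpha>])
  next
    assume "\<exists>j l. \<gamma> $ j \<noteq> \<gamma> $ l"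
    then show "tendsto_in_prob_at_top M (\<lambda>n w. test_stat (\<lambda>i. X i w) (N n) (k n))"
      by (auto intro: test_stat_alternative)
  next
    fix g :: real and \<alpha>' :: real and \<omega>hat :: "nat \<Rightarrow> 'a \<Rightarrow> 'm rvec" and \<omega>
    assume g: "\<gamma> = g *\<^sub>R 1"
      and \<omega>hat: "(\<forall>n. \<omega>hat n \<in> borel_measurable M) \<and> (\<forall>n. \<forall>w\<in>space M. \<omega>hat n w \<bullet> 1 = 1) \<and>
        tendsto_in_prob M \<omega>hat \<omega>"
      and \<alpha>': "0 < \<alpha>' \<and> \<alpha>' < 1"
    show "(\<lambda>n. measure M {w \<in> space M.
        let est = pooled_hill (\<lambda>i. X i w) (N n) (k n) (\<omega>hat n w);
            h = quantile std_normal_distribution (1 - \<alpha>' / 2) *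
                sqrt (\<omega>hat n w \<bullet> (V_hat \<omega>\<^sub>0 (\<lambda>i. X i w) (N n) (k n) *v \<omega>hat n w) / k_total (k n))
        in g \<in> {est - h .. est + h}}) \<longlonglongrightarrow> 1 - \<alpha>'"
      by (rule confidence_interval[OF \<omega>\<^sub>0 g]) (use \<omega>hat \<alpha>' in auto)
  qed
qed

end
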